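(* Let $\forall^{\mathrm{st}} x \, \exists^{\mathrm{st}} y\, \varphi(x,y)$ be a sentence of $\text{E-HA}^{\omega*}_{\mathrm{st}\lor}$ with $\varphi$ internal and $\lor$-free, and let $\Delta_\lor$ be a set of internal, $\lor$-free sentences. If $\text{E-HA}^{\omega*}_{\mathrm{st}\lor} + \mathsf{OS}^*_\lor + \mathsf{US}^*_\lor + \mathsf{NU} + \mathsf{AC}^{\mathrm{st}} + \mathsf{IP}_{\forall \, \lor}^{\mathrm{st}} + \Delta_\lor \vdash \forall^{\mathrm{st}} x \, \exists^{\mathrm{st}} y\, \varphi(x,y)$, then from the proof one can extract a closed term $T$ such that $\text{E-HA}^{\omega*}_\lor + \Delta_\lor \vdash \forall x \, \varphi(x, Tx)$.
   Context: $\text{E-HA}^{\omega*}$ is extensional Heyting arithmetic in all finite types over the types generated by $0$, $\sigma\to\tau$ and $\sigma^*$ (finite sequences), with constants for the empty sequence, prepending, a list recursor, and the axiom that every sequence is empty or a prepend; $a\in s$ means $a$ is a component of sequence $s$. $\text{E-HA}^{\omega*}_{\mathrm{st}}$ adds predicates $\mathrm{st}_\sigma$ and external quantifiers $\forall^{\mathrm{st}}x\,\Phi :\leftrightarrow \forall x(\mathrm{st}(x)\to\Phi)$, $\exists^{\mathrm{st}}x\,\Phi :\leftrightarrow \exists x(\mathrm{st}(x)\land\Phi)$; internal formulae (lowercase Greek) are those not containing $\mathrm{st}$. Axioms: those of $\text{E-HA}^{\omega*}$, $\mathrm{st}(x)\land x=y\to\mathrm{st}(y)$, $\mathrm{st}(a)$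 for closed terms $a$, $\mathrm{st}(f)\land\mathrm{st}(x)\to\mathrm{st}(fx)$, and external induction $(\Phi(0)\land\forall^{\mathrm{st}}x:0(\Phi(x)\to\Phi(\mathrm{S}x)))\to\forall^{\mathrm{st}}x:0\,\Phi(x)$ for all formulae. $\text{E-HA}^{\omega*}_\lor$, $\text{E-HA}^{\omega*}_{\mathrm{st}\lor}$: the same with internal induction restricted to internal $\lor$-free formulae. $\mathrm{hyper}(s):=\forall^{\mathrm{st}}x\,(x\in s)$. Principles (all types; $\varphi$ internal $\lor$-free; $\Phi,\Psi$ arbitrary): $\mathsf{OS}^*_\lor$: $\forall^{\mathrm{st}}s:\sigma^*\,\varphi(s)\to\exists s(\mathrm{hyper}(s)\land\varphi(s))$; $\mathsf{US}^*_\lor$: $\forall s(\mathrm{hyper}(s)\to\varphi(s))\to\exists^{\mathrm{st}}s\,\varphi(s)$; $\mathsf{NU}$: $\forall y\,\exists^{\mathrm{st}}x\,\Phi(x,y)\to\exists^{\mathrm{st}}x\,\forall y\,\Phi(x,y)$; $\mathsf{AC}^{\mathrm{st}}$: $\forall^{\mathrm{st}}x\,\exists^{\mathrm{st}}y\,\Phi(x,y)\to\exists^{\mathrm{st}}f\,\forall^{\mathrm{st}}x\,\Phi(x,fx)$; $\mathsf{IP}^{\mathrm{st}}_{\forall\lor}$: $(\forall^{\mathrm{st}}x\,\varphi(x)\to\exists^{\mathrm{st}}y\,\Psi(y))\to\exists^{\mathrm{st}}y(\forall^{\mathrm{st}}x\,\varphi(x)\to\Psi(y))$.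
   Formalization: "Every sequence is empty or a prepend" is stated with the ∨-free disjunction ∃n((n=0→…)∧(n≠0→…)), since with primitive ∨ the principle NU makes the nonstandard system inconsistent and the claim false; "one can extract T" is stated as existence of T. *)

theory Defs
  imports Main
begin

section \<open>Types, terms and formulae\<close>

datatype ty = TNat | Fun ty ty (infixr "\<Rrightarrow>" 70) | Seq ty

text \<open>
  Terms are combinatory: there is no binder inside a term, and \<open>Var n\<close> is the de Bruijn index
  of a variable bound in the surrounding formula or context. A closed term is thus a term that is
  typable in the empty context.
\<close>

datatype tm =
    Var nat
  | Zero
  | Succ
  | CK ty ty
  | CS ty ty ty
  | Rec ty
  | Empty ty
  | Prep ty
  | LRec ty ty
  | App tm tm (infixl "\<cdot>" 100)

text \<open>The typing context is a list; index 0 refers to its head.\<close>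

inductive has_type :: "ty list \<Rightarrow> tm \<Rightarrow> ty \<Rightarrow> bool" where
  "n < length \<Gamma> \<Longrightarrow> has_type \<Gamma> (Var n) (\<Gamma> ! n)"
| "has_type \<Gamma> Zero TNat"
| "has_type \<Gamma> Succ (TNat \<Rrightarrow> TNat)"
| "has_type \<Gamma> (CK \<sigma> \<tau>) (\<sigma> \<Rrightarrow> \<tau> \<Rrightarrow> \<sigma>)"
| "has_type \<Gamma> (CS \<rho> \<sigma> \<tau>) ((\<rho> \<Rrightarrow> \<sigma> \<Rrightarrow> \<tau>) \<Rrightarrow> (\<rho> \<Rrightarrow> \<sigma>) \<Rrightarrow> \<rho> \<Rrightarrow> \<tau>)"
| "has_type \<Gamma> (Rec \<sigma>) (\<sigma> \<Rrightarrow> (\<sigma> \<Rrightarrow> TNat \<Rrightarrow> \<sigma>) \<Rrightarrow> TNat \<Rrightarrow> \<sigma>)"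
| "has_type \<Gamma> (Empty \<sigma>) (Seq \<sigma>)"
| "has_type \<Gamma> (Prep \<sigma>) (\<sigma> \<Rrightarrow> Seq \<sigma> \<Rrightarrow> Seq \<sigma>)"
| "has_type \<Gamma> (LRec \<sigma> \<rho>) (\<sigma> \<Rrightarrow> (\<sigma> \<Rrightarrow> \<rho> \<Rrightarrow> \<sigma>) \<Rrightarrow> Seq \<rho> \<Rrightarrow> \<sigma>)"
| "has_type \<Gamma> f (\<sigma> \<Rrightarrow> \<tau>) \<Longrightarrow> has_type \<Gamma> a \<sigma> \<Longrightarrow> has_type \<Gamma> (f \<cdot> a) \<tau>"

abbreviation closed_term :: "tm \<Rightarrow> ty \<Rightarrow> bool" where
  "closed_term t \<sigma> \<equiv> has_type [] t \<sigma>"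

datatype fm =
    Eq ty tm tm
  | St ty tm
  | Bot
  | And fm fm (infixr "\<^bold>\<and>" 55)
  | Or fm fm (infixr "\<^bold>\<or>" 50)
  | Imp fm fm (infixr "\<^bold>\<longrightarrow>" 45)
  | Forall ty fm
  | Exists ty fm

abbreviation Neg :: "fm \<Rightarrow> fm" where
  "Neg \<phi> \<equiv> \<phi> \<^bold>\<longrightarrow> Bot"

primrec wff :: "ty list \<Rightarrow> fm \<Rightarrow> bool" where
  "wff \<Gamma> (Eq \<sigma> s t) \<longleftrightarrow> has_type \<Gamma> s \<sigma> \<and> has_type \<Gamma> t \<sigma>"
| "wff \<Gamma> (St \<sigma> t) \<longleftrightarrow> has_type \<Gamma> t \<sigma>"
| "wff \<Gamma> Bot \<longleftrightarrow> True"
| "wff \<Gamma> (\<phi> \<^bold>\<and> \<psi>) \<longleftrightarrow> wff \<Gamma> \<phi> \<and> wff \<Gamma> \<psi>"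
| "wff \<Gamma> (\<phi> \<^bold>\<or> \<psi>) \<longleftrightarrow> wff \<Gamma> \<phi> \<and> wff \<Gamma> \<psi>"
| "wff \<Gamma> (\<phi> \<^bold>\<longrightarrow> \<psi>) \<longleftrightarrow> wff \<Gamma> \<phi> \<and> wff \<Gamma> \<psi>"
| "wff \<Gamma> (Forall \<sigma> \<phi>) \<longleftrightarrow> wff (\<sigma> # \<Gamma>) \<phi>"
| "wff \<Gamma> (Exists \<sigma> \<phi>) \<longleftrightarrow> wff (\<sigma> # \<Gamma>) \<phi>"

abbreviation sentence :: "fm \<Rightarrow> bool" where
  "sentence \<phi> \<equiv> wff [] \<phi>"

primrec internal :: "fm \<Rightarrow> bool" where
  "internal (Eq \<sigma> s t) \<longleftrightarrow> True"
| "internal (St \<sigma> t) \<longleftrightarrow> False"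
| "internal Bot \<longleftrightarrow> True"
| "internal (\<phi> \<^bold>\<and> \<psi>) \<longleftrightarrow> internal \<phi> \<and> internal \<psi>"
| "internal (\<phi> \<^bold>\<or> \<psi>) \<longleftrightarrow> internal \<phi> \<and> internal \<psi>"
| "internal (\<phi> \<^bold>\<longrightarrow> \<psi>) \<longleftrightarrow> internal \<phi> \<and> internal \<psi>"
| "internal (Forall \<sigma> \<phi>) \<longleftrightarrow> internal \<phi>"
| "internal (Exists \<sigma> \<phi>) \<longleftrightarrow> internal \<phi>"

primrec or_free :: "fm \<Rightarrow> bool" where
  "or_free (Eq \<sigma> s t) \<longleftrightarrow> True"
| "or_free (St \<sigma> t) \<longleftrightarrow> True"
| "or_free Bot \<longleftrightarrow> True"
| "or_free (\<phi> \<^bold>\<and> \<psi>) \<longleftrightarrow> or_free \<phi> \<and> or_free \<psi>"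
| "or_free (\<phi> \<^bold>\<or> \<psi>) \<longleftrightarrow> False"
| "or_free (\<phi> \<^bold>\<longrightarrow> \<psi>) \<longleftrightarrow> or_free \<phi> \<and> or_free \<psi>"
| "or_free (Forall \<sigma> \<phi>) \<longleftrightarrow> or_free \<phi>"
| "or_free (Exists \<sigma> \<phi>) \<longleftrightarrow> or_free \<phi>"


section \<open>Simultaneous substitution\<close>

primrec subst_tm :: "(nat \<Rightarrow> tm) \<Rightarrow> tm \<Rightarrow> tm" where
  "subst_tm s (Var n) = s n"
| "subst_tm s Zero = Zero"
| "subst_tm s Succ = Succ"
| "subst_tm s (CK \<sigma> \<tau>) = CK \<sigma> \<tau>"
| "subst_tm s (CS \<rho> \<sigma> \<tau>) = CS \<rho> \<sigma> \<tau>"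
| "subst_tm s (Rec \<sigma>) = Rec \<sigma>"
| "subst_tm s (Empty \<sigma>) = Empty \<sigma>"
| "subst_tm s (Prep \<sigma>) = Prep \<sigma>"
| "subst_tm s (LRec \<sigma> \<rho>) = LRec \<sigma> \<rho>"
| "subst_tm s (f \<cdot> a) = subst_tm s f \<cdot> subst_tm s a"

text \<open>\<open>t .: s\<close> replaces index 0 by \<open>t\<close> and index \<open>n + 1\<close> by \<open>s n\<close>.\<close>

definition scons :: "tm \<Rightarrow> (nat \<Rightarrow> tm) \<Rightarrow> nat \<Rightarrow> tm" (infixr ".:" 60) where
  "(t .: s) n = (case n of 0 \<Rightarrow> t | Suc m \<Rightarrow> s m)"

definition weaken :: "nat \<Rightarrow> nat \<Rightarrow> tm" where
  "weaken k n = Var (n + k)"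

primrec subst :: "(nat \<Rightarrow> tm) \<Rightarrow> fm \<Rightarrow> fm" where
  "subst s (Eq \<sigma> t u) = Eq \<sigma> (subst_tm s t) (subst_tm s u)"
| "subst s (St \<sigma> t) = St \<sigma> (subst_tm s t)"
| "subst s Bot = Bot"
| "subst s (\<phi> \<^bold>\<and> \<psi>) = (subst s \<phi> \<^bold>\<and> subst s \<psi>)"
| "subst s (\<phi> \<^bold>\<or> \<psi>) = (subst s \<phi> \<^bold>\<or> subst s \<psi>)"
| "subst s (\<phi> \<^bold>\<longrightarrow> \<psi>) = (subst s \<phi> \<^bold>\<longrightarrow> subst s \<psi>)"
| "subst s (Forall \<sigma> \<phi>) = Forall \<sigma> (subst (Var 0 .: (\<lambda>n. subst_tm (weaken (Suc 0)) (s n))) \<phi>)"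
| "subst s (Exists \<sigma> \<phi>) = Exists \<sigma> (subst (Var 0 .: (\<lambda>n. subst_tm (weaken (Suc 0)) (s n))) \<phi>)"

abbreviation shift_tm :: "tm \<Rightarrow> tm" where
  "shift_tm \<equiv> subst_tm (weaken (Suc 0))"

abbreviation shift :: "fm \<Rightarrow> fm" where
  "shift \<equiv> subst (weaken (Suc 0))"

abbreviation inst :: "tm \<Rightarrow> fm \<Rightarrow> fm" where
  "inst t \<equiv> subst (t .: Var)"


section \<open>Intuitionistic natural deduction\<close>

text \<open>
  \<open>derives L A \<Gamma> H \<phi>\<close>: in the language \<open>L\<close>, with the axioms \<open>A\<close>, the formula \<open>\<phi>\<close> follows from the
  hypotheses \<open>H\<close>, all free variables being typed by \<open>\<Gamma>\<close>. Every formula of a derivation is a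
  well-formed formula of \<open>L\<close>; an element of \<open>A\<close> counts as an axiom in all contexts in which it is
  well-formed, so its free indices act as parameters.
\<close>

inductive derives :: "(fm \<Rightarrow> bool) \<Rightarrow> fm set \<Rightarrow> ty list \<Rightarrow> fm list \<Rightarrow> fm \<Rightarrow> bool"
  for L :: "fm \<Rightarrow> bool" and A :: "fm set" where
  Axiom: "\<phi> \<in> A \<Longrightarrow> wff \<Gamma> \<phi> \<Longrightarrow> L \<phi> \<Longrightarrow> derives L A \<Gamma> H \<phi>"
| Hyp: "\<phi> \<in> set H \<Longrightarrow> wff \<Gamma> \<phi> \<Longrightarrow> L \<phi> \<Longrightarrow> derives L A \<Gamma> H \<phi>"
| BotE: "derives L A \<Gamma> H Bot \<Longrightarrow> wff \<Gamma> \<phi> \<Longrightarrow> L \<phi> \<Longrightarrow> derives L A \<Gamma> H \<phi>"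
| AndI: "derives L A \<Gamma> H \<phi> \<Longrightarrow> derives L A \<Gamma> H \<psi> \<Longrightarrow> derives L A \<Gamma> H (\<phi> \<^bold>\<and> \<psi>)"
| AndE1: "derives L A \<Gamma> H (\<phi> \<^bold>\<and> \<psi>) \<Longrightarrow> derives L A \<Gamma> H \<phi>"
| AndE2: "derives L A \<Gamma> H (\<phi> \<^bold>\<and> \<psi>) \<Longrightarrow> derives L A \<Gamma> H \<psi>"
| OrI1: "derives L A \<Gamma> H \<phi> \<Longrightarrow> wff \<Gamma> \<psi> \<Longrightarrow> L \<psi> \<Longrightarrow> derives L A \<Gamma> H (\<phi> \<^bold>\<or> \<psi>)"
| OrI2: "derives L A \<Gamma> H \<psi> \<Longrightarrow> wff \<Gamma> \<phi> \<Longrightarrow> L \<phi> \<Longrightarrow> derives L A \<Gamma> H (\<phi> \<^bold>\<or> \<psi>)"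
| OrE: "derives L A \<Gamma> H (\<phi> \<^bold>\<or> \<psi>) \<Longrightarrow> derives L A \<Gamma> (\<phi> # H) \<chi> \<Longrightarrow> derives L A \<Gamma> (\<psi> # H) \<chi>
    \<Longrightarrow> derives L A \<Gamma> H \<chi>"
| ImpI: "wff \<Gamma> \<phi> \<Longrightarrow> L \<phi> \<Longrightarrow> derives L A \<Gamma> (\<phi> # H) \<psi> \<Longrightarrow> derives L A \<Gamma> H (\<phi> \<^bold>\<longrightarrow> \<psi>)"
| ImpE: "derives L A \<Gamma> H (\<phi> \<^bold>\<longrightarrow> \<psi>) \<Longrightarrow> derives L A \<Gamma> H \<phi> \<Longrightarrow> derives L A \<Gamma> H \<psi>"
| AllI: "derives L A (\<sigma> # \<Gamma>) (map shift H) \<phi> \<Longrightarrow> derives L A \<Gamma> H (Forall \<sigma> \<phi>)"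
| AllE: "derives L A \<Gamma> H (Forall \<sigma> \<phi>) \<Longrightarrow> has_type \<Gamma> t \<sigma> \<Longrightarrow> derives L A \<Gamma> H (inst t \<phi>)"
| ExI: "derives L A \<Gamma> H (inst t \<phi>) \<Longrightarrow> has_type \<Gamma> t \<sigma> \<Longrightarrow> wff (\<sigma> # \<Gamma>) \<phi> \<Longrightarrow> L \<phi>
    \<Longrightarrow> derives L A \<Gamma> H (Exists \<sigma> \<phi>)"
| ExE: "derives L A \<Gamma> H (Exists \<sigma> \<phi>) \<Longrightarrow> derives L A (\<sigma> # \<Gamma>) (\<phi> # map shift H) (shift \<psi>)
    \<Longrightarrow> wff \<Gamma> \<psi> \<Longrightarrow> L \<psi> \<Longrightarrow> derives L A \<Gamma> H \<psi>"

abbreviation proves_int :: "fm set \<Rightarrow> fm \<Rightarrow> bool" (infix "\<turnstile>\<^sub>i\<^sub>n\<^sub>t" 30) where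
  "A \<turnstile>\<^sub>i\<^sub>n\<^sub>t \<phi> \<equiv> derives internal A [] [] \<phi>"

abbreviation proves_st :: "fm set \<Rightarrow> fm \<Rightarrow> bool" (infix "\<turnstile>\<^sub>s\<^sub>t" 30) where
  "A \<turnstile>\<^sub>s\<^sub>t \<phi> \<equiv> derives (\<lambda>_. True) A [] [] \<phi>"


section \<open>Membership in sequences\<close>

definition comp_tm :: "ty \<Rightarrow> ty \<Rightarrow> ty \<Rightarrow> tm \<Rightarrow> tm \<Rightarrow> tm" where
  "comp_tm \<rho> \<sigma> \<tau> g f = CS \<rho> \<sigma> \<tau> \<cdot> (CK (\<sigma> \<Rrightarrow> \<tau>) \<rho> \<cdot> g) \<cdot> f"

text \<open>\<open>\<lambda>n a. S n\<close>, with \<open>a\<close> of type \<open>\<rho>\<close>.\<close>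

definition succ_step :: "ty \<Rightarrow> tm" where
  "succ_step \<rho> = comp_tm TNat TNat (\<rho> \<Rrightarrow> TNat) (CK TNat \<rho>) Succ"

definition plus_tm :: "tm \<Rightarrow> tm \<Rightarrow> tm" where
  "plus_tm m n = Rec TNat \<cdot> m \<cdot> succ_step TNat \<cdot> n"

definition len_tm :: "ty \<Rightarrow> tm \<Rightarrow> tm" where
  "len_tm \<sigma> s = LRec TNat \<sigma> \<cdot> Zero \<cdot> succ_step \<sigma> \<cdot> s"

primrec zero_tm :: "ty \<Rightarrow> tm" where
  "zero_tm TNat = Zero"
| "zero_tm (\<sigma> \<Rrightarrow> \<tau>) = CK \<tau> \<sigma> \<cdot> zero_tm \<tau>"
| "zero_tm (Seq \<sigma>) = Empty \<sigma>"

text \<open>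
  The \<open>i\<close>-th component of \<open>s\<close>, by recursion on \<open>s\<close> at type \<open>0 \<rightarrow> \<sigma>\<close>. The step is
  \<open>\<lambda>h a. Rec a (\<lambda>_ j. h j)\<close>; outside of the length of \<open>s\<close> the value is \<open>zero_tm \<sigma>\<close>.
\<close>

definition nth_step :: "ty \<Rightarrow> tm" where
  "nth_step \<sigma> =
    (let \<alpha> = TNat \<Rrightarrow> \<sigma>; \<beta> = \<sigma> \<Rrightarrow> \<alpha> in
     comp_tm \<alpha> (\<sigma> \<Rrightarrow> \<beta>) \<beta> (CS \<sigma> \<beta> \<alpha> \<cdot> Rec \<sigma>) (comp_tm \<alpha> \<beta> (\<sigma> \<Rrightarrow> \<beta>) (CK \<beta> \<sigma>) (CK \<alpha> \<sigma>)))"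

definition nth_tm :: "ty \<Rightarrow> tm \<Rightarrow> tm \<Rightarrow> tm" where
  "nth_tm \<sigma> s i = LRec (TNat \<Rrightarrow> \<sigma>) \<sigma> \<cdot> (CK \<sigma> TNat \<cdot> zero_tm \<sigma>) \<cdot> nth_step \<sigma> \<cdot> s \<cdot> i"

definition Less :: "tm \<Rightarrow> tm \<Rightarrow> fm" where
  "Less m n = Exists TNat (Eq TNat (shift_tm n) (Succ \<cdot> plus_tm (Var 0) (shift_tm m)))"

definition Mem :: "ty \<Rightarrow> tm \<Rightarrow> tm \<Rightarrow> fm" where
  "Mem \<sigma> a s = Exists TNat (Less (Var 0) (len_tm \<sigma> (shift_tm s)) \<^bold>\<and>
     Eq \<sigma> (shift_tm a) (nth_tm \<sigma> (shift_tm s) (Var 0)))"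


section \<open>External quantifiers\<close>

definition AllSt :: "ty \<Rightarrow> fm \<Rightarrow> fm" where
  "AllSt \<sigma> \<Phi> = Forall \<sigma> (St \<sigma> (Var 0) \<^bold>\<longrightarrow> \<Phi>)"

definition ExSt :: "ty \<Rightarrow> fm \<Rightarrow> fm" where
  "ExSt \<sigma> \<Phi> = Exists \<sigma> (St \<sigma> (Var 0) \<^bold>\<and> \<Phi>)"

definition hyper :: "ty \<Rightarrow> tm \<Rightarrow> fm" where
  "hyper \<sigma> s = AllSt \<sigma> (Mem \<sigma> (Var 0) (shift_tm s))"


section \<open>The base theories\<close>

text \<open>
  The substitution instance \<open>\<phi>(S x)\<close>, where \<open>x\<close> is index 0.
\<close>

abbreviation at_succ :: "fm \<Rightarrow> fm" where
  "at_succ \<equiv> subst (Succ \<cdot> Var 0 .: weaken (Suc 0))"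

text \<open>
  Equality is primitive at all types. In the axiom \<open>SA\<close> (every sequence is empty or a
  prepend) the word ``or'' cannot be the primitive disjunction: then the principle \<open>NU\<close> would yield
  one standard number that decides for all sequences at once which case holds, and the nonstandard
  theory would be inconsistent. It is read as the usual arithmetical disjunction
  \<open>\<exists>n. (n = 0 \<longrightarrow> \<phi>) \<and> (n \<noteq> 0 \<longrightarrow> \<psi>)\<close>, which is \<open>\<or>\<close>-free, is implied by \<open>\<phi> \<or> \<psi>\<close>, and
  is equivalent to it once induction for formulae with \<open>\<or>\<close> is available.
\<close>

inductive_set EHA_vf :: "fm set" where
  Refl: "Eq \<sigma> x x \<in> EHA_vf"
| Sym: "(Eq \<sigma> x y \<^bold>\<longrightarrow> Eq \<sigma> y x) \<in> EHA_vf"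
| Trans: "(Eq \<sigma> x y \<^bold>\<and> Eq \<sigma> y z \<^bold>\<longrightarrow> Eq \<sigma> x z) \<in> EHA_vf"
| Cong: "(Eq (\<sigma> \<Rrightarrow> \<tau>) f g \<^bold>\<and> Eq \<sigma> x y \<^bold>\<longrightarrow> Eq \<tau> (f \<cdot> x) (g \<cdot> y)) \<in> EHA_vf"
| Ext: "(Forall \<sigma> (Eq \<tau> (shift_tm f \<cdot> Var 0) (shift_tm g \<cdot> Var 0)) \<^bold>\<longrightarrow> Eq (\<sigma> \<Rrightarrow> \<tau>) f g) \<in> EHA_vf"
| Succ_not_Zero: "Neg (Eq TNat (Succ \<cdot> x) Zero) \<in> EHA_vf"
| Succ_inj: "(Eq TNat (Succ \<cdot> x) (Succ \<cdot> y) \<^bold>\<longrightarrow> Eq TNat x y) \<in> EHA_vf"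
| CK: "Eq \<sigma> (CK \<sigma> \<tau> \<cdot> x \<cdot> y) x \<in> EHA_vf"
| CS: "Eq \<tau> (CS \<rho> \<sigma> \<tau> \<cdot> x \<cdot> y \<cdot> z) (x \<cdot> z \<cdot> (y \<cdot> z)) \<in> EHA_vf"
| Rec_Zero: "Eq \<sigma> (Rec \<sigma> \<cdot> x \<cdot> y \<cdot> Zero) x \<in> EHA_vf"
| Rec_Succ: "Eq \<sigma> (Rec \<sigma> \<cdot> x \<cdot> y \<cdot> (Succ \<cdot> z)) (y \<cdot> (Rec \<sigma> \<cdot> x \<cdot> y \<cdot> z) \<cdot> z) \<in> EHA_vf"
| LRec_Empty: "Eq \<sigma> (LRec \<sigma> \<rho> \<cdot> x \<cdot> y \<cdot> Empty \<rho>) x \<in> EHA_vf"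
| LRec_Prep: "Eq \<sigma> (LRec \<sigma> \<rho> \<cdot> x \<cdot> y \<cdot> (Prep \<rho> \<cdot> a \<cdot> s)) (y \<cdot> (LRec \<sigma> \<rho> \<cdot> x \<cdot> y \<cdot> s) \<cdot> a) \<in> EHA_vf"
| SA: "Exists TNat
    ((Eq TNat (Var 0) Zero \<^bold>\<longrightarrow> Eq (Seq \<sigma>) (shift_tm s) (Empty \<sigma>)) \<^bold>\<and>
     (Neg (Eq TNat (Var 0) Zero) \<^bold>\<longrightarrow>
       Exists \<sigma> (Exists (Seq \<sigma>) (Eq (Seq \<sigma>) (subst_tm (weaken 3) s) (Prep \<sigma> \<cdot> Var 1 \<cdot> Var 0))))) \<in> EHA_vf"
| Induction: "internal \<phi> \<Longrightarrow> or_free \<phi> \<Longrightarrow>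
    (inst Zero \<phi> \<^bold>\<and> Forall TNat (\<phi> \<^bold>\<longrightarrow> at_succ \<phi>) \<^bold>\<longrightarrow> Forall TNat \<phi>) \<in> EHA_vf"

inductive_set EHAst_vf :: "fm set" where
  Base: "\<phi> \<in> EHA_vf \<Longrightarrow> \<phi> \<in> EHAst_vf"
| St_Eq: "(St \<sigma> x \<^bold>\<and> Eq \<sigma> x y \<^bold>\<longrightarrow> St \<sigma> y) \<in> EHAst_vf"
| St_closed: "closed_term a \<sigma> \<Longrightarrow> St \<sigma> a \<in> EHAst_vf"
| St_App: "(St (\<sigma> \<Rrightarrow> \<tau>) f \<^bold>\<and> St \<sigma> x \<^bold>\<longrightarrow> St \<tau> (f \<cdot> x)) \<in> EHAst_vf"
| External_Induction:
    "(inst Zero \<Phi> \<^bold>\<and> AllSt TNat (\<Phi> \<^bold>\<longrightarrow> at_succ \<Phi>) \<^bold>\<longrightarrow> AllSt TNat \<Phi>) \<in> EHAst_vf"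


section \<open>Nonstandard principles\<close>

definition OS_vf :: "fm set" where
  "OS_vf = {AllSt (Seq \<sigma>) \<phi> \<^bold>\<longrightarrow> Exists (Seq \<sigma>) (hyper \<sigma> (Var 0) \<^bold>\<and> \<phi>) | \<sigma> \<phi>.
     internal \<phi> \<and> or_free \<phi>}"

definition US_vf :: "fm set" where
  "US_vf = {Forall (Seq \<sigma>) (hyper \<sigma> (Var 0) \<^bold>\<longrightarrow> \<phi>) \<^bold>\<longrightarrow> ExSt (Seq \<sigma>) \<phi> | \<sigma> \<phi>.
     internal \<phi> \<and> or_free \<phi>}"

text \<open>
  In \<open>NU\<close> and \<open>ACst\<close> the matrix \<open>\<Phi>\<close> of the premise lives under two quantifiers, the inner
  variable being index 0 and the outer one index 1. In the conclusion of \<open>NU\<close> these two are swapped;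
  in that of \<open>ACst\<close>, index 0 is \<open>x\<close> and index 1 is \<open>f\<close>.
\<close>

definition NU :: "fm set" where
  "NU = {Forall \<tau> (ExSt \<sigma> \<Phi>) \<^bold>\<longrightarrow> ExSt \<sigma> (Forall \<tau> (subst (Var 1 .: Var 0 .: weaken 2) \<Phi>)) | \<sigma> \<tau> \<Phi>. True}"

definition ACst :: "fm set" where
  "ACst = {AllSt \<sigma> (ExSt \<tau> \<Phi>) \<^bold>\<longrightarrow>
     ExSt (\<sigma> \<Rrightarrow> \<tau>) (AllSt \<sigma> (subst (Var 1 \<cdot> Var 0 .: Var 0 .: weaken 2) \<Phi>)) | \<sigma> \<tau> \<Phi>. True}"

definition IPst_vf :: "fm set" where
  "IPst_vf = {(AllSt \<sigma> \<phi> \<^bold>\<longrightarrow> ExSt \<tau> \<Psi>) \<^bold>\<longrightarrow> ExSt \<tau> (shift (AllSt \<sigma> \<phi>) \<^bold>\<longrightarrow> \<Psi>) | \<sigma> \<tau> \<phi> \<Psi>.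
     internal \<phi> \<and> or_free \<phi>}"

end

theory Submission
  imports Defs "HOL-Library.Countable"
begin

text \<open>
  The proof uses a uniform Diller--Nahm interpretation. A formula \<open>\<Phi>\<close> is translated to
  \<open>\<exists>\<^sup>s\<^sup>tx. \<forall>\<^sup>s\<^sup>tc. m\<close> with an internal \<open>\<or>\<close>-free matrix \<open>m\<close>. A standardness statement \<open>st(t)\<close> is witnessed by a
  standard object equal to \<open>t\<close>, the unrestricted quantifiers carry no computational content, and an
  implication provides a witness for the conclusion together with a finite sequence of challenges
  to the premise. The translation of an internal \<open>\<or>\<close>-free formula is equivalent to the
  formula itself, and the nonstandard principles become almost literal identities. Hence a proof of
  \<open>\<forall>\<^sup>s\<^sup>tx \<exists>\<^sup>s\<^sup>ty \<phi>(x,y)\<close> yields a closed term that computes \<open>y\<close> from \<open>x\<close>, uniformly in all \<open>x\<close>.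

  The translation is verified in a forcing model of the internal theory. Its conditions are
  finite sets of internal hypotheses, and its constant domain consists of the terms modulo
  provable equality, so that the computation rules of the realizers become equalities. Pairs are coded
  in the finite types, which gives every formula a single witness type and a single challenge type.
\<close>

section \<open>Types and substitution\<close>

text \<open>Challenges form finite sequences because matrices need not be decidable: a premise used
  twice yields two challenges, and no term can tell which of them fails. Existential quantifiers
  take sequences for another reason. Their element is chosen after the challenges and must answer
  finitely many of them at once, which is the form in which an unrestricted existential quantifier
  passes a standard universal one. Realizers are closed terms that never see the values of the
  parameters. This uniformity validates \<open>NU\<close>, and it is also why internal formulas have
  to be \<or>-free: the flag of a disjunction would have to be chosen once for all parameters. The
  model spares object-level derivations. A world need not contain a witness for an existential
  statement that it proves, and it may be inconsistent; so existential elimination, case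
  distinctions and contradictions always lead to the forcing of another \<or>-free formula. Equality
  without hypotheses is made an identity by choosing representatives, whereas a world with
  hypotheses may identify further elements.\<close>

lemma has_type_simps [simp]:
  "has_type \<Gamma> (Var n) \<sigma> \<longleftrightarrow> n < length \<Gamma> \<and> \<sigma> = \<Gamma> ! n"
  "has_type \<Gamma> Zero \<sigma> \<longleftrightarrow> \<sigma> = TNat"
  "has_type \<Gamma> Succ \<sigma> \<longleftrightarrow> \<sigma> = (TNat \<Rrightarrow> TNat)"
  "has_type \<Gamma> (CK \<alpha> \<beta>) \<sigma> \<longleftrightarrow> \<sigma> = (\<alpha> \<Rrightarrow> \<beta> \<Rrightarrow> \<alpha>)"
  "has_type \<Gamma> (CS \<rho> \<alpha> \<beta>) \<sigma> \<longleftrightarrow> \<sigma> = ((\<rho> \<Rrightarrow> \<alpha> \<Rrightarrow> \<beta>) \<Rrightarrow> (\<rho> \<Rrightarrow> \<alpha>) \<Rrightarrow> \<rho> \<Rrightarrow> \<beta>)"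
  "has_type \<Gamma> (Rec \<alpha>) \<sigma> \<longleftrightarrow> \<sigma> = (\<alpha> \<Rrightarrow> (\<alpha> \<Rrightarrow> TNat \<Rrightarrow> \<alpha>) \<Rrightarrow> TNat \<Rrightarrow> \<alpha>)"
  "has_type \<Gamma> (Empty \<alpha>) \<sigma> \<longleftrightarrow> \<sigma> = Seq \<alpha>"
  "has_type \<Gamma> (Prep \<alpha>) \<sigma> \<longleftrightarrow> \<sigma> = (\<alpha> \<Rrightarrow> Seq \<alpha> \<Rrightarrow> Seq \<alpha>)"
  "has_type \<Gamma> (LRec \<alpha> \<rho>) \<sigma> \<longleftrightarrow> \<sigma> = (\<alpha> \<Rrightarrow> (\<alpha> \<Rrightarrow> \<rho> \<Rrightarrow> \<alpha>) \<Rrightarrow> Seq \<rho> \<Rrightarrow> \<alpha>)"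
  "has_type \<Gamma> (f \<cdot> a) \<tau> \<longleftrightarrow> (\<exists>\<sigma>. has_type \<Gamma> f (\<sigma> \<Rrightarrow> \<tau>) \<and> has_type \<Gamma> a \<sigma>)"
  by (auto elim: has_type.cases intro: has_type.intros)

text \<open>Constants carry their types, so the type of an application can be read off from its
  function part.\<close>

lemma has_type_unique: "has_type \<Gamma> t \<sigma> \<Longrightarrow> has_type \<Gamma> t \<tau> \<Longrightarrow> \<sigma> = \<tau>"
proof (induction t arbitrary: \<sigma> \<tau>)
  case (App f a)
  from App.prems obtain \<rho> \<rho>' where *: "has_type \<Gamma> f (\<rho> \<Rrightarrow> \<sigma>)" "has_type \<Gamma> f (\<rho>' \<Rrightarrow> \<tau>)" by auto
  show ?case using App.IH(1)[OF *] by simp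
qed auto

lemma scons_simps [simp]: "(t .: s) 0 = t" "(t .: s) (Suc n) = s n"
  by (simp_all add: scons_def)

lemma scons_numeral [simp]: "(t .: s) (numeral k) = s (pred_numeral k)"
  by (simp add: numeral_eq_Suc)

lemma all_less_Suc [simp]: "(\<forall>i<Suc n. P i) \<longleftrightarrow> P 0 \<and> (\<forall>i<n. P (Suc i))"
  using less_Suc_eq_0_disj by auto

abbreviation up :: "(nat \<Rightarrow> tm) \<Rightarrow> nat \<Rightarrow> tm" where
  "up s \<equiv> Var 0 .: (\<lambda>n. shift_tm (s n))"

abbreviation comp_subst :: "(nat \<Rightarrow> tm) \<Rightarrow> (nat \<Rightarrow> tm) \<Rightarrow> nat \<Rightarrow> tm" where
  "comp_subst s r \<equiv> \<lambda>n. subst_tm s (r n)"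

lemma weaken_Suc_0 [simp]: "weaken k n = Var (n + k)"
  by (simp add: weaken_def)

lemma subst_tm_subst_tm [simp]: "subst_tm s (subst_tm r t) = subst_tm (comp_subst s r) t"
  by (induction t) auto

lemma scons_comp [simp]: "comp_subst s (t .: r) = (subst_tm s t .: comp_subst s r)"
  by (auto simp: scons_def split: nat.splits)

lemma subst_subst [simp]: "subst s (subst r \<phi>) = subst (comp_subst s r) \<phi>"
  by (induction \<phi> arbitrary: s r) auto

lemma subst_tm_Var [simp]: "subst_tm Var t = t"
  by (induction t) auto

lemma scons_Var [simp]: "(Var 0 .: (\<lambda>n. Var (Suc n))) = Var"
  by (auto simp: scons_def split: nat.splits)

lemma subst_Var [simp]: "subst Var \<phi> = \<phi>"
  by (induction \<phi>) auto

lemma subst_tm_cong: "has_type \<Gamma> t \<sigma> \<Longrightarrow> \<forall>i<length \<Gamma>. s i = r i \<Longrightarrow> subst_tm s t = subst_tm r t"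
  by (induction t arbitrary: \<sigma>) auto

lemma subst_cong: "wff \<Gamma> \<phi> \<Longrightarrow> \<forall>i<length \<Gamma>. s i = r i \<Longrightarrow> subst s \<phi> = subst r \<phi>"
proof (induction \<phi> arbitrary: \<Gamma> s r)
  case (Forall \<sigma> \<phi>)
  have "subst (up s) \<phi> = subst (up r) \<phi>"
    by (rule Forall.IH[of "\<sigma> # \<Gamma>"]) (use Forall.prems in \<open>auto simp: all_less_Suc\<close>)
  then show ?case by simp
next
  case (Exists \<sigma> \<phi>)
  have "subst (up s) \<phi> = subst (up r) \<phi>"
    by (rule Exists.IH[of "\<sigma> # \<Gamma>"]) (use Exists.prems in \<open>auto simp: all_less_Suc\<close>)
  then show ?case by simp
qed (simp; blast intro: subst_tm_cong)+

lemma closed_subst: "has_type [] t \<sigma> \<Longrightarrow> subst_tm s t = t"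
  using subst_tm_cong[of "[]" t \<sigma> s Var] by simp

lemma sentence_subst: "sentence \<phi> \<Longrightarrow> subst s \<phi> = \<phi>"
  using subst_cong[of "[]" \<phi> s Var] by simp

lemma has_type_subst:
  "has_type \<Gamma> t \<sigma> \<Longrightarrow> \<forall>i<length \<Gamma>. has_type \<Gamma>' (s i) (\<Gamma> ! i) \<Longrightarrow> has_type \<Gamma>' (subst_tm s t) \<sigma>"
  by (induction t arbitrary: \<sigma>) (simp; blast)+

lemma has_type_shift [intro]: "has_type \<Gamma> t \<sigma> \<Longrightarrow> has_type (\<rho> # \<Gamma>) (shift_tm t) \<sigma>"
  by (erule has_type_subst) auto

lemma wff_subst:
  "wff \<Gamma> \<phi> \<Longrightarrow> \<forall>i<length \<Gamma>. has_type \<Gamma>' (s i) (\<Gamma> ! i) \<Longrightarrow> wff \<Gamma>' (subst s \<phi>)"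
proof (induction \<phi> arbitrary: \<Gamma> \<Gamma>' s)
  case (Forall \<sigma> \<phi>)
  have "wff (\<sigma> # \<Gamma>') (subst (up s) \<phi>)"
    by (rule Forall.IH[of "\<sigma> # \<Gamma>"]) (use Forall.prems in \<open>auto simp: all_less_Suc\<close>)
  then show ?case by simp
next
  case (Exists \<sigma> \<phi>)
  have "wff (\<sigma> # \<Gamma>') (subst (up s) \<phi>)"
    by (rule Exists.IH[of "\<sigma> # \<Gamma>"]) (use Exists.prems in \<open>auto simp: all_less_Suc\<close>)
  then show ?case by simp
qed (auto intro: has_type_subst)

lemma wff_inst: "wff (\<sigma> # \<Gamma>) \<phi> \<Longrightarrow> has_type \<Gamma> t \<sigma> \<Longrightarrow> wff \<Gamma> (inst t \<phi>)"
  by (erule wff_subst) simp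

lemma wff_up:
  assumes "wff (\<sigma> # \<Gamma>) \<phi>" "\<forall>i<length \<Gamma>. has_type \<Gamma>' (s i) (\<Gamma> ! i)"
  shows "wff (\<sigma> # \<Gamma>') (subst (up s) \<phi>)"
  using assms(1) by (rule wff_subst) (use assms(2) in auto)

lemma internal_subst [simp]: "internal (subst s \<phi>) = internal \<phi>"
  by (induction \<phi> arbitrary: s) auto

lemma or_free_subst [simp]: "or_free (subst s \<phi>) = or_free \<phi>"
  by (induction \<phi> arbitrary: s) auto

lemma has_type_append: "has_type \<Gamma> t \<sigma> \<Longrightarrow> has_type (\<Gamma> @ \<Gamma>') t \<sigma>"
  by (induction rule: has_type.induct) (auto simp: nth_append)

lemma closed_has_type: "closed_term t \<sigma> \<Longrightarrow> has_type \<Gamma> t \<tau> \<longleftrightarrow> \<tau> = \<sigma>"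
  using has_type_append[of "[]" t \<sigma> \<Gamma>] has_type_unique by auto

lemma wff_append: "wff \<Gamma> \<phi> \<Longrightarrow> wff (\<Gamma> @ \<Gamma>') \<phi>"
proof (induction \<phi> arbitrary: \<Gamma>)
  case (Forall \<sigma> \<phi>)
  then show ?case using Forall.IH[of "\<sigma> # \<Gamma>"] by simp
next
  case (Exists \<sigma> \<phi>)
  then show ?case using Exists.IH[of "\<sigma> # \<Gamma>"] by simp
qed (auto intro: has_type_append)

text \<open>Dummy witnesses, the padding of challenges and the removal of leftover variables from a
  derivation all rest on a closed inhabitant of every type.\<close>

lemma zero_tm_closed: "closed_term (zero_tm \<sigma>) \<sigma>"
  by (induction \<sigma>) auto

lemma subst_zero_tm [simp]: "subst_tm s (zero_tm \<sigma>) = zero_tm \<sigma>"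
  by (rule closed_subst[OF zero_tm_closed])

lemma has_type_zero_tm [simp]: "has_type \<Gamma> (zero_tm \<sigma>) \<tau> \<longleftrightarrow> \<tau> = \<sigma>"
  by (rule closed_has_type[OF zero_tm_closed])

section \<open>Structural rules\<close>

lemma derives_wff: "derives L A \<Gamma> H \<phi> \<Longrightarrow> wff \<Gamma> \<phi>"
proof (induction rule: derives.induct)
  case (AllE \<Gamma> H \<sigma> \<phi> t)
  then show ?case by (auto intro: wff_inst)
qed auto

text \<open>Hypotheses matter only as a set, which makes inclusion a sound order on worlds.\<close>

lemma derives_hyps: "derives L A \<Gamma> H \<phi> \<Longrightarrow> set H \<subseteq> set H' \<Longrightarrow> derives L A \<Gamma> H' \<phi>"
proof (induction arbitrary: H' rule: derives.induct)
  case (OrE \<Gamma> H \<phi> \<psi> \<chi>)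
  show ?case by (rule derives.OrE[OF OrE.IH(1) OrE.IH(2) OrE.IH(3)]) (use OrE.prems in auto)
next
  case (ImpI \<Gamma> \<phi> H \<psi>)
  show ?case by (rule derives.ImpI[OF ImpI.hyps(1,2) ImpI.IH]) (use ImpI.prems in auto)
next
  case (AllI \<sigma> \<Gamma> H \<phi>)
  show ?case by (rule derives.AllI[OF AllI.IH]) (use AllI.prems in auto)
next
  case (ExE \<Gamma> H \<sigma> \<phi> \<psi>)
  show ?case by (rule derives.ExE[OF ExE.IH(1) ExE.IH(2) ExE.hyps(3,4)]) (use ExE.prems in auto)
next
  case (AndE1 \<Gamma> H \<phi> \<psi>)
  show ?case by (rule derives.AndE1[OF AndE1.IH[OF AndE1.prems]])
next
  case (AndE2 \<Gamma> H \<phi> \<psi>)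
  show ?case by (rule derives.AndE2[OF AndE2.IH[OF AndE2.prems]])
next
  case (ImpE \<Gamma> H \<phi> \<psi>)
  show ?case by (rule derives.ImpE[OF ImpE.IH(1)[OF ImpE.prems] ImpE.IH(2)[OF ImpE.prems]])
next
  case (AllE \<Gamma> H \<sigma> \<phi> t)
  show ?case by (rule derives.AllE[OF AllE.IH[OF AllE.prems] AllE.hyps(2)])
next
  case (ExI \<Gamma> H t \<phi> \<sigma>)
  show ?case by (rule derives.ExI[OF ExI.IH[OF ExI.prems] ExI.hyps(2-4)])
next
  case (BotE \<Gamma> H \<phi>)
  show ?case by (rule derives.BotE[OF BotE.IH[OF BotE.prems] BotE.hyps(2-3)])
qed (auto intro: derives.Axiom derives.Hyp derives.AndI derives.OrI1 derives.OrI2)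

text \<open>Extension at the far end of the context leaves all de Bruijn indices alone, so a
  derivation over \<open>ctx n\<close> can be reused over any larger \<open>ctx m\<close> without
  renaming.\<close>

lemma derives_append: "derives L A \<Gamma> H \<phi> \<Longrightarrow> derives L A (\<Gamma> @ \<Gamma>') H \<phi>"
proof (induction rule: derives.induct)
  case (AllE \<Gamma> H \<sigma> \<phi> t)
  show ?case by (rule derives.AllE[OF AllE.IH has_type_append[OF AllE.hyps(2)]])
next
  case (ExI \<Gamma> H t \<phi> \<sigma>)
  then show ?case using wff_append[of "\<sigma> # \<Gamma>"] by (auto intro: derives.ExI has_type_append)
next
  case (ExE \<Gamma> H \<sigma> \<phi> \<psi>)
  then show ?case by (auto intro: derives.ExE wff_append)
next
  case (AndE1 \<Gamma> H \<phi> \<psi>)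
  show ?case by (rule derives.AndE1[OF AndE1.IH])
next
  case (AndE2 \<Gamma> H \<phi> \<psi>)
  show ?case by (rule derives.AndE2[OF AndE2.IH])
next
  case (ImpE \<Gamma> H \<phi> \<psi>)
  show ?case by (rule derives.ImpE[OF ImpE.IH])
next
  case (OrE \<Gamma> H \<phi> \<psi> \<chi>)
  show ?case by (rule derives.OrE[OF OrE.IH])
qed (auto intro: derives.Axiom derives.Hyp derives.AndI derives.OrI1 derives.OrI2 derives.BotE
      derives.ImpI derives.AllI wff_append)

lemma up_shift: "subst (up s) (shift \<phi>) = shift (subst s \<phi>)"
  by simp

text \<open>Serves to rename a fresh variable to index 0, as generalization and existential
  elimination demand, and to replace leftover variables by closed terms. Under a binder the
  induction hypothesis is used at \<open>up s\<close>, which commutes with shifting the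
  hypotheses.\<close>

lemma derives_subst:
  assumes "derives L A \<Gamma> H \<phi>"
    and A: "\<And>\<phi> s. \<phi> \<in> A \<Longrightarrow> subst s \<phi> \<in> A" and L: "\<And>\<phi> s. L \<phi> \<Longrightarrow> L (subst s \<phi>)"
    and "\<forall>i<length \<Gamma>. has_type \<Gamma>' (s i) (\<Gamma> ! i)"
  shows "derives L A \<Gamma>' (map (subst s) H) (subst s \<phi>)"
  using assms(1,4)
proof (induction arbitrary: \<Gamma>' s rule: derives.induct)
  case (Axiom \<phi> \<Gamma> H)
  then show ?case by (auto intro!: derives.Axiom A L intro: wff_subst)
next
  case (Hyp \<phi> H \<Gamma>)
  then show ?case by (auto intro!: derives.Hyp L intro: wff_subst)
next
  case (BotE \<Gamma> H \<phi>)
  show ?case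
    by (rule derives.BotE[OF BotE.IH[OF BotE.prems, unfolded subst.simps]
          wff_subst[OF BotE.hyps(2) BotE.prems] L[OF BotE.hyps(3)]])
next
  case (AndI \<Gamma> H \<phi> \<psi>)
  show ?case unfolding subst.simps by (rule derives.AndI[OF AndI.IH[OF AndI.prems]])
next
  case (AndE1 \<Gamma> H \<phi> \<psi>)
  show ?case by (rule derives.AndE1[OF AndE1.IH[OF AndE1.prems, unfolded subst.simps]])
next
  case (AndE2 \<Gamma> H \<phi> \<psi>)
  show ?case by (rule derives.AndE2[OF AndE2.IH[OF AndE2.prems, unfolded subst.simps]])
next
  case (OrI1 \<Gamma> H \<phi> \<psi>)
  show ?case unfolding subst.simps
    by (rule derives.OrI1[OF OrI1.IH[OF OrI1.prems] wff_subst[OF OrI1.hyps(2) OrI1.prems] L[OF OrI1.hyps(3)]])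
next
  case (OrI2 \<Gamma> H \<psi> \<phi>)
  show ?case unfolding subst.simps
    by (rule derives.OrI2[OF OrI2.IH[OF OrI2.prems] wff_subst[OF OrI2.hyps(2) OrI2.prems] L[OF OrI2.hyps(3)]])
next
  case (OrE \<Gamma> H \<phi> \<psi> \<chi>)
  show ?case
    by (rule derives.OrE[OF OrE.IH(1)[OF OrE.prems, unfolded subst.simps]
          OrE.IH(2,3)[OF OrE.prems, unfolded list.map]])
next
  case (ImpI \<Gamma> \<phi> H \<psi>)
  show ?case unfolding subst.simps
    by (rule derives.ImpI[OF wff_subst[OF ImpI.hyps(1) ImpI.prems] L[OF ImpI.hyps(2)]
          ImpI.IH[OF ImpI.prems, unfolded list.map]])
next
  case (ImpE \<Gamma> H \<phi> \<psi>)
  show ?case by (rule derives.ImpE[OF ImpE.IH(1)[OF ImpE.prems, unfolded subst.simps] ImpE.IH(2)[OF ImpE.prems]])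
next
  case (AllI \<sigma> \<Gamma> H \<phi>)
  have "derives L A (\<sigma> # \<Gamma>') (map (subst (up s)) (map shift H)) (subst (up s) \<phi>)"
    by (rule AllI.IH) (use AllI.prems in \<open>auto simp: all_less_Suc\<close>)
  moreover have "map (subst (up s)) (map shift H) = map shift (map (subst s) H)" by simp
  ultimately show ?case by (simp only: subst.simps) (rule derives.AllI)
next
  case (AllE \<Gamma> H \<sigma> \<phi> t)
  have "derives L A \<Gamma>' (map (subst s) H) (Forall \<sigma> (subst (up s) \<phi>))"
    using AllE.IH[OF AllE.prems] by simp
  then have "derives L A \<Gamma>' (map (subst s) H) (inst (subst_tm s t) (subst (up s) \<phi>))"
    by (rule derives.AllE) (use AllE in \<open>auto intro: has_type_subst\<close>)
  then show ?case by simp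
next
  case (ExI \<Gamma> H t \<phi> \<sigma>)
  have "derives L A \<Gamma>' (map (subst s) H) (Exists \<sigma> (subst (up s) \<phi>))"
  proof (rule derives.ExI)
    show "derives L A \<Gamma>' (map (subst s) H) (inst (subst_tm s t) (subst (up s) \<phi>))"
      using ExI.IH[OF ExI.prems] by simp
    show "has_type \<Gamma>' (subst_tm s t) \<sigma>" using ExI by (auto intro: has_type_subst)
    show "wff (\<sigma> # \<Gamma>') (subst (up s) \<phi>)"
      using ExI by (auto intro: wff_up)
  qed (use ExI L in auto)
  then show ?case by simp
next
  case (ExE \<Gamma> H \<sigma> \<phi> \<psi>)
  have "derives L A (\<sigma> # \<Gamma>') (map (subst (up s)) (\<phi> # map shift H)) (subst (up s) (shift \<psi>))"
    by (rule ExE.IH) (use ExE.prems in \<open>auto simp: all_less_Suc\<close>)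
  moreover have "map (subst (up s)) (\<phi> # map shift H) = subst (up s) \<phi> # map shift (map (subst s) H)"
    by simp
  moreover have "derives L A \<Gamma>' (map (subst s) H) (Exists \<sigma> (subst (up s) \<phi>))"
    using ExE.IH(1)[OF ExE.prems] by simp
  ultimately have *: "derives L A (\<sigma> # \<Gamma>') (subst (up s) \<phi> # map shift (map (subst s) H)) (shift (subst s \<psi>))"
    and **: "derives L A \<Gamma>' (map (subst s) H) (Exists \<sigma> (subst (up s) \<phi>))"
    by (simp_all only: up_shift)
  show ?case
    by (rule derives.ExE[OF ** *]) (use wff_subst[OF ExE.hyps(3) ExE.prems] L[OF ExE.hyps(4)] in auto)
qed

text \<open>The axioms are schemata. Where an axiom binds variables, as in extensionality,
  \<open>SA\<close> and induction, the result is the instance at the substituted parameters; for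
  induction this is the formula substituted under the binder.\<close>

lemma EHA_subst: "\<phi> \<in> EHA_vf \<Longrightarrow> subst s \<phi> \<in> EHA_vf"
proof (induction rule: EHA_vf.induct)
  case (Ext \<sigma> \<tau> f g)
  show ?case using EHA_vf.Ext[of \<sigma> \<tau> "subst_tm s f" "subst_tm s g"] by simp
next
  case (SA \<sigma> t)
  show ?case using EHA_vf.SA[of \<sigma> "subst_tm s t"] by (simp add: numeral_eq_Suc weaken_def[abs_def])
next
  case (Induction \<phi>)
  then show ?case using EHA_vf.Induction[of "subst (up s) \<phi>"] by (simp add: weaken_def[abs_def])
qed (simp_all add: EHA_vf.intros)

lemma EHA_internal: "\<phi> \<in> EHA_vf \<Longrightarrow> internal \<phi>"
  by (induction rule: EHA_vf.induct) auto

lemma EHA_or_free: "\<phi> \<in> EHA_vf \<Longrightarrow> or_free \<phi>"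
  by (induction rule: EHA_vf.induct) auto

section \<open>Worlds\<close>

instance ty :: countable
  by countable_datatype

text \<open>
  A global typing of the variables in which every type occurs infinitely often. It makes canonical
  representatives of provably equal terms independent of the context.
\<close>

definition nu :: "nat \<Rightarrow> ty" where
  "nu k = from_nat (fst (prod_decode k))"

definition ctx :: "nat \<Rightarrow> ty list" where
  "ctx n = map nu [0..<n]"

text \<open>An index codes a pair of a type and a counter. The code of a pair is at least its second
  component, so the counter \<open>n\<close> pushes the index beyond any bound.\<close>

lemma nu_fresh: "\<exists>k\<ge>n. nu k = \<sigma>"
  by (rule exI[of _ "prod_encode (to_nat \<sigma>, n)"]) (simp add: nu_def le_prod_encode_2)

lemma length_ctx [simp]: "length (ctx n) = n"
  by (simp add: ctx_def)

lemma nth_ctx [simp]: "i < n \<Longrightarrow> ctx n ! i = nu i"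
  by (simp add: ctx_def)

lemma ctx_le: "n \<le> m \<Longrightarrow> \<exists>\<Gamma>. ctx m = ctx n @ \<Gamma>"
  unfolding ctx_def by (metis le_add_diff_inverse map_append upt_add_eq_append zero_le)

lemma has_type_ctx_mono: "has_type (\<Gamma> @ ctx n) t \<sigma> \<Longrightarrow> n \<le> m \<Longrightarrow> has_type (\<Gamma> @ ctx m) t \<sigma>"
  using ctx_le[of n m] has_type_append[of "\<Gamma> @ ctx n"] by auto

lemma wff_ctx_mono: "wff (\<Gamma> @ ctx n) \<phi> \<Longrightarrow> n \<le> m \<Longrightarrow> wff (\<Gamma> @ ctx m) \<phi>"
  using ctx_le[of n m] wff_append[of "\<Gamma> @ ctx n"] by auto

lemmas ctx_mono = has_type_ctx_mono[of "[]", simplified] wff_ctx_mono[of "[]", simplified]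
  wff_ctx_mono[of "[\<sigma>]" for \<sigma>, simplified]

text \<open>All free indices are typed by \<open>nu\<close>, so the segment \<open>ctx n\<close>
  only has to be long enough. Types are therefore unique although no context is mentioned.\<close>

definition typed :: "tm \<Rightarrow> ty \<Rightarrow> bool" where
  "typed t \<sigma> \<longleftrightarrow> (\<exists>n. has_type (ctx n) t \<sigma>)"

definition good :: "fm \<Rightarrow> bool" where
  "good \<phi> \<longleftrightarrow> (\<exists>n. wff (ctx n) \<phi>) \<and> internal \<phi> \<and> or_free \<phi>"

abbreviation styped :: "(nat \<Rightarrow> tm) \<Rightarrow> ty list \<Rightarrow> bool" where
  "styped s \<Gamma> \<equiv> \<forall>i<length \<Gamma>. typed (s i) (\<Gamma> ! i)"

lemma typed_Var: "nu k = \<sigma> \<Longrightarrow> typed (Var k) \<sigma>"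
  unfolding typed_def by (auto intro: exI[of _ "Suc k"])

lemma typed_closed: "closed_term t \<sigma> \<Longrightarrow> typed t \<sigma>"
  unfolding typed_def by (auto intro!: exI[of _ 0] simp: ctx_def)

lemma typed_unique: "typed t \<sigma> \<Longrightarrow> typed t \<tau> \<Longrightarrow> \<sigma> = \<tau>"
  unfolding typed_def by (meson ctx_mono(1) has_type_unique nle_le)

text \<open>The maximum of finitely many bounds works because the property persists upwards. It
  yields one segment in which all entries of a substitution are typed.\<close>

lemma bounded_ctx:
  fixes n :: nat
  assumes "\<forall>i<n. \<exists>m. P i m" "\<And>i m m' :: nat. P i m \<Longrightarrow> m \<le> m' \<Longrightarrow> P i m'"
  shows "\<exists>m. \<forall>i<n. P i m"
  using assms(1)
proof (induction n)
  case (Suc n)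
  then obtain m m' where "\<forall>i<n. P i m" "P n m'" by (meson lessI less_SucI)
  then have "\<forall>i<Suc n. P i (max m m')"
    using assms(2) by (metis less_Suc_eq max.cobounded1 max.cobounded2)
  then show ?case by blast
qed simp

lemma styped_ctx: "styped s \<Gamma> \<Longrightarrow> \<exists>n. \<forall>i<length \<Gamma>. has_type (ctx n) (s i) (\<Gamma> ! i)"
  unfolding typed_def by (rule bounded_ctx) (auto intro: ctx_mono)

lemma typed_subst: "has_type \<Gamma> t \<sigma> \<Longrightarrow> styped s \<Gamma> \<Longrightarrow> typed (subst_tm s t) \<sigma>"
  using styped_ctx[of \<Gamma> s] has_type_subst unfolding typed_def by blast

lemma typed_App [intro]: "typed f (\<sigma> \<Rrightarrow> \<tau>) \<Longrightarrow> typed a \<sigma> \<Longrightarrow> typed (f \<cdot> a) \<tau>"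
  using typed_subst[of "[\<sigma> \<Rrightarrow> \<tau>, \<sigma>]" "Var 0 \<cdot> Var 1" \<tau> "f .: a .: Var"] by simp

lemma good_subst: "wff \<Gamma> \<phi> \<Longrightarrow> internal \<phi> \<Longrightarrow> or_free \<phi> \<Longrightarrow> styped s \<Gamma> \<Longrightarrow> good (subst s \<phi>)"
  using styped_ctx[of \<Gamma> s] wff_subst unfolding good_def by (auto; blast)

lemma good_simps [simp]:
  "good (\<phi> \<^bold>\<and> \<psi>) \<longleftrightarrow> good \<phi> \<and> good \<psi>"
  "good (\<phi> \<^bold>\<longrightarrow> \<psi>) \<longleftrightarrow> good \<phi> \<and> good \<psi>"
  "good Bot"
  unfolding good_def by (auto, (meson ctx_mono(2) nle_le)+)

lemma good_Eq: "typed s \<sigma> \<Longrightarrow> typed t \<sigma> \<Longrightarrow> good (Eq \<sigma> s t)"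
  unfolding good_def typed_def by (auto, meson ctx_mono(1) nle_le)

text \<open>
  A world is a finite set of hypotheses. Free variables need no bookkeeping, since the typing
  \<^const>\<open>nu\<close> is fixed.
\<close>

typedef world = "{H :: fm list. \<exists>n. \<forall>h\<in>set H. wff (ctx n) h}"
  by (rule exI[of _ "[]"]) simp

definition leq :: "world \<Rightarrow> world \<Rightarrow> bool" (infix "\<sqsubseteq>" 50) where
  "p \<sqsubseteq> q \<longleftrightarrow> set (Rep_world p) \<subseteq> set (Rep_world q)"

definition root :: world where
  "root = Abs_world []"

definition extend :: "fm \<Rightarrow> world \<Rightarrow> world" where
  "extend \<phi> p = Abs_world (\<phi> # Rep_world p)"

lemma leq_refl [simp, intro!]: "p \<sqsubseteq> p"
  by (simp add: leq_def)

lemma leq_trans [trans]: "p \<sqsubseteq> q \<Longrightarrow> q \<sqsubseteq> r \<Longrightarrow> p \<sqsubseteq> r"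
  by (auto simp: leq_def)

lemma Rep_root: "Rep_world root = []"
  by (simp add: root_def Abs_world_inverse)

lemma root_leq [simp]: "root \<sqsubseteq> p"
  by (simp add: leq_def Rep_root)

lemma world_ctx: "\<exists>n. \<forall>h\<in>set (Rep_world p). wff (ctx n) h"
  using Rep_world[of p] by simp

lemma Rep_extend: "good \<phi> \<Longrightarrow> Rep_world (extend \<phi> p) = \<phi> # Rep_world p"
proof -
  assume "good \<phi>"
  then obtain n where n: "wff (ctx n) \<phi>" by (auto simp: good_def)
  obtain m where m: "\<forall>h\<in>set (Rep_world p). wff (ctx m) h" using world_ctx by blast
  have "\<forall>h\<in>set (\<phi> # Rep_world p). wff (ctx (max n m)) h"
    using n m ctx_mono(2) by (metis max.cobounded1 max.cobounded2 set_ConsD)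
  then show ?thesis unfolding extend_def by (intro Abs_world_inverse) blast
qed

lemma leq_extend [simp]: "good \<phi> \<Longrightarrow> p \<sqsubseteq> extend \<phi> p"
  by (auto simp: leq_def Rep_extend)

section \<open>Provability under hypotheses as forcing\<close>

locale model =
  fixes \<Delta> :: "fm set"
  assumes Delta: "\<And>\<delta>. \<delta> \<in> \<Delta> \<Longrightarrow> sentence \<delta> \<and> internal \<delta> \<and> or_free \<delta>"
begin

definition Th :: "fm set" where
  "Th = EHA_vf \<union> \<Delta>"

lemma Th_subst: "\<phi> \<in> Th \<Longrightarrow> subst s \<phi> \<in> Th"
  using EHA_subst Delta by (auto simp: Th_def sentence_subst)

lemma Th_internal: "\<phi> \<in> Th \<Longrightarrow> internal \<phi>"
  using EHA_internal Delta by (auto simp: Th_def)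

lemma Th_or_free: "\<phi> \<in> Th \<Longrightarrow> or_free \<phi>"
  using EHA_or_free Delta by (auto simp: Th_def)

text \<open>The context is existential because a derivation over one segment is also one over every
  longer segment. A world can therefore consist of hypotheses alone.\<close>

definition prov :: "world \<Rightarrow> fm \<Rightarrow> bool" where
  "prov p \<phi> \<longleftrightarrow> (\<exists>n. derives internal Th (ctx n) (Rep_world p) \<phi>)"

lemma derives_ctx_mono: "derives L A (ctx n) H \<phi> \<Longrightarrow> n \<le> m \<Longrightarrow> derives L A (ctx m) H \<phi>"
  using ctx_le[of n m] derives_append by fastforce

lemma prov_mono: "prov p \<phi> \<Longrightarrow> p \<sqsubseteq> q \<Longrightarrow> prov q \<phi>"
  using derives_hyps unfolding prov_def leq_def by blast

lemma prov_at: "prov p \<phi> \<Longrightarrow> \<exists>n. \<forall>m\<ge>n. derives internal Th (ctx m) (Rep_world p) \<phi>"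
  unfolding prov_def using derives_ctx_mono by blast

lemma world_at: "\<exists>n. \<forall>m\<ge>n. \<forall>h\<in>set (Rep_world p). wff (ctx m) h"
  using world_ctx[of p] ctx_mono(2) by blast

lemma prov_Axiom: "\<phi> \<in> Th \<Longrightarrow> good \<phi> \<Longrightarrow> prov p \<phi>"
  unfolding prov_def good_def using derives.Axiom by blast

lemma prov_extend: "good \<phi> \<Longrightarrow> prov (extend \<phi> p) \<phi>"
  unfolding prov_def by (simp add: Rep_extend) (auto simp: good_def intro!: derives.Hyp)

lemma prov_AndI: "prov p \<phi> \<Longrightarrow> prov p \<psi> \<Longrightarrow> prov p (\<phi> \<^bold>\<and> \<psi>)"
  using prov_at[of p \<phi>] prov_at[of p \<psi>] unfolding prov_def
  by (metis derives.AndI nle_le)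

lemma prov_And: "prov p (\<phi> \<^bold>\<and> \<psi>) \<longleftrightarrow> prov p \<phi> \<and> prov p \<psi>"
  using prov_AndI unfolding prov_def by (blast intro: derives.AndE1 derives.AndE2)

lemma prov_Bot: "prov p Bot \<Longrightarrow> good \<phi> \<Longrightarrow> prov p \<phi>"
proof -
  assume "prov p Bot" "good \<phi>"
  then obtain n m where "\<forall>m\<ge>n. derives internal Th (ctx m) (Rep_world p) Bot"
      "wff (ctx m) \<phi>" "internal \<phi>"
    using prov_at by (meson good_def)
  then have "derives internal Th (ctx (max n m)) (Rep_world p) \<phi>"
    by - (rule derives.BotE, auto intro: ctx_mono)
  then show ?thesis unfolding prov_def by blast
qed

lemma prov_ImpE: "prov p (\<phi> \<^bold>\<longrightarrow> \<psi>) \<Longrightarrow> prov p \<phi> \<Longrightarrow> prov p \<psi>"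
proof -
  assume "prov p (\<phi> \<^bold>\<longrightarrow> \<psi>)" "prov p \<phi>"
  then obtain n m where *: "\<forall>k\<ge>n. derives internal Th (ctx k) (Rep_world p) (\<phi> \<^bold>\<longrightarrow> \<psi>)"
      "\<forall>k\<ge>m. derives internal Th (ctx k) (Rep_world p) \<phi>"
    using prov_at by meson
  then have "derives internal Th (ctx (max n m)) (Rep_world p) \<psi>"
    by - (rule derives.ImpE[of internal Th _ _ \<phi> \<psi>], auto)
  then show ?thesis unfolding prov_def by blast
qed

text \<open>The world \<open>extend \<phi> p\<close> is the generic extension that proves
  \<open>\<phi>\<close>: the semantic premise is applied there, and discharging the added hypothesis
  gives the implication.\<close>

lemma prov_ImpI:
  assumes "good \<phi>" and "\<And>q. p \<sqsubseteq> q \<Longrightarrow> prov q \<phi> \<Longrightarrow> prov q \<psi>"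
  shows "prov p (\<phi> \<^bold>\<longrightarrow> \<psi>)"
proof -
  have "prov (extend \<phi> p) \<psi>" using assms prov_extend leq_extend by blast
  then obtain n m where *: "\<forall>k\<ge>n. derives internal Th (ctx k) (\<phi> # Rep_world p) \<psi>"
      "wff (ctx m) \<phi>" "internal \<phi>"
    using prov_at assms(1) Rep_extend by (metis good_def)
  then have "derives internal Th (ctx (max n m)) (Rep_world p) (\<phi> \<^bold>\<longrightarrow> \<psi>)"
    by - (rule derives.ImpI, auto intro: ctx_mono)
  then show ?thesis unfolding prov_def by blast
qed

lemma prov_Imp:
  "good \<phi> \<Longrightarrow> prov p (\<phi> \<^bold>\<longrightarrow> \<psi>) \<longleftrightarrow> (\<forall>q. p \<sqsubseteq> q \<longrightarrow> prov q \<phi> \<longrightarrow> prov q \<psi>)"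
  using prov_ImpI prov_ImpE prov_mono by meson

lemma prov_AllE: "prov p (Forall \<sigma> \<phi>) \<Longrightarrow> typed t \<sigma> \<Longrightarrow> prov p (inst t \<phi>)"
proof -
  assume "prov p (Forall \<sigma> \<phi>)" "typed t \<sigma>"
  then obtain n m where *: "\<forall>k\<ge>n. derives internal Th (ctx k) (Rep_world p) (Forall \<sigma> \<phi>)"
      "has_type (ctx m) t \<sigma>"
    using prov_at by (meson typed_def)
  then have "derives internal Th (ctx (max n m)) (Rep_world p) (inst t \<phi>)"
    by - (rule derives.AllE[of internal Th _ _ \<sigma>], auto intro: ctx_mono)
  then show ?thesis unfolding prov_def by blast
qed

text \<open>
  Turns the fresh variable \<open>k\<close> into index 0; variables outside of \<open>ctx n\<close> that may occur in the
  derivation are replaced by closed terms.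
\<close>

definition bind :: "nat \<Rightarrow> nat \<Rightarrow> nat \<Rightarrow> tm" where
  "bind n k i = (if i < n then Var (Suc i) else if i = k then Var 0 else zero_tm (nu i))"

lemma derives_bind:
  assumes "derives internal Th (ctx m) H \<psi>" "k < m" "n \<le> k" "nu k = \<sigma>"
  shows "derives internal Th (\<sigma> # ctx n) (map (subst (bind n k)) H) (subst (bind n k) \<psi>)"
  by (rule derives_subst[OF assms(1) Th_subst]) (use assms(2-4) in \<open>auto simp: bind_def\<close>)

text \<open>Below \<open>n\<close> the substitution \<open>bind n k\<close> acts as the shift, so
  hypotheses over \<open>ctx n\<close> turn into the shifted hypotheses that the quantifier rules
  expect.\<close>

lemma bind_shift: "wff (ctx n) \<phi> \<Longrightarrow> subst (bind n k) \<phi> = shift \<phi>"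
  by (erule subst_cong) (simp add: bind_def)

lemma bind_inst: "wff (\<sigma> # ctx n) \<phi> \<Longrightarrow> n \<le> k \<Longrightarrow> subst (bind n k) (inst (Var k) \<phi>) = \<phi>"
  using subst_cong[of "\<sigma> # ctx n" \<phi> "comp_subst (bind n k) (Var k .: Var)" Var]
  by (simp add: bind_def)

text \<open>A variable of type \<open>\<sigma>\<close> beyond all variables of the formula and the
  hypotheses is a generic element. The premise at this variable is a derivation that meets the
  eigenvariable condition, and \<open>bind\<close> turns the variable into index 0.\<close>

lemma prov_AllI:
  assumes wf: "wff (\<sigma> # ctx n) \<phi>" and prem: "\<And>t. typed t \<sigma> \<Longrightarrow> prov p (inst t \<phi>)"
  shows "prov p (Forall \<sigma> \<phi>)"
proof -
  obtain n' where n': "\<And>m. m \<ge> n' \<Longrightarrow> \<forall>h\<in>set (Rep_world p). wff (ctx m) h"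
    using world_at by blast
  define N where "N = max n n'"
  have N: "wff (\<sigma> # ctx N) \<phi>" "\<forall>h\<in>set (Rep_world p). wff (ctx N) h"
    using wf n' ctx_mono(3) by (auto simp: N_def)
  obtain k where k: "k \<ge> N" "nu k = \<sigma>" using nu_fresh by blast
  \<comment> \<open>The segment has to contain the fresh variable \<open>k\<close> itself, hence the
    bound \<open>Suc k\<close>.\<close>
  obtain m where m: "derives internal Th (ctx (max m (Suc k))) (Rep_world p) (inst (Var k) \<phi>)"
    using prov_at[OF prem[OF typed_Var[OF k(2)]]] by (meson max.cobounded1)
  have eq: "map (subst (bind N k)) (Rep_world p) = map shift (Rep_world p)"
    using N(2) bind_shift by simp
  have "derives internal Th (\<sigma> # ctx N) (map shift (Rep_world p)) \<phi>"
    using derives_bind[OF m _ k] unfolding eq bind_inst[OF N(1) k(1)] by simp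
  then show ?thesis using derives.AllI unfolding prov_def by blast
qed

lemma prov_ExI:
  assumes "wff (\<sigma> # ctx n) \<phi>" "internal \<phi>" "prov p (inst t \<phi>)" "typed t \<sigma>"
  shows "prov p (Exists \<sigma> \<phi>)"
proof -
  obtain m k where *: "\<forall>j\<ge>m. derives internal Th (ctx j) (Rep_world p) (inst t \<phi>)"
      "has_type (ctx k) t \<sigma>"
    using prov_at assms(3,4) by (meson typed_def)
  have "derives internal Th (ctx (max n (max m k))) (Rep_world p) (Exists \<sigma> \<phi>)"
    by (rule derives.ExI[of internal Th _ _ t]) (use * assms(1,2) in \<open>auto intro: ctx_mono\<close>)
  then show ?thesis unfolding prov_def by blast
qed

text \<open>The fresh variable \<open>k\<close>, with its instance added as a hypothesis, supplies a
  witness in an extension of the world; existential elimination carries the goal back to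
  \<open>p\<close>. The goal must be a formula for this, which shapes all later elimination
  rules.\<close>

lemma prov_ExE:
  assumes ex: "prov p (Exists \<sigma> \<phi>)" and "good \<chi>" and \<phi>: "internal \<phi>" "or_free \<phi>"
    and prem: "\<And>q t. p \<sqsubseteq> q \<Longrightarrow> typed t \<sigma> \<Longrightarrow> prov q (inst t \<phi>) \<Longrightarrow> prov q \<chi>"
  shows "prov p \<chi>"
proof -
  obtain n1 where n1: "\<And>m. m \<ge> n1 \<Longrightarrow> \<forall>h\<in>set (Rep_world p). wff (ctx m) h"
    using world_at by blast
  obtain n2 where n2: "\<And>m. m \<ge> n2 \<Longrightarrow> derives internal Th (ctx m) (Rep_world p) (Exists \<sigma> \<phi>)"
    using prov_at[OF ex] by blast
  obtain n3 where n3: "wff (ctx n3) \<chi>" and int: "internal \<chi>" using assms(2) by (auto simp: good_def)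
  define N where "N = max n1 (max n2 n3)"
  have N: "wff (\<sigma> # ctx N) \<phi>" "\<forall>h\<in>set (Rep_world p). wff (ctx N) h" "wff (ctx N) \<chi>"
      "derives internal Th (ctx N) (Rep_world p) (Exists \<sigma> \<phi>)"
    using n1 n2[of N] derives_wff[OF n2[of N]] n3 ctx_mono(2)[OF n3, of N]
    by (auto simp: N_def)
  obtain k where k: "k \<ge> N" "nu k = \<sigma>" using nu_fresh by blast
  have good: "good (inst (Var k) \<phi>)"
    by (rule good_subst[OF N(1) \<phi>]) (use k in \<open>auto intro: typed_Var\<close>)
  define q where "q = extend (inst (Var k) \<phi>) p"
  have "prov q \<chi>"
    unfolding q_def by (rule prem) (use good k prov_extend in \<open>auto intro: typed_Var\<close>)
  then obtain m where m: "derives internal Th (ctx (max m (Suc k))) (inst (Var k) \<phi> # Rep_world p) \<chi>"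
    using prov_at by (metis max.cobounded1 Rep_extend[OF good] q_def)
  have eq: "map (subst (bind N k)) (inst (Var k) \<phi> # Rep_world p) = \<phi> # map shift (Rep_world p)"
    using N(2) bind_shift bind_inst[OF N(1) k(1)] by (simp del: subst_subst)
  have "derives internal Th (\<sigma> # ctx N) (\<phi> # map shift (Rep_world p)) (shift \<chi>)"
    using derives_bind[OF m _ k] unfolding eq bind_shift[OF N(3)] by simp
  then have "derives internal Th (ctx N) (Rep_world p) \<chi>"
    by (rule derives.ExE[OF N(4)]) (use N int in auto)
  then show ?thesis unfolding prov_def by blast
qed

section \<open>Equality and the applicative structure\<close>

lemma prov_EHA: "\<phi> \<in> EHA_vf \<Longrightarrow> good \<phi> \<Longrightarrow> prov p \<phi>"
  by (rule prov_Axiom) (simp_all add: Th_def)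

lemma prov_refl: "typed t \<sigma> \<Longrightarrow> prov p (Eq \<sigma> t t)"
  by (intro prov_EHA EHA_vf.Refl good_Eq)

lemma prov_sym: "prov p (Eq \<sigma> s t) \<Longrightarrow> typed s \<sigma> \<Longrightarrow> typed t \<sigma> \<Longrightarrow> prov p (Eq \<sigma> t s)"
  by (rule prov_ImpE[OF prov_EHA[OF EHA_vf.Sym]]) (simp_all add: good_Eq)

lemma prov_trans:
  "prov p (Eq \<sigma> s t) \<Longrightarrow> prov p (Eq \<sigma> t u) \<Longrightarrow> typed s \<sigma> \<Longrightarrow> typed t \<sigma> \<Longrightarrow> typed u \<sigma>
    \<Longrightarrow> prov p (Eq \<sigma> s u)"
  by (rule prov_ImpE[OF prov_EHA[OF EHA_vf.Trans[of _ s t u]]]) (simp_all add: good_Eq prov_And)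

lemma prov_App:
  "prov p (Eq (\<sigma> \<Rrightarrow> \<tau>) f g) \<Longrightarrow> prov p (Eq \<sigma> s t) \<Longrightarrow> typed f (\<sigma> \<Rrightarrow> \<tau>) \<Longrightarrow> typed g (\<sigma> \<Rrightarrow> \<tau>)
    \<Longrightarrow> typed s \<sigma> \<Longrightarrow> typed t \<sigma> \<Longrightarrow> prov p (Eq \<tau> (f \<cdot> s) (g \<cdot> t))"
  by (rule prov_ImpE[OF prov_EHA[OF EHA_vf.Cong[of \<sigma> \<tau> f g s t]]])
    (auto simp: prov_And intro!: good_Eq)

lemma styped_wff_up:
  assumes "wff (\<sigma> # \<Gamma>) \<phi>" "styped s \<Gamma>"
  shows "\<exists>n. wff (\<sigma> # ctx n) (subst (up s) \<phi>)"
  using styped_ctx[OF assms(2)] wff_up[OF assms(1)] by blast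

lemma inst_up [simp]: "inst t (subst (up s) \<phi>) = subst (t .: s) \<phi>"
  by simp

text \<open>The domain is the same in all worlds, so the clause needs no quantification over
  extensions.\<close>

lemma prov_subst_Forall:
  assumes "wff (\<sigma> # \<Gamma>) \<phi>" "styped s \<Gamma>"
  shows "prov p (subst s (Forall \<sigma> \<phi>)) \<longleftrightarrow> (\<forall>t. typed t \<sigma> \<longrightarrow> prov p (subst (t .: s) \<phi>))"
proof -
  obtain n where n: "wff (\<sigma> # ctx n) (subst (up s) \<phi>)" using styped_wff_up[OF assms] by blast
  show ?thesis
    using prov_AllI[OF n] prov_AllE[of p \<sigma> "subst (up s) \<phi>"] unfolding subst.simps inst_up by blast
qed

lemma prov_subst_ExistsI:
  assumes "wff (\<sigma> # \<Gamma>) \<phi>" "styped s \<Gamma>" "internal \<phi>" "typed t \<sigma>" "prov p (subst (t .: s) \<phi>)"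
  shows "prov p (subst s (Exists \<sigma> \<phi>))"
proof -
  obtain n where n: "wff (\<sigma> # ctx n) (subst (up s) \<phi>)" using styped_wff_up[OF assms(1,2)] by blast
  show ?thesis
    unfolding subst.simps by (rule prov_ExI[OF n _ _ assms(4)]) (use assms in simp_all)
qed

lemma prov_subst_ExistsE:
  assumes "prov p (subst s (Exists \<sigma> \<phi>))" "good \<chi>" "internal \<phi>" "or_free \<phi>"
    and "\<And>q t. p \<sqsubseteq> q \<Longrightarrow> typed t \<sigma> \<Longrightarrow> prov q (subst (t .: s) \<phi>) \<Longrightarrow> prov q \<chi>"
  shows "prov p \<chi>"
  by (rule prov_ExE[of p \<sigma> "subst (up s) \<phi>"]) (use assms in simp_all)

lemma prov_subst_tm_cong:
  assumes "has_type \<Gamma> t \<sigma>" "styped s \<Gamma>" "styped s' \<Gamma>"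
    and "\<forall>i<length \<Gamma>. prov p (Eq (\<Gamma> ! i) (s i) (s' i))"
  shows "prov p (Eq \<sigma> (subst_tm s t) (subst_tm s' t))"
  using assms(1)
proof (induction t arbitrary: \<sigma>)
  case (App f a)
  then obtain \<tau> where *: "has_type \<Gamma> f (\<tau> \<Rrightarrow> \<sigma>)" "has_type \<Gamma> a \<tau>" by auto
  show ?case
    using prov_App[OF App.IH(1)[OF *(1)] App.IH(2)[OF *(2)]] typed_subst[OF *(1)] typed_subst[OF *(2)]
      assms(2,3) by simp
qed (use assms in \<open>auto intro!: prov_refl typed_closed\<close>)

text \<open>One direction is enough for the induction, since the implication case exchanges the
  roles of the two substitutions and passes to a later world; hence both are kept arbitrary. A
  quantifier adds the same term to both substitutions.\<close>

lemma prov_subst_cong_imp: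
  assumes "wff \<Gamma> \<phi>" "internal \<phi>" "or_free \<phi>" "styped s \<Gamma>" "styped s' \<Gamma>"
    and "\<forall>i<length \<Gamma>. prov p (Eq (\<Gamma> ! i) (s i) (s' i))"
    and "prov p (subst s \<phi>)"
  shows "prov p (subst s' \<phi>)"
  using assms
proof (induction \<phi> arbitrary: \<Gamma> s s' p)
  case (Eq \<sigma> t u)
  note tu = Eq.prems(1)[simplified]
  note ty = typed_subst[OF _ Eq.prems(4)] typed_subst[OF _ Eq.prems(5)]
  have t: "prov p (Eq \<sigma> (subst_tm s' t) (subst_tm s t))"
    using prov_subst_tm_cong[of \<Gamma> t \<sigma> s s' p] Eq.prems tu ty prov_sym by blast
  have u: "prov p (Eq \<sigma> (subst_tm s u) (subst_tm s' u))"
    using prov_subst_tm_cong[of \<Gamma> u \<sigma> s s' p] Eq.prems tu by blast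
  have "prov p (Eq \<sigma> (subst_tm s t) (subst_tm s u))" using Eq.prems(7) by simp
  from prov_trans[OF prov_trans[OF t this] u] show ?case using tu ty by simp
next
  case (And \<phi> \<psi>)
  have "prov p (subst s' \<phi>)" by (rule And.IH(1)[of \<Gamma> s]) (use And.prems in \<open>auto simp: prov_And\<close>)
  moreover have "prov p (subst s' \<psi>)" by (rule And.IH(2)[of \<Gamma> s]) (use And.prems in \<open>auto simp: prov_And\<close>)
  ultimately show ?case by (simp add: prov_And)
next
  case (Imp \<phi> \<psi>)
  have good: "good (subst s' \<phi>)" using Imp.prems by (auto intro: good_subst)
  have "prov q (subst s' \<psi>)" if q: "p \<sqsubseteq> q" "prov q (subst s' \<phi>)" for q
  proof (rule Imp.IH(2)[of \<Gamma> s])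
    have "prov q (subst s \<phi>)"
    proof (rule Imp.IH(1)[of \<Gamma> s'])
      show "\<forall>i<length \<Gamma>. prov q (Eq (\<Gamma> ! i) (s' i) (s i))"
        using Imp.prems(4-6) prov_sym prov_mono[OF _ q(1)] by blast
    qed (use Imp.prems q in auto)
    moreover have "prov q (subst s \<phi> \<^bold>\<longrightarrow> subst s \<psi>)" using Imp.prems(7) prov_mono[OF _ q(1)] by simp
    ultimately show "prov q (subst s \<psi>)" using prov_ImpE by blast
    show "\<forall>i<length \<Gamma>. prov q (Eq (\<Gamma> ! i) (s i) (s' i))"
      using Imp.prems(6) prov_mono[OF _ q(1)] by blast
  qed (use Imp.prems q in auto)
  then show ?case using prov_ImpI[OF good] by simp
next
  case (Forall \<sigma> \<phi>)
  have "prov p (subst (t .: s') \<phi>)" if "typed t \<sigma>" for t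
  proof (rule Forall.IH[of "\<sigma> # \<Gamma>" "t .: s"])
    show "prov p (subst (t .: s) \<phi>)"
      using Forall.prems(7) prov_subst_Forall[of \<sigma> \<Gamma> \<phi> s p] Forall.prems that by simp
  qed (use Forall.prems that prov_refl in auto)
  then show ?case using prov_subst_Forall[of \<sigma> \<Gamma> \<phi> s' p] Forall.prems by simp
next
  case (Exists \<sigma> \<phi>)
  show ?case
  proof (rule prov_subst_ExistsE[OF Exists.prems(7)])
    show "good (subst s' (Exists \<sigma> \<phi>))" using good_subst[OF Exists.prems(1,2,3,5)] .
    fix q t assume q: "p \<sqsubseteq> q" and t: "typed t \<sigma>" and *: "prov q (subst (t .: s) \<phi>)"
    have "prov q (subst (t .: s') \<phi>)"
    proof (rule Exists.IH[of "\<sigma> # \<Gamma>", OF _ _ _ _ _ _ *])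
      show "\<forall>i<length (\<sigma> # \<Gamma>). prov q (Eq ((\<sigma> # \<Gamma>) ! i) ((t .: s) i) ((t .: s') i))"
        using Exists.prems(6) prov_mono[OF _ q] prov_refl[OF t] by simp
    qed (use Exists.prems t in auto)
    then show "prov q (subst s' (Exists \<sigma> \<phi>))"
      using prov_subst_ExistsI[of \<sigma> \<Gamma> \<phi> s' t q] Exists.prems t by simp
  qed (use Exists.prems in auto)
qed auto

lemma prov_subst_cong:
  assumes "wff \<Gamma> \<phi>" "internal \<phi>" "or_free \<phi>" "styped s \<Gamma>" "styped s' \<Gamma>"
    and "\<forall>i<length \<Gamma>. prov p (Eq (\<Gamma> ! i) (s i) (s' i))"
  shows "prov p (subst s \<phi>) \<longleftrightarrow> prov p (subst s' \<phi>)"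
  using prov_subst_cong_imp[OF assms] prov_subst_cong_imp[OF assms(1-3,5,4)] assms(4-6) prov_sym
  by blast

section \<open>Representatives of provably equal terms\<close>

definition teq :: "tm \<Rightarrow> tm \<Rightarrow> bool" where
  "teq t u \<longleftrightarrow> (\<exists>\<sigma>. typed t \<sigma> \<and> typed u \<sigma> \<and> prov root (Eq \<sigma> t u))"

text \<open>A choice that depends only on the class of the term, so that provable equality without
  hypotheses turns into identity of representatives.\<close>

definition rep :: "tm \<Rightarrow> tm" where
  "rep t = (SOME u. teq t u)"

definition D :: "ty \<Rightarrow> tm set" where
  "D \<sigma> = rep ` {t. typed t \<sigma>}"

definition app :: "tm \<Rightarrow> tm \<Rightarrow> tm" (infixl "\<bullet>" 100) where
  "app f a = rep (f \<cdot> a)"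

text \<open>Equality under the hypotheses of a world. It is identity at \<open>root\<close>, but a
  world with hypotheses may identify further elements of the domain.\<close>

definition eqv :: "world \<Rightarrow> ty \<Rightarrow> tm \<Rightarrow> tm \<Rightarrow> bool" where
  "eqv p \<sigma> a b \<longleftrightarrow> prov p (Eq \<sigma> a b)"

lemma teq_rep: "typed t \<sigma> \<Longrightarrow> teq t (rep t)"
  unfolding rep_def by (rule someI[of _ t]) (auto simp: teq_def prov_refl)

lemma typed_rep: "typed t \<sigma> \<Longrightarrow> typed (rep t) \<sigma>"
  using teq_rep typed_unique unfolding teq_def by blast

lemma prov_rep: "typed t \<sigma> \<Longrightarrow> prov p (Eq \<sigma> t (rep t))"
  using teq_rep typed_unique prov_mono[of root] unfolding teq_def by fastforce

lemma rep_eq: "teq t u \<Longrightarrow> rep t = rep u"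
proof -
  assume "teq t u"
  then have "teq t = teq u"
    unfolding teq_def by (intro ext) (metis prov_sym prov_trans typed_unique)
  then show ?thesis by (simp add: rep_def)
qed

lemma rep_eqI: "typed t \<sigma> \<Longrightarrow> typed u \<sigma> \<Longrightarrow> prov root (Eq \<sigma> t u) \<Longrightarrow> rep t = rep u"
  by (rule rep_eq) (auto simp: teq_def)

lemma rep_in: "typed t \<sigma> \<Longrightarrow> rep t \<in> D \<sigma>"
  by (simp add: D_def)

lemma D_typed: "d \<in> D \<sigma> \<Longrightarrow> typed d \<sigma>"
  by (auto simp: D_def typed_rep)

lemma rep_D [simp]: "d \<in> D \<sigma> \<Longrightarrow> rep d = d"
  unfolding D_def using rep_eq[OF teq_rep] by auto

lemma app_in: "f \<in> D (\<sigma> \<Rrightarrow> \<tau>) \<Longrightarrow> a \<in> D \<sigma> \<Longrightarrow> f \<bullet> a \<in> D \<tau>"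
  unfolding app_def by (auto intro!: rep_in dest: D_typed)

lemma app_rep: "typed f (\<sigma> \<Rrightarrow> \<tau>) \<Longrightarrow> typed a \<sigma> \<Longrightarrow> rep f \<bullet> rep a = rep (f \<cdot> a)"
  unfolding app_def
  by (rule rep_eqI[of _ \<tau>])
    (auto intro!: typed_App prov_App prov_sym[OF prov_rep] prov_refl typed_rep)

lemma eqv_refl: "a \<in> D \<sigma> \<Longrightarrow> eqv p \<sigma> a a"
  by (simp add: eqv_def prov_refl D_typed)

lemma eqv_sym: "eqv p \<sigma> a b \<Longrightarrow> a \<in> D \<sigma> \<Longrightarrow> b \<in> D \<sigma> \<Longrightarrow> eqv p \<sigma> b a"
  unfolding eqv_def by (blast intro: prov_sym D_typed)

lemma eqv_trans:
  "eqv p \<sigma> a b \<Longrightarrow> eqv p \<sigma> b c \<Longrightarrow> a \<in> D \<sigma> \<Longrightarrow> b \<in> D \<sigma> \<Longrightarrow> c \<in> D \<sigma> \<Longrightarrow> eqv p \<sigma> a c"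
  unfolding eqv_def by (blast intro: prov_trans D_typed)

lemma eqv_mono: "eqv p \<sigma> a b \<Longrightarrow> p \<sqsubseteq> q \<Longrightarrow> eqv q \<sigma> a b"
  unfolding eqv_def by (rule prov_mono)

text \<open>Elements of the domain are chosen representatives. By this lemma the equational axioms
  become rewrite rules of HOL.\<close>

lemma eqv_root: "eqv root \<sigma> a b \<Longrightarrow> a \<in> D \<sigma> \<Longrightarrow> b \<in> D \<sigma> \<Longrightarrow> a = b"
  unfolding eqv_def using rep_eqI[of a \<sigma> b] D_typed by simp

lemma eqv_rep: "typed a \<sigma> \<Longrightarrow> typed b \<sigma> \<Longrightarrow> prov p (Eq \<sigma> a b) \<Longrightarrow> eqv p \<sigma> (rep a) (rep b)"
  unfolding eqv_def by (meson prov_rep prov_sym prov_trans typed_rep)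

lemma rep_eqv: "typed a \<sigma> \<Longrightarrow> typed b \<sigma> \<Longrightarrow> eqv p \<sigma> (rep a) (rep b) \<Longrightarrow> prov p (Eq \<sigma> a b)"
  unfolding eqv_def by (meson prov_rep prov_sym prov_trans typed_rep)

primrec ev :: "(nat \<Rightarrow> tm) \<Rightarrow> tm \<Rightarrow> tm" where
  "ev e (Var n) = e n"
| "ev e Zero = rep Zero"
| "ev e Succ = rep Succ"
| "ev e (CK \<sigma> \<tau>) = rep (CK \<sigma> \<tau>)"
| "ev e (CS \<rho> \<sigma> \<tau>) = rep (CS \<rho> \<sigma> \<tau>)"
| "ev e (Rec \<sigma>) = rep (Rec \<sigma>)"
| "ev e (Empty \<sigma>) = rep (Empty \<sigma>)"
| "ev e (Prep \<sigma>) = rep (Prep \<sigma>)"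
| "ev e (LRec \<sigma> \<rho>) = rep (LRec \<sigma> \<rho>)"
| "ev e (f \<cdot> a) = ev e f \<bullet> ev e a"

abbreviation env :: "(nat \<Rightarrow> tm) \<Rightarrow> ty list \<Rightarrow> bool" where
  "env e \<Gamma> \<equiv> \<forall>i<length \<Gamma>. e i \<in> D (\<Gamma> ! i)"

lemma env_styped: "env e \<Gamma> \<Longrightarrow> styped e \<Gamma>"
  using D_typed by blast

text \<open>Evaluation takes a representative at every application, the right-hand side only one at
  the end. Application respects provable equality, so both reach the same representative.\<close>

lemma ev_eq: "has_type \<Gamma> t \<sigma> \<Longrightarrow> env e \<Gamma> \<Longrightarrow> ev e t = rep (subst_tm e t)"
proof (induction t arbitrary: \<sigma>)
  case (App f a)
  then obtain \<tau> where "has_type \<Gamma> f (\<tau> \<Rrightarrow> \<sigma>)" "has_type \<Gamma> a \<tau>" by auto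
  with App env_styped[OF App.prems(2)] show ?case
    using app_rep[of "subst_tm e f" \<tau> \<sigma> "subst_tm e a"] typed_subst by simp
qed auto

lemma ev_in: "has_type \<Gamma> t \<sigma> \<Longrightarrow> env e \<Gamma> \<Longrightarrow> ev e t \<in> D \<sigma>"
  using ev_eq typed_subst[OF _ env_styped] rep_in by metis

lemma ev_closed: "closed_term t \<sigma> \<Longrightarrow> ev e t = rep t"
  using ev_eq[of "[]" t \<sigma> e] closed_subst[of t \<sigma> e] by simp

lemma ev_subst: "ev e (subst_tm s t) = ev (\<lambda>n. ev e (s n)) t"
  by (induction t) auto

lemma ev_zero_tm [simp]: "ev e (zero_tm \<sigma>) = rep (zero_tm \<sigma>)"
  by (rule ev_closed[OF zero_tm_closed])

section \<open>Forcing clauses over the constant domain\<close>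

definition force :: "world \<Rightarrow> (nat \<Rightarrow> tm) \<Rightarrow> fm \<Rightarrow> bool" where
  "force p e \<phi> \<longleftrightarrow> prov p (subst e \<phi>)"

definition okf :: "ty list \<Rightarrow> fm \<Rightarrow> bool" where
  "okf \<Gamma> \<phi> \<longleftrightarrow> wff \<Gamma> \<phi> \<and> internal \<phi> \<and> or_free \<phi>"

lemma okf_simps [simp]:
  "okf \<Gamma> (Eq \<sigma> s t) \<longleftrightarrow> has_type \<Gamma> s \<sigma> \<and> has_type \<Gamma> t \<sigma>"
  "okf \<Gamma> Bot"
  "okf \<Gamma> (\<phi> \<^bold>\<and> \<psi>) \<longleftrightarrow> okf \<Gamma> \<phi> \<and> okf \<Gamma> \<psi>"
  "okf \<Gamma> (\<phi> \<^bold>\<longrightarrow> \<psi>) \<longleftrightarrow> okf \<Gamma> \<phi> \<and> okf \<Gamma> \<psi>"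
  "okf \<Gamma> (Forall \<sigma> \<phi>) \<longleftrightarrow> okf (\<sigma> # \<Gamma>) \<phi>"
  "okf \<Gamma> (Exists \<sigma> \<phi>) \<longleftrightarrow> okf (\<sigma> # \<Gamma>) \<phi>"
  by (auto simp: okf_def)

lemma okf_subst: "okf \<Gamma> \<phi> \<Longrightarrow> \<forall>i<length \<Gamma>. has_type \<Gamma>' (s i) (\<Gamma> ! i) \<Longrightarrow> okf \<Gamma>' (subst s \<phi>)"
  by (auto simp: okf_def intro: wff_subst)

lemma okf_good: "okf \<Gamma> \<phi> \<Longrightarrow> env e \<Gamma> \<Longrightarrow> good (subst e \<phi>)"
  using good_subst env_styped by (auto simp: okf_def)

lemma force_mono: "force p e \<phi> \<Longrightarrow> p \<sqsubseteq> q \<Longrightarrow> force q e \<phi>"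
  unfolding force_def by (rule prov_mono)

lemma force_Eq:
  assumes "has_type \<Gamma> s \<sigma>" "has_type \<Gamma> t \<sigma>" "env e \<Gamma>"
  shows "force p e (Eq \<sigma> s t) \<longleftrightarrow> eqv p \<sigma> (ev e s) (ev e t)"
  using assms ev_eq eqv_rep rep_eqv typed_subst env_styped unfolding force_def by (metis subst.simps(1))

lemma force_And: "force p e (\<phi> \<^bold>\<and> \<psi>) \<longleftrightarrow> force p e \<phi> \<and> force p e \<psi>"
  by (simp add: force_def prov_And)

lemma force_Bot: "force p e Bot \<Longrightarrow> okf \<Gamma> \<phi> \<Longrightarrow> env e' \<Gamma> \<Longrightarrow> force p e' \<phi>"
  unfolding force_def using prov_Bot okf_good by simp

lemma force_Imp:
  assumes "okf \<Gamma> \<phi>" "env e \<Gamma>"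
  shows "force p e (\<phi> \<^bold>\<longrightarrow> \<psi>) \<longleftrightarrow> (\<forall>q. p \<sqsubseteq> q \<longrightarrow> force q e \<phi> \<longrightarrow> force q e \<psi>)"
  unfolding force_def using prov_Imp[OF okf_good[OF assms]] by simp

text \<open>A term and its representative are provably equal in every world. Quantifiers over terms
  may therefore range over representatives instead.\<close>

lemma rep_scons_cong:
  assumes "okf (\<sigma> # \<Gamma>) \<phi>" "env e \<Gamma>" "typed t \<sigma>"
  shows "prov p (subst (t .: e) \<phi>) \<longleftrightarrow> prov p (subst (rep t .: e) \<phi>)"
  by (rule prov_subst_cong[of "\<sigma> # \<Gamma>"])
    (use assms(1,3) env_styped[OF assms(2)] typed_rep[OF assms(3)] prov_rep[OF assms(3)]
      in \<open>auto simp: okf_def intro!: prov_refl\<close>)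

lemma force_Forall:
  assumes "okf (\<sigma> # \<Gamma>) \<phi>" "env e \<Gamma>"
  shows "force p e (Forall \<sigma> \<phi>) \<longleftrightarrow> (\<forall>d\<in>D \<sigma>. force p (d .: e) \<phi>)"
proof -
  have "force p e (Forall \<sigma> \<phi>) \<longleftrightarrow> (\<forall>t. typed t \<sigma> \<longrightarrow> prov p (subst (t .: e) \<phi>))"
    unfolding force_def
    by (rule prov_subst_Forall[OF _ env_styped[OF assms(2)]]) (use assms(1) in \<open>simp add: okf_def\<close>)
  also have "\<dots> \<longleftrightarrow> (\<forall>d\<in>D \<sigma>. prov p (subst (d .: e) \<phi>))"
    using rep_scons_cong[OF assms] unfolding D_def by blast
  finally show ?thesis by (simp add: force_def)
qed

lemma force_ExistsI:
  assumes "okf (\<sigma> # \<Gamma>) \<phi>" "env e \<Gamma>" "d \<in> D \<sigma>" "force p (d .: e) \<phi>"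
  shows "force p e (Exists \<sigma> \<phi>)"
  unfolding force_def
  by (rule prov_subst_ExistsI[of _ \<Gamma>])
    (use assms env_styped D_typed in \<open>auto simp: okf_def force_def\<close>)

lemma force_ExistsE:
  assumes "force p e (Exists \<sigma> \<phi>)" "okf (\<sigma> # \<Gamma>) \<phi>" "env e \<Gamma>" "okf \<Gamma>' \<chi>" "env e' \<Gamma>'"
    and "\<And>q d. p \<sqsubseteq> q \<Longrightarrow> d \<in> D \<sigma> \<Longrightarrow> force q (d .: e) \<phi> \<Longrightarrow> force q e' \<chi>"
  shows "force p e' \<chi>"
  unfolding force_def
proof (rule prov_subst_ExistsE)
  show "prov p (subst e (Exists \<sigma> \<phi>))" using assms(1) by (simp add: force_def)
  show "good (subst e' \<chi>)" using okf_good assms(4,5) by blast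
  fix q t assume "p \<sqsubseteq> q" "typed t \<sigma>" "prov q (subst (t .: e) \<phi>)"
  then show "prov q (subst e' \<chi>)"
    using assms(6)[of q "rep t"] rep_scons_cong[OF assms(2,3)] rep_in by (simp add: force_def)
qed (use assms(2) in \<open>auto simp: okf_def\<close>)

text \<open>Each substituted term is provably equal to the element to which it evaluates, so the
  claim reduces to invariance under provable equality.\<close>

lemma force_subst:
  assumes "okf \<Gamma> \<phi>" "\<forall>i<length \<Gamma>. has_type \<Gamma>' (s i) (\<Gamma> ! i)" "env e \<Gamma>'"
  shows "force p e (subst s \<phi>) \<longleftrightarrow> force p (\<lambda>n. ev e (s n)) \<phi>"
proof -
  have s: "typed (subst_tm e (s i)) (\<Gamma> ! i)" "ev e (s i) = rep (subst_tm e (s i))"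
    if "i < length \<Gamma>" for i
    using that assms(2) typed_subst[OF _ env_styped[OF assms(3)]] ev_eq[OF _ assms(3)] by blast+
  have *: "typed (ev e (s i)) (\<Gamma> ! i)" "prov p (Eq (\<Gamma> ! i) (subst_tm e (s i)) (ev e (s i)))"
    if "i < length \<Gamma>" for i
    using typed_rep[OF s(1)[OF that]] prov_rep[OF s(1)[OF that]] s(2)[OF that] by simp_all
  show ?thesis
    unfolding force_def subst_subst
    by (rule prov_subst_cong[of \<Gamma>]) (use assms(1) s(1) * in \<open>simp_all add: okf_def\<close>)
qed

lemma force_env_cong: "okf \<Gamma> \<phi> \<Longrightarrow> \<forall>i<length \<Gamma>. e i = e' i \<Longrightarrow> force p e \<phi> \<longleftrightarrow> force p e' \<phi>"
  unfolding force_def okf_def using subst_cong by metis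

lemma force_eqv:
  assumes "okf \<Gamma> \<phi>" "env e \<Gamma>" "env e' \<Gamma>" "\<forall>i<length \<Gamma>. eqv p (\<Gamma> ! i) (e i) (e' i)"
  shows "force p e \<phi> \<longleftrightarrow> force p e' \<phi>"
  using prov_subst_cong[of \<Gamma> \<phi> e e' p] assms env_styped unfolding force_def okf_def eqv_def by blast

lemma force_axiom: "\<phi> \<in> Th \<Longrightarrow> okf \<Gamma> \<phi> \<Longrightarrow> env e \<Gamma> \<Longrightarrow> force p e \<phi>"
  unfolding force_def by (rule prov_Axiom[OF Th_subst okf_good])

end

section \<open>Combinatory completeness\<close>

definition tyof :: "ty list \<Rightarrow> tm \<Rightarrow> ty" where
  "tyof \<Gamma> t = (THE \<tau>. has_type \<Gamma> t \<tau>)"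

lemma tyof_eq: "has_type \<Gamma> t \<tau> \<Longrightarrow> tyof \<Gamma> t = \<tau>"
  unfolding tyof_def using has_type_unique by blast

text \<open>Bracket abstraction of index 0. The combinators carry types, so the abstraction gets the
  context, from which \<open>tyof\<close> recovers the types of applications; for constants the
  empty context suffices.\<close>

primrec LAM :: "ty list \<Rightarrow> ty \<Rightarrow> tm \<Rightarrow> tm" where
  "LAM \<Gamma> \<sigma> (Var n) = (case n of 0 \<Rightarrow> CS \<sigma> (\<sigma> \<Rrightarrow> \<sigma>) \<sigma> \<cdot> CK \<sigma> (\<sigma> \<Rrightarrow> \<sigma>) \<cdot> CK \<sigma> \<sigma>
     | Suc m \<Rightarrow> CK (\<Gamma> ! m) \<sigma> \<cdot> Var m)"
| "LAM \<Gamma> \<sigma> Zero = CK (tyof [] Zero) \<sigma> \<cdot> Zero"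
| "LAM \<Gamma> \<sigma> Succ = CK (tyof [] Succ) \<sigma> \<cdot> Succ"
| "LAM \<Gamma> \<sigma> (CK \<alpha> \<beta>) = CK (tyof [] (CK \<alpha> \<beta>)) \<sigma> \<cdot> CK \<alpha> \<beta>"
| "LAM \<Gamma> \<sigma> (CS \<alpha> \<beta> \<gamma>) = CK (tyof [] (CS \<alpha> \<beta> \<gamma>)) \<sigma> \<cdot> CS \<alpha> \<beta> \<gamma>"
| "LAM \<Gamma> \<sigma> (Rec \<alpha>) = CK (tyof [] (Rec \<alpha>)) \<sigma> \<cdot> Rec \<alpha>"
| "LAM \<Gamma> \<sigma> (Empty \<alpha>) = CK (tyof [] (Empty \<alpha>)) \<sigma> \<cdot> Empty \<alpha>"
| "LAM \<Gamma> \<sigma> (Prep \<alpha>) = CK (tyof [] (Prep \<alpha>)) \<sigma> \<cdot> Prep \<alpha>"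
| "LAM \<Gamma> \<sigma> (LRec \<alpha> \<beta>) = CK (tyof [] (LRec \<alpha> \<beta>)) \<sigma> \<cdot> LRec \<alpha> \<beta>"
| "LAM \<Gamma> \<sigma> (f \<cdot> a) = CS \<sigma> (tyof (\<sigma> # \<Gamma>) a) (tyof (\<sigma> # \<Gamma>) (f \<cdot> a)) \<cdot> LAM \<Gamma> \<sigma> f \<cdot> LAM \<Gamma> \<sigma> a"

lemma has_type_LAM: "has_type (\<sigma> # \<Gamma>) t \<tau> \<Longrightarrow> has_type \<Gamma> (LAM \<Gamma> \<sigma> t) (\<sigma> \<Rrightarrow> \<tau>)"
proof (induction t arbitrary: \<tau>)
  case (App f a)
  then obtain \<rho> where *: "has_type (\<sigma> # \<Gamma>) f (\<rho> \<Rrightarrow> \<tau>)" "has_type (\<sigma> # \<Gamma>) a \<rho>" by auto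
  show ?case using App.IH(1)[OF *(1)] App.IH(2)[OF *(2)] tyof_eq[OF *(2)] tyof_eq[OF App.prems] by simp
qed (auto split: nat.split simp: tyof_eq)

lemma has_type_LAM_iff [simp]:
  "has_type (\<sigma> # \<Gamma>) t \<tau> \<Longrightarrow> has_type \<Gamma> (LAM \<Gamma> \<sigma> t) \<rho> \<longleftrightarrow> \<rho> = (\<sigma> \<Rrightarrow> \<tau>)"
  using has_type_LAM has_type_unique by blast

text \<open>The head of the list is abstracted first and so becomes the last argument:
  \<open>lams [\<sigma>, \<rho>] t\<close> takes an argument of type \<open>\<rho>\<close> and then
  one of type \<open>\<sigma>\<close>.\<close>

primrec lams :: "ty list \<Rightarrow> tm \<Rightarrow> tm" where
  "lams [] t = t"
| "lams (\<sigma> # \<Gamma>) t = lams \<Gamma> (LAM \<Gamma> \<sigma> t)"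

primrec funs :: "ty list \<Rightarrow> ty \<Rightarrow> ty" where
  "funs [] \<tau> = \<tau>"
| "funs (\<sigma> # \<Gamma>) \<tau> = funs \<Gamma> (\<sigma> \<Rrightarrow> \<tau>)"

lemma closed_lams: "has_type \<Gamma> t \<tau> \<Longrightarrow> closed_term (lams \<Gamma> t) (funs \<Gamma> \<tau>)"
  by (induction \<Gamma> arbitrary: t \<tau>) (auto intro: has_type_LAM)

context model
begin

lemma ev_scons [simp]: "(\<lambda>n. ev e ((t .: s) n)) = (ev e t .: (\<lambda>n. ev e (s n)))"
  by (auto simp: scons_def split: nat.split)

text \<open>An equation among the axioms is forced at \<open>root\<close> in every environment, and
  there forced equality is identity.\<close>

lemma ev_axiom:
  assumes "Eq \<sigma> a b \<in> EHA_vf" "has_type \<Gamma> a \<sigma>" "has_type \<Gamma> b \<sigma>" "env e \<Gamma>"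
  shows "ev e a = ev e b"
proof (rule eqv_root)
  have "force root e (Eq \<sigma> a b)" by (rule force_axiom[of _ \<Gamma>]) (use assms in \<open>simp_all add: Th_def\<close>)
  then show "eqv root \<sigma> (ev e a) (ev e b)" using force_Eq assms by blast
qed (use ev_in assms in blast)+

lemma rep_closed_in: "closed_term t \<sigma> \<Longrightarrow> rep t \<in> D \<sigma>"
  by (simp add: rep_in typed_closed)

lemma consts_in:
  "rep Zero \<in> D TNat" "rep Succ \<in> D (TNat \<Rrightarrow> TNat)"
  "rep (CK \<sigma> \<tau>) \<in> D (\<sigma> \<Rrightarrow> \<tau> \<Rrightarrow> \<sigma>)"
  "rep (CS \<rho> \<sigma> \<tau>) \<in> D ((\<rho> \<Rrightarrow> \<sigma> \<Rrightarrow> \<tau>) \<Rrightarrow> (\<rho> \<Rrightarrow> \<sigma>) \<Rrightarrow> \<rho> \<Rrightarrow> \<tau>)"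
  "rep (Rec \<sigma>) \<in> D (\<sigma> \<Rrightarrow> (\<sigma> \<Rrightarrow> TNat \<Rrightarrow> \<sigma>) \<Rrightarrow> TNat \<Rrightarrow> \<sigma>)"
  "rep (Empty \<sigma>) \<in> D (Seq \<sigma>)" "rep (Prep \<sigma>) \<in> D (\<sigma> \<Rrightarrow> Seq \<sigma> \<Rrightarrow> Seq \<sigma>)"
  "rep (LRec \<sigma> \<rho>) \<in> D (\<sigma> \<Rrightarrow> (\<sigma> \<Rrightarrow> \<rho> \<Rrightarrow> \<sigma>) \<Rrightarrow> Seq \<rho> \<Rrightarrow> \<sigma>)"
  "rep (zero_tm \<sigma>) \<in> D \<sigma>"
  by (rule rep_closed_in, simp)+

lemma app_CK: "x \<in> D \<sigma> \<Longrightarrow> y \<in> D \<tau> \<Longrightarrow> rep (CK \<sigma> \<tau>) \<bullet> x \<bullet> y = x"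
  using ev_axiom[OF EHA_vf.CK[of \<sigma> \<tau> "Var 0" "Var 1"], of "[\<sigma>, \<tau>]" "x .: y .: Var"] by simp

lemma app_CS:
  "x \<in> D (\<rho> \<Rrightarrow> \<sigma> \<Rrightarrow> \<tau>) \<Longrightarrow> y \<in> D (\<rho> \<Rrightarrow> \<sigma>) \<Longrightarrow> z \<in> D \<rho>
    \<Longrightarrow> rep (CS \<rho> \<sigma> \<tau>) \<bullet> x \<bullet> y \<bullet> z = x \<bullet> z \<bullet> (y \<bullet> z)"
  using ev_axiom[OF EHA_vf.CS[of \<tau> \<rho> \<sigma> "Var 0" "Var 1" "Var 2"],
      of "[\<rho> \<Rrightarrow> \<sigma> \<Rrightarrow> \<tau>, \<rho> \<Rrightarrow> \<sigma>, \<rho>]" "x .: y .: z .: Var"]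
  by simp

lemma app_Rec_Zero:
  "x \<in> D \<sigma> \<Longrightarrow> y \<in> D (\<sigma> \<Rrightarrow> TNat \<Rrightarrow> \<sigma>) \<Longrightarrow> rep (Rec \<sigma>) \<bullet> x \<bullet> y \<bullet> rep Zero = x"
  using ev_axiom[OF EHA_vf.Rec_Zero[of \<sigma> "Var 0" "Var 1"],
      of "[\<sigma>, \<sigma> \<Rrightarrow> TNat \<Rrightarrow> \<sigma>]" "x .: y .: Var"]
  by simp

lemma app_Rec_Succ:
  "x \<in> D \<sigma> \<Longrightarrow> y \<in> D (\<sigma> \<Rrightarrow> TNat \<Rrightarrow> \<sigma>) \<Longrightarrow> z \<in> D TNat
    \<Longrightarrow> rep (Rec \<sigma>) \<bullet> x \<bullet> y \<bullet> (rep Succ \<bullet> z) = y \<bullet> (rep (Rec \<sigma>) \<bullet> x \<bullet> y \<bullet> z) \<bullet> z"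
  using ev_axiom[OF EHA_vf.Rec_Succ[of \<sigma> "Var 0" "Var 1" "Var 2"],
      of "[\<sigma>, \<sigma> \<Rrightarrow> TNat \<Rrightarrow> \<sigma>, TNat]" "x .: y .: z .: Var"]
  by simp

lemma app_LRec_Empty:
  "x \<in> D \<sigma> \<Longrightarrow> y \<in> D (\<sigma> \<Rrightarrow> \<rho> \<Rrightarrow> \<sigma>) \<Longrightarrow> rep (LRec \<sigma> \<rho>) \<bullet> x \<bullet> y \<bullet> rep (Empty \<rho>) = x"
  using ev_axiom[OF EHA_vf.LRec_Empty[of \<sigma> \<rho> "Var 0" "Var 1"],
      of "[\<sigma>, \<sigma> \<Rrightarrow> \<rho> \<Rrightarrow> \<sigma>]" "x .: y .: Var"]
  by simp

lemma app_LRec_Prep: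
  "x \<in> D \<sigma> \<Longrightarrow> y \<in> D (\<sigma> \<Rrightarrow> \<rho> \<Rrightarrow> \<sigma>) \<Longrightarrow> a \<in> D \<rho> \<Longrightarrow> s \<in> D (Seq \<rho>)
    \<Longrightarrow> rep (LRec \<sigma> \<rho>) \<bullet> x \<bullet> y \<bullet> (rep (Prep \<rho>) \<bullet> a \<bullet> s)
      = y \<bullet> (rep (LRec \<sigma> \<rho>) \<bullet> x \<bullet> y \<bullet> s) \<bullet> a"
  using ev_axiom[OF EHA_vf.LRec_Prep[of \<sigma> \<rho> "Var 0" "Var 1" "Var 2" "Var 3"],
      of "[\<sigma>, \<sigma> \<Rrightarrow> \<rho> \<Rrightarrow> \<sigma>, \<rho>, Seq \<rho>]" "x .: y .: a .: s .: Var"]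
  by simp

lemma ev_LAM:
  assumes "has_type (\<sigma> # \<Gamma>) t \<tau>" "env e \<Gamma>" "a \<in> D \<sigma>"
  shows "ev e (LAM \<Gamma> \<sigma> t) \<bullet> a = ev (a .: e) t"
  using assms(1)
proof (induction t arbitrary: \<tau>)
  case (Var n)
  then show ?case
    using assms(2,3) by (auto split: nat.split simp: app_CS app_CK consts_in app_in[OF consts_in(3)])
next
  case (App f b)
  then obtain \<rho> where *: "has_type (\<sigma> # \<Gamma>) f (\<rho> \<Rrightarrow> \<tau>)" "has_type (\<sigma> # \<Gamma>) b \<rho>" by auto
  have "ev e (LAM \<Gamma> \<sigma> f) \<in> D (\<sigma> \<Rrightarrow> \<rho> \<Rrightarrow> \<tau>)" "ev e (LAM \<Gamma> \<sigma> b) \<in> D (\<sigma> \<Rrightarrow> \<rho>)"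
    using ev_in[OF has_type_LAM assms(2)] * by blast+
  then show ?case
    using App.IH(1)[OF *(1)] App.IH(2)[OF *(2)] tyof_eq[OF *(2)] tyof_eq[OF App.prems]
      assms(3) by (simp add: app_CS)
qed (simp_all add: tyof_eq app_CK consts_in assms(3))

lemma app_lams1: "has_type [\<sigma>] t \<tau> \<Longrightarrow> a \<in> D \<sigma> \<Longrightarrow> rep (lams [\<sigma>] t) \<bullet> a = ev (a .: Var) t"
  using ev_LAM[of \<sigma> "[]" t \<tau> Var a] ev_closed[OF has_type_LAM, of \<sigma> t \<tau>] by simp

lemma app_lams2:
  assumes "has_type [\<sigma>, \<rho>] t \<tau>" "a \<in> D \<rho>" "b \<in> D \<sigma>"
  shows "rep (lams [\<sigma>, \<rho>] t) \<bullet> a \<bullet> b = ev (b .: a .: Var) t"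
  using app_lams1[OF has_type_LAM[OF assms(1)] assms(2)] ev_LAM[OF assms(1), of "a .: Var" b] assms
  by simp

lemma app_lams3:
  assumes "has_type [\<sigma>, \<rho>, \<rho>'] t \<tau>" "a \<in> D \<rho>'" "b \<in> D \<rho>" "c \<in> D \<sigma>"
  shows "rep (lams [\<sigma>, \<rho>, \<rho>'] t) \<bullet> a \<bullet> b \<bullet> c = ev (c .: b .: a .: Var) t"
  using app_lams2[OF has_type_LAM[OF assms(1)] assms(2,3)] ev_LAM[OF assms(1), of "b .: a .: Var" c]
    assms
  by simp

text \<open>Agreement on the whole constant domain forces the premise of the axiom
  \<open>Ext\<close> at \<open>root\<close>, where the resulting equality is identity.\<close>

lemma D_ext:
  assumes "f \<in> D (\<sigma> \<Rrightarrow> \<tau>)" "g \<in> D (\<sigma> \<Rrightarrow> \<tau>)" "\<And>x. x \<in> D \<sigma> \<Longrightarrow> f \<bullet> x = g \<bullet> x"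
  shows "f = g"
proof (rule eqv_root[OF _ assms(1,2)])
  let ?e = "f .: g .: Var" and ?\<Gamma> = "[\<sigma> \<Rrightarrow> \<tau>, \<sigma> \<Rrightarrow> \<tau>]"
  let ?\<phi> = "Eq \<tau> (Var 1 \<cdot> Var 0) (Var 2 \<cdot> Var 0)"
  have e: "env ?e ?\<Gamma>" using assms by simp
  have "force root (x .: ?e) ?\<phi>" if "x \<in> D \<sigma>" for x
    using force_Eq[of "\<sigma> # ?\<Gamma>" _ \<tau> _ "x .: ?e"] assms that by (simp add: eqv_refl app_in)
  then have "force root ?e (Forall \<sigma> ?\<phi>)" using force_Forall[of \<sigma> ?\<Gamma> ?\<phi> ?e root] e by simp
  moreover have "force root ?e (Forall \<sigma> ?\<phi> \<^bold>\<longrightarrow> Eq (\<sigma> \<Rrightarrow> \<tau>) (Var 0) (Var 1))"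
    by (rule force_axiom[of _ ?\<Gamma>]) (use e EHA_vf.Ext[of \<sigma> \<tau> "Var 0" "Var 1"] in \<open>simp_all add: Th_def numeral_2_eq_2\<close>)
  moreover have "okf ?\<Gamma> (Forall \<sigma> ?\<phi>)" by simp
  ultimately have "force root ?e (Eq (\<sigma> \<Rrightarrow> \<tau>) (Var 0) (Var 1))"
    using force_Imp e leq_refl by blast
  then show "eqv root (\<sigma> \<Rrightarrow> \<tau>) f g"
    using force_Eq[of ?\<Gamma> "Var 0" "\<sigma> \<Rrightarrow> \<tau>" "Var 1" ?e] assms by simp
qed

text \<open>The induction axiom contains an implication below a universal quantifier, so its step
  speaks about all later worlds; the premise \<open>step\<close> has the same form.\<close>

lemma force_induct:
  assumes "okf (TNat # \<Gamma>) \<phi>" "env e \<Gamma>" "d \<in> D TNat"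
    and zero: "force p (rep Zero .: e) \<phi>"
    and step: "\<And>q d. p \<sqsubseteq> q \<Longrightarrow> d \<in> D TNat \<Longrightarrow> force q (d .: e) \<phi> \<Longrightarrow> force q (rep Succ \<bullet> d .: e) \<phi>"
  shows "force p (d .: e) \<phi>"
proof -
  have ok: "okf \<Gamma> (inst Zero \<phi>)" "okf (TNat # \<Gamma>) (at_succ \<phi>)"
    by (rule okf_subst[OF assms(1)]; simp)+
  have "force p e (inst Zero \<phi>)"
    using zero by (subst force_subst[OF assms(1) _ assms(2)]) simp_all
  moreover have "force p e (Forall TNat (\<phi> \<^bold>\<longrightarrow> at_succ \<phi>))"
  proof -
    have "force q (d .: e) (at_succ \<phi>)" if "p \<sqsubseteq> q" "d \<in> D TNat" "force q (d .: e) \<phi>" for q d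
      using step[OF that] by (subst force_subst[OF assms(1), of "TNat # \<Gamma>"]) (use assms(2) that in \<open>simp_all\<close>)
    then show ?thesis
      using force_Forall[of TNat \<Gamma> "\<phi> \<^bold>\<longrightarrow> at_succ \<phi>" e p] force_Imp[OF assms(1)] assms ok by simp
  qed
  moreover have "force p e (inst Zero \<phi> \<^bold>\<and> Forall TNat (\<phi> \<^bold>\<longrightarrow> at_succ \<phi>) \<^bold>\<longrightarrow> Forall TNat \<phi>)"
    by (rule force_axiom[of _ \<Gamma>]) (use assms ok EHA_vf.Induction[of \<phi>] in \<open>auto simp: Th_def okf_def\<close>)
  ultimately have "force p e (Forall TNat \<phi>)"
    using force_Imp[of \<Gamma> "inst Zero \<phi> \<^bold>\<and> Forall TNat (\<phi> \<^bold>\<longrightarrow> at_succ \<phi>)" e p "Forall TNat \<phi>"] assms ok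
    by (simp add: force_And)
  then show ?thesis using force_Forall assms by blast
qed

section \<open>Numbers and sequences\<close>

text \<open>The context is an argument so that the forcing clauses can be used as rewrite rules.\<close>

definition frc :: "ty list \<Rightarrow> world \<Rightarrow> (nat \<Rightarrow> tm) \<Rightarrow> fm \<Rightarrow> bool" where
  "frc \<Gamma> p e \<phi> \<longleftrightarrow> force p e \<phi>"

lemma frc_Eq [simp]:
  "has_type \<Gamma> s \<sigma> \<Longrightarrow> has_type \<Gamma> t \<sigma> \<Longrightarrow> env e \<Gamma>
    \<Longrightarrow> frc \<Gamma> p e (Eq \<sigma> s t) \<longleftrightarrow> eqv p \<sigma> (ev e s) (ev e t)"
  unfolding frc_def by (rule force_Eq)

lemma frc_And [simp]: "frc \<Gamma> p e (\<phi> \<^bold>\<and> \<psi>) \<longleftrightarrow> frc \<Gamma> p e \<phi> \<and> frc \<Gamma> p e \<psi>"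
  unfolding frc_def by (rule force_And)

lemma frc_Imp [simp]:
  "okf \<Gamma> \<phi> \<Longrightarrow> env e \<Gamma>
    \<Longrightarrow> frc \<Gamma> p e (\<phi> \<^bold>\<longrightarrow> \<psi>) \<longleftrightarrow> (\<forall>q. p \<sqsubseteq> q \<longrightarrow> frc \<Gamma> q e \<phi> \<longrightarrow> frc \<Gamma> q e \<psi>)"
  unfolding frc_def by (rule force_Imp)

lemma frc_Forall [simp]:
  "okf (\<sigma> # \<Gamma>) \<phi> \<Longrightarrow> env e \<Gamma>
    \<Longrightarrow> frc \<Gamma> p e (Forall \<sigma> \<phi>) \<longleftrightarrow> (\<forall>d\<in>D \<sigma>. frc (\<sigma> # \<Gamma>) p (d .: e) \<phi>)"
  unfolding frc_def by (rule force_Forall)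

lemma frc_subst:
  "okf \<Gamma>' \<phi> \<Longrightarrow> \<forall>i<length \<Gamma>'. has_type \<Gamma> (s i) (\<Gamma>' ! i) \<Longrightarrow> env e \<Gamma>
    \<Longrightarrow> frc \<Gamma> p e (subst s \<phi>) \<longleftrightarrow> frc \<Gamma>' p (\<lambda>n. ev e (s n)) \<phi>"
  unfolding frc_def by (rule force_subst)

lemma frc_mono: "frc \<Gamma> p e \<phi> \<Longrightarrow> p \<sqsubseteq> q \<Longrightarrow> frc \<Gamma> q e \<phi>"
  unfolding frc_def by (rule force_mono)

lemma frc_ExI:
  "okf (\<sigma> # \<Gamma>) \<phi> \<Longrightarrow> env e \<Gamma> \<Longrightarrow> d \<in> D \<sigma> \<Longrightarrow> frc (\<sigma> # \<Gamma>) p (d .: e) \<phi> \<Longrightarrow> frc \<Gamma> p e (Exists \<sigma> \<phi>)"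
  unfolding frc_def by (rule force_ExistsI)

lemma frc_ExE:
  assumes "frc \<Gamma> p e (Exists \<sigma> \<phi>)" "okf (\<sigma> # \<Gamma>) \<phi>" "env e \<Gamma>" "okf \<Gamma>' \<chi>" "env e' \<Gamma>'"
    and "\<And>q d. p \<sqsubseteq> q \<Longrightarrow> d \<in> D \<sigma> \<Longrightarrow> frc (\<sigma> # \<Gamma>) q (d .: e) \<phi> \<Longrightarrow> frc \<Gamma>' q e' \<chi>"
  shows "frc \<Gamma>' p e' \<chi>"
  using force_ExistsE[of p e \<sigma> \<phi> \<Gamma> \<Gamma>' \<chi> e'] assms unfolding frc_def by blast

lemma frc_Bot: "frc \<Gamma> p e Bot \<Longrightarrow> okf \<Gamma>' \<phi> \<Longrightarrow> env e' \<Gamma>' \<Longrightarrow> frc \<Gamma>' p e' \<phi>"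
  unfolding frc_def by (rule force_Bot)

lemma frc_eqv:
  assumes "okf \<Gamma> \<phi>" "env e \<Gamma>" "env e' \<Gamma>" "\<forall>i<length \<Gamma>. eqv p (\<Gamma> ! i) (e i) (e' i)"
  shows "frc \<Gamma> p e \<phi> \<longleftrightarrow> frc \<Gamma> p e' \<phi>"
  unfolding frc_def by (rule force_eqv[OF assms])

lemma frc_eqv_scons:
  assumes "okf (\<sigma> # \<Gamma>) \<phi>" "env e \<Gamma>" "eqv p \<sigma> a b" "a \<in> D \<sigma>" "b \<in> D \<sigma>"
  shows "frc (\<sigma> # \<Gamma>) p (a .: e) \<phi> \<longleftrightarrow> frc (\<sigma> # \<Gamma>) p (b .: e) \<phi>"
  by (rule frc_eqv[OF assms(1)]) (use assms in \<open>simp_all add: eqv_refl\<close>)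

lemma frc_axiom: "\<phi> \<in> EHA_vf \<Longrightarrow> okf \<Gamma> \<phi> \<Longrightarrow> env e \<Gamma> \<Longrightarrow> frc \<Gamma> p e \<phi>"
  unfolding frc_def by (rule force_axiom) (simp_all add: Th_def)

lemma frc_induct:
  assumes "okf (TNat # \<Gamma>) \<phi>" "env e \<Gamma>" "d \<in> D TNat"
    and "frc (TNat # \<Gamma>) p (rep Zero .: e) \<phi>"
    and "\<And>q d. p \<sqsubseteq> q \<Longrightarrow> d \<in> D TNat \<Longrightarrow> frc (TNat # \<Gamma>) q (d .: e) \<phi>
      \<Longrightarrow> frc (TNat # \<Gamma>) q (rep Succ \<bullet> d .: e) \<phi>"
  shows "frc (TNat # \<Gamma>) p (d .: e) \<phi>"
  using force_induct[OF assms(1-3)] assms(4,5) unfolding frc_def by blast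

lemmas [simp] = consts_in

lemma Succ_in [simp]: "x \<in> D TNat \<Longrightarrow> rep Succ \<bullet> x \<in> D TNat"
  by (rule app_in[OF consts_in(2)])

lemma Prep_in [simp]: "a \<in> D \<sigma> \<Longrightarrow> s \<in> D (Seq \<sigma>) \<Longrightarrow> rep (Prep \<sigma>) \<bullet> a \<bullet> s \<in> D (Seq \<sigma>)"
  by (rule app_in[OF app_in[OF consts_in(7)]])

lemma eqv_app:
  "eqv p (\<sigma> \<Rrightarrow> \<tau>) f g \<Longrightarrow> eqv p \<sigma> a b \<Longrightarrow> f \<in> D (\<sigma> \<Rrightarrow> \<tau>) \<Longrightarrow> g \<in> D (\<sigma> \<Rrightarrow> \<tau>)
    \<Longrightarrow> a \<in> D \<sigma> \<Longrightarrow> b \<in> D \<sigma> \<Longrightarrow> eqv p \<tau> (f \<bullet> a) (g \<bullet> b)"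
  unfolding app_def by (intro eqv_rep) (auto intro: D_typed prov_App simp: eqv_def)

lemma eqv_app2:
  "eqv p \<sigma> a b \<Longrightarrow> f \<in> D (\<sigma> \<Rrightarrow> \<tau>) \<Longrightarrow> a \<in> D \<sigma> \<Longrightarrow> b \<in> D \<sigma> \<Longrightarrow> eqv p \<tau> (f \<bullet> a) (f \<bullet> b)"
  by (intro eqv_app eqv_refl)

text \<open>A world may be inconsistent, so a clash of constructors refutes nothing in HOL. It
  forces every \<or>-free formula instead.\<close>

lemma Zero_Succ:
  assumes "eqv p TNat (rep Succ \<bullet> x) (rep Zero)" "x \<in> D TNat" "okf \<Gamma> \<phi>" "env e \<Gamma>"
  shows "frc \<Gamma> p e \<phi>"
proof -
  have "frc [TNat] p (x .: Var) (Neg (Eq TNat (Succ \<cdot> Var 0) Zero))"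
    by (rule frc_axiom[OF EHA_vf.Succ_not_Zero]) (use assms in simp_all)
  then have "frc [TNat] p (x .: Var) Bot" using assms by simp
  then show ?thesis using frc_Bot assms by blast
qed

lemma Succ_inject:
  assumes "eqv p TNat (rep Succ \<bullet> x) (rep Succ \<bullet> y)" "x \<in> D TNat" "y \<in> D TNat"
  shows "eqv p TNat x y"
proof -
  have "frc [TNat, TNat] p (x .: y .: Var) (Eq TNat (Succ \<cdot> Var 0) (Succ \<cdot> Var 1) \<^bold>\<longrightarrow> Eq TNat (Var 0) (Var 1))"
    by (rule frc_axiom[OF EHA_vf.Succ_inj]) (use assms in simp_all)
  then show ?thesis using assms by simp
qed

text \<open>
  Induction is available for \<open>\<or>\<close>-free formulae only, so case distinctions are stated as
  elimination rules into an arbitrary \<open>\<or>\<close>-free goal.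
\<close>

lemma nat_cases:
  assumes "z \<in> D TNat" and \<chi>: "okf \<Gamma> \<chi>" "env e \<Gamma>"
    and "\<And>q. p \<sqsubseteq> q \<Longrightarrow> eqv q TNat z (rep Zero) \<Longrightarrow> frc \<Gamma> q e \<chi>"
    and "\<And>q m. p \<sqsubseteq> q \<Longrightarrow> m \<in> D TNat \<Longrightarrow> eqv q TNat z (rep Succ \<bullet> m) \<Longrightarrow> frc \<Gamma> q e \<chi>"
  shows "frc \<Gamma> p e \<chi>"
proof -
  \<comment> \<open>The two cases are premises of a formula with conclusion \<open>\<chi>\<close>,
    the impredicative form of a disjunction. This formula is \<or>-free, and induction on it acts as
    a case distinction between zero and successor.\<close>
  let ?\<psi> = "(Eq TNat (Var 0) Zero \<^bold>\<longrightarrow> shift \<chi>) \<^bold>\<longrightarrow>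
    Forall TNat (Eq TNat (Var 1) (Succ \<cdot> Var 0) \<^bold>\<longrightarrow> subst (weaken 2) \<chi>) \<^bold>\<longrightarrow> shift \<chi>"
  have ok: "okf (TNat # \<Gamma>) (shift \<chi>)" "okf (TNat # TNat # \<Gamma>) (subst (weaken 2) \<chi>)"
    by (rule okf_subst[OF \<chi>(1)]; simp)+
  have \<psi>: "frc (TNat # \<Gamma>) p (d .: e) ?\<psi> \<longleftrightarrow>
     (\<forall>q. p \<sqsubseteq> q \<longrightarrow> (\<forall>r. q \<sqsubseteq> r \<longrightarrow> eqv r TNat d (rep Zero) \<longrightarrow> frc \<Gamma> r e \<chi>) \<longrightarrow>
      (\<forall>r. q \<sqsubseteq> r \<longrightarrow> (\<forall>m\<in>D TNat. \<forall>s. r \<sqsubseteq> s \<longrightarrow> eqv s TNat d (rep Succ \<bullet> m) \<longrightarrow> frc \<Gamma> s e \<chi>) \<longrightarrow>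
        frc \<Gamma> r e \<chi>))" if "d \<in> D TNat" for d p
    using that \<chi>(2) ok by (simp add: frc_subst[OF \<chi>(1)])
  have "frc (TNat # \<Gamma>) p (z .: e) ?\<psi>"
  proof (rule frc_induct)
    show "frc (TNat # \<Gamma>) p (rep Zero .: e) ?\<psi>"
      unfolding \<psi>[OF consts_in(1)] using frc_mono eqv_refl[OF consts_in(1)] by blast
  next
    fix q d assume d: "d \<in> D TNat"
    show "frc (TNat # \<Gamma>) q (rep Succ \<bullet> d .: e) ?\<psi>"
      unfolding \<psi>[OF Succ_in[OF d]] using frc_mono eqv_refl[OF Succ_in[OF d]] d leq_refl by blast
  qed (use assms ok in simp_all)
  then show ?thesis unfolding \<psi>[OF assms(1)] using assms(4,5) leq_refl leq_trans by blast
qed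

lemma seq_cases:
  assumes "s \<in> D (Seq \<sigma>)" and \<chi>: "okf \<Gamma> \<chi>" "env e \<Gamma>"
    and nil: "\<And>q. p \<sqsubseteq> q \<Longrightarrow> eqv q (Seq \<sigma>) s (rep (Empty \<sigma>)) \<Longrightarrow> frc \<Gamma> q e \<chi>"
    and cons: "\<And>q a r. p \<sqsubseteq> q \<Longrightarrow> a \<in> D \<sigma> \<Longrightarrow> r \<in> D (Seq \<sigma>)
      \<Longrightarrow> eqv q (Seq \<sigma>) s (rep (Prep \<sigma>) \<bullet> a \<bullet> r) \<Longrightarrow> frc \<Gamma> q e \<chi>"
  shows "frc \<Gamma> p e \<chi>"
proof -
  let ?\<beta> = "Exists (Seq \<sigma>) (Eq (Seq \<sigma>) (Var 3) (Prep \<sigma> \<cdot> Var 1 \<cdot> Var 0))"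
  let ?\<alpha> = "(Eq TNat (Var 0) Zero \<^bold>\<longrightarrow> Eq (Seq \<sigma>) (Var 1) (Empty \<sigma>)) \<^bold>\<and>
     (Neg (Eq TNat (Var 0) Zero) \<^bold>\<longrightarrow> Exists \<sigma> ?\<beta>)"
  have "frc [Seq \<sigma>] p (s .: Var) (Exists TNat ?\<alpha>)"
    by (rule frc_axiom) (use assms EHA_vf.SA[of \<sigma> "Var 0"] in simp_all)
  then show ?thesis
  proof (rule frc_ExE[OF _ _ _ \<chi>])
    fix q n assume q: "p \<sqsubseteq> q" and n: "n \<in> D TNat" and *: "frc [TNat, Seq \<sigma>] q (n .: s .: Var) ?\<alpha>"
    \<comment> \<open>\<open>SA\<close> codes its disjunction by a number, so the case distinction
      on sequences becomes one on this number.\<close>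
    show "frc \<Gamma> q e \<chi>"
    proof (rule nat_cases[OF n \<chi>])
      fix r assume "q \<sqsubseteq> r" "eqv r TNat n (rep Zero)"
      with * assms(1) n have "eqv r (Seq \<sigma>) s (rep (Empty \<sigma>))" by simp
      then show "frc \<Gamma> r e \<chi>" using nil q \<open>q \<sqsubseteq> r\<close> leq_trans by blast
    next
      fix r m assume r: "q \<sqsubseteq> r" and m: "m \<in> D TNat" "eqv r TNat n (rep Succ \<bullet> m)"
      \<comment> \<open>A successor that is also zero makes a world inconsistent. So the negation in
        \<open>SA\<close> is forced and the nonempty case becomes available.\<close>
      have "frc [TNat, Seq \<sigma>] r' (n .: s .: Var) Bot" if r': "r \<sqsubseteq> r'" "eqv r' TNat n (rep Zero)" for r'
        using Zero_Succ[OF eqv_trans[OF eqv_sym[OF eqv_mono[OF m(2) r'(1)]] r'(2)] m(1)] m(1) n assms(1)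
        by simp
      then have "frc [TNat, Seq \<sigma>] r (n .: s .: Var) (Neg (Eq TNat (Var 0) Zero))"
        using assms(1) n by simp
      with * r have "frc [TNat, Seq \<sigma>] r (n .: s .: Var) (Exists \<sigma> ?\<beta>)"
        using assms(1) n by simp
      then show "frc \<Gamma> r e \<chi>"
      proof (rule frc_ExE[OF _ _ _ \<chi>])
        fix u a assume u: "r \<sqsubseteq> u" and a: "a \<in> D \<sigma>" and "frc [\<sigma>, TNat, Seq \<sigma>] u (a .: n .: s .: Var) ?\<beta>"
        from this(3) show "frc \<Gamma> u e \<chi>"
        proof (rule frc_ExE[OF _ _ _ \<chi>])
          fix v t assume v: "u \<sqsubseteq> v" and t: "t \<in> D (Seq \<sigma>)"
            and "frc [Seq \<sigma>, \<sigma>, TNat, Seq \<sigma>] v (t .: a .: n .: s .: Var)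
              (Eq (Seq \<sigma>) (Var 3) (Prep \<sigma> \<cdot> Var 1 \<cdot> Var 0))"
          then have "eqv v (Seq \<sigma>) s (rep (Prep \<sigma>) \<bullet> a \<bullet> t)" using assms(1) n a by simp
          then show "frc \<Gamma> v e \<chi>" using cons a t q r u v leq_trans by blast
        qed (use assms(1) n a in simp_all)
      qed (use assms(1) n in simp_all)
    qed
  qed (use assms(1) in simp_all)
qed

end

section \<open>Length, components and membership of sequences\<close>

lemma closed_succ_step: "closed_term (succ_step \<rho>) (TNat \<Rrightarrow> \<rho> \<Rrightarrow> TNat)"
  by (simp add: succ_step_def comp_tm_def)

lemma closed_nth_step:
  "closed_term (nth_step \<sigma>) ((TNat \<Rrightarrow> \<sigma>) \<Rrightarrow> \<sigma> \<Rrightarrow> TNat \<Rrightarrow> \<sigma>)"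
  by (simp add: nth_step_def comp_tm_def Let_def)

lemma has_type_len_tm [simp]:
  "has_type \<Gamma> (len_tm \<sigma> s) \<tau> \<longleftrightarrow> \<tau> = TNat \<and> has_type \<Gamma> s (Seq \<sigma>)"
  by (auto simp: len_tm_def closed_has_type[OF closed_succ_step])

lemma has_type_plus_tm [simp]:
  "has_type \<Gamma> (plus_tm m n) \<tau> \<longleftrightarrow> \<tau> = TNat \<and> has_type \<Gamma> m TNat \<and> has_type \<Gamma> n TNat"
  by (auto simp: plus_tm_def closed_has_type[OF closed_succ_step])

lemma has_type_nth_tm [simp]:
  "has_type \<Gamma> (nth_tm \<sigma> s i) \<tau> \<longleftrightarrow> \<tau> = \<sigma> \<and> has_type \<Gamma> s (Seq \<sigma>) \<and> has_type \<Gamma> i TNat"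
  by (auto simp: nth_tm_def closed_has_type[OF closed_nth_step])

lemma subst_len_tm [simp]: "subst_tm r (len_tm \<sigma> s) = len_tm \<sigma> (subst_tm r s)"
  by (simp add: len_tm_def closed_subst[OF closed_succ_step])

lemma subst_plus_tm [simp]: "subst_tm r (plus_tm m n) = plus_tm (subst_tm r m) (subst_tm r n)"
  by (simp add: plus_tm_def closed_subst[OF closed_succ_step])

lemma subst_nth_tm [simp]: "subst_tm r (nth_tm \<sigma> s i) = nth_tm \<sigma> (subst_tm r s) (subst_tm r i)"
  by (simp add: nth_tm_def closed_subst[OF closed_nth_step])

text \<open>Presents membership as an instance of one formula in two variables, so that forcing it
  depends only on the values of the two terms.\<close>

lemma Mem_eq_subst: "Mem \<sigma> t u = subst (t .: u .: Var) (Mem \<sigma> (Var 0) (Var 1))"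
  by (simp add: Mem_def Less_def)

lemma subst_Mem [simp]: "subst s (Mem \<sigma> t u) = Mem \<sigma> (subst_tm s t) (subst_tm s u)"
  by (simp add: Mem_def Less_def)

context model
begin

lemma okf_Mem0: "okf [\<sigma>, Seq \<sigma>] (Mem \<sigma> (Var 0) (Var 1))"
  by (simp add: Mem_def Less_def)

lemma okf_Mem [simp]: "has_type \<Gamma> t \<sigma> \<Longrightarrow> has_type \<Gamma> u (Seq \<sigma>) \<Longrightarrow> okf \<Gamma> (Mem \<sigma> t u)"
  by (subst Mem_eq_subst, rule okf_subst[OF okf_Mem0]) simp

text \<open>The recursor applied to its base and step, as an element of the domain: the value of a
  length term is then a plain application to the value of the sequence. \<open>nthf\<close> and
  \<open>plusf\<close> do the same for components and sums.\<close>

definition lenf :: "ty \<Rightarrow> tm" where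
  "lenf \<sigma> = rep (LRec TNat \<sigma>) \<bullet> rep Zero \<bullet> rep (succ_step \<sigma>)"

definition nthf :: "ty \<Rightarrow> tm" where
  "nthf \<sigma> = rep (LRec (TNat \<Rrightarrow> \<sigma>) \<sigma>) \<bullet> (rep (CK \<sigma> TNat) \<bullet> rep (zero_tm \<sigma>)) \<bullet> rep (nth_step \<sigma>)"

definition plusf :: "tm \<Rightarrow> tm" where
  "plusf m = rep (Rec TNat) \<bullet> m \<bullet> rep (succ_step TNat)"

lemmas step_in = rep_closed_in[OF closed_succ_step] rep_closed_in[OF closed_nth_step]

lemma CK_in: "x \<in> D \<sigma> \<Longrightarrow> rep (CK \<sigma> \<tau>) \<bullet> x \<in> D (\<tau> \<Rrightarrow> \<sigma>)"
  by (rule app_in[OF consts_in(3)])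

lemma lenf_in [simp]: "lenf \<sigma> \<in> D (Seq \<sigma> \<Rrightarrow> TNat)"
  unfolding lenf_def by (rule app_in[OF app_in[OF consts_in(8)]], rule consts_in, rule step_in)

lemma nthf_in [simp]: "nthf \<sigma> \<in> D (Seq \<sigma> \<Rrightarrow> TNat \<Rrightarrow> \<sigma>)"
  unfolding nthf_def
  by (rule app_in[OF app_in[OF consts_in(8)]], rule CK_in, rule consts_in, rule step_in)

lemma plusf_in [simp]: "m \<in> D TNat \<Longrightarrow> plusf m \<in> D (TNat \<Rrightarrow> TNat)"
  unfolding plusf_def by (rule app_in[OF app_in[OF consts_in(5)]], assumption, rule step_in)

lemmas [simp] = app_in[OF lenf_in] app_in[OF nthf_in] app_in[OF app_in[OF nthf_in]] app_in[OF plusf_in]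

lemma ev_len_tm [simp]: "ev e (len_tm \<sigma> s) = lenf \<sigma> \<bullet> ev e s"
  by (simp add: len_tm_def lenf_def ev_closed[OF closed_succ_step])

lemma ev_nth_tm [simp]: "ev e (nth_tm \<sigma> s i) = nthf \<sigma> \<bullet> ev e s \<bullet> ev e i"
  by (simp add: nth_tm_def nthf_def ev_closed[OF closed_nth_step])

lemma ev_plus_tm [simp]: "ev e (plus_tm m n) = plusf (ev e m) \<bullet> ev e n"
  by (simp add: plus_tm_def plusf_def ev_closed[OF closed_succ_step])

lemma ev_comp_tm:
  assumes "ev e g \<in> D (\<sigma> \<Rrightarrow> \<tau>)" "ev e f \<in> D (\<rho> \<Rrightarrow> \<sigma>)" "x \<in> D \<rho>"
  shows "ev e (comp_tm \<rho> \<sigma> \<tau> g f) \<bullet> x = ev e g \<bullet> (ev e f \<bullet> x)"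
  using assms by (simp add: comp_tm_def app_CS app_CK CK_in)

lemma app_succ_step: "n \<in> D TNat \<Longrightarrow> a \<in> D \<rho> \<Longrightarrow> rep (succ_step \<rho>) \<bullet> n \<bullet> a = rep Succ \<bullet> n"
proof -
  have "rep (succ_step \<rho>) = ev Var (comp_tm TNat TNat (\<rho> \<Rrightarrow> TNat) (CK TNat \<rho>) Succ)"
    using ev_closed[OF closed_succ_step, of Var \<rho>] unfolding succ_step_def by (rule sym)
  then show "n \<in> D TNat \<Longrightarrow> a \<in> D \<rho> \<Longrightarrow> ?thesis" by (simp add: ev_comp_tm app_CK)
qed

lemma app_nth_step:
  assumes "h \<in> D (TNat \<Rrightarrow> \<sigma>)" "a \<in> D \<sigma>"
  shows "rep (nth_step \<sigma>) \<bullet> h \<bullet> a = rep (Rec \<sigma>) \<bullet> a \<bullet> (rep (CK (TNat \<Rrightarrow> \<sigma>) \<sigma>) \<bullet> h)"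
proof -
  let ?\<alpha> = "TNat \<Rrightarrow> \<sigma>" let ?\<beta> = "\<sigma> \<Rrightarrow> ?\<alpha>"
  have 1: "ev Var (CS \<sigma> ?\<beta> ?\<alpha> \<cdot> Rec \<sigma>) \<in> D ((\<sigma> \<Rrightarrow> ?\<beta>) \<Rrightarrow> ?\<beta>)"
    "ev Var (comp_tm ?\<alpha> ?\<beta> (\<sigma> \<Rrightarrow> ?\<beta>) (CK ?\<beta> \<sigma>) (CK ?\<alpha> \<sigma>)) \<in> D (?\<alpha> \<Rrightarrow> \<sigma> \<Rrightarrow> ?\<beta>)"
    by (rule ev_in[of "[]"]; simp add: comp_tm_def)+
  have "rep (nth_step \<sigma>) = ev Var (comp_tm ?\<alpha> (\<sigma> \<Rrightarrow> ?\<beta>) ?\<beta> (CS \<sigma> ?\<beta> ?\<alpha> \<cdot> Rec \<sigma>)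
      (comp_tm ?\<alpha> ?\<beta> (\<sigma> \<Rrightarrow> ?\<beta>) (CK ?\<beta> \<sigma>) (CK ?\<alpha> \<sigma>)))"
    using ev_closed[OF closed_nth_step, of Var \<sigma>] unfolding nth_step_def Let_def by (rule sym)
  then show ?thesis
    using assms by (simp add: ev_comp_tm[OF 1] ev_comp_tm[of _ _ ?\<beta>] app_CK app_CS CK_in)
qed

lemma len_Empty [simp]: "lenf \<sigma> \<bullet> rep (Empty \<sigma>) = rep Zero"
  by (simp add: lenf_def app_LRec_Empty step_in)

lemma len_Prep [simp]:
  "a \<in> D \<sigma> \<Longrightarrow> s \<in> D (Seq \<sigma>) \<Longrightarrow> lenf \<sigma> \<bullet> (rep (Prep \<sigma>) \<bullet> a \<bullet> s) = rep Succ \<bullet> (lenf \<sigma> \<bullet> s)"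
  using app_in[OF lenf_in, of s \<sigma>] by (simp add: lenf_def app_LRec_Prep step_in app_succ_step)

lemma plus_Zero [simp]: "m \<in> D TNat \<Longrightarrow> plusf m \<bullet> rep Zero = m"
  by (simp add: plusf_def app_Rec_Zero step_in)

lemma plus_Succ [simp]:
  "m \<in> D TNat \<Longrightarrow> n \<in> D TNat \<Longrightarrow> plusf m \<bullet> (rep Succ \<bullet> n) = rep Succ \<bullet> (plusf m \<bullet> n)"
  using app_in[OF plusf_in, of m n] by (simp add: plusf_def app_Rec_Succ step_in app_succ_step)

lemma nth_Prep [simp]:
  assumes "a \<in> D \<sigma>" "s \<in> D (Seq \<sigma>)"
  shows "nthf \<sigma> \<bullet> (rep (Prep \<sigma>) \<bullet> a \<bullet> s) \<bullet> rep Zero = a"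
    and "i \<in> D TNat \<Longrightarrow> nthf \<sigma> \<bullet> (rep (Prep \<sigma>) \<bullet> a \<bullet> s) \<bullet> (rep Succ \<bullet> i) = nthf \<sigma> \<bullet> s \<bullet> i"
proof -
  have "nthf \<sigma> \<bullet> (rep (Prep \<sigma>) \<bullet> a \<bullet> s) =
      rep (Rec \<sigma>) \<bullet> a \<bullet> (rep (CK (TNat \<Rrightarrow> \<sigma>) \<sigma>) \<bullet> (nthf \<sigma> \<bullet> s))"
    using assms app_in[OF nthf_in assms(2)] by (simp add: nthf_def app_LRec_Prep step_in CK_in app_nth_step)
  note * = this CK_in[OF app_in[OF nthf_in assms(2)]] app_CK[OF app_in[OF nthf_in assms(2)]]
  show "nthf \<sigma> \<bullet> (rep (Prep \<sigma>) \<bullet> a \<bullet> s) \<bullet> rep Zero = a"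
    using assms by (simp add: * app_Rec_Zero)
  show "nthf \<sigma> \<bullet> (rep (Prep \<sigma>) \<bullet> a \<bullet> s) \<bullet> (rep Succ \<bullet> i) = nthf \<sigma> \<bullet> s \<bullet> i" if i: "i \<in> D TNat"
  proof -
    have "rep (Rec \<sigma>) \<bullet> a \<bullet> (rep (CK (TNat \<Rrightarrow> \<sigma>) \<sigma>) \<bullet> (nthf \<sigma> \<bullet> s)) \<bullet> i \<in> D \<sigma>"
      using assms i by (intro app_in[OF app_in[OF app_in[OF consts_in(5)]]]) (simp_all add: *)
    then show ?thesis using assms i by (simp add: * app_Rec_Succ)
  qed
qed

text \<open>The theory has induction for numbers only. The induction is therefore on the length, for
  all sequences of that length at once, and \<open>seq_cases\<close> decomposes each
  sequence.\<close>

lemma seq_induct: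
  assumes ok: "okf (Seq \<sigma> # \<Gamma>) \<phi>" and e: "env e \<Gamma>" and s: "s \<in> D (Seq \<sigma>)"
    and nil: "frc (Seq \<sigma> # \<Gamma>) p (rep (Empty \<sigma>) .: e) \<phi>"
    and cons: "\<And>q a s. p \<sqsubseteq> q \<Longrightarrow> a \<in> D \<sigma> \<Longrightarrow> s \<in> D (Seq \<sigma>) \<Longrightarrow> frc (Seq \<sigma> # \<Gamma>) q (s .: e) \<phi>
      \<Longrightarrow> frc (Seq \<sigma> # \<Gamma>) q (rep (Prep \<sigma>) \<bullet> a \<bullet> s .: e) \<phi>"
  shows "frc (Seq \<sigma> # \<Gamma>) p (s .: e) \<phi>"
proof -
  let ?\<psi> = "Forall (Seq \<sigma>) (Eq TNat (len_tm \<sigma> (Var 0)) (Var 1) \<^bold>\<longrightarrow> subst (Var 0 .: weaken 2) \<phi>)"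
  have ok': "okf (Seq \<sigma> # TNat # \<Gamma>) (subst (Var 0 .: weaken 2) \<phi>)" by (rule okf_subst[OF ok]) simp
  have \<psi>: "frc (TNat # \<Gamma>) p (n .: e) ?\<psi> \<longleftrightarrow> (\<forall>s\<in>D (Seq \<sigma>). \<forall>q. p \<sqsubseteq> q \<longrightarrow>
      eqv q TNat (lenf \<sigma> \<bullet> s) n \<longrightarrow> frc (Seq \<sigma> # \<Gamma>) q (s .: e) \<phi>)" if "n \<in> D TNat" for n p
    using e that ok' by (simp add: frc_subst[OF ok])
  have "frc (TNat # \<Gamma>) p (lenf \<sigma> \<bullet> s .: e) ?\<psi>"
  proof (rule frc_induct)
    show "frc (TNat # \<Gamma>) p (rep Zero .: e) ?\<psi>"
      unfolding \<psi>[OF consts_in(1)]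
    proof (intro ballI allI impI)
      fix t q assume t: "t \<in> D (Seq \<sigma>)" and q: "p \<sqsubseteq> q" and 0: "eqv q TNat (lenf \<sigma> \<bullet> t) (rep Zero)"
      show "frc (Seq \<sigma> # \<Gamma>) q (t .: e) \<phi>"
      proof (rule seq_cases[OF t ok])
        fix r assume "q \<sqsubseteq> r" "eqv r (Seq \<sigma>) t (rep (Empty \<sigma>))"
        then show "frc (Seq \<sigma> # \<Gamma>) r (t .: e) \<phi>"
          using frc_eqv_scons[OF ok e] t frc_mono[OF nil] q leq_trans by (metis consts_in(6))
      next
        fix r a u assume r: "q \<sqsubseteq> r" and a: "a \<in> D \<sigma>" "u \<in> D (Seq \<sigma>)"
          and tu: "eqv r (Seq \<sigma>) t (rep (Prep \<sigma>) \<bullet> a \<bullet> u)"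
        have "eqv r TNat (lenf \<sigma> \<bullet> t) (rep Succ \<bullet> (lenf \<sigma> \<bullet> u))"
          using eqv_app2[OF tu lenf_in t] a by simp
        \<comment> \<open>A prepend has a successor as its length, which clashes with length zero
          and forces the goal.\<close>
        from eqv_trans[OF eqv_sym[OF this] eqv_mono[OF 0 r]]
        have "eqv r TNat (rep Succ \<bullet> (lenf \<sigma> \<bullet> u)) (rep Zero)" using t a by simp
        then show "frc (Seq \<sigma> # \<Gamma>) r (t .: e) \<phi>" by (rule Zero_Succ) (use t a e ok in simp_all)
      qed (use e t in simp)
    qed
  next
    fix q n assume pq: "p \<sqsubseteq> q" and n: "n \<in> D TNat" and IH: "frc (TNat # \<Gamma>) q (n .: e) ?\<psi>"
    show "frc (TNat # \<Gamma>) q (rep Succ \<bullet> n .: e) ?\<psi>"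
      unfolding \<psi>[OF Succ_in[OF n]]
    proof (intro ballI allI impI)
      fix t q' assume t: "t \<in> D (Seq \<sigma>)" and q: "q \<sqsubseteq> q'"
        and S: "eqv q' TNat (lenf \<sigma> \<bullet> t) (rep Succ \<bullet> n)"
      show "frc (Seq \<sigma> # \<Gamma>) q' (t .: e) \<phi>"
      proof (rule seq_cases[OF t ok])
        \<comment> \<open>An empty sequence of successor length is contradictory, but the base case
          \<open>nil\<close> already gives the claim for it.\<close>
        fix r assume "q' \<sqsubseteq> r" "eqv r (Seq \<sigma>) t (rep (Empty \<sigma>))"
        then show "frc (Seq \<sigma> # \<Gamma>) r (t .: e) \<phi>"
          using frc_eqv_scons[OF ok e] t frc_mono[OF nil] q pq leq_trans by (metis consts_in(6))
      next
        fix r a u assume r: "q' \<sqsubseteq> r" and a: "a \<in> D \<sigma>" "u \<in> D (Seq \<sigma>)"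
          and tu: "eqv r (Seq \<sigma>) t (rep (Prep \<sigma>) \<bullet> a \<bullet> u)"
        have "eqv r TNat (lenf \<sigma> \<bullet> t) (rep Succ \<bullet> (lenf \<sigma> \<bullet> u))"
          using eqv_app2[OF tu lenf_in t] a by simp
        from eqv_trans[OF eqv_sym[OF this] eqv_mono[OF S r]]
        have "eqv r TNat (lenf \<sigma> \<bullet> u) n" using t a n by (simp add: Succ_inject)
        with IH[unfolded \<psi>[OF n]] have "frc (Seq \<sigma> # \<Gamma>) r (u .: e) \<phi>"
          using a(2) leq_trans[OF q r] by blast
        from cons[OF _ a this] have "frc (Seq \<sigma> # \<Gamma>) r (rep (Prep \<sigma>) \<bullet> a \<bullet> u .: e) \<phi>"
          using pq q r leq_trans by blast
        then show "frc (Seq \<sigma> # \<Gamma>) r (t .: e) \<phi>"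
          using frc_eqv_scons[OF ok e tu t] a by simp
      qed (use e t in simp)
    qed
  qed (use e s ok' in simp_all)
  then show ?thesis unfolding \<psi>[OF app_in[OF lenf_in s]] using s eqv_refl by simp
qed

definition mem :: "world \<Rightarrow> ty \<Rightarrow> tm \<Rightarrow> tm \<Rightarrow> bool" where
  "mem p \<sigma> a s \<longleftrightarrow> frc [\<sigma>, Seq \<sigma>] p (a .: s .: Var) (Mem \<sigma> (Var 0) (Var 1))"

lemma frc_Mem [simp]:
  assumes "has_type \<Gamma> t \<sigma>" "has_type \<Gamma> u (Seq \<sigma>)" "env e \<Gamma>"
  shows "frc \<Gamma> p e (Mem \<sigma> t u) \<longleftrightarrow> mem p \<sigma> (ev e t) (ev e u)"
  unfolding Mem_eq_subst[of \<sigma> t u] mem_def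
proof (subst frc_subst[OF okf_Mem0])
  show "\<forall>i<length [\<sigma>, Seq \<sigma>]. has_type \<Gamma> ((t .: u .: Var) i) ([\<sigma>, Seq \<sigma>] ! i)" "env e \<Gamma>"
    using assms by simp_all
  show "frc [\<sigma>, Seq \<sigma>] p (\<lambda>n. ev e ((t .: u .: Var) n)) (Mem \<sigma> (Var 0) (Var 1)) =
    frc [\<sigma>, Seq \<sigma>] p (ev e t .: ev e u .: Var) (Mem \<sigma> (Var 0) (Var 1))"
    unfolding frc_def by (rule force_env_cong[OF okf_Mem0]) simp
qed

lemma mem_mono: "mem p \<sigma> a s \<Longrightarrow> p \<sqsubseteq> q \<Longrightarrow> mem q \<sigma> a s"
  unfolding mem_def by (rule frc_mono)

text \<open>The element \<open>k\<close> witnesses that the position \<open>i\<close> is below the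
  length: the length is \<open>k + i + 1\<close>.\<close>

lemma memI:
  assumes "i \<in> D TNat" "k \<in> D TNat" "a \<in> D \<sigma>" "s \<in> D (Seq \<sigma>)"
    and "eqv p TNat (lenf \<sigma> \<bullet> s) (rep Succ \<bullet> (plusf k \<bullet> i))" "eqv p \<sigma> a (nthf \<sigma> \<bullet> s \<bullet> i)"
  shows "mem p \<sigma> a s"
proof -
  have "frc [TNat, \<sigma>, Seq \<sigma>] p (i .: a .: s .: Var) (Less (Var 0) (len_tm \<sigma> (Var 2)))"
    unfolding Less_def by (rule frc_ExI[of _ _ _ _ k]) (use assms in simp_all)
  then show ?thesis
    unfolding mem_def Mem_def by (intro frc_ExI[of _ _ _ _ i]) (use assms in \<open>simp_all add: Less_def numeral_2_eq_2\<close>)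
qed

lemma memE:
  assumes "mem p \<sigma> a s" and as: "a \<in> D \<sigma>" "s \<in> D (Seq \<sigma>)" and \<chi>: "okf \<Gamma> \<chi>" "env e \<Gamma>"
    and "\<And>q i k. p \<sqsubseteq> q \<Longrightarrow> i \<in> D TNat \<Longrightarrow> k \<in> D TNat
      \<Longrightarrow> eqv q TNat (lenf \<sigma> \<bullet> s) (rep Succ \<bullet> (plusf k \<bullet> i)) \<Longrightarrow> eqv q \<sigma> a (nthf \<sigma> \<bullet> s \<bullet> i)
      \<Longrightarrow> frc \<Gamma> q e \<chi>"
  shows "frc \<Gamma> p e \<chi>"
proof (rule frc_ExE[OF assms(1)[unfolded mem_def Mem_def] _ _ \<chi>])
  fix q i assume q: "p \<sqsubseteq> q" and i: "i \<in> D TNat"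
    and "frc [TNat, \<sigma>, Seq \<sigma>] q (i .: a .: s .: Var) (Less (Var 0) (len_tm \<sigma> (shift_tm (Var 1))) \<^bold>\<and>
      Eq \<sigma> (shift_tm (Var 0)) (nth_tm \<sigma> (shift_tm (Var 1)) (Var 0)))"
  then have *: "frc [TNat, \<sigma>, Seq \<sigma>] q (i .: a .: s .: Var) (Less (Var 0) (len_tm \<sigma> (Var 2)))"
    and **: "eqv q \<sigma> a (nthf \<sigma> \<bullet> s \<bullet> i)" using as by (simp_all add: numeral_2_eq_2)
  show "frc \<Gamma> q e \<chi>"
  proof (rule frc_ExE[OF *[unfolded Less_def] _ _ \<chi>])
    fix r k assume r: "q \<sqsubseteq> r" and k: "k \<in> D TNat" and
      "frc [TNat, TNat, \<sigma>, Seq \<sigma>] r (k .: i .: a .: s .: Var)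
        (Eq TNat (shift_tm (len_tm \<sigma> (Var 2))) (Succ \<cdot> plus_tm (Var 0) (shift_tm (Var 0))))"
    then have "eqv r TNat (lenf \<sigma> \<bullet> s) (rep Succ \<bullet> (plusf k \<bullet> i))" using as i by simp
    then show "frc \<Gamma> r e \<chi>"
      using assms(6)[OF leq_trans[OF q r] i k] eqv_mono[OF ** r] by blast
  qed (use as i in simp_all)
qed (use as in \<open>simp_all add: Less_def\<close>)

lemma mem_eqv:
  "mem p \<sigma> a s \<Longrightarrow> eqv p \<sigma> a b \<Longrightarrow> a \<in> D \<sigma> \<Longrightarrow> b \<in> D \<sigma> \<Longrightarrow> s \<in> D (Seq \<sigma>) \<Longrightarrow> mem p \<sigma> b s"
  unfolding mem_def using frc_eqv_scons[OF okf_Mem0, where e = "s .: Var" and a = a and b = b] by simp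

lemma mem_Prep1: "a \<in> D \<sigma> \<Longrightarrow> s \<in> D (Seq \<sigma>) \<Longrightarrow> mem p \<sigma> a (rep (Prep \<sigma>) \<bullet> a \<bullet> s)"
  by (rule memI[of "rep Zero" "lenf \<sigma> \<bullet> s"]) (simp_all add: eqv_refl)

lemma mem_Prep2:
  assumes "mem p \<sigma> a s" "a \<in> D \<sigma>" "b \<in> D \<sigma>" "s \<in> D (Seq \<sigma>)"
  shows "mem p \<sigma> a (rep (Prep \<sigma>) \<bullet> b \<bullet> s)"
  unfolding mem_def
proof (rule memE[OF assms(1,2,4) okf_Mem0])
  fix q i k assume *: "p \<sqsubseteq> q" "i \<in> D TNat" "k \<in> D TNat"
    "eqv q TNat (lenf \<sigma> \<bullet> s) (rep Succ \<bullet> (plusf k \<bullet> i))" "eqv q \<sigma> a (nthf \<sigma> \<bullet> s \<bullet> i)"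
  have "mem q \<sigma> a (rep (Prep \<sigma>) \<bullet> b \<bullet> s)"
    by (rule memI[of "rep Succ \<bullet> i" k]) (use * assms eqv_app2[OF *(4) consts_in(2)] in simp_all)
  then show "frc [\<sigma>, Seq \<sigma>] q (a .: rep (Prep \<sigma>) \<bullet> b \<bullet> s .: Var) (Mem \<sigma> (Var 0) (Var 1))"
    by (simp add: mem_def)
qed (use assms in simp)

lemma mem_Empty:
  assumes "mem p \<sigma> a (rep (Empty \<sigma>))" "a \<in> D \<sigma>" "okf \<Gamma> \<chi>" "env e \<Gamma>"
  shows "frc \<Gamma> p e \<chi>"
proof (rule memE[OF assms(1,2) consts_in(6) assms(3,4)])
  fix q i k assume *: "i \<in> D TNat" "k \<in> D TNat"
    "eqv q TNat (lenf \<sigma> \<bullet> rep (Empty \<sigma>)) (rep Succ \<bullet> (plusf k \<bullet> i))"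
  then have "eqv q TNat (rep Succ \<bullet> (plusf k \<bullet> i)) (rep Zero)" by (simp add: eqv_sym)
  then show "frc \<Gamma> q e \<chi>" by (rule Zero_Succ) (use * assms in simp_all)
qed

text \<open>Case distinction on the position. Position zero is the head; a successor position,
  lowered by one, is a position in the tail with the same difference \<open>k\<close> to the
  length.\<close>

lemma mem_Prep_cases:
  assumes "mem p \<sigma> a (rep (Prep \<sigma>) \<bullet> b \<bullet> s)" "a \<in> D \<sigma>" "b \<in> D \<sigma>" "s \<in> D (Seq \<sigma>)"
    and \<chi>: "okf \<Gamma> \<chi>" "env e \<Gamma>"
    and eq: "\<And>q. p \<sqsubseteq> q \<Longrightarrow> eqv q \<sigma> a b \<Longrightarrow> frc \<Gamma> q e \<chi>"
    and mem: "\<And>q. p \<sqsubseteq> q \<Longrightarrow> mem q \<sigma> a s \<Longrightarrow> frc \<Gamma> q e \<chi>"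
  shows "frc \<Gamma> p e \<chi>"
proof (rule memE[OF assms(1,2) Prep_in[OF assms(3,4)] \<chi>])
  fix q i k assume q: "p \<sqsubseteq> q" and ik: "i \<in> D TNat" "k \<in> D TNat"
    and len: "eqv q TNat (lenf \<sigma> \<bullet> (rep (Prep \<sigma>) \<bullet> b \<bullet> s)) (rep Succ \<bullet> (plusf k \<bullet> i))"
    and nth: "eqv q \<sigma> a (nthf \<sigma> \<bullet> (rep (Prep \<sigma>) \<bullet> b \<bullet> s) \<bullet> i)"
  have nthP: "nthf \<sigma> \<bullet> (rep (Prep \<sigma>) \<bullet> b \<bullet> s) \<in> D (TNat \<Rrightarrow> \<sigma>)" using assms by simp
  show "frc \<Gamma> q e \<chi>"
  proof (rule nat_cases[OF ik(1) \<chi>])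
    fix r assume r: "q \<sqsubseteq> r" and "eqv r TNat i (rep Zero)"
    from eqv_app2[OF this(2) nthP ik(1) consts_in(1)]
    have "eqv r \<sigma> a b"
      using eqv_trans[OF eqv_mono[OF nth r]] assms ik by simp
    then show "frc \<Gamma> r e \<chi>" using eq leq_trans[OF q r] by blast
  next
    fix r j assume r: "q \<sqsubseteq> r" and j: "j \<in> D TNat" and ij: "eqv r TNat i (rep Succ \<bullet> j)"
    have 1: "eqv r \<sigma> a (nthf \<sigma> \<bullet> s \<bullet> j)"
      using eqv_trans[OF eqv_mono[OF nth r] eqv_app2[OF ij nthP]] assms ik j by simp
    have "eqv r TNat (plusf k \<bullet> i) (rep Succ \<bullet> (plusf k \<bullet> j))"
      using eqv_app2[OF ij plusf_in[OF ik(2)]] ik j by simp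
    moreover have "eqv r TNat (lenf \<sigma> \<bullet> s) (plusf k \<bullet> i)"
      using eqv_mono[OF len r] assms ik by (simp add: Succ_inject)
    ultimately have 2: "eqv r TNat (lenf \<sigma> \<bullet> s) (rep Succ \<bullet> (plusf k \<bullet> j))"
      using eqv_trans assms ik j by (meson Succ_in app_in lenf_in plusf_in)
    have "mem r \<sigma> a s" by (rule memI[OF j ik(2) assms(2,4) 2 1])
    then show "frc \<Gamma> r e \<chi>" using mem leq_trans[OF q r] by blast
  qed
qed

end

declare lams.simps [simp del] LAM.simps [simp del]

section \<open>Closed terms operating on sequences\<close>

definition append_step :: "ty \<Rightarrow> tm" where
  "append_step \<sigma> = lams [\<sigma>, Seq \<sigma>] (Prep \<sigma> \<cdot> Var 0 \<cdot> Var 1)"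

lemma closed_append_step: "closed_term (append_step \<sigma>) (Seq \<sigma> \<Rrightarrow> \<sigma> \<Rrightarrow> Seq \<sigma>)"
  unfolding append_step_def by (rule closed_lams[where \<Gamma> = "[_, _]", unfolded funs.simps]) simp

lemmas [simp] = closed_has_type[OF closed_append_step]

definition append_tm :: "ty \<Rightarrow> tm" where
  "append_tm \<sigma> = lams [Seq \<sigma>, Seq \<sigma>] (LRec (Seq \<sigma>) \<sigma> \<cdot> Var 0 \<cdot> append_step \<sigma> \<cdot> Var 1)"

lemma closed_append: "closed_term (append_tm \<sigma>) (Seq \<sigma> \<Rrightarrow> Seq \<sigma> \<Rrightarrow> Seq \<sigma>)"
  unfolding append_tm_def by (rule closed_lams[where \<Gamma> = "[_, _]", unfolded funs.simps]) simp

lemmas [simp] = closed_has_type[OF closed_append]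

definition concat_step :: "ty \<Rightarrow> ty \<Rightarrow> tm" where
  "concat_step \<sigma> \<tau> = lams [\<sigma>, Seq \<tau>, \<sigma> \<Rrightarrow> Seq \<tau>] (append_tm \<tau> \<cdot> (Var 2 \<cdot> Var 0) \<cdot> Var 1)"

lemma closed_concat_step:
  "closed_term (concat_step \<sigma> \<tau>) ((\<sigma> \<Rrightarrow> Seq \<tau>) \<Rrightarrow> Seq \<tau> \<Rrightarrow> \<sigma> \<Rrightarrow> Seq \<tau>)"
  unfolding concat_step_def by (rule closed_lams[where \<Gamma> = "[_, _, _]", unfolded funs.simps]) simp

lemmas [simp] = closed_has_type[OF closed_concat_step]

text \<open>The union of the family \<open>f\<close> over the members of a sequence. It composes the
  challenge functionals of two realizers.\<close>

definition concat_tm :: "ty \<Rightarrow> ty \<Rightarrow> tm" where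
  "concat_tm \<sigma> \<tau> = lams [Seq \<sigma>, \<sigma> \<Rrightarrow> Seq \<tau>]
     (LRec (Seq \<tau>) \<sigma> \<cdot> Empty \<tau> \<cdot> (concat_step \<sigma> \<tau> \<cdot> Var 1) \<cdot> Var 0)"

lemma closed_concat: "closed_term (concat_tm \<sigma> \<tau>) ((\<sigma> \<Rrightarrow> Seq \<tau>) \<Rrightarrow> Seq \<sigma> \<Rrightarrow> Seq \<tau>)"
  unfolding concat_tm_def by (rule closed_lams[where \<Gamma> = "[_, _]", unfolded funs.simps]) simp

lemmas [simp] = closed_has_type[OF closed_concat]

definition map_tm :: "ty \<Rightarrow> ty \<Rightarrow> tm" where
  "map_tm \<sigma> \<tau> = lams [Seq \<sigma>, \<sigma> \<Rrightarrow> \<tau>]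
     (concat_tm \<sigma> \<tau> \<cdot> LAM [Seq \<sigma>, \<sigma> \<Rrightarrow> \<tau>] \<sigma> (Prep \<tau> \<cdot> (Var 2 \<cdot> Var 0) \<cdot> Empty \<tau>) \<cdot> Var 0)"

lemma closed_map: "closed_term (map_tm \<sigma> \<tau>) ((\<sigma> \<Rrightarrow> \<tau>) \<Rrightarrow> Seq \<sigma> \<Rrightarrow> Seq \<tau>)"
  unfolding map_tm_def by (rule closed_lams[where \<Gamma> = "[_, _]", unfolded funs.simps]) simp

lemmas [simp] = closed_has_type[OF closed_map]

text \<open>Recursion with a constant step, used as a test for zero: the value at zero is the first
  branch. It lets the flag of a disjunction select a witness.\<close>

definition cond_tm :: "ty \<Rightarrow> tm" where
  "cond_tm \<sigma> = lams [\<sigma>, \<sigma>, TNat]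
     (Rec \<sigma> \<cdot> Var 1 \<cdot> LAM [\<sigma>, \<sigma>, TNat] \<sigma> (LAM [\<sigma>, \<sigma>, \<sigma>, TNat] TNat (Var 2)) \<cdot> Var 2)"

lemma closed_cond: "closed_term (cond_tm \<sigma>) (TNat \<Rrightarrow> \<sigma> \<Rrightarrow> \<sigma> \<Rrightarrow> \<sigma>)"
  unfolding cond_tm_def by (rule closed_lams[where \<Gamma> = "[_, _, _]", unfolded funs.simps]) simp

lemmas [simp] = closed_has_type[OF closed_cond]

section \<open>Pairs\<close>

text \<open>The sequence grows at the front: its head is the value at zero, and its tail tabulates
  the function shifted by one. As the function changes in the recursion, the recursor runs at a type
  of functionals.\<close>

definition build_step :: "ty \<Rightarrow> tm" where
  "build_step \<sigma> = lams [TNat \<Rrightarrow> \<sigma>, TNat, (TNat \<Rrightarrow> \<sigma>) \<Rrightarrow> Seq \<sigma>]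
     (Prep \<sigma> \<cdot> (Var 0 \<cdot> Zero) \<cdot>
       (Var 2 \<cdot> LAM [TNat \<Rrightarrow> \<sigma>, TNat, (TNat \<Rrightarrow> \<sigma>) \<Rrightarrow> Seq \<sigma>] TNat (Var 1 \<cdot> (Succ \<cdot> Var 0))))"

lemma closed_build_step:
  "closed_term (build_step \<sigma>)
    (((TNat \<Rrightarrow> \<sigma>) \<Rrightarrow> Seq \<sigma>) \<Rrightarrow> TNat \<Rrightarrow> (TNat \<Rrightarrow> \<sigma>) \<Rrightarrow> Seq \<sigma>)"
  unfolding build_step_def by (rule closed_lams[where \<Gamma> = "[_, _, _]", unfolded funs.simps]) simp

lemmas [simp] = closed_has_type[OF closed_build_step]

text \<open>\<open>build n f\<close> is the sequence of the values of \<open>f\<close> at all numbers below \<open>n\<close>.\<close>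

definition build_tm :: "ty \<Rightarrow> tm" where
  "build_tm \<sigma> = Rec ((TNat \<Rrightarrow> \<sigma>) \<Rrightarrow> Seq \<sigma>) \<cdot> (CK (Seq \<sigma>) (TNat \<Rrightarrow> \<sigma>) \<cdot> Empty \<sigma>) \<cdot> build_step \<sigma>"

lemma closed_build: "closed_term (build_tm \<sigma>) (TNat \<Rrightarrow> (TNat \<Rrightarrow> \<sigma>) \<Rrightarrow> Seq \<sigma>)"
  by (simp add: build_tm_def)

lemmas [simp] = closed_has_type[OF closed_build]

text \<open>
  Recovers an object \<open>a\<close> from the functional \<open>\<lambda>o. o a\<close> on numerical observations. Hence a pair
  can be coded by the functional \<open>\<lambda>k. k a b\<close> with values of type \<open>0\<close>, although the components
  have arbitrary types.
\<close>

primrec read_tm :: "ty \<Rightarrow> tm" where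
  "read_tm TNat = lams [(TNat \<Rrightarrow> TNat) \<Rrightarrow> TNat]
     (Var 0 \<cdot> LAM [(TNat \<Rrightarrow> TNat) \<Rrightarrow> TNat] TNat (Var 0))"
| "read_tm (\<sigma> \<Rrightarrow> \<tau>) = lams [\<sigma>, ((\<sigma> \<Rrightarrow> \<tau>) \<Rrightarrow> TNat) \<Rrightarrow> TNat]
     (read_tm \<tau> \<cdot> LAM [\<sigma>, ((\<sigma> \<Rrightarrow> \<tau>) \<Rrightarrow> TNat) \<Rrightarrow> TNat] (\<tau> \<Rrightarrow> TNat)
       (Var 2 \<cdot> LAM [\<tau> \<Rrightarrow> TNat, \<sigma>, ((\<sigma> \<Rrightarrow> \<tau>) \<Rrightarrow> TNat) \<Rrightarrow> TNat] (\<sigma> \<Rrightarrow> \<tau>) (Var 1 \<cdot> (Var 0 \<cdot> Var 2))))"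
| "read_tm (Seq \<sigma>) = lams [(Seq \<sigma> \<Rrightarrow> TNat) \<Rrightarrow> TNat]
     (build_tm \<sigma> \<cdot>
       (Var 0 \<cdot> LAM [(Seq \<sigma> \<Rrightarrow> TNat) \<Rrightarrow> TNat] (Seq \<sigma>) (len_tm \<sigma> (Var 0))) \<cdot>
       LAM [(Seq \<sigma> \<Rrightarrow> TNat) \<Rrightarrow> TNat] TNat
         (read_tm \<sigma> \<cdot> LAM [TNat, (Seq \<sigma> \<Rrightarrow> TNat) \<Rrightarrow> TNat] (\<sigma> \<Rrightarrow> TNat)
           (Var 2 \<cdot> LAM [\<sigma> \<Rrightarrow> TNat, TNat, (Seq \<sigma> \<Rrightarrow> TNat) \<Rrightarrow> TNat] (Seq \<sigma>)
             (Var 1 \<cdot> nth_tm \<sigma> (Var 0) (Var 2)))))"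

lemma closed_read: "closed_term (read_tm \<sigma>) (((\<sigma> \<Rrightarrow> TNat) \<Rrightarrow> TNat) \<Rrightarrow> \<sigma>)"
proof (induction \<sigma>)
  case TNat
  show ?case unfolding read_tm.simps by (rule closed_lams[where \<Gamma> = "[_]", unfolded funs.simps]) simp
next
  case (Fun \<sigma> \<tau>)
  show ?case unfolding read_tm.simps
    by (rule closed_lams[where \<Gamma> = "[_, _]", unfolded funs.simps]) (simp add: closed_has_type[OF Fun(2)])
next
  case (Seq \<sigma>)
  show ?case unfolding read_tm.simps
    by (rule closed_lams[where \<Gamma> = "[_]", unfolded funs.simps]) (simp add: closed_has_type[OF Seq])
qed

lemmas [simp] = closed_has_type[OF closed_read]

definition Pr :: "ty \<Rightarrow> ty \<Rightarrow> ty" where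
  "Pr \<sigma> \<tau> = (\<sigma> \<Rrightarrow> \<tau> \<Rrightarrow> TNat) \<Rrightarrow> TNat"

definition pair_tm :: "ty \<Rightarrow> ty \<Rightarrow> tm" where
  "pair_tm \<sigma> \<tau> = lams [\<sigma> \<Rrightarrow> \<tau> \<Rrightarrow> TNat, \<tau>, \<sigma>] (Var 0 \<cdot> Var 2 \<cdot> Var 1)"

text \<open>The pair is fed with the selector that applies an observation to its first argument.
  This yields the functional of observations from which \<open>read_tm\<close> rebuilds the
  component.\<close>

definition fst_tm :: "ty \<Rightarrow> ty \<Rightarrow> tm" where
  "fst_tm \<sigma> \<tau> = lams [Pr \<sigma> \<tau>] (read_tm \<sigma> \<cdot> LAM [Pr \<sigma> \<tau>] (\<sigma> \<Rrightarrow> TNat)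
     (Var 1 \<cdot> LAM [\<sigma> \<Rrightarrow> TNat, Pr \<sigma> \<tau>] \<sigma> (LAM [\<sigma>, \<sigma> \<Rrightarrow> TNat, Pr \<sigma> \<tau>] \<tau> (Var 2 \<cdot> Var 1))))"

definition snd_tm :: "ty \<Rightarrow> ty \<Rightarrow> tm" where
  "snd_tm \<sigma> \<tau> = lams [Pr \<sigma> \<tau>] (read_tm \<tau> \<cdot> LAM [Pr \<sigma> \<tau>] (\<tau> \<Rrightarrow> TNat)
     (Var 1 \<cdot> LAM [\<tau> \<Rrightarrow> TNat, Pr \<sigma> \<tau>] \<sigma> (LAM [\<sigma>, \<tau> \<Rrightarrow> TNat, Pr \<sigma> \<tau>] \<tau> (Var 2 \<cdot> Var 0))))"

lemma closed_pair: "closed_term (pair_tm \<sigma> \<tau>) (\<sigma> \<Rrightarrow> \<tau> \<Rrightarrow> Pr \<sigma> \<tau>)"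
  unfolding pair_tm_def Pr_def by (rule closed_lams[where \<Gamma> = "[_, _, _]", unfolded funs.simps]) simp

lemma closed_fst: "closed_term (fst_tm \<sigma> \<tau>) (Pr \<sigma> \<tau> \<Rrightarrow> \<sigma>)"
  unfolding fst_tm_def Pr_def by (rule closed_lams[where \<Gamma> = "[_]", unfolded funs.simps]) simp

lemma closed_snd: "closed_term (snd_tm \<sigma> \<tau>) (Pr \<sigma> \<tau> \<Rrightarrow> \<tau>)"
  unfolding snd_tm_def Pr_def by (rule closed_lams[where \<Gamma> = "[_]", unfolded funs.simps]) simp

lemmas [simp] = closed_has_type[OF closed_pair] closed_has_type[OF closed_fst] closed_has_type[OF closed_snd]

lemmas closed_terms = closed_append_step closed_append closed_concat_step closed_concat closed_map
  closed_cond closed_build_step closed_build closed_read closed_pair closed_fst closed_snd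

lemmas subst_closed_terms [simp] = closed_terms[THEN closed_subst]

section \<open>Computation rules for sequences, conditionals and pairs\<close>

context model
begin

lemmas ev_closed_terms [simp] = closed_terms[THEN ev_closed]

lemmas rep_closed_terms [simp] = closed_terms[THEN rep_closed_in]

lemma append_in [simp]: "s \<in> D (Seq \<sigma>) \<Longrightarrow> t \<in> D (Seq \<sigma>) \<Longrightarrow> rep (append_tm \<sigma>) \<bullet> s \<bullet> t \<in> D (Seq \<sigma>)"
  by (rule app_in[OF app_in[OF rep_closed_in[OF closed_append]]])

lemma concat_in [simp]:
  "f \<in> D (\<sigma> \<Rrightarrow> Seq \<tau>) \<Longrightarrow> s \<in> D (Seq \<sigma>) \<Longrightarrow> rep (concat_tm \<sigma> \<tau>) \<bullet> f \<bullet> s \<in> D (Seq \<tau>)"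
  by (rule app_in[OF app_in[OF rep_closed_in[OF closed_concat]]])

lemma map_in [simp]:
  "f \<in> D (\<sigma> \<Rrightarrow> \<tau>) \<Longrightarrow> s \<in> D (Seq \<sigma>) \<Longrightarrow> rep (map_tm \<sigma> \<tau>) \<bullet> f \<bullet> s \<in> D (Seq \<tau>)"
  by (rule app_in[OF app_in[OF rep_closed_in[OF closed_map]]])

lemma cond_in [simp]:
  "z \<in> D TNat \<Longrightarrow> a \<in> D \<sigma> \<Longrightarrow> b \<in> D \<sigma> \<Longrightarrow> rep (cond_tm \<sigma>) \<bullet> z \<bullet> a \<bullet> b \<in> D \<sigma>"
  by (rule app_in[OF app_in[OF app_in[OF rep_closed_in[OF closed_cond]]]])

lemma pair_in [simp]: "a \<in> D \<sigma> \<Longrightarrow> b \<in> D \<tau> \<Longrightarrow> rep (pair_tm \<sigma> \<tau>) \<bullet> a \<bullet> b \<in> D (Pr \<sigma> \<tau>)"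
  by (rule app_in[OF app_in[OF rep_closed_in[OF closed_pair]]])

lemma fst_in [simp]: "x \<in> D (Pr \<sigma> \<tau>) \<Longrightarrow> rep (fst_tm \<sigma> \<tau>) \<bullet> x \<in> D \<sigma>"
  by (rule app_in[OF rep_closed_in[OF closed_fst]])

lemma snd_in [simp]: "x \<in> D (Pr \<sigma> \<tau>) \<Longrightarrow> rep (snd_tm \<sigma> \<tau>) \<bullet> x \<in> D \<tau>"
  by (rule app_in[OF rep_closed_in[OF closed_snd]])

lemma build_in [simp]:
  "n \<in> D TNat \<Longrightarrow> f \<in> D (TNat \<Rrightarrow> \<sigma>) \<Longrightarrow> rep (build_tm \<sigma>) \<bullet> n \<bullet> f \<in> D (Seq \<sigma>)"
  by (rule app_in[OF app_in[OF rep_closed_in[OF closed_build]]])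

lemma app_append_step:
  "h \<in> D (Seq \<sigma>) \<Longrightarrow> a \<in> D \<sigma> \<Longrightarrow> rep (append_step \<sigma>) \<bullet> h \<bullet> a = rep (Prep \<sigma>) \<bullet> a \<bullet> h"
  unfolding append_step_def by (subst app_lams2[where \<tau> = "Seq \<sigma>"]) simp_all

lemma append_unfold:
  "s \<in> D (Seq \<sigma>) \<Longrightarrow> t \<in> D (Seq \<sigma>)
    \<Longrightarrow> rep (append_tm \<sigma>) \<bullet> s \<bullet> t = rep (LRec (Seq \<sigma>) \<sigma>) \<bullet> t \<bullet> rep (append_step \<sigma>) \<bullet> s"
  unfolding append_tm_def by (subst app_lams2[where \<tau> = "Seq \<sigma>"]) simp_all

lemma append_Empty [simp]: "t \<in> D (Seq \<sigma>) \<Longrightarrow> rep (append_tm \<sigma>) \<bullet> rep (Empty \<sigma>) \<bullet> t = t"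
  by (simp add: append_unfold app_LRec_Empty)

lemma append_Prep [simp]:
  "a \<in> D \<sigma> \<Longrightarrow> s \<in> D (Seq \<sigma>) \<Longrightarrow> t \<in> D (Seq \<sigma>)
    \<Longrightarrow> rep (append_tm \<sigma>) \<bullet> (rep (Prep \<sigma>) \<bullet> a \<bullet> s) \<bullet> t = rep (Prep \<sigma>) \<bullet> a \<bullet> (rep (append_tm \<sigma>) \<bullet> s \<bullet> t)"
  using append_in[of s \<sigma> t] by (simp add: append_unfold app_LRec_Prep app_append_step)

lemma app_concat_step:
  "f \<in> D (\<sigma> \<Rrightarrow> Seq \<tau>) \<Longrightarrow> h \<in> D (Seq \<tau>) \<Longrightarrow> a \<in> D \<sigma>
    \<Longrightarrow> rep (concat_step \<sigma> \<tau>) \<bullet> f \<bullet> h \<bullet> a = rep (append_tm \<tau>) \<bullet> (f \<bullet> a) \<bullet> h"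
  unfolding concat_step_def by (subst app_lams3[where \<tau> = "Seq \<tau>"]) simp_all

lemma concat_unfold:
  "s \<in> D (Seq \<sigma>) \<Longrightarrow> f \<in> D (\<sigma> \<Rrightarrow> Seq \<tau>) \<Longrightarrow> rep (concat_tm \<sigma> \<tau>) \<bullet> f \<bullet> s =
    rep (LRec (Seq \<tau>) \<sigma>) \<bullet> rep (Empty \<tau>) \<bullet> (rep (concat_step \<sigma> \<tau>) \<bullet> f) \<bullet> s"
  unfolding concat_tm_def by (subst app_lams2[where \<tau> = "Seq \<tau>"]) simp_all

lemma concat_Prep [simp]:
  assumes "a \<in> D \<sigma>" "s \<in> D (Seq \<sigma>)" "f \<in> D (\<sigma> \<Rrightarrow> Seq \<tau>)"
  shows "rep (concat_tm \<sigma> \<tau>) \<bullet> f \<bullet> (rep (Prep \<sigma>) \<bullet> a \<bullet> s) =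
    rep (append_tm \<tau>) \<bullet> (f \<bullet> a) \<bullet> (rep (concat_tm \<sigma> \<tau>) \<bullet> f \<bullet> s)"
  using concat_in[OF assms(3,2)] app_in[OF rep_closed_in[OF closed_concat_step] assms(3)] assms
  by (simp add: concat_unfold app_LRec_Prep app_concat_step)

lemma mem_eqv2:
  assumes "mem p \<sigma> a s" "eqv p (Seq \<sigma>) s t" "a \<in> D \<sigma>" "s \<in> D (Seq \<sigma>)" "t \<in> D (Seq \<sigma>)"
  shows "mem p \<sigma> a t"
proof -
  have "frc [\<sigma>, Seq \<sigma>] p (a .: s .: Var) (Mem \<sigma> (Var 0) (Var 1)) \<longleftrightarrow>
    frc [\<sigma>, Seq \<sigma>] p (a .: t .: Var) (Mem \<sigma> (Var 0) (Var 1))"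
    by (rule frc_eqv[OF okf_Mem0]) (use assms in \<open>simp_all add: eqv_refl\<close>)
  then show ?thesis using assms(1) unfolding mem_def by blast
qed

text \<open>Sequences serve as finite sets of challenges in which a member has to be found again.
  Both rules go by induction on the first sequence; for the first rule, membership in that sequence
  is the premise of the induction formula.\<close>

lemma mem_append:
  assumes "a \<in> D \<sigma>" "s \<in> D (Seq \<sigma>)" "t \<in> D (Seq \<sigma>)"
  shows mem_append1: "mem p \<sigma> a s \<Longrightarrow> mem p \<sigma> a (rep (append_tm \<sigma>) \<bullet> s \<bullet> t)"
    and mem_append2: "mem p \<sigma> a t \<Longrightarrow> mem p \<sigma> a (rep (append_tm \<sigma>) \<bullet> s \<bullet> t)"
proof -
  let ?e = "a .: t .: Var" and ?\<Gamma> = "[\<sigma>, Seq \<sigma>]"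
  let ?G = "Mem \<sigma> (Var 1) (append_tm \<sigma> \<cdot> Var 0 \<cdot> Var 2)"
  have G: "frc (Seq \<sigma> # ?\<Gamma>) q (u .: ?e) ?G \<longleftrightarrow> mem q \<sigma> a (rep (append_tm \<sigma>) \<bullet> u \<bullet> t)"
    if "u \<in> D (Seq \<sigma>)" for q u using assms that by simp
  have F: "frc (Seq \<sigma> # ?\<Gamma>) q (u .: ?e) (Mem \<sigma> (Var 1) (Var 0) \<^bold>\<longrightarrow> ?G) \<longleftrightarrow>
    (\<forall>r. q \<sqsubseteq> r \<longrightarrow> mem r \<sigma> a u \<longrightarrow> mem r \<sigma> a (rep (append_tm \<sigma>) \<bullet> u \<bullet> t))"
    if "u \<in> D (Seq \<sigma>)" for q u using assms that by simp
  have "frc (Seq \<sigma> # ?\<Gamma>) p (s .: ?e) (Mem \<sigma> (Var 1) (Var 0) \<^bold>\<longrightarrow> ?G)"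
  proof (rule seq_induct)
    show "frc (Seq \<sigma> # ?\<Gamma>) p (rep (Empty \<sigma>) .: ?e) (Mem \<sigma> (Var 1) (Var 0) \<^bold>\<longrightarrow> ?G)"
      unfolding F[OF consts_in(6)]
    proof (intro allI impI)
      fix r assume "p \<sqsubseteq> r" "mem r \<sigma> a (rep (Empty \<sigma>))"
      then have "frc (Seq \<sigma> # ?\<Gamma>) r (rep (Empty \<sigma>) .: ?e) ?G"
        by (intro mem_Empty) (use assms in simp_all)
      then show "mem r \<sigma> a (rep (append_tm \<sigma>) \<bullet> rep (Empty \<sigma>) \<bullet> t)" unfolding G[OF consts_in(6)] .
    qed
  next
    fix q b u assume b: "b \<in> D \<sigma>" and u: "u \<in> D (Seq \<sigma>)"
      and IH: "frc (Seq \<sigma> # ?\<Gamma>) q (u .: ?e) (Mem \<sigma> (Var 1) (Var 0) \<^bold>\<longrightarrow> ?G)"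
    show "frc (Seq \<sigma> # ?\<Gamma>) q (rep (Prep \<sigma>) \<bullet> b \<bullet> u .: ?e) (Mem \<sigma> (Var 1) (Var 0) \<^bold>\<longrightarrow> ?G)"
      unfolding F[OF Prep_in[OF b u]]
    proof (intro allI impI)
      fix r assume r: "q \<sqsubseteq> r" "mem r \<sigma> a (rep (Prep \<sigma>) \<bullet> b \<bullet> u)"
      have "frc (Seq \<sigma> # ?\<Gamma>) r (rep (Prep \<sigma>) \<bullet> b \<bullet> u .: ?e) ?G"
      proof (rule mem_Prep_cases[OF r(2) assms(1) b u])
        fix r' assume "eqv r' \<sigma> a b"
        then show "frc (Seq \<sigma> # ?\<Gamma>) r' (rep (Prep \<sigma>) \<bullet> b \<bullet> u .: ?e) ?G"
          unfolding G[OF Prep_in[OF b u]]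
          using mem_eqv[OF mem_Prep1[OF b append_in[OF u assms(3)]] eqv_sym] assms b u by simp
      next
        fix r' assume "r \<sqsubseteq> r'" "mem r' \<sigma> a u"
        then show "frc (Seq \<sigma> # ?\<Gamma>) r' (rep (Prep \<sigma>) \<bullet> b \<bullet> u .: ?e) ?G"
          unfolding G[OF Prep_in[OF b u]]
          using IH[unfolded F[OF u]] leq_trans[OF r(1)] assms b u by (simp add: mem_Prep2)
      qed (use assms b u in simp_all)
      then show "mem r \<sigma> a (rep (append_tm \<sigma>) \<bullet> (rep (Prep \<sigma>) \<bullet> b \<bullet> u) \<bullet> t)"
        unfolding G[OF Prep_in[OF b u]] .
    qed
  qed (use assms in simp_all)
  then show "mem p \<sigma> a s \<Longrightarrow> mem p \<sigma> a (rep (append_tm \<sigma>) \<bullet> s \<bullet> t)"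
    unfolding F[OF assms(2)] by blast
next
  assume "mem p \<sigma> a t"
  let ?e = "a .: t .: Var" and ?\<Gamma> = "[\<sigma>, Seq \<sigma>]"
  let ?G = "Mem \<sigma> (Var 1) (append_tm \<sigma> \<cdot> Var 0 \<cdot> Var 2)"
  have G: "frc (Seq \<sigma> # ?\<Gamma>) q (u .: ?e) ?G \<longleftrightarrow> mem q \<sigma> a (rep (append_tm \<sigma>) \<bullet> u \<bullet> t)"
    if "u \<in> D (Seq \<sigma>)" for q u using assms that by simp
  have "frc (Seq \<sigma> # ?\<Gamma>) p (s .: ?e) ?G"
  proof (rule seq_induct)
    show "frc (Seq \<sigma> # ?\<Gamma>) p (rep (Empty \<sigma>) .: ?e) ?G"
      unfolding G[OF consts_in(6)] using assms \<open>mem p \<sigma> a t\<close> by simp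
    fix q b u assume "b \<in> D \<sigma>" "u \<in> D (Seq \<sigma>)" "frc (Seq \<sigma> # ?\<Gamma>) q (u .: ?e) ?G"
    then show "frc (Seq \<sigma> # ?\<Gamma>) q (rep (Prep \<sigma>) \<bullet> b \<bullet> u .: ?e) ?G"
      using assms by (simp add: mem_Prep2)
  qed (use assms in simp_all)
  then show "mem p \<sigma> a (rep (append_tm \<sigma>) \<bullet> s \<bullet> t)" unfolding G[OF assms(2)] .
qed

text \<open>Induction on \<open>s\<close> with the membership of \<open>a\<close> as a premise. If
  \<open>a\<close> equals the head \<open>c\<close>, membership in \<open>f a\<close> is transported
  to \<open>f c\<close>, the first part of the result; otherwise \<open>b\<close> is found in the
  second part.\<close>

lemma mem_concat:
  assumes "mem p \<sigma> a s" "mem p \<tau> b (f \<bullet> a)"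
    and "a \<in> D \<sigma>" "s \<in> D (Seq \<sigma>)" "b \<in> D \<tau>" "f \<in> D (\<sigma> \<Rrightarrow> Seq \<tau>)"
  shows "mem p \<tau> b (rep (concat_tm \<sigma> \<tau>) \<bullet> f \<bullet> s)"
proof -
  let ?e = "a .: b .: f .: Var" and ?\<Gamma> = "[\<sigma>, \<tau>, \<sigma> \<Rrightarrow> Seq \<tau>]"
  let ?G = "Mem \<tau> (Var 2) (concat_tm \<sigma> \<tau> \<cdot> Var 3 \<cdot> Var 0)"
  have G: "frc (Seq \<sigma> # ?\<Gamma>) q (u .: ?e) ?G \<longleftrightarrow> mem q \<tau> b (rep (concat_tm \<sigma> \<tau>) \<bullet> f \<bullet> u)"
    if "u \<in> D (Seq \<sigma>)" for q u using assms that by simp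
  have F: "frc (Seq \<sigma> # ?\<Gamma>) q (u .: ?e) (Mem \<sigma> (Var 1) (Var 0) \<^bold>\<longrightarrow> ?G) \<longleftrightarrow>
    (\<forall>r. q \<sqsubseteq> r \<longrightarrow> mem r \<sigma> a u \<longrightarrow> mem r \<tau> b (rep (concat_tm \<sigma> \<tau>) \<bullet> f \<bullet> u))"
    if "u \<in> D (Seq \<sigma>)" for q u using assms that by simp
  have "frc (Seq \<sigma> # ?\<Gamma>) p (s .: ?e) (Mem \<sigma> (Var 1) (Var 0) \<^bold>\<longrightarrow> ?G)"
  proof (rule seq_induct)
    show "frc (Seq \<sigma> # ?\<Gamma>) p (rep (Empty \<sigma>) .: ?e) (Mem \<sigma> (Var 1) (Var 0) \<^bold>\<longrightarrow> ?G)"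
      unfolding F[OF consts_in(6)]
    proof (intro allI impI)
      fix r assume "p \<sqsubseteq> r" "mem r \<sigma> a (rep (Empty \<sigma>))"
      then have "frc (Seq \<sigma> # ?\<Gamma>) r (rep (Empty \<sigma>) .: ?e) ?G"
        by (intro mem_Empty) (use assms in simp_all)
      then show "mem r \<tau> b (rep (concat_tm \<sigma> \<tau>) \<bullet> f \<bullet> rep (Empty \<sigma>))" unfolding G[OF consts_in(6)] .
    qed
  next
    fix q c u assume q: "p \<sqsubseteq> q" and c: "c \<in> D \<sigma>" and u: "u \<in> D (Seq \<sigma>)"
      and IH: "frc (Seq \<sigma> # ?\<Gamma>) q (u .: ?e) (Mem \<sigma> (Var 1) (Var 0) \<^bold>\<longrightarrow> ?G)"
    note in_D = app_in[OF assms(6) c] app_in[OF assms(6,3)] concat_in[OF assms(6) u]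
    show "frc (Seq \<sigma> # ?\<Gamma>) q (rep (Prep \<sigma>) \<bullet> c \<bullet> u .: ?e) (Mem \<sigma> (Var 1) (Var 0) \<^bold>\<longrightarrow> ?G)"
      unfolding F[OF Prep_in[OF c u]]
    proof (intro allI impI)
      fix r assume r: "q \<sqsubseteq> r" "mem r \<sigma> a (rep (Prep \<sigma>) \<bullet> c \<bullet> u)"
      have "frc (Seq \<sigma> # ?\<Gamma>) r (rep (Prep \<sigma>) \<bullet> c \<bullet> u .: ?e) ?G"
      proof (rule mem_Prep_cases[OF r(2) assms(3) c u])
        fix r' assume r': "r \<sqsubseteq> r'" "eqv r' \<sigma> a c"
        have "mem r' \<tau> b (f \<bullet> a)" using assms(2) q r(1) r'(1) mem_mono leq_trans by blast
        then have "mem r' \<tau> b (f \<bullet> c)"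
          using mem_eqv2[OF _ eqv_app2[OF r'(2) assms(6)]] assms in_D c by blast
        then show "frc (Seq \<sigma> # ?\<Gamma>) r' (rep (Prep \<sigma>) \<bullet> c \<bullet> u .: ?e) ?G"
          unfolding G[OF Prep_in[OF c u]] using mem_append1[OF _ in_D(1,3)] assms c u by simp
      next
        fix r' assume r': "r \<sqsubseteq> r'" "mem r' \<sigma> a u"
        then have "mem r' \<tau> b (rep (concat_tm \<sigma> \<tau>) \<bullet> f \<bullet> u)"
          using IH[unfolded F[OF u]] leq_trans[OF r(1)] by blast
        then show "frc (Seq \<sigma> # ?\<Gamma>) r' (rep (Prep \<sigma>) \<bullet> c \<bullet> u .: ?e) ?G"
          unfolding G[OF Prep_in[OF c u]] using mem_append2[OF _ in_D(1,3)] assms c u by simp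
      qed (use assms c u in simp_all)
      then show "mem r \<tau> b (rep (concat_tm \<sigma> \<tau>) \<bullet> f \<bullet> (rep (Prep \<sigma>) \<bullet> c \<bullet> u))"
        unfolding G[OF Prep_in[OF c u]] .
    qed
  qed (use assms in simp_all)
  then show ?thesis unfolding F[OF assms(4)] using assms(1) by blast
qed

text \<open>The map is a concatenation of singletons, so this is an instance of
  \<open>mem_concat\<close>.\<close>

lemma mem_map:
  assumes "mem p \<sigma> a s" "a \<in> D \<sigma>" "s \<in> D (Seq \<sigma>)" "f \<in> D (\<sigma> \<Rrightarrow> \<tau>)"
  shows "mem p \<tau> (f \<bullet> a) (rep (map_tm \<sigma> \<tau>) \<bullet> f \<bullet> s)"
proof -
  let ?e = "s .: f .: Var" and ?\<Gamma> = "[Seq \<sigma>, \<sigma> \<Rrightarrow> \<tau>]"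
  let ?t = "Prep \<tau> \<cdot> (Var 2 \<cdot> Var 0) \<cdot> Empty \<tau>"
  let ?g = "ev ?e (LAM ?\<Gamma> \<sigma> ?t)"
  have t: "has_type (\<sigma> # ?\<Gamma>) ?t (Seq \<tau>)" by simp
  have e: "env ?e ?\<Gamma>" using assms by simp
  have g: "?g \<in> D (\<sigma> \<Rrightarrow> Seq \<tau>)" by (rule ev_in[OF _ e]) simp
  have "mem p \<tau> (f \<bullet> a) (?g \<bullet> a)"
    unfolding ev_LAM[OF t e assms(2)] using app_in[OF assms(4,2)] by (simp add: mem_Prep1)
  then have "mem p \<tau> (f \<bullet> a) (rep (concat_tm \<sigma> \<tau>) \<bullet> ?g \<bullet> s)"
    using mem_concat[OF assms(1)] assms g app_in[OF assms(4,2)] by blast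
  then show ?thesis
    unfolding map_tm_def by (subst app_lams2[where \<tau> = "Seq \<tau>"]) (use assms in simp_all)
qed

text \<open>The two computation rules need only that the step functional is constant, so its term is
  hidden behind an existential quantifier.\<close>

lemma cond_unfold:
  assumes "z \<in> D TNat" "a \<in> D \<sigma>" "b \<in> D \<sigma>"
  shows "\<exists>k\<in>D (\<sigma> \<Rrightarrow> TNat \<Rrightarrow> \<sigma>). rep (cond_tm \<sigma>) \<bullet> z \<bullet> a \<bullet> b = rep (Rec \<sigma>) \<bullet> a \<bullet> k \<bullet> z \<and>
    (\<forall>x\<in>D \<sigma>. \<forall>n\<in>D TNat. k \<bullet> x \<bullet> n = b)"
proof -
  let ?e = "b .: a .: z .: Var" and ?\<Gamma> = "[\<sigma>, \<sigma>, TNat]"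
  let ?k = "LAM ?\<Gamma> \<sigma> (LAM (\<sigma> # ?\<Gamma>) TNat (Var 2))"
  have "ev ?e ?k \<in> D (\<sigma> \<Rrightarrow> TNat \<Rrightarrow> \<sigma>)" by (rule ev_in[of ?\<Gamma>]) (use assms in simp_all)
  moreover have "ev ?e ?k \<bullet> x \<bullet> n = b" if "x \<in> D \<sigma>" "n \<in> D TNat" for x n
    using assms that by (simp add: ev_LAM[where \<tau> = "TNat \<Rrightarrow> \<sigma>"] ev_LAM[where \<tau> = \<sigma>])
  moreover have "rep (cond_tm \<sigma>) \<bullet> z \<bullet> a \<bullet> b = rep (Rec \<sigma>) \<bullet> a \<bullet> ev ?e ?k \<bullet> z"
    unfolding cond_tm_def by (subst app_lams3[where \<tau> = \<sigma>]) (use assms in simp_all)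
  ultimately show ?thesis by blast
qed

lemma cond_Zero [simp]:
  assumes "a \<in> D \<sigma>" "b \<in> D \<sigma>"
  shows "rep (cond_tm \<sigma>) \<bullet> rep Zero \<bullet> a \<bullet> b = a"
  using cond_unfold[OF consts_in(1) assms] assms by (auto simp: app_Rec_Zero)

lemma cond_Succ [simp]:
  assumes "n \<in> D TNat" "a \<in> D \<sigma>" "b \<in> D \<sigma>"
  shows "rep (cond_tm \<sigma>) \<bullet> (rep Succ \<bullet> n) \<bullet> a \<bullet> b = b"
proof -
  obtain k where k: "k \<in> D (\<sigma> \<Rrightarrow> TNat \<Rrightarrow> \<sigma>)"
    "rep (cond_tm \<sigma>) \<bullet> (rep Succ \<bullet> n) \<bullet> a \<bullet> b = rep (Rec \<sigma>) \<bullet> a \<bullet> k \<bullet> (rep Succ \<bullet> n)"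
    "\<forall>x\<in>D \<sigma>. \<forall>n\<in>D TNat. k \<bullet> x \<bullet> n = b"
    using cond_unfold[OF Succ_in[OF assms(1)] assms(2,3)] by blast
  have "rep (Rec \<sigma>) \<bullet> a \<bullet> k \<bullet> n \<in> D \<sigma>"
    using assms k by (intro app_in[OF app_in[OF app_in[OF consts_in(5)]]])
  then show ?thesis using k assms by (simp add: app_Rec_Succ)
qed

lemma build_unfold: "rep (build_tm \<sigma>) = rep (Rec ((TNat \<Rrightarrow> \<sigma>) \<Rrightarrow> Seq \<sigma>)) \<bullet>
    (rep (CK (Seq \<sigma>) (TNat \<Rrightarrow> \<sigma>)) \<bullet> rep (Empty \<sigma>)) \<bullet> rep (build_step \<sigma>)"
  by (subst ev_closed[OF closed_build, of Var, symmetric]) (simp add: build_tm_def)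

lemma build_Zero: "f \<in> D (TNat \<Rrightarrow> \<sigma>) \<Longrightarrow> rep (build_tm \<sigma>) \<bullet> rep Zero \<bullet> f = rep (Empty \<sigma>)"
  by (simp add: build_unfold app_Rec_Zero CK_in app_CK)

text \<open>The function \<open>g\<close> stands for \<open>f\<close> shifted by one. Extensionality
  of the domain identifies it with the abstraction that \<open>build_step\<close> produces.\<close>

lemma build_Succ:
  assumes "n \<in> D TNat" "f \<in> D (TNat \<Rrightarrow> \<sigma>)" "g \<in> D (TNat \<Rrightarrow> \<sigma>)"
    and "\<And>i. i \<in> D TNat \<Longrightarrow> f \<bullet> (rep Succ \<bullet> i) = g \<bullet> i"
  shows "rep (build_tm \<sigma>) \<bullet> (rep Succ \<bullet> n) \<bullet> f =
    rep (Prep \<sigma>) \<bullet> (f \<bullet> rep Zero) \<bullet> (rep (build_tm \<sigma>) \<bullet> n \<bullet> g)"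
proof -
  let ?h = "rep (build_tm \<sigma>) \<bullet> n" and ?\<Gamma> = "[TNat \<Rrightarrow> \<sigma>, TNat, (TNat \<Rrightarrow> \<sigma>) \<Rrightarrow> Seq \<sigma>]"
  let ?e = "f .: n .: ?h .: Var"
  have h: "?h \<in> D ((TNat \<Rrightarrow> \<sigma>) \<Rrightarrow> Seq \<sigma>)" by (rule app_in[OF rep_closed_in[OF closed_build] assms(1)])
  have e: "env ?e ?\<Gamma>" using assms h by simp
  have g: "ev ?e (LAM ?\<Gamma> TNat (Var 1 \<cdot> (Succ \<cdot> Var 0))) = g"
  proof (rule D_ext[OF ev_in[OF _ e] assms(3)])
    fix x assume "x \<in> D TNat"
    then show "ev ?e (LAM ?\<Gamma> TNat (Var 1 \<cdot> (Succ \<cdot> Var 0))) \<bullet> x = g \<bullet> x"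
      by (subst ev_LAM[OF _ e, where \<tau> = \<sigma>]) (simp_all add: assms(4))
  qed simp
  have "rep (build_tm \<sigma>) \<bullet> (rep Succ \<bullet> n) = rep (build_step \<sigma>) \<bullet> ?h \<bullet> n"
    using assms(1) by (simp add: build_unfold app_Rec_Succ CK_in)
  moreover have "rep (build_step \<sigma>) \<bullet> ?h \<bullet> n \<bullet> f = rep (Prep \<sigma>) \<bullet> (f \<bullet> rep Zero) \<bullet> (?h \<bullet> g)"
    unfolding build_step_def by (subst app_lams3[where \<tau> = "Seq \<sigma>"]) (use h assms g in simp_all)
  ultimately show ?thesis by simp
qed

text \<open>Internal induction on sequences forces the equation at \<open>root\<close>, where it is
  an identity. It allows a sequence to be rebuilt from its length and its components.\<close>

lemma build_nth:
  assumes "s \<in> D (Seq \<sigma>)"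
  shows "rep (build_tm \<sigma>) \<bullet> (lenf \<sigma> \<bullet> s) \<bullet> (nthf \<sigma> \<bullet> s) = s"
proof (rule eqv_root)
  let ?t = "LRec (TNat \<Rrightarrow> \<sigma>) \<sigma> \<cdot> (CK \<sigma> TNat \<cdot> zero_tm \<sigma>) \<cdot> nth_step \<sigma> \<cdot> Var 0"
  let ?\<phi> = "Eq (Seq \<sigma>) (build_tm \<sigma> \<cdot> len_tm \<sigma> (Var 0) \<cdot> ?t) (Var 0)"
  have t: "has_type [Seq \<sigma>] ?t (TNat \<Rrightarrow> \<sigma>)" by (simp add: closed_has_type[OF closed_nth_step])
  have \<phi>: "frc [Seq \<sigma>] q (u .: Var) ?\<phi> \<longleftrightarrow>
      eqv q (Seq \<sigma>) (rep (build_tm \<sigma>) \<bullet> (lenf \<sigma> \<bullet> u) \<bullet> (nthf \<sigma> \<bullet> u)) u"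
    if "u \<in> D (Seq \<sigma>)" for u q
    using that by (subst frc_Eq) (simp_all add: closed_has_type[OF closed_nth_step] ev_closed[OF closed_nth_step] nthf_def)
  have "frc [Seq \<sigma>] root (s .: Var) ?\<phi>"
  proof (rule seq_induct)
    show "frc [Seq \<sigma>] root (rep (Empty \<sigma>) .: Var) ?\<phi>"
      unfolding \<phi>[OF consts_in(6)] by (simp add: build_Zero eqv_refl)
    fix q a u assume a: "a \<in> D \<sigma>" and u: "u \<in> D (Seq \<sigma>)" and "frc [Seq \<sigma>] q (u .: Var) ?\<phi>"
    then have IH: "eqv q (Seq \<sigma>) (rep (build_tm \<sigma>) \<bullet> (lenf \<sigma> \<bullet> u) \<bullet> (nthf \<sigma> \<bullet> u)) u"
      unfolding \<phi>[OF u] by blast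
    have "rep (build_tm \<sigma>) \<bullet> (rep Succ \<bullet> (lenf \<sigma> \<bullet> u)) \<bullet> (nthf \<sigma> \<bullet> (rep (Prep \<sigma>) \<bullet> a \<bullet> u)) =
      rep (Prep \<sigma>) \<bullet> a \<bullet> (rep (build_tm \<sigma>) \<bullet> (lenf \<sigma> \<bullet> u) \<bullet> (nthf \<sigma> \<bullet> u))"
      using a u by (subst build_Succ[where g = "nthf \<sigma> \<bullet> u"]) simp_all
    then show "frc [Seq \<sigma>] q (rep (Prep \<sigma>) \<bullet> a \<bullet> u .: Var) ?\<phi>"
      unfolding \<phi>[OF Prep_in[OF a u]] using a u eqv_app2[OF IH app_in[OF consts_in(7)]] by simp
  qed (use assms t in simp_all)
  then show "eqv root (Seq \<sigma>) (rep (build_tm \<sigma>) \<bullet> (lenf \<sigma> \<bullet> s) \<bullet> (nthf \<sigma> \<bullet> s)) s"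
    unfolding \<phi>[OF assms] .
qed (use assms in simp_all)

text \<open>By induction on the type. At a function type the value at \<open>x\<close> is observed
  through the functionals that send \<open>f\<close> to \<open>ob (f x)\<close>. For a sequence the
  length is a number and observed directly, while the components are read at the smaller
  type.\<close>

lemma read_eq:
  assumes "a \<in> D \<sigma>" "g \<in> D ((\<sigma> \<Rrightarrow> TNat) \<Rrightarrow> TNat)" "\<And>ob. ob \<in> D (\<sigma> \<Rrightarrow> TNat) \<Longrightarrow> g \<bullet> ob = ob \<bullet> a"
  shows "rep (read_tm \<sigma>) \<bullet> g = a"
  using assms
proof (induction \<sigma> arbitrary: a g)
  case TNat
  let ?\<Gamma> = "[(TNat \<Rrightarrow> TNat) \<Rrightarrow> TNat]"
  have e: "env (g .: Var) ?\<Gamma>" using TNat by simp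
  have "ev (g .: Var) (LAM ?\<Gamma> TNat (Var 0)) \<in> D (TNat \<Rrightarrow> TNat)" by (rule ev_in[OF _ e]) simp
  from TNat(3)[OF this] have "g \<bullet> ev (g .: Var) (LAM ?\<Gamma> TNat (Var 0)) = a"
    using ev_LAM[OF _ e TNat(1), of "Var 0" TNat] by simp
  then show ?case
    unfolding read_tm.simps by (subst app_lams1[where \<tau> = TNat]) (use TNat in simp_all)
next
  case (Fun \<sigma> \<tau>)
  show ?case
  proof (rule D_ext[OF app_in[OF rep_closed_in[OF closed_read] Fun.prems(2)] Fun.prems(1)])
    fix x assume x: "x \<in> D \<sigma>"
    let ?\<Gamma> = "[\<sigma>, ((\<sigma> \<Rrightarrow> \<tau>) \<Rrightarrow> TNat) \<Rrightarrow> TNat]" and ?e = "x .: g .: Var"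
    let ?v = "Var 1 \<cdot> (Var 0 \<cdot> Var 2)"
    let ?u = "Var 2 \<cdot> LAM ((\<tau> \<Rrightarrow> TNat) # ?\<Gamma>) (\<sigma> \<Rrightarrow> \<tau>) ?v"
    have e: "env ?e ?\<Gamma>" using Fun.prems x by simp
    have "rep (read_tm \<tau>) \<bullet> ev ?e (LAM ?\<Gamma> (\<tau> \<Rrightarrow> TNat) ?u) = a \<bullet> x"
    proof (rule Fun.IH(2)[OF app_in[OF Fun.prems(1) x]])
      show "ev ?e (LAM ?\<Gamma> (\<tau> \<Rrightarrow> TNat) ?u) \<in> D ((\<tau> \<Rrightarrow> TNat) \<Rrightarrow> TNat)" by (rule ev_in[OF _ e]) simp
      fix ob assume ob: "ob \<in> D (\<tau> \<Rrightarrow> TNat)"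
      have e': "env (ob .: ?e) ((\<tau> \<Rrightarrow> TNat) # ?\<Gamma>)" using e ob by simp
      have l: "ev (ob .: ?e) (LAM ((\<tau> \<Rrightarrow> TNat) # ?\<Gamma>) (\<sigma> \<Rrightarrow> \<tau>) ?v) \<in> D ((\<sigma> \<Rrightarrow> \<tau>) \<Rrightarrow> TNat)"
        by (rule ev_in[OF _ e']) simp
      have "ev ?e (LAM ?\<Gamma> (\<tau> \<Rrightarrow> TNat) ?u) \<bullet> ob = ev (ob .: ?e) ?u"
        by (rule ev_LAM[OF _ e ob, of _ TNat]) simp
      also have "\<dots> = ev (a .: ob .: ?e) ?v"
        using Fun.prems(3)[OF l] ev_LAM[OF _ e' Fun.prems(1), of ?v TNat] by simp
      finally show "ev ?e (LAM ?\<Gamma> (\<tau> \<Rrightarrow> TNat) ?u) \<bullet> ob = ob \<bullet> (a \<bullet> x)" by simp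
    qed
    then show "rep (read_tm (\<sigma> \<Rrightarrow> \<tau>)) \<bullet> g \<bullet> x = a \<bullet> x"
      unfolding read_tm.simps by (subst app_lams2[where \<tau> = \<tau>]) (use Fun.prems x in simp_all)
  qed
next
  case (Seq \<sigma>)
  let ?\<Gamma> = "[(Seq \<sigma> \<Rrightarrow> TNat) \<Rrightarrow> TNat]" and ?e = "g .: Var"
  let ?l = "LAM ?\<Gamma> (Seq \<sigma>) (len_tm \<sigma> (Var 0))"
  let ?w = "Var 1 \<cdot> nth_tm \<sigma> (Var 0) (Var 2)"
  let ?v = "Var 2 \<cdot> LAM ((\<sigma> \<Rrightarrow> TNat) # TNat # ?\<Gamma>) (Seq \<sigma>) ?w"
  let ?u = "read_tm \<sigma> \<cdot> LAM (TNat # ?\<Gamma>) (\<sigma> \<Rrightarrow> TNat) ?v"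
  have e: "env ?e ?\<Gamma>" using Seq.prems by simp
  have l: "ev ?e ?l \<in> D (Seq \<sigma> \<Rrightarrow> TNat)" by (rule ev_in[OF _ e]) simp
  have 1: "g \<bullet> ev ?e ?l = lenf \<sigma> \<bullet> a"
    using Seq.prems(3)[OF l] ev_LAM[OF _ e Seq.prems(1), of "len_tm \<sigma> (Var 0)" TNat] by simp
  have 2: "ev ?e (LAM ?\<Gamma> TNat ?u) = nthf \<sigma> \<bullet> a"
  proof (rule D_ext)
    show "ev ?e (LAM ?\<Gamma> TNat ?u) \<in> D (TNat \<Rrightarrow> \<sigma>)" by (rule ev_in[OF _ e]) simp
    show "nthf \<sigma> \<bullet> a \<in> D (TNat \<Rrightarrow> \<sigma>)" using Seq.prems by simp
    fix i assume i: "i \<in> D TNat"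
    have e': "env (i .: ?e) (TNat # ?\<Gamma>)" using e i by simp
    have "rep (read_tm \<sigma>) \<bullet> ev (i .: ?e) (LAM (TNat # ?\<Gamma>) (\<sigma> \<Rrightarrow> TNat) ?v) = nthf \<sigma> \<bullet> a \<bullet> i"
    proof (rule Seq.IH)
      show "nthf \<sigma> \<bullet> a \<bullet> i \<in> D \<sigma>" using Seq.prems i by simp
      show "ev (i .: ?e) (LAM (TNat # ?\<Gamma>) (\<sigma> \<Rrightarrow> TNat) ?v) \<in> D ((\<sigma> \<Rrightarrow> TNat) \<Rrightarrow> TNat)"
        by (rule ev_in[OF _ e']) simp
      fix ob assume ob: "ob \<in> D (\<sigma> \<Rrightarrow> TNat)"
      have e'': "env (ob .: i .: ?e) ((\<sigma> \<Rrightarrow> TNat) # TNat # ?\<Gamma>)" using e' ob by simp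
      have w: "ev (ob .: i .: ?e) (LAM ((\<sigma> \<Rrightarrow> TNat) # TNat # ?\<Gamma>) (Seq \<sigma>) ?w) \<in> D (Seq \<sigma> \<Rrightarrow> TNat)"
        by (rule ev_in[OF _ e'']) simp
      have "ev (i .: ?e) (LAM (TNat # ?\<Gamma>) (\<sigma> \<Rrightarrow> TNat) ?v) \<bullet> ob = ev (ob .: i .: ?e) ?v"
        by (rule ev_LAM[OF _ e' ob, of _ TNat]) simp
      also have "\<dots> = ev (a .: ob .: i .: ?e) ?w"
        using Seq.prems(3)[OF w] ev_LAM[OF _ e'' Seq.prems(1), of ?w TNat] by simp
      finally show "ev (i .: ?e) (LAM (TNat # ?\<Gamma>) (\<sigma> \<Rrightarrow> TNat) ?v) \<bullet> ob = ob \<bullet> (nthf \<sigma> \<bullet> a \<bullet> i)"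
        by simp
    qed
    moreover have "ev ?e (LAM ?\<Gamma> TNat ?u) \<bullet> i = ev (i .: ?e) ?u"
      by (rule ev_LAM[OF _ e i, of _ \<sigma>]) simp
    ultimately show "ev ?e (LAM ?\<Gamma> TNat ?u) \<bullet> i = nthf \<sigma> \<bullet> a \<bullet> i" by simp
  qed
  show ?case
    unfolding read_tm.simps
    by (subst app_lams1[where \<tau> = "Seq \<sigma>"]) (use Seq.prems build_nth 1 2 in simp_all)
qed

lemma fst_pair [simp]:
  assumes a: "a \<in> D \<sigma>" and b: "b \<in> D \<tau>"
  shows "rep (fst_tm \<sigma> \<tau>) \<bullet> (rep (pair_tm \<sigma> \<tau>) \<bullet> a \<bullet> b) = a"
proof -
  let ?p = "rep (pair_tm \<sigma> \<tau>) \<bullet> a \<bullet> b"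
  let ?\<Gamma> = "[Pr \<sigma> \<tau>]" and ?e = "?p .: Var"
  let ?w = "Var 2 \<cdot> Var 1"
  let ?v = "LAM (\<sigma> # (\<sigma> \<Rrightarrow> TNat) # ?\<Gamma>) \<tau> ?w"
  let ?u = "Var 1 \<cdot> LAM ((\<sigma> \<Rrightarrow> TNat) # ?\<Gamma>) \<sigma> ?v"
  have e: "env ?e ?\<Gamma>" using assms by simp
  have "rep (read_tm \<sigma>) \<bullet> ev ?e (LAM ?\<Gamma> (\<sigma> \<Rrightarrow> TNat) ?u) = a"
  proof (rule read_eq[OF a])
    show "ev ?e (LAM ?\<Gamma> (\<sigma> \<Rrightarrow> TNat) ?u) \<in> D ((\<sigma> \<Rrightarrow> TNat) \<Rrightarrow> TNat)"
      by (rule ev_in[OF _ e]) (simp add: Pr_def)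
    fix ob assume ob: "ob \<in> D (\<sigma> \<Rrightarrow> TNat)"
    have e': "env (ob .: ?e) ((\<sigma> \<Rrightarrow> TNat) # ?\<Gamma>)" using e ob by simp
    have e'': "env (a .: ob .: ?e) (\<sigma> # (\<sigma> \<Rrightarrow> TNat) # ?\<Gamma>)" using e' a by simp
    have v: "ev (ob .: ?e) (LAM ((\<sigma> \<Rrightarrow> TNat) # ?\<Gamma>) \<sigma> ?v) \<in> D (\<sigma> \<Rrightarrow> \<tau> \<Rrightarrow> TNat)"
      by (rule ev_in[OF _ e']) simp
    have "ev ?e (LAM ?\<Gamma> (\<sigma> \<Rrightarrow> TNat) ?u) \<bullet> ob = ev (ob .: ?e) ?u"
      by (rule ev_LAM[OF _ e ob, of _ TNat]) (simp add: Pr_def)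
    also have "\<dots> = ev (ob .: ?e) (LAM ((\<sigma> \<Rrightarrow> TNat) # ?\<Gamma>) \<sigma> ?v) \<bullet> a \<bullet> b"
      using assms v unfolding pair_tm_def by (simp add: app_lams3[where \<tau> = TNat])
    also have "\<dots> = ob \<bullet> a"
      using ev_LAM[OF _ e' a, of ?v "\<tau> \<Rrightarrow> TNat"] ev_LAM[OF _ e'' b, of ?w TNat] by simp
    finally show "ev ?e (LAM ?\<Gamma> (\<sigma> \<Rrightarrow> TNat) ?u) \<bullet> ob = ob \<bullet> a" .
  qed
  moreover have "rep (fst_tm \<sigma> \<tau>) \<bullet> ?p = rep (read_tm \<sigma>) \<bullet> ev ?e (LAM ?\<Gamma> (\<sigma> \<Rrightarrow> TNat) ?u)"
    unfolding fst_tm_def by (subst app_lams1[where \<tau> = \<sigma>]) (use assms pair_in[of a \<sigma> b \<tau>] in \<open>simp_all add: Pr_def\<close>)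
  ultimately show ?thesis by simp
qed

lemma snd_pair [simp]:
  assumes a: "a \<in> D \<sigma>" and b: "b \<in> D \<tau>"
  shows "rep (snd_tm \<sigma> \<tau>) \<bullet> (rep (pair_tm \<sigma> \<tau>) \<bullet> a \<bullet> b) = b"
proof -
  let ?p = "rep (pair_tm \<sigma> \<tau>) \<bullet> a \<bullet> b"
  let ?\<Gamma> = "[Pr \<sigma> \<tau>]" and ?e = "?p .: Var"
  let ?w = "Var 2 \<cdot> Var 0"
  let ?v = "LAM (\<sigma> # (\<tau> \<Rrightarrow> TNat) # ?\<Gamma>) \<tau> ?w"
  let ?u = "Var 1 \<cdot> LAM ((\<tau> \<Rrightarrow> TNat) # ?\<Gamma>) \<sigma> ?v"
  have e: "env ?e ?\<Gamma>" using assms by simp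
  have "rep (read_tm \<tau>) \<bullet> ev ?e (LAM ?\<Gamma> (\<tau> \<Rrightarrow> TNat) ?u) = b"
  proof (rule read_eq[OF b])
    show "ev ?e (LAM ?\<Gamma> (\<tau> \<Rrightarrow> TNat) ?u) \<in> D ((\<tau> \<Rrightarrow> TNat) \<Rrightarrow> TNat)"
      by (rule ev_in[OF _ e]) (simp add: Pr_def)
    fix ob assume ob: "ob \<in> D (\<tau> \<Rrightarrow> TNat)"
    have e': "env (ob .: ?e) ((\<tau> \<Rrightarrow> TNat) # ?\<Gamma>)" using e ob by simp
    have e'': "env (a .: ob .: ?e) (\<sigma> # (\<tau> \<Rrightarrow> TNat) # ?\<Gamma>)" using e' a by simp
    have v: "ev (ob .: ?e) (LAM ((\<tau> \<Rrightarrow> TNat) # ?\<Gamma>) \<sigma> ?v) \<in> D (\<sigma> \<Rrightarrow> \<tau> \<Rrightarrow> TNat)"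
      by (rule ev_in[OF _ e']) simp
    have "ev ?e (LAM ?\<Gamma> (\<tau> \<Rrightarrow> TNat) ?u) \<bullet> ob = ev (ob .: ?e) ?u"
      by (rule ev_LAM[OF _ e ob, of _ TNat]) (simp add: Pr_def)
    also have "\<dots> = ev (ob .: ?e) (LAM ((\<tau> \<Rrightarrow> TNat) # ?\<Gamma>) \<sigma> ?v) \<bullet> a \<bullet> b"
      using assms v unfolding pair_tm_def by (simp add: app_lams3[where \<tau> = TNat])
    also have "\<dots> = ob \<bullet> b"
      using ev_LAM[OF _ e' a, of ?v "\<tau> \<Rrightarrow> TNat"] ev_LAM[OF _ e'' b, of ?w TNat] by simp
    finally show "ev ?e (LAM ?\<Gamma> (\<tau> \<Rrightarrow> TNat) ?u) \<bullet> ob = ob \<bullet> b" .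
  qed
  moreover have "rep (snd_tm \<sigma> \<tau>) \<bullet> ?p = rep (read_tm \<tau>) \<bullet> ev ?e (LAM ?\<Gamma> (\<tau> \<Rrightarrow> TNat) ?u)"
    unfolding snd_tm_def by (subst app_lams1[where \<tau> = \<tau>]) (use assms pair_in[of a \<sigma> b \<tau>] in \<open>simp_all add: Pr_def\<close>)
  ultimately show ?thesis by simp
qed

end

section \<open>Dialectica objects\<close>

text \<open>
  \<open>Dob X C m\<close> stands for \<open>\<exists>\<^sup>s\<^sup>tx : X. \<forall>\<^sup>s\<^sup>tc : C. m\<close> with an internal \<open>\<or>\<close>-free matrix \<open>m\<close> in which
  index 0 is the challenge \<open>c\<close>, index 1 the witness \<open>x\<close>, and the parameters follow.
\<close>

datatype dob = Dob (wit: ty) (chl: ty) (mat: fm)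

text \<open>There is no unit type, so \<open>TNat\<close> takes the place of an empty witness and an
  empty challenge.\<close>

definition dInt :: "fm \<Rightarrow> dob" where
  "dInt \<phi> = Dob TNat TNat (subst (weaken 2) \<phi>)"

definition dSt :: "ty \<Rightarrow> tm \<Rightarrow> dob" where
  "dSt \<sigma> t = Dob \<sigma> TNat (Eq \<sigma> (Var 1) (subst_tm (weaken 2) t))"

definition dAnd :: "dob \<Rightarrow> dob \<Rightarrow> dob" where
  "dAnd A B = Dob (Pr (wit A) (wit B)) (Pr (chl A) (chl B))
    (subst (fst_tm (chl A) (chl B) \<cdot> Var 0 .: fst_tm (wit A) (wit B) \<cdot> Var 1 .: weaken 2) (mat A) \<^bold>\<and>
     subst (snd_tm (chl A) (chl B) \<cdot> Var 0 .: snd_tm (wit A) (wit B) \<cdot> Var 1 .: weaken 2) (mat B))"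

text \<open>The flag \<open>z\<close> is zero for the first disjunct. A sum type is avoided by
  storing witnesses for both sides, one of them being arbitrary.\<close>

definition dOr :: "dob \<Rightarrow> dob \<Rightarrow> dob" where
  "dOr A B = (let W = Pr (wit A) (wit B); z = fst_tm TNat W \<cdot> Var 1; w = snd_tm TNat W \<cdot> Var 1 in
    Dob (Pr TNat W) (Pr (chl A) (chl B))
    ((Eq TNat z Zero \<^bold>\<longrightarrow>
        subst (fst_tm (chl A) (chl B) \<cdot> Var 0 .: fst_tm (wit A) (wit B) \<cdot> w .: weaken 2) (mat A)) \<^bold>\<and>
     (Neg (Eq TNat z Zero) \<^bold>\<longrightarrow>
        subst (snd_tm (chl A) (chl B) \<cdot> Var 0 .: snd_tm (wit A) (wit B) \<cdot> w .: weaken 2) (mat B))))"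

text \<open>The bounded quantifier over the sequence given by \<open>G\<close> replaces the choice
  of a single counterexample, which would require a decidable matrix. A challenge contains a witness
  of the premise, at which \<open>F\<close> and \<open>G\<close> are evaluated.\<close>

definition dImp :: "dob \<Rightarrow> dob \<Rightarrow> dob" where
  "dImp A B = (let F = wit A \<Rrightarrow> wit B; G = wit A \<Rrightarrow> chl B \<Rrightarrow> Seq (chl A);
      a = fst_tm (wit A) (chl B); c = snd_tm (wit A) (chl B) in
    Dob (Pr F G) (Pr (wit A) (chl B))
    (Forall (chl A) (Mem (chl A) (Var 0) (snd_tm F G \<cdot> Var 2 \<cdot> (a \<cdot> Var 1) \<cdot> (c \<cdot> Var 1)) \<^bold>\<longrightarrow>
        subst (Var 0 .: a \<cdot> Var 1 .: weaken 3) (mat A)) \<^bold>\<longrightarrow>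
     subst (c \<cdot> Var 0 .: fst_tm F G \<cdot> Var 1 \<cdot> (a \<cdot> Var 0) .: weaken 2) (mat B)))"

text \<open>The witness stays outside the quantifier and is independent of the quantified element;
  \<open>NU\<close> becomes realizable for this reason.\<close>

definition dAll :: "ty \<Rightarrow> dob \<Rightarrow> dob" where
  "dAll \<sigma> A = Dob (wit A) (chl A) (Forall \<sigma> (subst (Var 1 .: Var 2 .: Var 0 .: weaken 3) (mat A)))"

text \<open>The element comes after the challenge, so it would be too weak to let it answer a single
  one. In the manner of idealization, one element has to answer all members of a finite
  sequence.\<close>

definition dEx :: "ty \<Rightarrow> dob \<Rightarrow> dob" where
  "dEx \<sigma> A = Dob (wit A) (Seq (chl A)) (Exists \<sigma> (Forall (chl A) (Mem (chl A) (Var 0) (Var 2) \<^bold>\<longrightarrow>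
     subst (Var 0 .: Var 3 .: Var 1 .: weaken 4) (mat A))))"

lemma dob_simps [simp]:
  "wit (dInt \<phi>) = TNat" "chl (dInt \<phi>) = TNat"
  "wit (dSt \<sigma> t) = \<sigma>" "chl (dSt \<sigma> t) = TNat"
  "wit (dAnd A B) = Pr (wit A) (wit B)" "chl (dAnd A B) = Pr (chl A) (chl B)"
  "wit (dOr A B) = Pr TNat (Pr (wit A) (wit B))" "chl (dOr A B) = Pr (chl A) (chl B)"
  "wit (dImp A B) = Pr (wit A \<Rrightarrow> wit B) (wit A \<Rrightarrow> chl B \<Rrightarrow> Seq (chl A))"
  "chl (dImp A B) = Pr (wit A) (chl B)"
  "wit (dAll \<sigma> A) = wit A" "chl (dAll \<sigma> A) = chl A"
  "wit (dEx \<sigma> A) = wit A" "chl (dEx \<sigma> A) = Seq (chl A)"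
  by (simp_all add: dInt_def dSt_def dAnd_def dOr_def dImp_def dAll_def dEx_def Let_def)

context model
begin

definition ok :: "ty list \<Rightarrow> dob \<Rightarrow> bool" where
  "ok \<Gamma> A \<longleftrightarrow> okf (chl A # wit A # \<Gamma>) (mat A)"

definition tr :: "ty list \<Rightarrow> world \<Rightarrow> dob \<Rightarrow> (nat \<Rightarrow> tm) \<Rightarrow> tm \<Rightarrow> tm \<Rightarrow> bool" where
  "tr \<Gamma> p A e x y \<longleftrightarrow> frc (chl A # wit A # \<Gamma>) p (y .: x .: e) (mat A)"

lemma ok_Int [simp]: "okf \<Gamma> \<phi> \<Longrightarrow> ok \<Gamma> (dInt \<phi>)"
  unfolding ok_def dInt_def by simp (erule okf_subst, simp add: numeral_2_eq_2)

lemma ok_St [simp]: "has_type \<Gamma> t \<sigma> \<Longrightarrow> ok \<Gamma> (dSt \<sigma> t)"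
  unfolding ok_def dSt_def by simp (erule has_type_subst, simp add: numeral_2_eq_2)

lemma ok_And [simp]:
  assumes "ok \<Gamma> A" "ok \<Gamma> B"
  shows "ok \<Gamma> (dAnd A B)"
  using okf_subst[OF assms(1)[unfolded ok_def]] okf_subst[OF assms(2)[unfolded ok_def]]
  unfolding ok_def dAnd_def by (simp add: numeral_eq_Suc)

lemma ok_Or [simp]:
  assumes "ok \<Gamma> A" "ok \<Gamma> B"
  shows "ok \<Gamma> (dOr A B)"
  using okf_subst[OF assms(1)[unfolded ok_def]] okf_subst[OF assms(2)[unfolded ok_def]]
  unfolding ok_def dOr_def Let_def by (simp add: numeral_eq_Suc)

lemma ok_Imp [simp]:
  assumes "ok \<Gamma> A" "ok \<Gamma> B"
  shows "ok \<Gamma> (dImp A B)"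
  using okf_subst[OF assms(1)[unfolded ok_def]] okf_subst[OF assms(2)[unfolded ok_def]]
  unfolding ok_def dImp_def Let_def by (simp add: numeral_eq_Suc)

lemma ok_All [simp]: "ok (\<sigma> # \<Gamma>) A \<Longrightarrow> ok \<Gamma> (dAll \<sigma> A)"
  unfolding ok_def dAll_def by simp (erule okf_subst, simp add: numeral_eq_Suc)

lemma ok_Ex [simp]: "ok (\<sigma> # \<Gamma>) A \<Longrightarrow> ok \<Gamma> (dEx \<sigma> A)"
  unfolding ok_def dEx_def by simp (erule okf_subst, simp add: numeral_eq_Suc)

lemma tr_mono: "tr \<Gamma> p A e x y \<Longrightarrow> p \<sqsubseteq> q \<Longrightarrow> tr \<Gamma> q A e x y"
  unfolding tr_def by (rule frc_mono)

lemma tr_eqv: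
  assumes "ok \<Gamma> A" "env e \<Gamma>" "eqv p (wit A) x x'" "eqv p (chl A) y y'"
    and "x \<in> D (wit A)" "x' \<in> D (wit A)" "y \<in> D (chl A)" "y' \<in> D (chl A)"
  shows "tr \<Gamma> p A e x y \<longleftrightarrow> tr \<Gamma> p A e x' y'"
  unfolding tr_def
  by (rule frc_eqv[OF assms(1)[unfolded ok_def]]) (use assms in \<open>simp_all add: eqv_refl\<close>)

text \<open>Worlds may be inconsistent, so falsity is a condition on worlds and not the HOL
  constant.\<close>

definition absurd :: "world \<Rightarrow> bool" where
  "absurd p \<longleftrightarrow> prov p Bot"

lemma frc_absurd [simp]: "frc \<Gamma> p e Bot \<longleftrightarrow> absurd p"
  by (simp add: frc_def force_def absurd_def)

lemma absurd_tr: "absurd p \<Longrightarrow> ok \<Gamma> A \<Longrightarrow> env e \<Gamma> \<Longrightarrow> x \<in> D (wit A) \<Longrightarrow> y \<in> D (chl A) \<Longrightarrow> tr \<Gamma> p A e x y"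
  unfolding tr_def ok_def by (rule frc_Bot[of "[]" p e]) simp_all

lemma tr_Int:
  "okf \<Gamma> \<phi> \<Longrightarrow> env e \<Gamma> \<Longrightarrow> x \<in> D TNat \<Longrightarrow> y \<in> D TNat \<Longrightarrow> tr \<Gamma> p (dInt \<phi>) e x y \<longleftrightarrow> frc \<Gamma> p e \<phi>"
  unfolding tr_def by (simp add: dInt_def) (simp add: frc_subst[of \<Gamma>] numeral_2_eq_2)

lemma tr_St:
  assumes "has_type \<Gamma> t \<sigma>" "env e \<Gamma>" "x \<in> D \<sigma>" "y \<in> D TNat"
  shows "tr \<Gamma> p (dSt \<sigma> t) e x y \<longleftrightarrow> eqv p \<sigma> x (ev e t)"
proof -
  have "has_type (TNat # \<sigma> # \<Gamma>) (subst_tm (weaken 2) t) \<sigma>"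
    by (rule has_type_subst[OF assms(1)]) (simp add: numeral_2_eq_2)
  then show ?thesis
    unfolding tr_def dSt_def using assms by (simp add: ev_subst numeral_2_eq_2)
qed

lemma tr_And:
  assumes "ok \<Gamma> A" "ok \<Gamma> B" "env e \<Gamma>" "x \<in> D (wit (dAnd A B))" "y \<in> D (chl (dAnd A B))"
  shows "tr \<Gamma> p (dAnd A B) e x y \<longleftrightarrow>
    tr \<Gamma> p A e (rep (fst_tm (wit A) (wit B)) \<bullet> x) (rep (fst_tm (chl A) (chl B)) \<bullet> y) \<and>
    tr \<Gamma> p B e (rep (snd_tm (wit A) (wit B)) \<bullet> x) (rep (snd_tm (chl A) (chl B)) \<bullet> y)"
  using assms unfolding tr_def ok_def
  by (simp add: dAnd_def) (simp add: frc_subst[OF assms(1)[unfolded ok_def]]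
      frc_subst[OF assms(2)[unfolded ok_def]] numeral_2_eq_2)

lemma tr_Or:
  assumes "ok \<Gamma> A" "ok \<Gamma> B" "env e \<Gamma>" "x \<in> D (wit (dOr A B))" "y \<in> D (chl (dOr A B))"
  defines "z \<equiv> rep (fst_tm TNat (Pr (wit A) (wit B))) \<bullet> x"
    and "w \<equiv> rep (snd_tm TNat (Pr (wit A) (wit B))) \<bullet> x"
  shows "tr \<Gamma> p (dOr A B) e x y \<longleftrightarrow>
    (\<forall>q. p \<sqsubseteq> q \<longrightarrow> eqv q TNat z (rep Zero) \<longrightarrow>
      tr \<Gamma> q A e (rep (fst_tm (wit A) (wit B)) \<bullet> w) (rep (fst_tm (chl A) (chl B)) \<bullet> y)) \<and>
    (\<forall>q. p \<sqsubseteq> q \<longrightarrow> (\<forall>r. q \<sqsubseteq> r \<longrightarrow> eqv r TNat z (rep Zero) \<longrightarrow> absurd r) \<longrightarrow>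
      tr \<Gamma> q B e (rep (snd_tm (wit A) (wit B)) \<bullet> w) (rep (snd_tm (chl A) (chl B)) \<bullet> y))"
  using assms(1-5) unfolding tr_def z_def w_def
  by (simp add: dOr_def Let_def) (simp add: frc_subst[OF assms(1)[unfolded ok_def]]
      frc_subst[OF assms(2)[unfolded ok_def]] numeral_2_eq_2)

lemma tr_Imp:
  assumes "ok \<Gamma> A" "ok \<Gamma> B" "env e \<Gamma>" "x \<in> D (wit (dImp A B))" "y \<in> D (chl (dImp A B))"
  defines "F \<equiv> wit A \<Rrightarrow> wit B" and "G \<equiv> wit A \<Rrightarrow> chl B \<Rrightarrow> Seq (chl A)"
    and "a \<equiv> rep (fst_tm (wit A) (chl B)) \<bullet> y" and "c \<equiv> rep (snd_tm (wit A) (chl B)) \<bullet> y"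
  shows "tr \<Gamma> p (dImp A B) e x y \<longleftrightarrow> (\<forall>q. p \<sqsubseteq> q \<longrightarrow>
    (\<forall>d\<in>D (chl A). \<forall>r. q \<sqsubseteq> r \<longrightarrow> mem r (chl A) d (rep (snd_tm F G) \<bullet> x \<bullet> a \<bullet> c) \<longrightarrow> tr \<Gamma> r A e a d) \<longrightarrow>
    tr \<Gamma> q B e (rep (fst_tm F G) \<bullet> x \<bullet> a) c)"
proof -
  note AB = assms(1,2)[unfolded ok_def]
  have x: "x \<in> D (Pr F G)" and y: "y \<in> D (Pr (wit A) (chl B))"
    using assms(4,5) by (simp_all add: F_def G_def)
  have *: "rep (snd_tm F G) \<bullet> x \<bullet> a \<bullet> c \<in> D (Seq (chl A))" "rep (fst_tm F G) \<bullet> x \<bullet> a \<in> D (wit B)"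
    using snd_in[OF x] fst_in[OF x] fst_in[OF y] snd_in[OF y] unfolding a_def c_def F_def G_def
    by (auto intro: app_in)
  have ok': "okf (chl A # Pr (wit A) (chl B) # Pr F G # \<Gamma>)
      (subst (Var 0 .: fst_tm (wit A) (chl B) \<cdot> Var 1 .: weaken 3) (mat A))"
    by (rule okf_subst[OF AB(1)]) (simp add: numeral_eq_Suc)
  show ?thesis
    using assms(3) x y * ok' unfolding tr_def a_def c_def
    by (simp add: dImp_def Let_def flip: F_def G_def)
      (simp add: frc_subst[OF AB(1)] frc_subst[OF AB(2)] numeral_eq_Suc F_def G_def)
qed

lemma tr_All:
  assumes "ok (\<sigma> # \<Gamma>) A" "env e \<Gamma>" "x \<in> D (wit A)" "y \<in> D (chl A)"
  shows "tr \<Gamma> p (dAll \<sigma> A) e x y \<longleftrightarrow> (\<forall>d\<in>D \<sigma>. tr (\<sigma> # \<Gamma>) p A (d .: e) x y)"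
proof -
  have ok': "okf (\<sigma> # chl A # wit A # \<Gamma>) (subst (Var 1 .: Var 2 .: Var 0 .: weaken 3) (mat A))"
    by (rule okf_subst[OF assms(1)[unfolded ok_def]]) (simp add: numeral_eq_Suc)
  then show ?thesis
    using assms unfolding tr_def
    by (simp add: dAll_def) (simp add: frc_subst[OF assms(1)[unfolded ok_def]] numeral_eq_Suc)
qed

lemma Ex_aux:
  assumes "ok (\<sigma> # \<Gamma>) A" "env e \<Gamma>" "x \<in> D (wit A)" "s \<in> D (Seq (chl A))"
  defines "m \<equiv> Forall (chl A) (Mem (chl A) (Var 0) (Var 2) \<^bold>\<longrightarrow>
     subst (Var 0 .: Var 3 .: Var 1 .: weaken 4) (mat A))"
  shows "okf (\<sigma> # Seq (chl A) # wit A # \<Gamma>) m"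
    and "d \<in> D \<sigma> \<Longrightarrow> frc (\<sigma> # Seq (chl A) # wit A # \<Gamma>) p (d .: s .: x .: e) m \<longleftrightarrow>
      (\<forall>y\<in>D (chl A). \<forall>q. p \<sqsubseteq> q \<longrightarrow> mem q (chl A) y s \<longrightarrow> tr (\<sigma> # \<Gamma>) q A (d .: e) x y)"
proof -
  have *: "okf (chl A # \<sigma> # Seq (chl A) # wit A # \<Gamma>) (subst (Var 0 .: Var 3 .: Var 1 .: weaken 4) (mat A))"
    by (rule okf_subst[OF assms(1)[unfolded ok_def]]) (simp add: numeral_eq_Suc)
  then show "okf (\<sigma> # Seq (chl A) # wit A # \<Gamma>) m" by (simp add: m_def)
  show "d \<in> D \<sigma> \<Longrightarrow> frc (\<sigma> # Seq (chl A) # wit A # \<Gamma>) p (d .: s .: x .: e) m \<longleftrightarrow>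
      (\<forall>y\<in>D (chl A). \<forall>q. p \<sqsubseteq> q \<longrightarrow> mem q (chl A) y s \<longrightarrow> tr (\<sigma> # \<Gamma>) q A (d .: e) x y)"
    using * assms(2-4) unfolding m_def tr_def
    by simp (simp add: frc_subst[OF assms(1)[unfolded ok_def]] numeral_eq_Suc)
qed

lemma tr_ExI:
  assumes "ok (\<sigma> # \<Gamma>) A" "env e \<Gamma>" "x \<in> D (wit A)" "s \<in> D (Seq (chl A))" "d \<in> D \<sigma>"
    and "\<And>y q. y \<in> D (chl A) \<Longrightarrow> p \<sqsubseteq> q \<Longrightarrow> mem q (chl A) y s \<Longrightarrow> tr (\<sigma> # \<Gamma>) q A (d .: e) x y"
  shows "tr \<Gamma> p (dEx \<sigma> A) e x s"
  using frc_ExI[OF Ex_aux(1)[OF assms(1-4)], of "s .: x .: e" d p] Ex_aux(2)[OF assms(1-5)] assms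
  unfolding tr_def[of _ _ "dEx \<sigma> A"] by (simp add: dEx_def)

text \<open>The element is available in extensions of the world only. Elimination is therefore into
  the truth of another Dialectica object, whose matrix is again a formula.\<close>

lemma tr_ExE:
  assumes "tr \<Gamma> p (dEx \<sigma> A) e x s"
    and A: "ok (\<sigma> # \<Gamma>) A" "env e \<Gamma>" "x \<in> D (wit A)" "s \<in> D (Seq (chl A))"
    and B: "ok \<Gamma>' B" "env e' \<Gamma>'" "u \<in> D (wit B)" "v \<in> D (chl B)"
    and "\<And>q d. p \<sqsubseteq> q \<Longrightarrow> d \<in> D \<sigma>
      \<Longrightarrow> (\<And>y r. y \<in> D (chl A) \<Longrightarrow> q \<sqsubseteq> r \<Longrightarrow> mem r (chl A) y s \<Longrightarrow> tr (\<sigma> # \<Gamma>) r A (d .: e) x y)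
      \<Longrightarrow> tr \<Gamma>' q B e' u v"
  shows "tr \<Gamma>' p B e' u v"
  unfolding tr_def
proof (rule frc_ExE[OF _ Ex_aux(1)[OF A] _ B(1)[unfolded ok_def]])
  show "frc (Seq (chl A) # wit A # \<Gamma>) p (s .: x .: e) (Exists \<sigma> (Forall (chl A)
      (Mem (chl A) (Var 0) (Var 2) \<^bold>\<longrightarrow> subst (Var 0 .: Var 3 .: Var 1 .: weaken 4) (mat A))))"
    using assms(1) unfolding tr_def by (simp add: dEx_def)
  fix q d assume "p \<sqsubseteq> q" and d: "d \<in> D \<sigma>" and
    "frc (\<sigma> # Seq (chl A) # wit A # \<Gamma>) q (d .: s .: x .: e) (Forall (chl A)
      (Mem (chl A) (Var 0) (Var 2) \<^bold>\<longrightarrow> subst (Var 0 .: Var 3 .: Var 1 .: weaken 4) (mat A)))"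
  then show "frc (chl B # wit B # \<Gamma>') q (v .: u .: e') (mat B)"
    using assms(10) unfolding Ex_aux(2)[OF A d] tr_def by blast
qed (use A B in simp_all)

section \<open>Entailment between Dialectica objects by closed realizers\<close>

text \<open>\<open>U\<close> and \<open>Y\<close> do not depend on the environment \<open>e\<close>,
  so one realizer serves all values of the parameters. The premise concerns only the challenges
  listed by \<open>Y\<close>, but in all later worlds, since a challenge may become a member
  later.\<close>

definition realizes :: "ty list \<Rightarrow> dob \<Rightarrow> dob \<Rightarrow> tm \<Rightarrow> tm \<Rightarrow> bool" where
  "realizes \<Gamma> A B U Y \<longleftrightarrow>
    closed_term U (wit A \<Rrightarrow> wit B) \<and> closed_term Y (wit A \<Rrightarrow> chl B \<Rrightarrow> Seq (chl A)) \<and>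
    (\<forall>p e x v. env e \<Gamma> \<longrightarrow> x \<in> D (wit A) \<longrightarrow> v \<in> D (chl B) \<longrightarrow>
      (\<forall>q y. p \<sqsubseteq> q \<longrightarrow> y \<in> D (chl A) \<longrightarrow> mem q (chl A) y (rep Y \<bullet> x \<bullet> v) \<longrightarrow> tr \<Gamma> q A e x y) \<longrightarrow>
      tr \<Gamma> p B e (rep U \<bullet> x) v)"

definition Ent :: "ty list \<Rightarrow> dob \<Rightarrow> dob \<Rightarrow> bool" where
  "Ent \<Gamma> A B \<longleftrightarrow> (\<exists>U Y. realizes \<Gamma> A B U Y)"

lemma realizes_closed:
  assumes "realizes \<Gamma> A B U Y"
  shows "closed_term U (wit A \<Rrightarrow> wit B)" "closed_term Y (wit A \<Rrightarrow> chl B \<Rrightarrow> Seq (chl A))"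
  using assms by (simp_all add: realizes_def)

lemma realizes_tr:
  "realizes \<Gamma> A B U Y \<Longrightarrow> env e \<Gamma> \<Longrightarrow> x \<in> D (wit A) \<Longrightarrow> v \<in> D (chl B) \<Longrightarrow>
    (\<And>q y. p \<sqsubseteq> q \<Longrightarrow> y \<in> D (chl A) \<Longrightarrow> mem q (chl A) y (rep Y \<bullet> x \<bullet> v) \<Longrightarrow> tr \<Gamma> q A e x y) \<Longrightarrow>
    tr \<Gamma> p B e (rep U \<bullet> x) v"
  unfolding realizes_def by blast

lemma EntI:
  assumes u: "has_type [wit A] u (wit B)" and y: "has_type [chl B, wit A] y (Seq (chl A))"
    and "\<And>p e x v. env e \<Gamma> \<Longrightarrow> x \<in> D (wit A) \<Longrightarrow> v \<in> D (chl B) \<Longrightarrow>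
      (\<And>q c. p \<sqsubseteq> q \<Longrightarrow> c \<in> D (chl A) \<Longrightarrow> mem q (chl A) c (ev (v .: x .: Var) y) \<Longrightarrow> tr \<Gamma> q A e x c) \<Longrightarrow>
      tr \<Gamma> p B e (ev (x .: Var) u) v"
  shows "Ent \<Gamma> A B"
  unfolding Ent_def realizes_def
proof (intro exI conjI allI impI)
  show "closed_term (lams [wit A] u) (wit A \<Rrightarrow> wit B)"
    using closed_lams[OF u] by simp
  show "closed_term (lams [chl B, wit A] y) (wit A \<Rrightarrow> chl B \<Rrightarrow> Seq (chl A))"
    using closed_lams[OF y] by simp
  fix p e x v
  assume *: "env e \<Gamma>" "x \<in> D (wit A)" "v \<in> D (chl B)" and
    "\<forall>q c. p \<sqsubseteq> q \<longrightarrow> c \<in> D (chl A) \<longrightarrow>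
      mem q (chl A) c (rep (lams [chl B, wit A] y) \<bullet> x \<bullet> v) \<longrightarrow> tr \<Gamma> q A e x c"
  then show "tr \<Gamma> p B e (rep (lams [wit A] u) \<bullet> x) v"
    unfolding app_lams1[OF u *(2)] app_lams2[OF y *(2,3)] using assms(3) by blast
qed

lemma mem_single: "a \<in> D \<sigma> \<Longrightarrow> mem p \<sigma> a (rep (Prep \<sigma>) \<bullet> a \<bullet> rep (Empty \<sigma>))"
  by (simp add: mem_Prep1)

text \<open>The common case in which one challenge to the premise is enough and the sequence is a
  singleton.\<close>

lemma Ent_single:
  assumes u: "has_type [wit A] u (wit B)" and y: "has_type [chl B, wit A] y (chl A)"
    and "\<And>p e x v. env e \<Gamma> \<Longrightarrow> x \<in> D (wit A) \<Longrightarrow> v \<in> D (chl B) \<Longrightarrow>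
      tr \<Gamma> p A e x (ev (v .: x .: Var) y) \<Longrightarrow> tr \<Gamma> p B e (ev (x .: Var) u) v"
  shows "Ent \<Gamma> A B"
proof (rule EntI[OF u, of "Prep (chl A) \<cdot> y \<cdot> Empty (chl A)"])
  show "has_type [chl B, wit A] (Prep (chl A) \<cdot> y \<cdot> Empty (chl A)) (Seq (chl A))" using y by simp
  fix p e x v
  assume *: "env e \<Gamma>" "x \<in> D (wit A)" "v \<in> D (chl B)" and
    prem: "\<And>q c. p \<sqsubseteq> q \<Longrightarrow> c \<in> D (chl A) \<Longrightarrow>
      mem q (chl A) c (ev (v .: x .: Var) (Prep (chl A) \<cdot> y \<cdot> Empty (chl A))) \<Longrightarrow> tr \<Gamma> q A e x c"
  have "ev (v .: x .: Var) y \<in> D (chl A)" by (rule ev_in[OF y]) (use * in simp)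
  then show "tr \<Gamma> p B e (ev (x .: Var) u) v" using assms(3)[OF *] prem by (simp add: mem_single)
qed

lemma Ent_same:
  assumes "wit A = wit B" "chl A = chl B"
    and "\<And>p e x v. env e \<Gamma> \<Longrightarrow> x \<in> D (wit A) \<Longrightarrow> v \<in> D (chl A) \<Longrightarrow> tr \<Gamma> p A e x v \<Longrightarrow> tr \<Gamma> p B e x v"
  shows "Ent \<Gamma> A B"
  by (rule Ent_single[of _ "Var 0" _ "Var 0"]) (use assms in simp_all)

lemma Ent_refl: "Ent \<Gamma> A A"
  by (rule Ent_same) simp_all

text \<open>The second realizer lists challenges to the middle object, and for each of them the
  first lists challenges to the premise. The concatenation of these lists serves the
  composition.\<close>

lemma Ent_trans:
  assumes "Ent \<Gamma> A B" "Ent \<Gamma> B C"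
  shows "Ent \<Gamma> A C"
proof -
  obtain U Y where R: "realizes \<Gamma> A B U Y" using assms(1) by (auto simp: Ent_def)
  note U = realizes_closed(1)[OF R] and Y = realizes_closed(2)[OF R] and 1 = realizes_tr[OF R]
  obtain U' Y' where R': "realizes \<Gamma> B C U' Y'" using assms(2) by (auto simp: Ent_def)
  note U' = realizes_closed(1)[OF R'] and Y' = realizes_closed(2)[OF R'] and 2 = realizes_tr[OF R']
  note ty [simp] = closed_has_type[OF U] closed_has_type[OF Y] closed_has_type[OF U'] closed_has_type[OF Y']
  note ev [simp] = ev_closed[OF U] ev_closed[OF Y] ev_closed[OF U'] ev_closed[OF Y']
  show ?thesis
  proof (rule EntI[of _ "U' \<cdot> (U \<cdot> Var 0)" _ "concat_tm (chl B) (chl A) \<cdot> (Y \<cdot> Var 1) \<cdot> (Y' \<cdot> (U \<cdot> Var 1) \<cdot> Var 0)"])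
    fix p e x v
    assume e: "env e \<Gamma>" and x: "x \<in> D (wit A)" and v: "v \<in> D (chl C)" and
      prem: "\<And>q c. p \<sqsubseteq> q \<Longrightarrow> c \<in> D (chl A) \<Longrightarrow> mem q (chl A) c (ev (v .: x .: Var)
        (concat_tm (chl B) (chl A) \<cdot> (Y \<cdot> Var 1) \<cdot> (Y' \<cdot> (U \<cdot> Var 1) \<cdot> Var 0))) \<Longrightarrow> tr \<Gamma> q A e x c"
    have Ux: "rep U \<bullet> x \<in> D (wit B)" by (rule app_in[OF rep_closed_in[OF U] x])
    have Yx: "rep Y \<bullet> x \<in> D (chl B \<Rrightarrow> Seq (chl A))" by (rule app_in[OF rep_closed_in[OF Y] x])
    have Y'x: "rep Y' \<bullet> (rep U \<bullet> x) \<bullet> v \<in> D (Seq (chl B))"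
      by (rule app_in[OF app_in[OF rep_closed_in[OF Y'] Ux] v])
    have "tr \<Gamma> p C e (rep U' \<bullet> (rep U \<bullet> x)) v"
    proof (rule 2[OF e Ux v])
      fix q y assume q: "p \<sqsubseteq> q" and y: "y \<in> D (chl B)" and m: "mem q (chl B) y (rep Y' \<bullet> (rep U \<bullet> x) \<bullet> v)"
      show "tr \<Gamma> q B e (rep U \<bullet> x) y"
      proof (rule 1[OF e x y])
        fix r z assume r: "q \<sqsubseteq> r" and z: "z \<in> D (chl A)" and m': "mem r (chl A) z (rep Y \<bullet> x \<bullet> y)"
        show "tr \<Gamma> r A e x z"
          using prem[OF leq_trans[OF q r] z] mem_concat[OF mem_mono[OF m r] m' y Y'x z Yx] by simp
      qed
    qed
    then show "tr \<Gamma> p C e (ev (x .: Var) (U' \<cdot> (U \<cdot> Var 0))) v" by simp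
  qed simp_all
qed

text \<open>Contraction of the premise \<open>C\<close>. The challenges of both realizers are
  appended, which avoids deciding which of the two conclusions needs them.\<close>

lemma Ent_AndI:
  assumes A: "ok \<Gamma> A" "ok \<Gamma> B" and "Ent \<Gamma> C A" "Ent \<Gamma> C B"
  shows "Ent \<Gamma> C (dAnd A B)"
proof -
  obtain U Y where R: "realizes \<Gamma> C A U Y" using assms(3) by (auto simp: Ent_def)
  note U = realizes_closed(1)[OF R] and Y = realizes_closed(2)[OF R] and 1 = realizes_tr[OF R]
  obtain U' Y' where R': "realizes \<Gamma> C B U' Y'" using assms(4) by (auto simp: Ent_def)
  note U' = realizes_closed(1)[OF R'] and Y' = realizes_closed(2)[OF R'] and 2 = realizes_tr[OF R']
  note ty [simp] = closed_has_type[OF U] closed_has_type[OF Y] closed_has_type[OF U'] closed_has_type[OF Y']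
  note ev [simp] = ev_closed[OF U] ev_closed[OF Y] ev_closed[OF U'] ev_closed[OF Y']
  note in_D [simp] = app_in[OF rep_closed_in[OF U]] app_in[OF rep_closed_in[OF U']]
    app_in[OF app_in[OF rep_closed_in[OF Y]]] app_in[OF app_in[OF rep_closed_in[OF Y']]]
  let ?u = "pair_tm (wit A) (wit B) \<cdot> (U \<cdot> Var 0) \<cdot> (U' \<cdot> Var 0)"
  let ?y = "append_tm (chl C) \<cdot> (Y \<cdot> Var 1 \<cdot> (fst_tm (chl A) (chl B) \<cdot> Var 0)) \<cdot>
    (Y' \<cdot> Var 1 \<cdot> (snd_tm (chl A) (chl B) \<cdot> Var 0))"
  show ?thesis
  proof (rule EntI[of _ ?u _ ?y])
    fix p e x v
    assume e: "env e \<Gamma>" and x: "x \<in> D (wit C)" and v: "v \<in> D (chl (dAnd A B))" and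
      prem: "\<And>q c. p \<sqsubseteq> q \<Longrightarrow> c \<in> D (chl C) \<Longrightarrow> mem q (chl C) c (ev (v .: x .: Var) ?y) \<Longrightarrow> tr \<Gamma> q C e x c"
    have v': "v \<in> D (Pr (chl A) (chl B))" using v by simp
    have "tr \<Gamma> p A e (rep U \<bullet> x) (rep (fst_tm (chl A) (chl B)) \<bullet> v)"
      by (rule 1[OF e x fst_in[OF v']], rule prem) (use x v' in \<open>simp_all add: mem_append1\<close>)
    moreover have "tr \<Gamma> p B e (rep U' \<bullet> x) (rep (snd_tm (chl A) (chl B)) \<bullet> v)"
      by (rule 2[OF e x snd_in[OF v']], rule prem) (use x v' in \<open>simp_all add: mem_append2\<close>)
    ultimately show "tr \<Gamma> p (dAnd A B) e (ev (x .: Var) ?u) v"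
      using x v' by (simp add: tr_And[OF A e])
  qed simp_all
qed

lemma Ent_AndE1:
  assumes "ok \<Gamma> A" "ok \<Gamma> B"
  shows "Ent \<Gamma> (dAnd A B) A"
  by (rule Ent_single[of _ "fst_tm (wit A) (wit B) \<cdot> Var 0" _
        "pair_tm (chl A) (chl B) \<cdot> Var 0 \<cdot> zero_tm (chl B)"])
    (simp_all add: tr_And[OF assms])

lemma Ent_AndE2:
  assumes "ok \<Gamma> A" "ok \<Gamma> B"
  shows "Ent \<Gamma> (dAnd A B) B"
  by (rule Ent_single[of _ "snd_tm (wit A) (wit B) \<cdot> Var 0" _
        "pair_tm (chl A) (chl B) \<cdot> zero_tm (chl A) \<cdot> Var 0"])
    (simp_all add: tr_And[OF assms])

text \<open>Currying. The given realizer lists pairs of challenges: the first components are put to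
  \<open>C\<close>, and the second components form the sequence that the implication puts to
  \<open>A\<close>.\<close>

lemma Ent_ImpI:
  assumes C: "ok \<Gamma> C" and A: "ok \<Gamma> A" and B: "ok \<Gamma> B" and "Ent \<Gamma> (dAnd C A) B"
  shows "Ent \<Gamma> C (dImp A B)"
proof -
  let ?W = "Pr (wit C) (wit A)" and ?K = "Pr (chl C) (chl A)"
  obtain U Y where R: "realizes \<Gamma> (dAnd C A) B U Y" using assms(4) by (auto simp: Ent_def)
  note U = realizes_closed(1)[OF R, unfolded dob_simps] and Y = realizes_closed(2)[OF R, unfolded dob_simps] and 1 = realizes_tr[OF R]
  note ty [simp] = closed_has_type[OF U] closed_has_type[OF Y]
  note ev [simp] = ev_closed[OF U] ev_closed[OF Y]
  note in_D [simp] = app_in[OF rep_closed_in[OF U]] app_in[OF app_in[OF rep_closed_in[OF Y]]]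
  let ?F = "wit A \<Rrightarrow> wit B" and ?G = "wit A \<Rrightarrow> chl B \<Rrightarrow> Seq (chl A)"
  let ?\<Gamma> = "[wit C]"
  let ?f = "U \<cdot> (pair_tm (wit C) (wit A) \<cdot> Var 1 \<cdot> Var 0)"
  let ?g = "map_tm ?K (chl A) \<cdot> snd_tm (chl C) (chl A) \<cdot> (Y \<cdot> (pair_tm (wit C) (wit A) \<cdot> Var 2 \<cdot> Var 1) \<cdot> Var 0)"
  let ?u = "pair_tm ?F ?G \<cdot> LAM ?\<Gamma> (wit A) ?f \<cdot> LAM ?\<Gamma> (wit A) (LAM (wit A # ?\<Gamma>) (chl B) ?g)"
  let ?y = "map_tm ?K (chl C) \<cdot> fst_tm (chl C) (chl A) \<cdot>
    (Y \<cdot> (pair_tm (wit C) (wit A) \<cdot> Var 1 \<cdot> (fst_tm (wit A) (chl B) \<cdot> Var 0)) \<cdot> (snd_tm (wit A) (chl B) \<cdot> Var 0))"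
  show ?thesis
  proof (rule EntI[of _ ?u _ ?y])
    fix p e x v
    assume e: "env e \<Gamma>" and x: "x \<in> D (wit C)" and v0: "v \<in> D (chl (dImp A B))" and
      prem: "\<And>q c. p \<sqsubseteq> q \<Longrightarrow> c \<in> D (chl C) \<Longrightarrow> mem q (chl C) c (ev (v .: x .: Var) ?y) \<Longrightarrow> tr \<Gamma> q C e x c"
    let ?a = "rep (fst_tm (wit A) (chl B)) \<bullet> v" and ?c = "rep (snd_tm (wit A) (chl B)) \<bullet> v"
    have v: "v \<in> D (Pr (wit A) (chl B))" using v0 by simp
    note a = fst_in[OF v] and c = snd_in[OF v]
    let ?x = "rep (pair_tm (wit C) (wit A)) \<bullet> x \<bullet> ?a"
    have x': "?x \<in> D ?W" using x a by simp
    have ex: "env (x .: Var) ?\<Gamma>" "env (?a .: x .: Var) (wit A # ?\<Gamma>)" using x a by simp_all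
    have f: "ev (x .: Var) (LAM ?\<Gamma> (wit A) ?f) \<in> D ?F"
      and g: "ev (x .: Var) (LAM ?\<Gamma> (wit A) (LAM (wit A # ?\<Gamma>) (chl B) ?g)) \<in> D ?G"
      by (rule ev_in[OF _ ex(1)], simp)+
    have fa: "ev (x .: Var) (LAM ?\<Gamma> (wit A) ?f) \<bullet> ?a = rep U \<bullet> ?x"
      using ev_LAM[OF _ ex(1) a, of ?f "wit B"] by simp
    have ga: "ev (x .: Var) (LAM ?\<Gamma> (wit A) (LAM (wit A # ?\<Gamma>) (chl B) ?g)) \<bullet> ?a \<bullet> ?c =
        rep (map_tm ?K (chl A)) \<bullet> rep (snd_tm (chl C) (chl A)) \<bullet> (rep Y \<bullet> ?x \<bullet> ?c)"
      using ev_LAM[OF _ ex(1) a, of "LAM (wit A # ?\<Gamma>) (chl B) ?g" "chl B \<Rrightarrow> Seq (chl A)"]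
        ev_LAM[OF _ ex(2) c, of ?g "Seq (chl A)"] by simp
    have u: "ev (x .: Var) ?u \<in> D (wit (dImp A B))" using f g by simp
    show "tr \<Gamma> p (dImp A B) e (ev (x .: Var) ?u) v"
      unfolding tr_Imp[OF A B e u v0]
    proof (intro allI impI)
      fix q assume q: "p \<sqsubseteq> q" and hyp: "\<forall>d\<in>D (chl A). \<forall>r. q \<sqsubseteq> r \<longrightarrow>
         mem r (chl A) d (rep (snd_tm ?F ?G) \<bullet> ev (x .: Var) ?u \<bullet> ?a \<bullet> ?c) \<longrightarrow> tr \<Gamma> r A e ?a d"
      have "tr \<Gamma> q B e (rep U \<bullet> ?x) ?c"
      proof (rule 1[OF e _ c])
        fix r l assume r: "q \<sqsubseteq> r" and l: "l \<in> D (chl (dAnd C A))"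
          and m: "mem r (chl (dAnd C A)) l (rep Y \<bullet> ?x \<bullet> ?c)"
        have l': "l \<in> D ?K" and m': "mem r ?K l (rep Y \<bullet> ?x \<bullet> ?c)" using l m by simp_all
        have "tr \<Gamma> r C e x (rep (fst_tm (chl C) (chl A)) \<bullet> l)"
          by (rule prem[OF leq_trans[OF q r] fst_in[OF l']]) (use mem_map[OF m' l'] x' c in simp)
        moreover have "tr \<Gamma> r A e ?a (rep (snd_tm (chl C) (chl A)) \<bullet> l)"
          by (rule hyp[rule_format, OF snd_in[OF l'] r]) (use mem_map[OF m' l'] x' c f g ga in simp)
        ultimately show "tr \<Gamma> r (dAnd C A) e ?x l"
          using l' x a by (simp add: tr_And[OF C A e])
      qed (use x' in simp)
      then show "tr \<Gamma> q B e (rep (fst_tm ?F ?G) \<bullet> ev (x .: Var) ?u \<bullet> ?a) ?c"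
        using f g fa by simp
    qed
  qed simp_all
qed

text \<open>The implication is asked at the stored witness of its premise and at \<open>v\<close>;
  the premise is asked for every challenge that the implication returns. Challenges to a conjunction
  are pairs, so the first one is padded with a zero term. It ensures that the implication is asked
  even if it returns an empty sequence.\<close>

lemma Ent_eval:
  assumes A: "ok \<Gamma> A" and B: "ok \<Gamma> B"
  shows "Ent \<Gamma> (dAnd (dImp A B) A) B"
proof -
  let ?F = "wit A \<Rrightarrow> wit B" and ?G = "wit A \<Rrightarrow> chl B \<Rrightarrow> Seq (chl A)"
  let ?I = "Pr ?F ?G" and ?K = "Pr (wit A) (chl B)"
  let ?W = "Pr ?I (wit A)" and ?L = "Pr ?K (chl A)"
  let ?u = "fst_tm ?F ?G \<cdot> (fst_tm ?I (wit A) \<cdot> Var 0) \<cdot> (snd_tm ?I (wit A) \<cdot> Var 0)"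
  let ?b = "pair_tm ?K (chl A) \<cdot> (pair_tm (wit A) (chl B) \<cdot> (snd_tm ?I (wit A) \<cdot> Var 2) \<cdot> Var 1) \<cdot> Var 0"
  let ?y = "Prep ?L \<cdot> (pair_tm ?K (chl A) \<cdot> (pair_tm (wit A) (chl B) \<cdot> (snd_tm ?I (wit A) \<cdot> Var 1) \<cdot> Var 0) \<cdot> zero_tm (chl A)) \<cdot>
    (map_tm (chl A) ?L \<cdot> LAM [chl B, ?W] (chl A) ?b \<cdot>
      (snd_tm ?F ?G \<cdot> (fst_tm ?I (wit A) \<cdot> Var 1) \<cdot> (snd_tm ?I (wit A) \<cdot> Var 1) \<cdot> Var 0))"
  note AB = ok_Imp[OF A B]
  show ?thesis
  proof (rule EntI[of _ ?u _ ?y])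
    fix p e x v
    assume e: "env e \<Gamma>" and x0: "x \<in> D (wit (dAnd (dImp A B) A))" and v: "v \<in> D (chl B)" and
      prem: "\<And>q c. p \<sqsubseteq> q \<Longrightarrow> c \<in> D (chl (dAnd (dImp A B) A)) \<Longrightarrow>
        mem q (chl (dAnd (dImp A B) A)) c (ev (v .: x .: Var) ?y) \<Longrightarrow> tr \<Gamma> q (dAnd (dImp A B) A) e x c"
    have x: "x \<in> D ?W" using x0 by simp
    define w where "w = rep (fst_tm ?I (wit A)) \<bullet> x"
    define a where "a = rep (snd_tm ?I (wit A)) \<bullet> x"
    have w: "w \<in> D ?I" and a: "a \<in> D (wit A)" using x by (simp_all add: w_def a_def)
    define s where "s = rep (snd_tm ?F ?G) \<bullet> w \<bullet> a \<bullet> v"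
    have s: "s \<in> D (Seq (chl A))"
      unfolding s_def by (rule app_in[OF app_in[OF snd_in[OF w] a] v])
    define k where "k = rep (pair_tm (wit A) (chl B)) \<bullet> a \<bullet> v"
    have k: "k \<in> D ?K" using a v by (simp add: k_def)
    have kp: "rep (fst_tm (wit A) (chl B)) \<bullet> k = a" "rep (snd_tm (wit A) (chl B)) \<bullet> k = v"
      using a v by (simp_all add: k_def)
    define f where "f = ev (v .: x .: Var) (LAM [chl B, ?W] (chl A) ?b)"
    have exv: "env (v .: x .: Var) [chl B, ?W]" using x v by simp
    have f: "f \<in> D (chl A \<Rrightarrow> ?L)" unfolding f_def by (rule ev_in[OF _ exv]) simp
    have fd: "f \<bullet> d = rep (pair_tm ?K (chl A)) \<bullet> k \<bullet> d" if "d \<in> D (chl A)" for d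
      unfolding f_def using ev_LAM[OF _ exv that, of ?b ?L] by (simp add: k_def a_def)
    have y: "ev (v .: x .: Var) ?y = rep (Prep ?L) \<bullet> (rep (pair_tm ?K (chl A)) \<bullet> k \<bullet> rep (zero_tm (chl A))) \<bullet>
        (rep (map_tm (chl A) ?L) \<bullet> f \<bullet> s)"
      by (simp add: k_def a_def w_def s_def f_def)
    have prem': "tr \<Gamma> q (dImp A B) e w (rep (fst_tm ?K (chl A)) \<bullet> c)"
      "tr \<Gamma> q A e a (rep (snd_tm ?K (chl A)) \<bullet> c)"
      if "p \<sqsubseteq> q" "c \<in> D ?L" "mem q ?L c (ev (v .: x .: Var) ?y)" for q c
      using prem[OF that(1), of c] that(2,3) x by (simp_all add: tr_And[OF AB A e] w_def a_def)
    \<comment> \<open>This is due to the leading challenge; the mapped ones give the premise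
      \<open>A\<close> at each member of \<open>s\<close>.\<close>
    have "tr \<Gamma> p (dImp A B) e w k"
      using prem'(1)[OF leq_refl, of "rep (pair_tm ?K (chl A)) \<bullet> k \<bullet> rep (zero_tm (chl A))"] k f s
      unfolding y by (simp add: mem_Prep1)
    moreover have "tr \<Gamma> r A e a d"
      if r: "p \<sqsubseteq> r" and d: "d \<in> D (chl A)" and m: "mem r (chl A) d s" for r d
      using prem'(2)[OF r, of "f \<bullet> d"] mem_Prep2[OF mem_map[OF m d s f]] k f s d
      unfolding y by (simp add: fd)
    ultimately have "tr \<Gamma> p B e (rep (fst_tm ?F ?G) \<bullet> w \<bullet> a) v"
      using tr_Imp[OF A B e, of w k p] w k kp by (simp add: s_def)
    then show "tr \<Gamma> p B e (ev (x .: Var) ?u) v" by (simp add: w_def a_def)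
  qed simp_all
qed

lemma Ent_ImpE:
  assumes "ok \<Gamma> A" "ok \<Gamma> B" "Ent \<Gamma> C (dImp A B)" "Ent \<Gamma> C A"
  shows "Ent \<Gamma> C B"
  by (rule Ent_trans[OF Ent_AndI[OF ok_Imp[OF assms(1,2)] assms(1,3,4)] Ent_eval[OF assms(1,2)]])

lemma Ent_Bot:
  assumes "ok \<Gamma> A"
  shows "Ent \<Gamma> (dInt Bot) A"
  by (rule Ent_single[of _ "zero_tm (wit A)" _ "zero_tm TNat"])
    (use assms absurd_tr in \<open>simp_all add: tr_Int del: zero_tm.simps\<close>)

text \<open>With flag zero the clause for \<open>B\<close> applies in absurd worlds only. The
  missing witness for \<open>B\<close> is filled by a zero term.\<close>

lemma Ent_OrI1:
  assumes "ok \<Gamma> A" "ok \<Gamma> B"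
  shows "Ent \<Gamma> A (dOr A B)"
proof (rule Ent_single[of _ "pair_tm TNat (Pr (wit A) (wit B)) \<cdot> Zero \<cdot> (pair_tm (wit A) (wit B) \<cdot> Var 0 \<cdot> zero_tm (wit B))"
      _ "fst_tm (chl A) (chl B) \<cdot> Var 0"])
  let ?u = "pair_tm TNat (Pr (wit A) (wit B)) \<cdot> Zero \<cdot> (pair_tm (wit A) (wit B) \<cdot> Var 0 \<cdot> zero_tm (wit B))"
  fix p e x v
  assume e: "env e \<Gamma>" and x: "x \<in> D (wit A)" and v: "v \<in> D (chl (dOr A B))"
    and *: "tr \<Gamma> p A e x (ev (v .: x .: Var) (fst_tm (chl A) (chl B) \<cdot> Var 0))"
  have v': "v \<in> D (Pr (chl A) (chl B))" using v by simp
  have "tr \<Gamma> q B e z (rep (snd_tm (chl A) (chl B)) \<bullet> v)"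
    if "\<forall>r. q \<sqsubseteq> r \<longrightarrow> eqv r TNat (rep Zero) (rep Zero) \<longrightarrow> absurd r" "z \<in> D (wit B)" for q z
    using that absurd_tr[OF _ assms(2) e] v' by (simp add: eqv_refl)
  moreover have "ev (x .: Var) ?u \<in> D (wit (dOr A B))" using x by simp
  ultimately show "tr \<Gamma> p (dOr A B) e (ev (x .: Var) ?u) v"
    using x tr_mono[OF *] by (simp add: tr_Or[OF assms e _ v])
qed simp_all

lemma Ent_OrI2:
  assumes "ok \<Gamma> A" "ok \<Gamma> B"
  shows "Ent \<Gamma> B (dOr A B)"
proof (rule Ent_single[of _ "pair_tm TNat (Pr (wit A) (wit B)) \<cdot> (Succ \<cdot> Zero) \<cdot> (pair_tm (wit A) (wit B) \<cdot> zero_tm (wit A) \<cdot> Var 0)"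
      _ "snd_tm (chl A) (chl B) \<cdot> Var 0"])
  let ?u = "pair_tm TNat (Pr (wit A) (wit B)) \<cdot> (Succ \<cdot> Zero) \<cdot> (pair_tm (wit A) (wit B) \<cdot> zero_tm (wit A) \<cdot> Var 0)"
  fix p e x v
  assume e: "env e \<Gamma>" and x: "x \<in> D (wit B)" and v: "v \<in> D (chl (dOr A B))"
    and *: "tr \<Gamma> p B e x (ev (v .: x .: Var) (snd_tm (chl A) (chl B) \<cdot> Var 0))"
  have v': "v \<in> D (Pr (chl A) (chl B))" using v by simp
  have "tr \<Gamma> q A e z (rep (fst_tm (chl A) (chl B)) \<bullet> v)"
    if "eqv q TNat (rep Succ \<bullet> rep Zero) (rep Zero)" "z \<in> D (wit A)" for q z
    using Zero_Succ[OF that(1) consts_in(1) okf_simps(2), of "[]" e] absurd_tr[OF _ assms(1) e] v' that(2) by simp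
  moreover have "ev (x .: Var) ?u \<in> D (wit (dOr A B))" using x by simp
  ultimately show "tr \<Gamma> p (dOr A B) e (ev (x .: Var) ?u) v"
    using x tr_mono[OF *] by (simp add: tr_Or[OF assms e _ v])
qed simp_all

text \<open>The object \<open>C'\<close> is \<open>C\<close> in the enlarged context, which
  \<open>lift\<close> expresses through truth instead of syntax. The realizer is closed, so it works
  for all values of the new variable at once.\<close>

lemma Ent_AllI:
  assumes A: "ok (\<sigma> # \<Gamma>) A" and "Ent (\<sigma> # \<Gamma>) C' A" and C: "wit C' = wit C" "chl C' = chl C"
    and lift: "\<And>p e d x y. env e \<Gamma> \<Longrightarrow> d \<in> D \<sigma> \<Longrightarrow> x \<in> D (wit C) \<Longrightarrow> y \<in> D (chl C) \<Longrightarrow>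
      tr \<Gamma> p C e x y \<Longrightarrow> tr (\<sigma> # \<Gamma>) p C' (d .: e) x y"
  shows "Ent \<Gamma> C (dAll \<sigma> A)"
proof -
  obtain U Y where R: "realizes (\<sigma> # \<Gamma>) C' A U Y" using assms(2) by (auto simp: Ent_def)
  note U = realizes_closed(1)[OF R, unfolded C] and Y = realizes_closed(2)[OF R, unfolded C]
    and 1 = realizes_tr[OF R, unfolded C]
  show ?thesis
    unfolding Ent_def realizes_def dob_simps
  proof (intro exI conjI allI impI)
    fix p e x v
    assume e: "env e \<Gamma>" and x: "x \<in> D (wit C)" and v: "v \<in> D (chl A)"
      and prem: "\<forall>q y. p \<sqsubseteq> q \<longrightarrow> y \<in> D (chl C) \<longrightarrow> mem q (chl C) y (rep Y \<bullet> x \<bullet> v) \<longrightarrow> tr \<Gamma> q C e x y"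
    have "tr (\<sigma> # \<Gamma>) p A (d .: e) (rep U \<bullet> x) v" if d: "d \<in> D \<sigma>" for d
      by (rule 1[OF _ x v]) (use e d x prem lift in auto)
    then show "tr \<Gamma> p (dAll \<sigma> A) e (rep U \<bullet> x) v"
      using tr_All[OF A e app_in[OF rep_closed_in[OF U] x] v] by blast
  qed (rule U Y)+
qed

lemma Ent_AllE:
  assumes A: "ok (\<sigma> # \<Gamma>) A" and "wit A' = wit A" "chl A' = chl A" and t: "has_type \<Gamma> t \<sigma>"
    and inst: "\<And>p e x y. env e \<Gamma> \<Longrightarrow> x \<in> D (wit A) \<Longrightarrow> y \<in> D (chl A) \<Longrightarrow>
      tr (\<sigma> # \<Gamma>) p A (ev e t .: e) x y \<Longrightarrow> tr \<Gamma> p A' e x y"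
  shows "Ent \<Gamma> (dAll \<sigma> A) A'"
  by (rule Ent_same) (use assms ev_in[OF t] in \<open>simp_all add: tr_All\<close>)

text \<open>The value of \<open>t\<close> answers every challenge, so the sequence put to the
  existential object is passed on unchanged.\<close>

lemma Ent_ExI:
  assumes A: "ok (\<sigma> # \<Gamma>) A" and A': "wit A' = wit A" "chl A' = chl A" and t: "has_type \<Gamma> t \<sigma>"
    and inst: "\<And>p e x y. env e \<Gamma> \<Longrightarrow> x \<in> D (wit A) \<Longrightarrow> y \<in> D (chl A) \<Longrightarrow>
      tr \<Gamma> p A' e x y \<Longrightarrow> tr (\<sigma> # \<Gamma>) p A (ev e t .: e) x y"
  shows "Ent \<Gamma> A' (dEx \<sigma> A)"
proof (rule EntI[of _ "Var 0" _ "Var 0"])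
  fix p e x v
  assume e: "env e \<Gamma>" and x: "x \<in> D (wit A')" and v: "v \<in> D (chl (dEx \<sigma> A))" and
    prem: "\<And>q c. p \<sqsubseteq> q \<Longrightarrow> c \<in> D (chl A') \<Longrightarrow> mem q (chl A') c (ev (v .: x .: Var) (Var 0)) \<Longrightarrow> tr \<Gamma> q A' e x c"
  show "tr \<Gamma> p (dEx \<sigma> A) e (ev (x .: Var) (Var 0)) v"
    by (rule tr_ExI[OF A e _ _ ev_in[OF t e]]) (use x v A' prem inst e in auto)
qed (use A' in simp_all)

end

section \<open>External quantifiers as Dialectica objects\<close>

text \<open>\<open>\<exists>\<^sup>s\<^sup>t\<close> and \<open>\<forall>\<^sup>s\<^sup>t\<close> with the standard object itself as part of the witness or challenge.\<close>

definition dAllSt :: "ty \<Rightarrow> dob \<Rightarrow> dob" where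
  "dAllSt \<sigma> A = (let a = fst_tm \<sigma> (chl A) \<cdot> Var 0 in Dob (\<sigma> \<Rrightarrow> wit A) (Pr \<sigma> (chl A))
    (subst (snd_tm \<sigma> (chl A) \<cdot> Var 0 .: Var 1 \<cdot> a .: a .: weaken 2) (mat A)))"

definition dExSt :: "ty \<Rightarrow> dob \<Rightarrow> dob" where
  "dExSt \<sigma> A = Dob (Pr \<sigma> (wit A)) (chl A)
    (subst (Var 0 .: snd_tm \<sigma> (wit A) \<cdot> Var 1 .: fst_tm \<sigma> (wit A) \<cdot> Var 1 .: weaken 2) (mat A))"

definition dTop :: dob where
  "dTop = dInt (Bot \<^bold>\<longrightarrow> Bot)"

lemma dSt_simps [simp]:
  "wit (dAllSt \<sigma> A) = (\<sigma> \<Rrightarrow> wit A)" "chl (dAllSt \<sigma> A) = Pr \<sigma> (chl A)"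
  "wit (dExSt \<sigma> A) = Pr \<sigma> (wit A)" "chl (dExSt \<sigma> A) = chl A"
  "wit dTop = TNat" "chl dTop = TNat"
  by (simp_all add: dAllSt_def dExSt_def dTop_def Let_def)

context model
begin

lemma eqv_cond:
  assumes "eqv p TNat z z'" "z \<in> D TNat" "z' \<in> D TNat" "a \<in> D \<sigma>" "b \<in> D \<sigma>"
  shows "eqv p \<sigma> (rep (cond_tm \<sigma>) \<bullet> z \<bullet> a \<bullet> b) (rep (cond_tm \<sigma>) \<bullet> z' \<bullet> a \<bullet> b)"
proof -
  note c = rep_closed_in[OF closed_cond[of \<sigma>]]
  note c1 = app_in[OF c assms(2)] app_in[OF c assms(3)]
  note c2 = app_in[OF c1(1) assms(4)] app_in[OF c1(2) assms(4)]
  show ?thesis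
    by (rule eqv_app[OF eqv_app[OF eqv_app2[OF assms(1) c assms(2,3)] eqv_refl[OF assms(4)] c1 assms(4,4)]
          eqv_refl[OF assms(5)] c2 assms(5,5)])
qed

text \<open>The conditional term selects the witness by the flag. The challenges of both branches
  are issued in any case, each padded with a zero term for the other disjunct. The verification
  distinguishes the cases of the flag, which is possible since truth of \<open>G\<close> is the
  forcing of an \<or>-free formula.\<close>

lemma Ent_OrE:
  assumes C: "ok \<Gamma> C" and A: "ok \<Gamma> A" and B: "ok \<Gamma> B" and G: "ok \<Gamma> G"
    and "Ent \<Gamma> (dAnd C A) G" "Ent \<Gamma> (dAnd C B) G"
  shows "Ent \<Gamma> (dAnd C (dOr A B)) G"
proof -
  let ?W = "Pr (wit A) (wit B)"
  let ?Z = "Pr TNat ?W"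
  let ?X = "Pr (wit C) ?Z"
  let ?K = "Pr (chl C) (chl A)" and ?K' = "Pr (chl C) (chl B)" and ?KO = "Pr (chl A) (chl B)"
  let ?KK = "Pr (chl C) ?KO"
  obtain U Y where R: "realizes \<Gamma> (dAnd C A) G U Y" using assms(5) by (auto simp: Ent_def)
  note U = realizes_closed(1)[OF R, unfolded dob_simps] and Y = realizes_closed(2)[OF R, unfolded dob_simps] and 1 = realizes_tr[OF R]
  obtain U' Y' where R': "realizes \<Gamma> (dAnd C B) G U' Y'" using assms(6) by (auto simp: Ent_def)
  note U' = realizes_closed(1)[OF R', unfolded dob_simps] and Y' = realizes_closed(2)[OF R', unfolded dob_simps] and 2 = realizes_tr[OF R']
  note ty [simp] = closed_has_type[OF U] closed_has_type[OF Y] closed_has_type[OF U'] closed_has_type[OF Y']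
  note ev [simp] = ev_closed[OF U] ev_closed[OF Y] ev_closed[OF U'] ev_closed[OF Y']
  note in_D [simp] = app_in[OF rep_closed_in[OF U]] app_in[OF rep_closed_in[OF U']]
    app_in[OF app_in[OF rep_closed_in[OF Y]]] app_in[OF app_in[OF rep_closed_in[OF Y']]]
  let ?c = "\<lambda>i. fst_tm (wit C) ?Z \<cdot> Var i"
  let ?z = "\<lambda>i. fst_tm TNat ?W \<cdot> (snd_tm (wit C) ?Z \<cdot> Var i)"
  let ?w = "\<lambda>i. snd_tm TNat ?W \<cdot> (snd_tm (wit C) ?Z \<cdot> Var i)"
  let ?x1 = "\<lambda>i. pair_tm (wit C) (wit A) \<cdot> ?c i \<cdot> (fst_tm (wit A) (wit B) \<cdot> ?w i)"
  let ?x2 = "\<lambda>i. pair_tm (wit C) (wit B) \<cdot> ?c i \<cdot> (snd_tm (wit A) (wit B) \<cdot> ?w i)"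
  let ?b1 = "pair_tm (chl C) ?KO \<cdot> (fst_tm (chl C) (chl A) \<cdot> Var 0) \<cdot>
    (pair_tm (chl A) (chl B) \<cdot> (snd_tm (chl C) (chl A) \<cdot> Var 0) \<cdot> zero_tm (chl B))"
  let ?b2 = "pair_tm (chl C) ?KO \<cdot> (fst_tm (chl C) (chl B) \<cdot> Var 0) \<cdot>
    (pair_tm (chl A) (chl B) \<cdot> zero_tm (chl A) \<cdot> (snd_tm (chl C) (chl B) \<cdot> Var 0))"
  let ?u = "cond_tm (wit G) \<cdot> ?z 0 \<cdot> (U \<cdot> ?x1 0) \<cdot> (U' \<cdot> ?x2 0)"
  let ?\<Gamma> = "[chl G, ?X]"
  let ?y = "append_tm ?KK \<cdot> (map_tm ?K ?KK \<cdot> LAM ?\<Gamma> ?K ?b1 \<cdot> (Y \<cdot> ?x1 1 \<cdot> Var 0)) \<cdot>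
    (map_tm ?K' ?KK \<cdot> LAM ?\<Gamma> ?K' ?b2 \<cdot> (Y' \<cdot> ?x2 1 \<cdot> Var 0))"
  note AB = ok_Or[OF A B]
  show ?thesis
  proof (rule EntI[of _ ?u _ ?y])
    fix p e x v
    assume e: "env e \<Gamma>" and x0: "x \<in> D (wit (dAnd C (dOr A B)))" and v: "v \<in> D (chl G)" and
      prem: "\<And>q k. p \<sqsubseteq> q \<Longrightarrow> k \<in> D (chl (dAnd C (dOr A B))) \<Longrightarrow>
        mem q (chl (dAnd C (dOr A B))) k (ev (v .: x .: Var) ?y) \<Longrightarrow> tr \<Gamma> q (dAnd C (dOr A B)) e x k"
    have x: "x \<in> D ?X" using x0 by simp
    define c where "c = rep (fst_tm (wit C) ?Z) \<bullet> x"
    define zw where "zw = rep (snd_tm (wit C) ?Z) \<bullet> x"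
    define z where "z = rep (fst_tm TNat ?W) \<bullet> zw"
    define w where "w = rep (snd_tm TNat ?W) \<bullet> zw"
    define a where "a = rep (fst_tm (wit A) (wit B)) \<bullet> w"
    define b where "b = rep (snd_tm (wit A) (wit B)) \<bullet> w"
    define x1 where "x1 = rep (pair_tm (wit C) (wit A)) \<bullet> c \<bullet> a"
    define x2 where "x2 = rep (pair_tm (wit C) (wit B)) \<bullet> c \<bullet> b"
    have c: "c \<in> D (wit C)" and zw: "zw \<in> D ?Z" using x by (simp_all add: c_def zw_def)
    have z: "z \<in> D TNat" and w: "w \<in> D ?W" using zw by (simp_all add: z_def w_def)
    have a: "a \<in> D (wit A)" and b: "b \<in> D (wit B)" using w by (simp_all add: a_def b_def)
    have x1: "x1 \<in> D (Pr (wit C) (wit A))" and x2: "x2 \<in> D (Pr (wit C) (wit B))"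
      using a b c by (simp_all add: x1_def x2_def)
    define f1 where "f1 = ev (v .: x .: Var) (LAM ?\<Gamma> ?K ?b1)"
    define f2 where "f2 = ev (v .: x .: Var) (LAM ?\<Gamma> ?K' ?b2)"
    have exv: "env (v .: x .: Var) ?\<Gamma>" using x v by simp
    have f: "f1 \<in> D (?K \<Rrightarrow> ?KK)" "f2 \<in> D (?K' \<Rrightarrow> ?KK)"
      unfolding f1_def f2_def by (rule ev_in[OF _ exv], simp)+
    have f1d: "f1 \<bullet> l = rep (pair_tm (chl C) ?KO) \<bullet> (rep (fst_tm (chl C) (chl A)) \<bullet> l) \<bullet>
      (rep (pair_tm (chl A) (chl B)) \<bullet> (rep (snd_tm (chl C) (chl A)) \<bullet> l) \<bullet> rep (zero_tm (chl B)))"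
      if "l \<in> D ?K" for l unfolding f1_def using ev_LAM[OF _ exv that, of ?b1 ?KK] by simp
    have f2d: "f2 \<bullet> l = rep (pair_tm (chl C) ?KO) \<bullet> (rep (fst_tm (chl C) (chl B)) \<bullet> l) \<bullet>
      (rep (pair_tm (chl A) (chl B)) \<bullet> rep (zero_tm (chl A)) \<bullet> (rep (snd_tm (chl C) (chl B)) \<bullet> l))"
      if "l \<in> D ?K'" for l unfolding f2_def using ev_LAM[OF _ exv that, of ?b2 ?KK] by simp
    let ?L = "rep Y \<bullet> x1 \<bullet> v" and ?L' = "rep Y' \<bullet> x2 \<bullet> v"
    have y: "ev (v .: x .: Var) ?y = rep (append_tm ?KK) \<bullet> (rep (map_tm ?K ?KK) \<bullet> f1 \<bullet> ?L) \<bullet>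
        (rep (map_tm ?K' ?KK) \<bullet> f2 \<bullet> ?L')"
      by (simp add: f1_def f2_def x1_def x2_def a_def b_def c_def w_def zw_def)
    have L: "?L \<in> D (Seq ?K)" "?L' \<in> D (Seq ?K')" using x1 x2 v by simp_all
    have prem': "tr \<Gamma> q C e c (rep (fst_tm (chl C) ?KO) \<bullet> k)"
      "tr \<Gamma> q (dOr A B) e zw (rep (snd_tm (chl C) ?KO) \<bullet> k)"
      if "p \<sqsubseteq> q" "k \<in> D ?KK" "mem q ?KK k (ev (v .: x .: Var) ?y)" for q k
      using prem[OF that(1), of k] that(2,3) x by (simp_all add: tr_And[OF C AB e] c_def zw_def)
    have m1: "f1 \<bullet> l \<in> D ?KK" "mem q ?KK (f1 \<bullet> l) (ev (v .: x .: Var) ?y)"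
      if "l \<in> D ?K" "mem q ?K l ?L" for l q
      using mem_append1[OF app_in[OF f(1) that(1)] map_in[OF f(1) L(1)] map_in[OF f(2) L(2)]
          mem_map[OF that(2,1) L(1) f(1)]] app_in[OF f(1) that(1)] unfolding y by simp_all
    have m2: "f2 \<bullet> l \<in> D ?KK" "mem q ?KK (f2 \<bullet> l) (ev (v .: x .: Var) ?y)"
      if "l \<in> D ?K'" "mem q ?K' l ?L'" for l q
      using mem_append2[OF app_in[OF f(2) that(1)] map_in[OF f(1) L(1)] map_in[OF f(2) L(2)]
          mem_map[OF that(2,1) L(2) f(2)]] app_in[OF f(2) that(1)] unfolding y by simp_all
    let ?g = "rep (cond_tm (wit G)) \<bullet> z \<bullet> (rep U \<bullet> x1) \<bullet> (rep U' \<bullet> x2)"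
    have g: "?g \<in> D (wit G)" using z x1 x2 by simp
    have "tr \<Gamma> p G e ?g v"
      unfolding tr_def
    proof (rule nat_cases[OF z G[unfolded ok_def]], goal_cases)
      case 1
      show ?case using e g v by simp
    next
      case (2 q)
      have "tr \<Gamma> q G e (rep U \<bullet> x1) v"
      proof (rule 1[OF e _ v])
        fix r l assume r: "q \<sqsubseteq> r" and l0: "l \<in> D (chl (dAnd C A))"
          and m0: "mem r (chl (dAnd C A)) l (rep Y \<bullet> x1 \<bullet> v)"
        have l: "l \<in> D ?K" and m: "mem r ?K l ?L" using l0 m0 by simp_all
        note pr = leq_trans[OF 2(1) r]
        have "tr \<Gamma> r C e c (rep (fst_tm (chl C) (chl A)) \<bullet> l)"
          using prem'(1)[OF pr m1[OF l m]] l by (simp add: f1d)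
        moreover have "tr \<Gamma> r A e a (rep (snd_tm (chl C) (chl A)) \<bullet> l)"
          using prem'(2)[OF pr m1[OF l m]] l zw eqv_mono[OF 2(2) r]
          by (simp add: f1d tr_Or[OF A B e] a_def w_def z_def)
        ultimately show "tr \<Gamma> r (dAnd C A) e x1 l"
          using l x1 a c by (simp add: tr_And[OF C A e] x1_def)
      qed (use x1 in simp)
      \<comment> \<open>The flag is zero only under the hypotheses of \<open>q\<close>, so the
        conditional is merely forced equal to the branch and the truth has to be
        transported.\<close>
      moreover have "eqv q (wit G) ?g (rep U \<bullet> x1)"
        using eqv_cond[OF 2(2) z consts_in(1), of "rep U \<bullet> x1" "wit G" "rep U' \<bullet> x2"] x1 x2 by simp
      ultimately show ?case
        using tr_eqv[OF G e, of q ?g "rep U \<bullet> x1" v v] g x1 v by (simp add: eqv_refl tr_def)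
    next
      case (3 q n)
      \<comment> \<open>With a successor as flag, equality to zero makes every later world absurd;
        this is the condition under which \<open>dOr\<close> yields its second disjunct.\<close>
      have abs: "absurd r" if "q \<sqsubseteq> r" "eqv r TNat z (rep Zero)" for r
        using Zero_Succ[OF eqv_trans[OF eqv_sym[OF eqv_mono[OF 3(3) that(1)] z] that(2)] 3(2) okf_simps(2), of "[]" e] z 3(2)
        by simp
      have "tr \<Gamma> q G e (rep U' \<bullet> x2) v"
      proof (rule 2[OF e _ v])
        fix r l assume r: "q \<sqsubseteq> r" and l0: "l \<in> D (chl (dAnd C B))"
          and m0: "mem r (chl (dAnd C B)) l (rep Y' \<bullet> x2 \<bullet> v)"
        have l: "l \<in> D ?K'" and m: "mem r ?K' l ?L'" using l0 m0 by simp_all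
        note pr = leq_trans[OF 3(1) r]
        have "tr \<Gamma> r C e c (rep (fst_tm (chl C) (chl B)) \<bullet> l)"
          using prem'(1)[OF pr m2[OF l m]] l by (simp add: f2d)
        moreover have "tr \<Gamma> r B e b (rep (snd_tm (chl C) (chl B)) \<bullet> l)"
          using prem'(2)[OF pr m2[OF l m]] l zw abs leq_trans[OF r]
          by (simp add: f2d tr_Or[OF A B e] b_def w_def flip: z_def)
        ultimately show "tr \<Gamma> r (dAnd C B) e x2 l"
          using l x2 b c by (simp add: tr_And[OF C B e] x2_def)
      qed (use x2 in simp)
      moreover have "eqv q (wit G) ?g (rep U' \<bullet> x2)"
        using eqv_cond[OF 3(3) z, of "rep U \<bullet> x1" "wit G" "rep U' \<bullet> x2"] x1 x2 3(2) by simp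
      ultimately show ?case
        using tr_eqv[OF G e, of q ?g "rep U' \<bullet> x2" v v] g x2 v by (simp add: eqv_refl tr_def)
    qed
    then show "tr \<Gamma> p G e (ev (x .: Var) ?u) v"
      by (simp add: x1_def x2_def a_def b_def c_def w_def z_def zw_def)
  qed simp_all
qed

text \<open>All challenges to \<open>A\<close> are collected in one sequence \<open>s\<close>, so
  that a single element answers them. Each listed challenge to \<open>C\<close> is paired with
  \<open>s\<close>. A leading pair with a zero term for \<open>C\<close> ensures that the
  existential object is asked even when the realizer lists no challenge.\<close>

lemma Ent_ExE:
  assumes C: "ok \<Gamma> C" and A: "ok (\<sigma> # \<Gamma>) A" and B: "ok \<Gamma> B" and C': "ok (\<sigma> # \<Gamma>) C'"
    and "Ent (\<sigma> # \<Gamma>) (dAnd C' A) B'"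
    and W: "wit C' = wit C" "chl C' = chl C" "wit B' = wit B" "chl B' = chl B"
    and liftC: "\<And>p e d x y. env e \<Gamma> \<Longrightarrow> d \<in> D \<sigma> \<Longrightarrow> x \<in> D (wit C) \<Longrightarrow> y \<in> D (chl C) \<Longrightarrow>
      tr \<Gamma> p C e x y \<Longrightarrow> tr (\<sigma> # \<Gamma>) p C' (d .: e) x y"
    and liftB: "\<And>p e d x y. env e \<Gamma> \<Longrightarrow> d \<in> D \<sigma> \<Longrightarrow> x \<in> D (wit B) \<Longrightarrow> y \<in> D (chl B) \<Longrightarrow>
      tr (\<sigma> # \<Gamma>) p B' (d .: e) x y \<Longrightarrow> tr \<Gamma> p B e x y"
  shows "Ent \<Gamma> (dAnd C (dEx \<sigma> A)) B"
proof -
  let ?X = "Pr (wit C) (wit A)" and ?K = "Pr (chl C) (chl A)" and ?S = "Seq (chl A)"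
  let ?KK = "Pr (chl C) ?S"
  obtain U Y where R: "realizes (\<sigma> # \<Gamma>) (dAnd C' A) B' U Y" using assms(5) by (auto simp: Ent_def)
  note U = realizes_closed(1)[OF R, unfolded dob_simps W] and Y = realizes_closed(2)[OF R, unfolded dob_simps W]
    and 1 = realizes_tr[OF R, unfolded dob_simps W]
  note ty [simp] = closed_has_type[OF U] closed_has_type[OF Y]
  note ev [simp] = ev_closed[OF U] ev_closed[OF Y]
  note in_D [simp] = app_in[OF rep_closed_in[OF U]] app_in[OF app_in[OF rep_closed_in[OF Y]]]
  let ?s = "\<lambda>i j. map_tm ?K (chl A) \<cdot> snd_tm (chl C) (chl A) \<cdot> (Y \<cdot> Var i \<cdot> Var j)"
  let ?b = "pair_tm (chl C) ?S \<cdot> (fst_tm (chl C) (chl A) \<cdot> Var 0) \<cdot> ?s 2 1"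
  let ?\<Gamma> = "[chl B, ?X]"
  let ?y = "Prep ?KK \<cdot> (pair_tm (chl C) ?S \<cdot> zero_tm (chl C) \<cdot> ?s 1 0) \<cdot>
    (map_tm ?K ?KK \<cdot> LAM ?\<Gamma> ?K ?b \<cdot> (Y \<cdot> Var 1 \<cdot> Var 0))"
  show ?thesis
  proof (rule EntI[of _ "U \<cdot> Var 0" _ ?y])
    fix p e x v
    assume e: "env e \<Gamma>" and x0: "x \<in> D (wit (dAnd C (dEx \<sigma> A)))" and v: "v \<in> D (chl B)" and
      prem: "\<And>q k. p \<sqsubseteq> q \<Longrightarrow> k \<in> D (chl (dAnd C (dEx \<sigma> A))) \<Longrightarrow>
        mem q (chl (dAnd C (dEx \<sigma> A))) k (ev (v .: x .: Var) ?y) \<Longrightarrow> tr \<Gamma> q (dAnd C (dEx \<sigma> A)) e x k"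
    have x: "x \<in> D ?X" using x0 by simp
    define c where "c = rep (fst_tm (wit C) (wit A)) \<bullet> x"
    define a where "a = rep (snd_tm (wit C) (wit A)) \<bullet> x"
    have c: "c \<in> D (wit C)" and a: "a \<in> D (wit A)" using x by (simp_all add: c_def a_def)
    let ?L = "rep Y \<bullet> x \<bullet> v"
    have L: "?L \<in> D (Seq ?K)" using x v by simp
    define s where "s = rep (map_tm ?K (chl A)) \<bullet> rep (snd_tm (chl C) (chl A)) \<bullet> ?L"
    have s: "s \<in> D ?S" using L by (simp add: s_def)
    define f where "f = ev (v .: x .: Var) (LAM ?\<Gamma> ?K ?b)"
    have exv: "env (v .: x .: Var) ?\<Gamma>" using x v by simp
    have f: "f \<in> D (?K \<Rrightarrow> ?KK)" unfolding f_def by (rule ev_in[OF _ exv]) simp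
    have fd: "f \<bullet> l = rep (pair_tm (chl C) ?S) \<bullet> (rep (fst_tm (chl C) (chl A)) \<bullet> l) \<bullet> s"
      if "l \<in> D ?K" for l unfolding f_def using ev_LAM[OF _ exv that, of ?b ?KK] by (simp add: s_def)
    define k0 where "k0 = rep (pair_tm (chl C) ?S) \<bullet> rep (zero_tm (chl C)) \<bullet> s"
    have k0: "k0 \<in> D ?KK" using s by (simp add: k0_def)
    have y: "ev (v .: x .: Var) ?y = rep (Prep ?KK) \<bullet> k0 \<bullet> (rep (map_tm ?K ?KK) \<bullet> f \<bullet> ?L)"
      by (simp add: k0_def s_def f_def)
    have prem': "tr \<Gamma> q C e c (rep (fst_tm (chl C) ?S) \<bullet> k)"
      "tr \<Gamma> q (dEx \<sigma> A) e a (rep (snd_tm (chl C) ?S) \<bullet> k)"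
      if "p \<sqsubseteq> q" "k \<in> D ?KK" "mem q ?KK k (ev (v .: x .: Var) ?y)" for q k
      using prem[OF that(1), of k] that(2,3) x by (simp_all add: tr_And[OF C ok_Ex[OF A] e] c_def a_def)
    have "tr \<Gamma> p (dEx \<sigma> A) e a s"
      using prem'(2)[OF leq_refl k0] f L k0 s unfolding y by (simp add: mem_Prep1 k0_def)
    then have "tr \<Gamma> p B e (rep U \<bullet> x) v"
    proof (rule tr_ExE[OF _ A e a s B e _ v])
      fix q d assume q: "p \<sqsubseteq> q" and d: "d \<in> D \<sigma>" and
        hyp: "\<And>y r. y \<in> D (chl A) \<Longrightarrow> q \<sqsubseteq> r \<Longrightarrow> mem r (chl A) y s \<Longrightarrow> tr (\<sigma> # \<Gamma>) r A (d .: e) a y"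
      have ed: "env (d .: e) (\<sigma> # \<Gamma>)" using d e by simp
      have "tr (\<sigma> # \<Gamma>) q B' (d .: e) (rep U \<bullet> x) v"
      proof (rule 1[OF ed x v])
        fix r l assume r: "q \<sqsubseteq> r" and l: "l \<in> D ?K" and m: "mem r ?K l ?L"
        have "tr \<Gamma> r C e c (rep (fst_tm (chl C) (chl A)) \<bullet> l)"
          using prem'(1)[OF leq_trans[OF q r] app_in[OF f l]] mem_Prep2[OF mem_map[OF m l L f]]
            f L k0 s l app_in[OF f l] unfolding y by (simp add: fd)
        from liftC[OF e d c _ this]
        have "tr (\<sigma> # \<Gamma>) r C' (d .: e) c (rep (fst_tm (chl C) (chl A)) \<bullet> l)" using l by simp
        moreover have "tr (\<sigma> # \<Gamma>) r A (d .: e) a (rep (snd_tm (chl C) (chl A)) \<bullet> l)"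
          using hyp[OF snd_in[OF l] r] mem_map[OF m l L, of "rep (snd_tm (chl C) (chl A))" "chl A"]
          by (simp add: s_def)
        ultimately show "tr (\<sigma> # \<Gamma>) r (dAnd C' A) (d .: e) x l"
          using x l by (simp add: tr_And[OF C' A ed] W c_def a_def)
      qed
      \<comment> \<open>The realizer does not contain the element \<open>d\<close>, so the result
        holds for \<open>B\<close> in the original context.\<close>
      then show "tr \<Gamma> q B e (rep U \<bullet> x) v" by (rule liftB[OF e d _ v, rotated]) (use x in simp)
    qed (use x in simp)
    then show "tr \<Gamma> p B e (ev (x .: Var) (U \<cdot> Var 0)) v" by simp
  qed simp_all
qed

lemma ok_Top [simp]: "ok \<Gamma> dTop"
  by (simp add: dTop_def)

lemma ok_AllSt [simp]: "ok (\<sigma> # \<Gamma>) A \<Longrightarrow> ok \<Gamma> (dAllSt \<sigma> A)"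
  unfolding ok_def dAllSt_def Let_def by simp (erule okf_subst, simp add: numeral_eq_Suc)

lemma ok_ExSt [simp]: "ok (\<sigma> # \<Gamma>) A \<Longrightarrow> ok \<Gamma> (dExSt \<sigma> A)"
  unfolding ok_def dExSt_def by simp (erule okf_subst, simp add: numeral_eq_Suc)

lemma tr_AllSt:
  assumes "ok (\<sigma> # \<Gamma>) A" "env e \<Gamma>" "x \<in> D (\<sigma> \<Rrightarrow> wit A)" "y \<in> D (Pr \<sigma> (chl A))"
  defines "d \<equiv> rep (fst_tm \<sigma> (chl A)) \<bullet> y"
  shows "tr \<Gamma> p (dAllSt \<sigma> A) e x y \<longleftrightarrow>
    tr (\<sigma> # \<Gamma>) p A (d .: e) (x \<bullet> d) (rep (snd_tm \<sigma> (chl A)) \<bullet> y)"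
  using assms(2-4) app_in[OF assms(3)] unfolding tr_def d_def
  by (simp add: dAllSt_def Let_def) (simp add: frc_subst[OF assms(1)[unfolded ok_def]] numeral_2_eq_2)

lemma tr_ExSt:
  assumes "ok (\<sigma> # \<Gamma>) A" "env e \<Gamma>" "x \<in> D (Pr \<sigma> (wit A))" "y \<in> D (chl A)"
  shows "tr \<Gamma> p (dExSt \<sigma> A) e x y \<longleftrightarrow>
    tr (\<sigma> # \<Gamma>) p A (rep (fst_tm \<sigma> (wit A)) \<bullet> x .: e) (rep (snd_tm \<sigma> (wit A)) \<bullet> x) y"
  using assms(2-4) unfolding tr_def
  by (simp add: dExSt_def) (simp add: frc_subst[OF assms(1)[unfolded ok_def]] numeral_2_eq_2)

lemma tr_eqv_env:
  assumes "ok (\<sigma> # \<Gamma>) A" "env e \<Gamma>" "eqv p \<sigma> a b" "a \<in> D \<sigma>" "b \<in> D \<sigma>" "x \<in> D (wit A)" "y \<in> D (chl A)"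
  shows "tr (\<sigma> # \<Gamma>) p A (a .: e) x y \<longleftrightarrow> tr (\<sigma> # \<Gamma>) p A (b .: e) x y"
  unfolding tr_def
  by (rule frc_eqv[OF assms(1)[unfolded ok_def]]) (use assms in \<open>simp_all add: eqv_refl\<close>)

lemma tr_Top: "env e \<Gamma> \<Longrightarrow> x \<in> D TNat \<Longrightarrow> y \<in> D TNat \<Longrightarrow> tr \<Gamma> p dTop e x y"
  unfolding dTop_def by (simp add: tr_Int)

lemma Ent_TopI: "Ent \<Gamma> A dTop"
  by (rule Ent_single[of _ "zero_tm TNat" _ "zero_tm (chl A)"]) (simp_all add: tr_Top del: zero_tm.simps)

lemma Ent_Imp_Top:
  assumes "ok \<Gamma> A" "ok \<Gamma> B" "Ent \<Gamma> A B"
  shows "Ent \<Gamma> dTop (dImp A B)"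
  by (rule Ent_ImpI[OF ok_Top assms(1,2) Ent_trans[OF Ent_AndE2[OF ok_Top assms(1)] assms(3)]])

lemma Ent_And_cong:
  assumes "ok \<Gamma> A" "ok \<Gamma> A'" "ok \<Gamma> B" "ok \<Gamma> B'" "Ent \<Gamma> A A'" "Ent \<Gamma> B B'"
  shows "Ent \<Gamma> (dAnd A B) (dAnd A' B')"
  using assms by (meson Ent_AndI Ent_AndE1 Ent_AndE2 Ent_trans)

lemma Ent_Imp_cong:
  assumes A: "ok \<Gamma> A" "ok \<Gamma> A'" and B: "ok \<Gamma> B" "ok \<Gamma> B'" and "Ent \<Gamma> A' A" "Ent \<Gamma> B B'"
  shows "Ent \<Gamma> (dImp A B) (dImp A' B')"
proof (rule Ent_ImpI[OF ok_Imp[OF A(1) B(1)] A(2) B(2)])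
  have "Ent \<Gamma> (dAnd (dImp A B) A') B"
    using Ent_ImpE[OF A(1) B(1) Ent_AndE1[OF ok_Imp[OF A(1) B(1)] A(2)]]
      Ent_trans[OF Ent_AndE2[OF ok_Imp[OF A(1) B(1)] A(2)] assms(5)] by blast
  then show "Ent \<Gamma> (dAnd (dImp A B) A') B'" using Ent_trans assms(6) by blast
qed

lemma Ent_All_cong:
  assumes "ok (\<sigma> # \<Gamma>) A" "ok (\<sigma> # \<Gamma>) A'" "Ent (\<sigma> # \<Gamma>) A A'"
  shows "Ent \<Gamma> (dAll \<sigma> A) (dAll \<sigma> A')"
  by (rule Ent_AllI[OF assms(2,3)]) (simp_all add: tr_All[OF assms(1)])

text \<open>A sequence of challenges to \<open>A'\<close> is expanded to the concatenation of the
  challenges to \<open>A\<close> that its members cause. The element that answers all of these also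
  serves for \<open>A'\<close>.\<close>

lemma Ent_Ex_cong:
  assumes A: "ok (\<sigma> # \<Gamma>) A" "ok (\<sigma> # \<Gamma>) A'" and "Ent (\<sigma> # \<Gamma>) A A'"
  shows "Ent \<Gamma> (dEx \<sigma> A) (dEx \<sigma> A')"
proof -
  obtain U Y where R: "realizes (\<sigma> # \<Gamma>) A A' U Y" using assms(3) by (auto simp: Ent_def)
  note U = realizes_closed(1)[OF R] and Y = realizes_closed(2)[OF R] and 1 = realizes_tr[OF R]
  note ty [simp] = closed_has_type[OF U] closed_has_type[OF Y]
  note ev [simp] = ev_closed[OF U] ev_closed[OF Y]
  let ?y = "concat_tm (chl A') (chl A) \<cdot> (Y \<cdot> Var 1) \<cdot> Var 0"
  show ?thesis
  proof (rule Ent_single[of _ "U \<cdot> Var 0" _ ?y])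
    fix p e x v
    assume e: "env e \<Gamma>" and x: "x \<in> D (wit (dEx \<sigma> A))" and v: "v \<in> D (chl (dEx \<sigma> A'))"
      and *: "tr \<Gamma> p (dEx \<sigma> A) e x (ev (v .: x .: Var) ?y)"
    have x': "x \<in> D (wit A)" and v': "v \<in> D (Seq (chl A'))" using x v by simp_all
    note Ux = app_in[OF rep_closed_in[OF U] x'] and Yx = app_in[OF rep_closed_in[OF Y] x']
    have "tr \<Gamma> p (dEx \<sigma> A') e (rep U \<bullet> x) v"
    proof (rule tr_ExE[OF * A(1) e x' _ ok_Ex[OF A(2)] e _ v])
      fix q d assume q: "p \<sqsubseteq> q" and d: "d \<in> D \<sigma>" and hyp: "\<And>y r. y \<in> D (chl A) \<Longrightarrow> q \<sqsubseteq> r \<Longrightarrow>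
        mem r (chl A) y (ev (v .: x .: Var) ?y) \<Longrightarrow> tr (\<sigma> # \<Gamma>) r A (d .: e) x y"
      show "tr \<Gamma> q (dEx \<sigma> A') e (rep U \<bullet> x) v"
      proof (rule tr_ExI[OF A(2) e Ux v' d])
        fix y r assume y: "y \<in> D (chl A')" and r: "q \<sqsubseteq> r" and m: "mem r (chl A') y v"
        show "tr (\<sigma> # \<Gamma>) r A' (d .: e) (rep U \<bullet> x) y"
        proof (rule 1[OF _ x' y])
          fix r' z assume r': "r \<sqsubseteq> r'" and z: "z \<in> D (chl A)" and m': "mem r' (chl A) z (rep Y \<bullet> x \<bullet> y)"
          show "tr (\<sigma> # \<Gamma>) r' A (d .: e) x z"
            by (rule hyp[OF z leq_trans[OF r r']])
              (use mem_concat[OF mem_mono[OF m r'] m' y v' z Yx] in simp)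
        qed (use e d in simp)
      qed
    qed (use v' Yx Ux in simp_all)
    then show "tr \<Gamma> p (dEx \<sigma> A') e (ev (x .: Var) (U \<cdot> Var 0)) v" by simp
  qed simp_all
qed

section \<open>Connectives between internal formulas lose their computational content\<close>

lemma Int_And:
  assumes "okf \<Gamma> \<phi>" "okf \<Gamma> \<psi>"
  shows "Ent \<Gamma> (dAnd (dInt \<phi>) (dInt \<psi>)) (dInt (\<phi> \<^bold>\<and> \<psi>))"
    and "Ent \<Gamma> (dInt (\<phi> \<^bold>\<and> \<psi>)) (dAnd (dInt \<phi>) (dInt \<psi>))"
  by (rule Ent_single[of _ "zero_tm TNat" _ "pair_tm TNat TNat \<cdot> zero_tm TNat \<cdot> zero_tm TNat"],
      use assms in \<open>simp_all add: tr_And tr_Int del: zero_tm.simps\<close>)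
    (rule Ent_single[of _ "pair_tm TNat TNat \<cdot> zero_tm TNat \<cdot> zero_tm TNat" _ "zero_tm TNat"],
      use assms in \<open>simp_all add: tr_And tr_Int del: zero_tm.simps\<close>)

lemma Int_Imp1:
  assumes "okf \<Gamma> \<phi>" "okf \<Gamma> \<psi>"
  shows "Ent \<Gamma> (dImp (dInt \<phi>) (dInt \<psi>)) (dInt (\<phi> \<^bold>\<longrightarrow> \<psi>))"
proof (rule Ent_single[of _ Zero _ "pair_tm TNat TNat \<cdot> Zero \<cdot> Zero"])
  let ?F = "TNat \<Rrightarrow> TNat" and ?G = "TNat \<Rrightarrow> TNat \<Rrightarrow> Seq TNat"
  fix p e x v
  assume e: "env e \<Gamma>" and x: "x \<in> D (wit (dImp (dInt \<phi>) (dInt \<psi>)))" and v: "v \<in> D (chl (dInt (\<phi> \<^bold>\<longrightarrow> \<psi>)))"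
    and *: "tr \<Gamma> p (dImp (dInt \<phi>) (dInt \<psi>)) e x (ev (v .: x .: Var) (pair_tm TNat TNat \<cdot> Zero \<cdot> Zero))"
  have x': "rep (fst_tm ?F ?G) \<bullet> x \<in> D ?F" using x by simp
  from * show "tr \<Gamma> p (dInt (\<phi> \<^bold>\<longrightarrow> \<psi>)) e (ev (x .: Var) Zero) v"
    using assms e x v frc_mono[of \<Gamma> _ e \<phi>] app_in[OF x']
    by (subst (asm) tr_Imp) (simp_all add: tr_Int)
qed simp_all

text \<open>The sequence of challenges to the premise must be nonempty: over an empty sequence the
  bounded quantifier holds trivially and tells nothing about \<open>\<phi>\<close>. As the
  challenges are dummies, a single zero does.\<close>

lemma Int_Imp2:
  assumes \<phi>: "okf \<Gamma> \<phi>" "okf \<Gamma> \<psi>"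
  shows "Ent \<Gamma> (dInt (\<phi> \<^bold>\<longrightarrow> \<psi>)) (dImp (dInt \<phi>) (dInt \<psi>))"
proof -
  let ?F = "TNat \<Rrightarrow> TNat" and ?G = "TNat \<Rrightarrow> TNat \<Rrightarrow> Seq TNat"
  let ?g = "Prep TNat \<cdot> Zero \<cdot> Empty TNat"
  let ?u = "pair_tm ?F ?G \<cdot> LAM [TNat] TNat Zero \<cdot> LAM [TNat] TNat (LAM [TNat, TNat] TNat ?g)"
  show ?thesis
  proof (rule Ent_single[of _ ?u _ Zero])
    fix p e x v
    assume e: "env e \<Gamma>" and x: "x \<in> D (wit (dInt (\<phi> \<^bold>\<longrightarrow> \<psi>)))" and v0: "v \<in> D (chl (dImp (dInt \<phi>) (dInt \<psi>)))"
      and *: "tr \<Gamma> p (dInt (\<phi> \<^bold>\<longrightarrow> \<psi>)) e x (ev (v .: x .: Var) Zero)"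
    have v: "v \<in> D (Pr TNat TNat)" using v0 by simp
    have ex: "env (x .: Var) [TNat]" using x by simp
    have f: "ev (x .: Var) (LAM [TNat] TNat Zero) \<in> D ?F"
      and g: "ev (x .: Var) (LAM [TNat] TNat (LAM [TNat, TNat] TNat ?g)) \<in> D ?G"
      by (rule ev_in[OF _ ex], simp)+
    have ga: "ev (x .: Var) (LAM [TNat] TNat (LAM [TNat, TNat] TNat ?g)) \<bullet> a \<bullet> c = ev Var ?g"
      if "a \<in> D TNat" "c \<in> D TNat" for a c
      using ev_LAM[OF _ ex that(1), of "LAM [TNat, TNat] TNat ?g" "TNat \<Rrightarrow> Seq TNat"]
        ev_LAM[of TNat "[TNat, TNat]" ?g "Seq TNat" "a .: x .: Var" c] that x by simp
    have u: "ev (x .: Var) ?u \<in> D (wit (dImp (dInt \<phi>) (dInt \<psi>)))" using f g by simp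
    show "tr \<Gamma> p (dImp (dInt \<phi>) (dInt \<psi>)) e (ev (x .: Var) ?u) v"
      unfolding tr_Imp[OF ok_Int[OF \<phi>(1)] ok_Int[OF \<phi>(2)] e u v0]
    proof (intro allI impI)
      fix q assume q: "p \<sqsubseteq> q" and "\<forall>d\<in>D (chl (dInt \<phi>)). \<forall>r. q \<sqsubseteq> r \<longrightarrow> mem r (chl (dInt \<phi>)) d
        (rep (snd_tm (wit (dInt \<phi>) \<Rrightarrow> wit (dInt \<psi>)) (wit (dInt \<phi>) \<Rrightarrow> chl (dInt \<psi>) \<Rrightarrow> Seq (chl (dInt \<phi>)))) \<bullet>
          ev (x .: Var) ?u \<bullet> (rep (fst_tm (wit (dInt \<phi>)) (chl (dInt \<psi>))) \<bullet> v) \<bullet> (rep (snd_tm (wit (dInt \<phi>)) (chl (dInt \<psi>))) \<bullet> v)) \<longrightarrow>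
        tr \<Gamma> r (dInt \<phi>) e (rep (fst_tm (wit (dInt \<phi>)) (chl (dInt \<psi>))) \<bullet> v) d"
      then have "frc \<Gamma> q e \<phi>"
        using f g v ga \<phi> e leq_refl mem_single[OF consts_in(1)] by (simp add: tr_Int) (meson consts_in(1) leq_refl)
      then show "tr \<Gamma> q (dInt \<psi>) e (rep (fst_tm (wit (dInt \<phi>) \<Rrightarrow> wit (dInt \<psi>)) (wit (dInt \<phi>) \<Rrightarrow> chl (dInt \<psi>) \<Rrightarrow> Seq (chl (dInt \<phi>)))) \<bullet>
          ev (x .: Var) ?u \<bullet> (rep (fst_tm (wit (dInt \<phi>)) (chl (dInt \<psi>))) \<bullet> v)) (rep (snd_tm (wit (dInt \<phi>)) (chl (dInt \<psi>))) \<bullet> v)"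
        using * q f g v \<phi> e x app_in[OF f] by (simp add: tr_Int)
    qed
  qed simp_all
qed

lemma Int_All:
  assumes "okf (\<sigma> # \<Gamma>) \<phi>"
  shows "Ent \<Gamma> (dAll \<sigma> (dInt \<phi>)) (dInt (Forall \<sigma> \<phi>))"
    and "Ent \<Gamma> (dInt (Forall \<sigma> \<phi>)) (dAll \<sigma> (dInt \<phi>))"
  by (rule Ent_same; use assms in \<open>simp add: tr_All tr_Int\<close>)+

text \<open>The existential object is challenged by a singleton, since an empty sequence would say
  nothing about the element.\<close>

lemma Int_Ex1:
  assumes \<phi>: "okf (\<sigma> # \<Gamma>) \<phi>"
  shows "Ent \<Gamma> (dEx \<sigma> (dInt \<phi>)) (dInt (Exists \<sigma> \<phi>))"
proof (rule Ent_single[of _ Zero _ "Prep TNat \<cdot> Zero \<cdot> Empty TNat"])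
  fix p e x v
  assume e: "env e \<Gamma>" and x: "x \<in> D (wit (dEx \<sigma> (dInt \<phi>)))" and v: "v \<in> D (chl (dInt (Exists \<sigma> \<phi>)))"
    and *: "tr \<Gamma> p (dEx \<sigma> (dInt \<phi>)) e x (ev (v .: x .: Var) (Prep TNat \<cdot> Zero \<cdot> Empty TNat))"
  have ex: "okf \<Gamma> (Exists \<sigma> \<phi>)" using \<phi> by simp
  show "tr \<Gamma> p (dInt (Exists \<sigma> \<phi>)) e (ev (x .: Var) Zero) v"
  proof (rule tr_ExE[OF * ok_Int[OF \<phi>] e _ _ ok_Int[OF ex] e _ v])
    fix q d assume d: "d \<in> D \<sigma>" and hyp: "\<And>y r. y \<in> D (chl (dInt \<phi>)) \<Longrightarrow> q \<sqsubseteq> r \<Longrightarrow>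
      mem r (chl (dInt \<phi>)) y (ev (v .: x .: Var) (Prep TNat \<cdot> Zero \<cdot> Empty TNat)) \<Longrightarrow> tr (\<sigma> # \<Gamma>) r (dInt \<phi>) (d .: e) x y"
    have "frc (\<sigma> # \<Gamma>) q (d .: e) \<phi>"
      using hyp[OF _ leq_refl, of "rep Zero"] mem_single[OF consts_in(1)] \<phi> e d x by (simp add: tr_Int)
    then show "tr \<Gamma> q (dInt (Exists \<sigma> \<phi>)) e (ev (x .: Var) Zero) v"
      using frc_ExI[OF \<phi> e d] ex e v by (simp add: tr_Int)
  qed (use x in simp_all)
qed simp_all

lemma Int_Ex2:
  assumes \<phi>: "okf (\<sigma> # \<Gamma>) \<phi>"
  shows "Ent \<Gamma> (dInt (Exists \<sigma> \<phi>)) (dEx \<sigma> (dInt \<phi>))"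
proof (rule Ent_single[of _ Zero _ Zero])
  fix p e x v
  assume e: "env e \<Gamma>" and x: "x \<in> D (wit (dInt (Exists \<sigma> \<phi>)))" and v: "v \<in> D (chl (dEx \<sigma> (dInt \<phi>)))"
    and "tr \<Gamma> p (dInt (Exists \<sigma> \<phi>)) e x (ev (v .: x .: Var) Zero)"
  then have *: "frc \<Gamma> p e (Exists \<sigma> \<phi>)" using \<phi> by (simp add: tr_Int)
  show "tr \<Gamma> p (dEx \<sigma> (dInt \<phi>)) e (ev (x .: Var) Zero) v"
    unfolding tr_def
  proof (rule frc_ExE[OF * \<phi> e ok_Ex[OF ok_Int[OF \<phi>], unfolded ok_def]], goal_cases)
    case 1
    show ?case using e v by simp
  next
    case (2 q d)
    have "tr \<Gamma> q (dEx \<sigma> (dInt \<phi>)) e (ev (x .: Var) Zero) v"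
    proof (rule tr_ExI[OF ok_Int[OF \<phi>] e _ _ 2(2)])
      fix y r assume "y \<in> D (chl (dInt \<phi>))" "q \<sqsubseteq> r"
      then show "tr (\<sigma> # \<Gamma>) r (dInt \<phi>) (d .: e) (ev (x .: Var) Zero) y"
        using frc_mono[OF 2(3)] \<phi> e 2(2) by (simp add: tr_Int)
    qed (use v in simp_all)
    then show ?case unfolding tr_def .
  qed
qed simp_all

section \<open>External quantifiers versus their relativized definitions\<close>

text \<open>An element witnesses its own standardness, so the implication is evaluated at the
  element that the challenge contains.\<close>

lemma AllSt1:
  assumes A: "ok (\<sigma> # \<Gamma>) A"
  shows "Ent \<Gamma> (dAll \<sigma> (dImp (dSt \<sigma> (Var 0)) A)) (dAllSt \<sigma> A)"
proof -
  let ?F = "\<sigma> \<Rrightarrow> wit A" and ?G = "\<sigma> \<Rrightarrow> chl A \<Rrightarrow> Seq TNat"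
  have S: "ok (\<sigma> # \<Gamma>) (dSt \<sigma> (Var 0))" by simp
  show ?thesis
  proof (rule Ent_single[of _ "fst_tm ?F ?G \<cdot> Var 0" _ "Var 0"])
    fix p e x v
    assume e: "env e \<Gamma>" and x: "x \<in> D (wit (dAll \<sigma> (dImp (dSt \<sigma> (Var 0)) A)))" and v: "v \<in> D (chl (dAllSt \<sigma> A))"
      and *: "tr \<Gamma> p (dAll \<sigma> (dImp (dSt \<sigma> (Var 0)) A)) e x (ev (v .: x .: Var) (Var 0))"
    have x': "x \<in> D (Pr ?F ?G)" and v': "v \<in> D (Pr \<sigma> (chl A))" using x v by simp_all
    let ?d = "rep (fst_tm \<sigma> (chl A)) \<bullet> v"
    have "tr (\<sigma> # \<Gamma>) p (dImp (dSt \<sigma> (Var 0)) A) (?d .: e) x v"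
      using * x v v' e by (simp add: tr_All[OF ok_Imp[OF S A]])
    then have "tr (\<sigma> # \<Gamma>) p A (?d .: e) (rep (fst_tm ?F ?G) \<bullet> x \<bullet> ?d) (rep (snd_tm \<sigma> (chl A)) \<bullet> v)"
      using e v' x' by (subst (asm) tr_Imp[OF S A]) (simp_all add: tr_St eqv_refl)
    then show "tr \<Gamma> p (dAllSt \<sigma> A) e (ev (x .: Var) (fst_tm ?F ?G \<cdot> Var 0)) v"
      using tr_AllSt[OF A e fst_in[OF x'] v'] by simp
  qed simp_all
qed

text \<open>The challenge supplies a standard object that is only forced equal to the quantified
  element; the matrix is transported along this equality. The singleton sequence guarantees that the
  equality is among the premises.\<close>

lemma AllSt2:
  assumes A: "ok (\<sigma> # \<Gamma>) A"
  shows "Ent \<Gamma> (dAllSt \<sigma> A) (dAll \<sigma> (dImp (dSt \<sigma> (Var 0)) A))"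
proof -
  let ?F = "\<sigma> \<Rrightarrow> wit A" and ?G = "\<sigma> \<Rrightarrow> chl A \<Rrightarrow> Seq TNat"
  let ?g = "Prep TNat \<cdot> Zero \<cdot> Empty TNat"
  let ?u = "pair_tm ?F ?G \<cdot> Var 0 \<cdot> LAM [?F] \<sigma> (LAM [\<sigma>, ?F] (chl A) ?g)"
  let ?S = "dSt \<sigma> (Var 0)"
  have S: "ok (\<sigma> # \<Gamma>) ?S" by simp
  show ?thesis
  proof (rule Ent_single[of _ ?u _ "Var 0"])
    fix p e x v
    assume e: "env e \<Gamma>" and x0: "x \<in> D (wit (dAllSt \<sigma> A))" and v0: "v \<in> D (chl (dAll \<sigma> (dImp ?S A)))"
      and *: "tr \<Gamma> p (dAllSt \<sigma> A) e x (ev (v .: x .: Var) (Var 0))"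
    have x: "x \<in> D ?F" and v: "v \<in> D (Pr \<sigma> (chl A))" using x0 v0 by simp_all
    have ex: "env (x .: Var) [?F]" using x by simp
    have g: "ev (x .: Var) (LAM [?F] \<sigma> (LAM [\<sigma>, ?F] (chl A) ?g)) \<in> D ?G"
      by (rule ev_in[OF _ ex]) simp
    have ga: "ev (x .: Var) (LAM [?F] \<sigma> (LAM [\<sigma>, ?F] (chl A) ?g)) \<bullet> a \<bullet> c = ev Var ?g"
      if "a \<in> D \<sigma>" "c \<in> D (chl A)" for a c
      using ev_LAM[OF _ ex that(1), of "LAM [\<sigma>, ?F] (chl A) ?g" "chl A \<Rrightarrow> Seq TNat"]
        ev_LAM[of "chl A" "[\<sigma>, ?F]" ?g "Seq TNat" "a .: x .: Var" c] that x by simp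
    let ?a = "rep (fst_tm \<sigma> (chl A)) \<bullet> v" and ?c = "rep (snd_tm \<sigma> (chl A)) \<bullet> v"
    have A': "tr (\<sigma> # \<Gamma>) p A (?a .: e) (x \<bullet> ?a) ?c" using * tr_AllSt[OF A e x v] by simp
    have "tr (\<sigma> # \<Gamma>) p (dImp ?S A) (d .: e) (ev (x .: Var) ?u) v" if d: "d \<in> D \<sigma>" for d
    proof (subst tr_Imp[OF S A])
      show "\<forall>q. p \<sqsubseteq> q \<longrightarrow>
        (\<forall>da\<in>D (chl ?S). \<forall>r. q \<sqsubseteq> r \<longrightarrow> mem r (chl ?S) da (rep (snd_tm (wit ?S \<Rrightarrow> wit A) (wit ?S \<Rrightarrow> chl A \<Rrightarrow> Seq (chl ?S))) \<bullet>
            ev (x .: Var) ?u \<bullet> (rep (fst_tm (wit ?S) (chl A)) \<bullet> v) \<bullet> (rep (snd_tm (wit ?S) (chl A)) \<bullet> v)) \<longrightarrow>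
          tr (\<sigma> # \<Gamma>) r ?S (d .: e) (rep (fst_tm (wit ?S) (chl A)) \<bullet> v) da) \<longrightarrow>
        tr (\<sigma> # \<Gamma>) q A (d .: e) (rep (fst_tm (wit ?S \<Rrightarrow> wit A) (wit ?S \<Rrightarrow> chl A \<Rrightarrow> Seq (chl ?S))) \<bullet>
            ev (x .: Var) ?u \<bullet> (rep (fst_tm (wit ?S) (chl A)) \<bullet> v)) (rep (snd_tm (wit ?S) (chl A)) \<bullet> v)"
        (is "\<forall>q. p \<sqsubseteq> q \<longrightarrow> ?H q \<longrightarrow> ?C q")
      proof (intro allI impI)
        fix q assume q: "p \<sqsubseteq> q" and "?H q"
        then have "\<forall>da\<in>D TNat. \<forall>r. q \<sqsubseteq> r \<longrightarrow> mem r TNat da (ev Var ?g) \<longrightarrow> eqv r \<sigma> ?a d"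
          using d e x g v ga by (simp add: tr_St)
        from this[rule_format, OF consts_in(1) leq_refl]
        have "eqv q \<sigma> ?a d" by (simp add: mem_single)
        then have "tr (\<sigma> # \<Gamma>) q A (d .: e) (x \<bullet> ?a) ?c"
          using tr_mono[OF A' q] tr_eqv_env[OF A e _ _ d] v app_in[OF x] by simp
        then show "?C q" using x g by simp
      qed
    qed (use e d x g v in simp_all)
    moreover have "ev (x .: Var) ?u \<in> D (wit (dImp ?S A))" using x g by simp
    ultimately show "tr \<Gamma> p (dAll \<sigma> (dImp ?S A)) e (ev (x .: Var) ?u) v"
      using tr_All[OF ok_Imp[OF S A] e] v by simp
  qed simp_all
qed

text \<open>The element found may differ from the stored standard object, but the standardness
  clause forces the two equal, and the matrix is transported to the stored object.\<close>

lemma ExSt1: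
  assumes A: "ok (\<sigma> # \<Gamma>) A"
  shows "Ent \<Gamma> (dEx \<sigma> (dAnd (dSt \<sigma> (Var 0)) A)) (dExSt \<sigma> A)"
proof -
  let ?S = "dSt \<sigma> (Var 0)" and ?K = "Pr TNat (chl A)"
  let ?y = "Prep ?K \<cdot> (pair_tm TNat (chl A) \<cdot> Zero \<cdot> Var 0) \<cdot> Empty ?K"
  have S: "ok (\<sigma> # \<Gamma>) ?S" by simp
  show ?thesis
  proof (rule Ent_single[of _ "Var 0" _ ?y])
    fix p e x v
    assume e: "env e \<Gamma>" and x0: "x \<in> D (wit (dEx \<sigma> (dAnd ?S A)))" and v0: "v \<in> D (chl (dExSt \<sigma> A))"
      and *: "tr \<Gamma> p (dEx \<sigma> (dAnd ?S A)) e x (ev (v .: x .: Var) ?y)"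
    have x: "x \<in> D (Pr \<sigma> (wit A))" and v: "v \<in> D (chl A)" using x0 v0 by simp_all
    have "tr \<Gamma> p (dExSt \<sigma> A) e x v"
    proof (rule tr_ExE[OF * ok_And[OF S A] e _ _ ok_ExSt[OF A] e _ v0])
      fix q d assume d: "d \<in> D \<sigma>" and hyp: "\<And>y r. y \<in> D (chl (dAnd ?S A)) \<Longrightarrow> q \<sqsubseteq> r \<Longrightarrow>
        mem r (chl (dAnd ?S A)) y (ev (v .: x .: Var) ?y) \<Longrightarrow> tr (\<sigma> # \<Gamma>) r (dAnd ?S A) (d .: e) x y"
      have "tr (\<sigma> # \<Gamma>) q (dAnd ?S A) (d .: e) x (rep (pair_tm TNat (chl A)) \<bullet> rep Zero \<bullet> v)"
        by (rule hyp[OF _ leq_refl]) (use v in \<open>simp_all add: mem_single\<close>)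
      then have "eqv q \<sigma> (rep (fst_tm \<sigma> (wit A)) \<bullet> x) d"
        "tr (\<sigma> # \<Gamma>) q A (d .: e) (rep (snd_tm \<sigma> (wit A)) \<bullet> x) v"
        using x v d e by (simp_all add: tr_And[OF S A] tr_St)
      then show "tr \<Gamma> q (dExSt \<sigma> A) e x v"
        using x v d tr_eqv_env[OF A e] by (simp add: tr_ExSt[OF A e])
    qed (use x v in simp_all)
    then show "tr \<Gamma> p (dExSt \<sigma> A) e (ev (x .: Var) (Var 0)) v" by simp
  qed simp_all
qed

text \<open>The stored standard object is itself chosen as the element, so the standardness clause
  holds by reflexivity.\<close>

lemma ExSt2:
  assumes A: "ok (\<sigma> # \<Gamma>) A"
  shows "Ent \<Gamma> (dExSt \<sigma> A) (dEx \<sigma> (dAnd (dSt \<sigma> (Var 0)) A))"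
proof -
  let ?S = "dSt \<sigma> (Var 0)" and ?K = "Pr TNat (chl A)"
  let ?y = "map_tm ?K (chl A) \<cdot> snd_tm TNat (chl A) \<cdot> Var 0"
  have S: "ok (\<sigma> # \<Gamma>) ?S" by simp
  show ?thesis
  proof (rule EntI[of _ "Var 0" _ ?y])
    fix p e x v
    assume e: "env e \<Gamma>" and x0: "x \<in> D (wit (dExSt \<sigma> A))" and v0: "v \<in> D (chl (dEx \<sigma> (dAnd ?S A)))"
      and prem: "\<And>q c. p \<sqsubseteq> q \<Longrightarrow> c \<in> D (chl (dExSt \<sigma> A)) \<Longrightarrow>
        mem q (chl (dExSt \<sigma> A)) c (ev (v .: x .: Var) ?y) \<Longrightarrow> tr \<Gamma> q (dExSt \<sigma> A) e x c"
    have x: "x \<in> D (Pr \<sigma> (wit A))" and v: "v \<in> D (Seq ?K)" using x0 v0 by simp_all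
    have "tr \<Gamma> p (dEx \<sigma> (dAnd ?S A)) e x v"
    proof (rule tr_ExI[OF ok_And[OF S A] e _ _ fst_in[OF x]])
      fix l q assume l0: "l \<in> D (chl (dAnd ?S A))" and q: "p \<sqsubseteq> q" and m0: "mem q (chl (dAnd ?S A)) l v"
      have l: "l \<in> D ?K" and m: "mem q ?K l v" using l0 m0 by simp_all
      have "tr \<Gamma> q (dExSt \<sigma> A) e x (rep (snd_tm TNat (chl A)) \<bullet> l)"
        by (rule prem[OF q]) (use l mem_map[OF m l v] in simp_all)
      then show "tr (\<sigma> # \<Gamma>) q (dAnd ?S A) (rep (fst_tm \<sigma> (wit A)) \<bullet> x .: e) x l"
        using x l e by (simp add: tr_And[OF S A] tr_St tr_ExSt[OF A] eqv_refl)
    qed (use x v in simp_all)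
    then show "tr \<Gamma> p (dEx \<sigma> (dAnd ?S A)) e (ev (x .: Var) (Var 0)) v" by simp
  qed simp_all
qed

end

section \<open>The interpretation and its soundness\<close>

primrec interp :: "fm \<Rightarrow> dob" where
  "interp (Eq \<sigma> s t) = dInt (Eq \<sigma> s t)"
| "interp (St \<sigma> t) = dSt \<sigma> t"
| "interp Bot = dInt Bot"
| "interp (\<phi> \<^bold>\<and> \<psi>) = dAnd (interp \<phi>) (interp \<psi>)"
| "interp (\<phi> \<^bold>\<or> \<psi>) = dOr (interp \<phi>) (interp \<psi>)"
| "interp (\<phi> \<^bold>\<longrightarrow> \<psi>) = dImp (interp \<phi>) (interp \<psi>)"
| "interp (Forall \<sigma> \<phi>) = dAll \<sigma> (interp \<phi>)"
| "interp (Exists \<sigma> \<phi>) = dEx \<sigma> (interp \<phi>)"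

primrec hyps :: "fm list \<Rightarrow> dob" where
  "hyps [] = dTop"
| "hyps (h # H) = dAnd (hyps H) (interp h)"

lemma interp_subst_types [simp]:
  "wit (interp (subst s \<phi>)) = wit (interp \<phi>) \<and> chl (interp (subst s \<phi>)) = chl (interp \<phi>)"
  by (induction \<phi> arbitrary: s) auto

lemmas [simp] = interp_subst_types[THEN conjunct1] interp_subst_types[THEN conjunct2]

text \<open>Indices 0 and 1 of a matrix are the challenge and the witness, so a substitution of the
  parameters is lifted twice. The translation itself adds only closed terms and renamings of
  variables.\<close>

lemma mat_interp_subst: "mat (interp (subst s \<phi>)) = subst (up (up s)) (mat (interp \<phi>))"
  by (induction \<phi> arbitrary: s)
    (simp_all add: dInt_def dSt_def dAnd_def dOr_def dImp_def dAll_def dEx_def Let_def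
      weaken_def[abs_def] numeral_eq_Suc)

context model
begin

lemma ok_interp [simp]: "wff \<Gamma> \<phi> \<Longrightarrow> ok \<Gamma> (interp \<phi>)"
  by (induction \<phi> arbitrary: \<Gamma>) auto

lemma tr_interp_subst:
  assumes "wff \<Gamma>' \<phi>" "\<forall>i<length \<Gamma>'. has_type \<Gamma> (s i) (\<Gamma>' ! i)" "env e \<Gamma>"
    and "x \<in> D (wit (interp \<phi>))" "y \<in> D (chl (interp \<phi>))"
  shows "tr \<Gamma> p (interp (subst s \<phi>)) e x y \<longleftrightarrow> tr \<Gamma>' p (interp \<phi>) (\<lambda>n. ev e (s n)) x y"
proof -
  have "\<forall>i<length (chl (interp \<phi>) # wit (interp \<phi>) # \<Gamma>').
      has_type (chl (interp \<phi>) # wit (interp \<phi>) # \<Gamma>) (up (up s) i) ((chl (interp \<phi>) # wit (interp \<phi>) # \<Gamma>') ! i)"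
    using assms(2) has_type_shift[OF has_type_shift] by simp
  then show ?thesis
    using assms(3-5) unfolding tr_def mat_interp_subst
    by (simp add: frc_subst[OF ok_interp[OF assms(1), unfolded ok_def]] ev_subst)
qed

lemma tr_interp_inst:
  assumes "wff (\<sigma> # \<Gamma>) \<phi>" "has_type \<Gamma> t \<sigma>" "env e \<Gamma>"
    and "x \<in> D (wit (interp \<phi>))" "y \<in> D (chl (interp \<phi>))"
  shows "tr \<Gamma> p (interp (inst t \<phi>)) e x y \<longleftrightarrow> tr (\<sigma> # \<Gamma>) p (interp \<phi>) (ev e t .: e) x y"
  using assms by (subst tr_interp_subst[of "\<sigma> # \<Gamma>"]) simp_all

lemma tr_interp_shift:
  assumes "wff \<Gamma> \<phi>" "env e \<Gamma>" "d \<in> D \<sigma>"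
    and "x \<in> D (wit (interp \<phi>))" "y \<in> D (chl (interp \<phi>))"
  shows "tr (\<sigma> # \<Gamma>) p (interp (shift \<phi>)) (d .: e) x y \<longleftrightarrow> tr \<Gamma> p (interp \<phi>) e x y"
  using assms by (subst tr_interp_subst[of \<Gamma>]) simp_all

lemma ok_hyps [simp]: "\<forall>h\<in>set H. wff \<Gamma> h \<Longrightarrow> ok \<Gamma> (hyps H)"
  by (induction H) auto

lemma hyps_shift_types [simp]:
  "wit (hyps (map shift H)) = wit (hyps H)" "chl (hyps (map shift H)) = chl (hyps H)"
  by (induction H) simp_all

lemma wff_shift: "wff \<Gamma> \<phi> \<Longrightarrow> wff (\<sigma> # \<Gamma>) (shift \<phi>)"
  by (erule wff_subst) simp

lemma tr_hyps_shift:
  assumes "\<forall>h\<in>set H. wff \<Gamma> h" "env e \<Gamma>" "d \<in> D \<sigma>"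
    and "x \<in> D (wit (hyps H))" "y \<in> D (chl (hyps H))"
  shows "tr (\<sigma> # \<Gamma>) p (hyps (map shift H)) (d .: e) x y \<longleftrightarrow> tr \<Gamma> p (hyps H) e x y"
  using assms
proof (induction H arbitrary: x y)
  case Nil
  then show ?case by (simp add: tr_Top)
next
  case (Cons h H)
  have ed: "env (d .: e) (\<sigma> # \<Gamma>)" using Cons.prems by simp
  have ok: "ok (\<sigma> # \<Gamma>) (hyps (map shift H))" "ok (\<sigma> # \<Gamma>) (interp (shift h))"
    "ok \<Gamma> (hyps H)" "ok \<Gamma> (interp h)"
    using Cons.prems wff_shift by auto
  have xy: "x \<in> D (Pr (wit (hyps H)) (wit (interp h)))" "y \<in> D (Pr (chl (hyps H)) (chl (interp h)))"
    using Cons.prems by simp_all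
  have "tr (\<sigma> # \<Gamma>) p (dAnd (hyps (map shift H)) (interp (shift h))) (d .: e) x y \<longleftrightarrow>
    tr \<Gamma> p (dAnd (hyps H) (interp h)) e x y"
    using xy Cons.prems(1-3)
    by (subst tr_And[OF ok(1,2) ed], simp, simp, subst tr_And[OF ok(3,4) Cons.prems(2)], simp, simp)
      (simp del: weaken_Suc_0 add: Cons.IH tr_interp_shift)
  then show ?case unfolding list.map hyps.simps .
qed

lemma Ent_hyp:
  assumes "\<phi> \<in> set H" "\<forall>h\<in>set H. wff \<Gamma> h"
  shows "Ent \<Gamma> (hyps H) (interp \<phi>)"
  using assms
proof (induction H)
  case (Cons h H)
  have ok: "ok \<Gamma> (hyps H)" "ok \<Gamma> (interp h)" using Cons.prems by simp_all
  show ?case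
  proof (cases "\<phi> = h")
    case True
    then show ?thesis using Ent_AndE2[OF ok] by simp
  next
    case False
    then show ?thesis using Cons Ent_trans[OF Ent_AndE1[OF ok]] by simp
  qed
qed simp

text \<open>Each rule has its lemma on entailment. Axioms must be realized in all contexts because a
  derivation may use them below quantifiers; the side conditions of the quantifier lemmas come from
  the invariance of truth under shifting and instantiation.\<close>

theorem soundness:
  assumes "derives L A \<Gamma> H \<phi>" "\<forall>h\<in>set H. wff \<Gamma> h"
    and A: "\<And>\<Gamma> \<phi>. \<phi> \<in> A \<Longrightarrow> wff \<Gamma> \<phi> \<Longrightarrow> Ent \<Gamma> dTop (interp \<phi>)"
  shows "Ent \<Gamma> (hyps H) (interp \<phi>)"
  using assms(1,2)
proof (induction rule: derives.induct)
  case (Axiom \<phi> \<Gamma> H)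
  show ?case by (rule Ent_trans[OF Ent_TopI A[OF Axiom.hyps(1,2)]])
next
  case (Hyp \<phi> H \<Gamma>)
  show ?case by (rule Ent_hyp[OF Hyp.hyps(1) Hyp.prems])
next
  case (BotE \<Gamma> H \<phi>)
  show ?case
    using Ent_trans[OF BotE.IH[OF BotE.prems]] Ent_Bot[OF ok_interp[OF BotE.hyps(2)]] by simp
next
  case (AndI \<Gamma> H \<phi> \<psi>)
  show ?case
    using Ent_AndI[OF ok_interp ok_interp AndI.IH] derives_wff AndI.hyps AndI.prems by simp
next
  case (AndE1 \<Gamma> H \<phi> \<psi>)
  then have "wff \<Gamma> \<phi>" "wff \<Gamma> \<psi>" using derives_wff[OF AndE1.hyps] by simp_all
  then show ?case
    by (intro Ent_trans[OF AndE1.IH[OF AndE1.prems, unfolded interp.simps] Ent_AndE1] ok_interp)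
next
  case (AndE2 \<Gamma> H \<phi> \<psi>)
  then have "wff \<Gamma> \<phi>" "wff \<Gamma> \<psi>" using derives_wff[OF AndE2.hyps] by simp_all
  then show ?case
    by (intro Ent_trans[OF AndE2.IH[OF AndE2.prems, unfolded interp.simps] Ent_AndE2] ok_interp)
next
  case (OrI1 \<Gamma> H \<phi> \<psi>)
  have "wff \<Gamma> \<phi>" using derives_wff[OF OrI1.hyps(1)] .
  then show ?case
    using Ent_trans[OF OrI1.IH[OF OrI1.prems] Ent_OrI1[OF ok_interp ok_interp]] OrI1.hyps by simp
next
  case (OrI2 \<Gamma> H \<psi> \<phi>)
  have "wff \<Gamma> \<psi>" using derives_wff[OF OrI2.hyps(1)] .
  then show ?case
    using Ent_trans[OF OrI2.IH[OF OrI2.prems] Ent_OrI2[OF ok_interp ok_interp]] OrI2.hyps by simp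
next
  case (OrE \<Gamma> H \<phi> \<psi> \<chi>)
  have w: "wff \<Gamma> \<phi>" "wff \<Gamma> \<psi>" "wff \<Gamma> \<chi>"
    using derives_wff[OF OrE.hyps(1)] derives_wff[OF OrE.hyps(2)] by simp_all
  have "Ent \<Gamma> (dAnd (hyps H) (interp \<phi>)) (interp \<chi>)" "Ent \<Gamma> (dAnd (hyps H) (interp \<psi>)) (interp \<chi>)"
    using OrE.IH(2,3) OrE.prems w by simp_all
  from Ent_OrE[OF ok_hyps[OF OrE.prems] ok_interp[OF w(1)] ok_interp[OF w(2)] ok_interp[OF w(3)] this]
  show ?case
    using Ent_trans[OF Ent_AndI[OF ok_hyps[OF OrE.prems] _ Ent_refl OrE.IH(1)[OF OrE.prems]]] w by simp
next
  case (ImpI \<Gamma> \<phi> H \<psi>)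
  have "Ent \<Gamma> (dAnd (hyps H) (interp \<phi>)) (interp \<psi>)" using ImpI by simp
  moreover have "wff \<Gamma> \<psi>" using derives_wff[OF ImpI.hyps(3)] .
  ultimately show ?case using Ent_ImpI ok_hyps[OF ImpI.prems] ImpI.hyps(1) by simp
next
  case (ImpE \<Gamma> H \<phi> \<psi>)
  then have w: "wff \<Gamma> \<phi>" "wff \<Gamma> \<psi>" using derives_wff[OF ImpE.hyps(1)] by simp_all
  show ?case
    by (rule Ent_ImpE[OF ok_interp[OF w(1)] ok_interp[OF w(2)] _ ImpE.IH(2)[OF ImpE.prems]])
      (use ImpE in simp)
next
  case (AllI \<sigma> \<Gamma> H \<phi>)
  have "Ent (\<sigma> # \<Gamma>) (hyps (map shift H)) (interp \<phi>)"
    using AllI.IH AllI.prems wff_shift by simp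
  then show ?case
    unfolding interp.simps
    by (rule Ent_AllI[OF ok_interp[OF derives_wff[OF AllI.hyps]]])
      (simp_all add: tr_hyps_shift[OF AllI.prems])
next
  case (AllE \<Gamma> H \<sigma> \<phi> t)
  have w: "wff (\<sigma> # \<Gamma>) \<phi>" using derives_wff[OF AllE.hyps(1)] by simp
  have "Ent \<Gamma> (dAll \<sigma> (interp \<phi>)) (interp (inst t \<phi>))"
    by (rule Ent_AllE[OF ok_interp[OF w] _ _ AllE.hyps(2)])
      (simp_all add: tr_interp_inst[OF w AllE.hyps(2)])
  from Ent_trans[OF AllE.IH[OF AllE.prems, unfolded interp.simps] this] show ?case .
next
  case (ExI \<Gamma> H t \<phi> \<sigma>)
  have "Ent \<Gamma> (interp (inst t \<phi>)) (dEx \<sigma> (interp \<phi>))"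
    by (rule Ent_ExI[OF ok_interp[OF ExI.hyps(3)] _ _ ExI.hyps(2)])
      (simp_all add: tr_interp_inst[OF ExI.hyps(3,2)])
  from Ent_trans[OF ExI.IH[OF ExI.prems] this] show ?case by simp
next
  case (ExE \<Gamma> H \<sigma> \<phi> \<psi>)
  have w: "wff (\<sigma> # \<Gamma>) \<phi>" using derives_wff[OF ExE.hyps(1)] by simp
  have sh: "\<forall>h\<in>set (map shift H). wff (\<sigma> # \<Gamma>) h" using ExE.prems wff_shift by auto
  have "Ent (\<sigma> # \<Gamma>) (dAnd (hyps (map shift H)) (interp \<phi>)) (interp (shift \<psi>))"
    using ExE.IH(2) w sh by simp
  then have "Ent \<Gamma> (dAnd (hyps H) (dEx \<sigma> (interp \<phi>))) (interp \<psi>)"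
    by (rule Ent_ExE[OF ok_hyps[OF ExE.prems] ok_interp[OF w] ok_interp[OF ExE.hyps(3)] ok_hyps[OF sh]])
      (simp_all add: tr_hyps_shift[OF ExE.prems] tr_interp_shift[OF ExE.hyps(3)])
  then show ?case
    using Ent_trans[OF Ent_AndI[OF ok_hyps[OF ExE.prems] ok_Ex[OF ok_interp[OF w]] Ent_refl]]
      ExE.IH(1)[OF ExE.prems] by simp
qed

text \<open>At this point \<or>-freeness is essential: a disjunction is translated with a flag,
  which an object without computational content cannot supply.\<close>

lemma interp_Int:
  assumes "okf \<Gamma> \<phi>"
  shows "Ent \<Gamma> (interp \<phi>) (dInt \<phi>) \<and> Ent \<Gamma> (dInt \<phi>) (interp \<phi>)"
  using assms
proof (induction \<phi> arbitrary: \<Gamma>)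
  case (And \<phi> \<psi>)
  then have w: "ok \<Gamma> (interp \<phi>)" "ok \<Gamma> (interp \<psi>)" "ok \<Gamma> (dInt \<phi>)" "ok \<Gamma> (dInt \<psi>)"
    by (simp_all add: okf_def ok_interp)
  note IH = And.IH(1)[of \<Gamma>] And.IH(2)[of \<Gamma>]
  show ?case
    unfolding interp.simps
    using Ent_trans[OF Ent_And_cong[OF w(1,3,2,4)] Int_And(1)]
      Ent_trans[OF Int_And(2) Ent_And_cong[OF w(3,1,4,2)]] IH And.prems by simp
next
  case (Imp \<phi> \<psi>)
  then have w: "ok \<Gamma> (interp \<phi>)" "ok \<Gamma> (interp \<psi>)" "ok \<Gamma> (dInt \<phi>)" "ok \<Gamma> (dInt \<psi>)"
    by (simp_all add: okf_def ok_interp)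
  note IH = Imp.IH(1)[of \<Gamma>] Imp.IH(2)[of \<Gamma>]
  show ?case
    unfolding interp.simps
    using Ent_trans[OF Ent_Imp_cong[OF w(1,3,2,4)] Int_Imp1]
      Ent_trans[OF Int_Imp2 Ent_Imp_cong[OF w(3,1,4,2)]] IH Imp.prems by simp
next
  case (Forall \<sigma> \<phi>)
  then have w: "ok (\<sigma> # \<Gamma>) (interp \<phi>)" "ok (\<sigma> # \<Gamma>) (dInt \<phi>)" by (simp_all add: okf_def ok_interp)
  note IH = Forall.IH[of "\<sigma> # \<Gamma>"]
  show ?case
    unfolding interp.simps
    using Ent_trans[OF Ent_All_cong[OF w] Int_All(1)] Ent_trans[OF Int_All(2) Ent_All_cong[OF w(2,1)]]
      IH Forall.prems by simp
next
  case (Exists \<sigma> \<phi>)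
  then have w: "ok (\<sigma> # \<Gamma>) (interp \<phi>)" "ok (\<sigma> # \<Gamma>) (dInt \<phi>)" by (simp_all add: okf_def ok_interp)
  note IH = Exists.IH[of "\<sigma> # \<Gamma>"]
  show ?case
    unfolding interp.simps
    using Ent_trans[OF Ent_Ex_cong[OF w] Int_Ex1] Ent_trans[OF Int_Ex2 Ent_Ex_cong[OF w(2,1)]]
      IH Exists.prems by simp
qed (auto simp: okf_def Ent_refl)

section \<open>The axioms\<close>

text \<open>
  Only the witness of the induction step is used, not its challenges: universally quantified over the
  challenges, the interpretation of \<open>X\<close> is an internal \<open>\<or>\<close>-free formula, to which internal induction
  applies.
\<close>

lemma Ent_ext_induct:
  assumes X: "ok (TNat # \<Gamma>) X"
    and X0: "Ent \<Gamma> dTop X0" "wit X0 = wit X" "chl X0 = chl X"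
    and X0_tr: "\<And>p e x y. env e \<Gamma> \<Longrightarrow> x \<in> D (wit X) \<Longrightarrow> y \<in> D (chl X) \<Longrightarrow>
      tr \<Gamma> p X0 e x y \<Longrightarrow> tr (TNat # \<Gamma>) p X (rep Zero .: e) x y"
    and X1: "Ent (TNat # \<Gamma>) (dAnd (dSt TNat (Var 0)) X) X1" "wit X1 = wit X" "chl X1 = chl X"
    and X1_tr: "\<And>p e d x y. env e \<Gamma> \<Longrightarrow> d \<in> D TNat \<Longrightarrow> x \<in> D (wit X) \<Longrightarrow> y \<in> D (chl X) \<Longrightarrow>
      tr (TNat # \<Gamma>) p X1 (d .: e) x y \<Longrightarrow> tr (TNat # \<Gamma>) p X (rep Succ \<bullet> d .: e) x y"
  shows "Ent \<Gamma> dTop (dAll TNat (dImp (dSt TNat (Var 0)) X))"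
proof (rule Ent_trans[OF _ AllSt2[OF X]])
  let ?S = "dSt TNat (Var 0)" and ?P = "Pr TNat (wit X)"
  have S: "ok (TNat # \<Gamma>) ?S" by simp
  obtain U Y where R: "realizes \<Gamma> dTop X0 U Y" using X0(1) by (auto simp: Ent_def)
  note U = realizes_closed(1)[OF R, unfolded dSt_simps X0]
  have 0: "tr \<Gamma> p X0 e (rep U \<bullet> x) v" if "env e \<Gamma>" "x \<in> D TNat" "v \<in> D (chl X)" for p e x v
    by (rule realizes_tr[OF R]) (use that X0 in \<open>simp_all add: tr_Top\<close>)
  obtain U' Y' where R': "realizes (TNat # \<Gamma>) (dAnd ?S X) X1 U' Y'" using X1(1) by (auto simp: Ent_def)
  note U' = realizes_closed(1)[OF R', unfolded dob_simps X1] and 1 = realizes_tr[OF R', unfolded X1]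
  note ty [simp] = closed_has_type[OF U] closed_has_type[OF U']
  note ev [simp] = ev_closed[OF U] ev_closed[OF U']
  \<comment> \<open>The premise of the step is a conjunction. Its witness is the number itself, as
    the witness of its standardness, paired with the witness from the previous stage.\<close>
  let ?b = "U' \<cdot> (pair_tm TNat (wit X) \<cdot> Var 0 \<cdot> Var 1)"
  define step where "step = lams [TNat, wit X] ?b"
  have step: "closed_term step (wit X \<Rrightarrow> TNat \<Rrightarrow> wit X)"
    unfolding step_def by (rule closed_lams[where \<Gamma> = "[_, _]", unfolded funs.simps]) simp
  have step_app: "rep step \<bullet> k \<bullet> n = rep U' \<bullet> (rep (pair_tm TNat (wit X)) \<bullet> n \<bullet> k)"
    if "k \<in> D (wit X)" "n \<in> D TNat" for k n
    unfolding step_def by (subst app_lams2[where \<tau> = "wit X"]) (use that in simp_all)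
  define R where "R = Rec (wit X) \<cdot> (U \<cdot> Zero) \<cdot> step"
  have R: "closed_term R (TNat \<Rrightarrow> wit X)" by (simp add: R_def closed_has_type[OF step])
  have Rr: "rep R = rep (Rec (wit X)) \<bullet> (rep U \<bullet> rep Zero) \<bullet> rep step"
    unfolding ev_closed[OF R, of Var, symmetric] by (simp add: R_def ev_closed[OF step])
  note Ui = app_in[OF rep_closed_in[OF U]] and si = rep_closed_in[OF step] and Ri = app_in[OF rep_closed_in[OF R]]
  have R0: "rep R \<bullet> rep Zero = rep U \<bullet> rep Zero"
    unfolding Rr by (rule app_Rec_Zero[OF Ui si]) simp
  have RS: "rep R \<bullet> (rep Succ \<bullet> n) = rep U' \<bullet> (rep (pair_tm TNat (wit X)) \<bullet> n \<bullet> (rep R \<bullet> n))"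
    if n: "n \<in> D TNat" for n
    using app_Rec_Succ[OF Ui si n, of "rep Zero"] step_app[OF Ri[OF n] n] by (simp add: Rr)
  have claim: "tr (TNat # \<Gamma>) p X (n .: e) (rep R \<bullet> n) c"
    if e: "env e \<Gamma>" and n: "n \<in> D TNat" and c: "c \<in> D (chl X)" for p e n c
  proof -
    let ?\<phi> = "Forall (chl X) (subst (Var 0 .: R \<cdot> Var 1 .: Var 1 .: weaken 2) (mat X))"
    have ok: "okf (chl X # TNat # \<Gamma>) (subst (Var 0 .: R \<cdot> Var 1 .: Var 1 .: weaken 2) (mat X))"
      by (rule okf_subst[OF X[unfolded ok_def]]) (simp add: numeral_2_eq_2 closed_has_type[OF R])
    have \<phi>: "frc (TNat # \<Gamma>) p (d .: e) ?\<phi> \<longleftrightarrow> (\<forall>c\<in>D (chl X). tr (TNat # \<Gamma>) p X (d .: e) (rep R \<bullet> d) c)"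
      if "d \<in> D TNat" for p d
      using that e ok unfolding tr_def
      by simp (simp add: frc_subst[OF X[unfolded ok_def]] closed_has_type[OF R] ev_closed[OF R] numeral_2_eq_2)
    have "frc (TNat # \<Gamma>) p (n .: e) ?\<phi>"
    proof (rule frc_induct[OF _ e n])
      show "frc (TNat # \<Gamma>) p (rep Zero .: e) ?\<phi>"
        unfolding \<phi>[OF consts_in(1)] R0 using X0_tr[OF e Ui _ 0[OF e]] by simp
    next
      fix q d assume d: "d \<in> D TNat" and "frc (TNat # \<Gamma>) q (d .: e) ?\<phi>"
      then have IH: "\<forall>c\<in>D (chl X). tr (TNat # \<Gamma>) q X (d .: e) (rep R \<bullet> d) c" unfolding \<phi>[OF d] by blast
      have ed: "env (d .: e) (TNat # \<Gamma>)" using d e by simp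
      let ?x = "rep (pair_tm TNat (wit X)) \<bullet> d \<bullet> (rep R \<bullet> d)"
      have x: "?x \<in> D ?P" using d Ri by simp
      have "tr (TNat # \<Gamma>) q X1 (d .: e) (rep U' \<bullet> ?x) c" if c: "c \<in> D (chl X)" for c
      proof (rule 1[OF ed _ c])
        fix r y assume r: "q \<sqsubseteq> r" and y: "y \<in> D (chl (dAnd ?S X))"
        then show "tr (TNat # \<Gamma>) r (dAnd ?S X) (d .: e) ?x y"
          using IH tr_mono[OF _ r] x d Ri ed by (simp add: tr_And[OF S X] tr_St eqv_refl)
      qed (use x in simp)
      then show "frc (TNat # \<Gamma>) q (rep Succ \<bullet> d .: e) ?\<phi>"
        unfolding \<phi>[OF Succ_in[OF d]] RS[OF d]
        using X1_tr[OF e d app_in[OF rep_closed_in[OF U'] x]] by blast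
    qed (use ok in simp)
    then show ?thesis unfolding \<phi>[OF n] using c by blast
  qed
  show "Ent \<Gamma> dTop (dAllSt TNat X)"
  proof (rule Ent_single[of _ R _ Zero])
    fix p e x v
    assume e: "env e \<Gamma>" and v0: "v \<in> D (chl (dAllSt TNat X))"
    have v: "v \<in> D (Pr TNat (chl X))" using v0 by simp
    show "tr \<Gamma> p (dAllSt TNat X) e (ev (x .: Var) R) v"
      unfolding ev_closed[OF R] tr_AllSt[OF X e rep_closed_in[OF R] v]
      by (rule claim[OF e fst_in[OF v] snd_in[OF v]])
  qed (use closed_has_type[OF R] in simp_all)
qed

text \<open>Rearrangements of premises are derived in pure logic, without axioms, and carried over
  by soundness; no realizers have to be written for them.\<close>

abbreviation lder :: "ty list \<Rightarrow> fm list \<Rightarrow> fm \<Rightarrow> bool" where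
  "lder \<equiv> derives (\<lambda>_. True) {}"

lemma logic_sound: "lder \<Gamma> H \<phi> \<Longrightarrow> \<forall>h\<in>set H. wff \<Gamma> h \<Longrightarrow> Ent \<Gamma> (hyps H) (interp \<phi>)"
  by (erule soundness) auto

lemma ax_External_Induction:
  assumes "wff \<Gamma> (inst Zero \<Phi> \<^bold>\<and> AllSt TNat (\<Phi> \<^bold>\<longrightarrow> at_succ \<Phi>) \<^bold>\<longrightarrow> AllSt TNat \<Phi>)"
  shows "Ent \<Gamma> dTop (interp (inst Zero \<Phi> \<^bold>\<and> AllSt TNat (\<Phi> \<^bold>\<longrightarrow> at_succ \<Phi>) \<^bold>\<longrightarrow> AllSt TNat \<Phi>))"
proof -
  define P where "P = (inst Zero \<Phi> \<^bold>\<and> AllSt TNat (\<Phi> \<^bold>\<longrightarrow> at_succ \<Phi>))"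
  txt \<open>
    The induction is on \<open>P \<longrightarrow> \<Phi>\<close>, so that the challenges to the premises become part of the witnesses.
  \<close>
  define \<chi> where "\<chi> = (shift P \<^bold>\<longrightarrow> \<Phi>)"
  have w: "wff \<Gamma> P" "wff (TNat # \<Gamma>) \<Phi>" using assms by (simp_all add: P_def AllSt_def)
  have w': "wff (TNat # \<Gamma>) (shift P)" "wff (TNat # \<Gamma>) \<chi>" "wff (TNat # \<Gamma>) (at_succ \<Phi>)"
    using w wff_shift[OF w(1)] wff_subst[OF w(2), of "TNat # \<Gamma>"] by (simp_all add: \<chi>_def)
  have e0: "inst Zero \<chi> = (P \<^bold>\<longrightarrow> inst Zero \<Phi>)" and e1: "at_succ \<chi> = (shift P \<^bold>\<longrightarrow> at_succ \<Phi>)"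
    by (simp_all add: \<chi>_def weaken_def[abs_def])
  have "lder \<Gamma> [] (inst Zero \<chi>)"
    unfolding e0
    by (rule derives.ImpI[OF w(1) TrueI], rule derives.AndE1[where \<psi> = "AllSt TNat (\<Phi> \<^bold>\<longrightarrow> at_succ \<Phi>)"],
        rule derives.Hyp) (use w in \<open>simp_all add: P_def\<close>)
  from logic_sound[OF this] have 0: "Ent \<Gamma> dTop (interp (inst Zero \<chi>))" by simp
  have "lder (TNat # \<Gamma>) [\<chi>, St TNat (Var 0)] (at_succ \<chi>)"
    unfolding e1
  proof (rule derives.ImpI[OF w'(1) TrueI])
    let ?H = "[shift P, \<chi>, St TNat (Var 0)]"
    have s: "lder (TNat # \<Gamma>) ?H (shift P)" by (rule derives.Hyp) (use w' in simp_all)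
    have "lder (TNat # \<Gamma>) ?H (shift P \<^bold>\<longrightarrow> \<Phi>)"
      unfolding \<chi>_def[symmetric] by (rule derives.Hyp) (use w' in simp_all)
    from derives.ImpE[OF this s] have \<Phi>: "lder (TNat # \<Gamma>) ?H \<Phi>" .
    have "lder (TNat # \<Gamma>) ?H (shift (AllSt TNat (\<Phi> \<^bold>\<longrightarrow> at_succ \<Phi>)))"
      by (rule derives.AndE2[where \<phi> = "shift (inst Zero \<Phi>)"]) (use s in \<open>simp only: P_def subst.simps\<close>)
    \<comment> \<open>Instantiation at index 0 undoes the shift, so the step becomes available for
      the current number.\<close>
    then have "lder (TNat # \<Gamma>) ?H (inst (Var 0) (subst (up (weaken (Suc 0))) (St TNat (Var 0) \<^bold>\<longrightarrow> \<Phi> \<^bold>\<longrightarrow> at_succ \<Phi>)))"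
      unfolding AllSt_def subst.simps(7) by (rule derives.AllE) simp
    moreover have "inst (Var 0) (subst (up (weaken (Suc 0))) (St TNat (Var 0) \<^bold>\<longrightarrow> \<Phi> \<^bold>\<longrightarrow> at_succ \<Phi>)) =
        (St TNat (Var 0) \<^bold>\<longrightarrow> \<Phi> \<^bold>\<longrightarrow> at_succ \<Phi>)"
      unfolding inst_up by simp
    ultimately have "lder (TNat # \<Gamma>) ?H (St TNat (Var 0) \<^bold>\<longrightarrow> \<Phi> \<^bold>\<longrightarrow> at_succ \<Phi>)" by metis
    from derives.ImpE[OF derives.ImpE[OF this] \<Phi>]
    show "lder (TNat # \<Gamma>) ?H (at_succ \<Phi>)" by (simp add: derives.Hyp)
  qed
  from logic_sound[OF this]
  have 1: "Ent (TNat # \<Gamma>) (dAnd (dAnd dTop (dSt TNat (Var 0))) (interp \<chi>)) (interp (at_succ \<chi>))"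
    using w' by simp
  have S: "ok (TNat # \<Gamma>) (dSt TNat (Var 0))" by simp
  have 2: "Ent (TNat # \<Gamma>) (dAnd (dSt TNat (Var 0)) (interp \<chi>)) (interp (at_succ \<chi>))"
    by (rule Ent_trans[OF Ent_And_cong[OF S ok_And[OF ok_Top S] ok_interp[OF w'(2)] ok_interp[OF w'(2)]
            Ent_AndI[OF ok_Top S Ent_TopI Ent_refl] Ent_refl] 1])
  have "Ent \<Gamma> dTop (dAll TNat (dImp (dSt TNat (Var 0)) (interp \<chi>)))"
  proof (rule Ent_ext_induct[OF ok_interp[OF w'(2)] 0 _ _ _ 2])
    fix p e d x y
    assume e: "env e \<Gamma>" and d: "d \<in> D TNat" and "x \<in> D (wit (interp \<chi>))" "y \<in> D (chl (interp \<chi>))"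
      "tr (TNat # \<Gamma>) p (interp (at_succ \<chi>)) (d .: e) x y"
    then show "tr (TNat # \<Gamma>) p (interp \<chi>) (rep Succ \<bullet> d .: e) x y"
      using tr_interp_subst[OF w'(2), of "TNat # \<Gamma>" "Succ \<cdot> Var 0 .: weaken (Suc 0)" "d .: e" x y p] by simp
  qed (simp_all add: tr_interp_inst[OF w'(2)])
  then have "Ent \<Gamma> dTop (interp (AllSt TNat \<chi>))" by (simp add: AllSt_def)
  moreover have wA: "wff \<Gamma> (AllSt TNat \<chi>)" using w' by (simp add: AllSt_def)
  ultimately have 3: "Ent \<Gamma> dTop (hyps [AllSt TNat \<chi>])" by (simp add: Ent_AndI Ent_TopI)
  \<comment> \<open>It remains to move the premise \<open>P\<close> from inside the external
    quantifier to the front, which is pure logic.\<close>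
  have "lder \<Gamma> [AllSt TNat \<chi>] (P \<^bold>\<longrightarrow> AllSt TNat \<Phi>)"
    unfolding AllSt_def[of _ \<Phi>]
  proof (rule derives.ImpI[OF w(1) TrueI], rule derives.AllI, rule derives.ImpI)
    let ?H = "St TNat (Var 0) # map shift [P, AllSt TNat \<chi>]"
    have "lder (TNat # \<Gamma>) ?H (shift (AllSt TNat \<chi>))"
      by (rule derives.Hyp) (use wff_shift[OF wA] in simp_all)
    then have "lder (TNat # \<Gamma>) ?H (inst (Var 0) (subst (up (weaken (Suc 0))) (St TNat (Var 0) \<^bold>\<longrightarrow> \<chi>)))"
      unfolding AllSt_def subst.simps(7) by (rule derives.AllE) simp
    moreover have "inst (Var 0) (subst (up (weaken (Suc 0))) (St TNat (Var 0) \<^bold>\<longrightarrow> \<chi>)) = (St TNat (Var 0) \<^bold>\<longrightarrow> \<chi>)"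
      unfolding inst_up by simp
    ultimately have "lder (TNat # \<Gamma>) ?H (St TNat (Var 0) \<^bold>\<longrightarrow> \<chi>)" by metis
    moreover have "lder (TNat # \<Gamma>) ?H (St TNat (Var 0))" by (rule derives.Hyp) simp_all
    ultimately have "lder (TNat # \<Gamma>) ?H (shift P \<^bold>\<longrightarrow> \<Phi>)" unfolding \<chi>_def[symmetric] by (rule derives.ImpE)
    moreover have "lder (TNat # \<Gamma>) ?H (shift P)" by (rule derives.Hyp) (use w' in simp_all)
    ultimately show "lder (TNat # \<Gamma>) ?H \<Phi>" by (rule derives.ImpE)
  qed simp_all
  from Ent_trans[OF 3 logic_sound[OF this]] show ?thesis using wA by (simp add: P_def)
qed

section \<open>Realizers of the internal axioms and of standardness\<close>

text \<open>By \<open>interp_Int\<close> such an axiom amounts to an object with dummy witness and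
  challenge; its matrix is forced in every world.\<close>

lemma ax_Th:
  assumes "\<phi> \<in> Th" "wff \<Gamma> \<phi>"
  shows "Ent \<Gamma> dTop (interp \<phi>)"
proof -
  have \<phi>: "okf \<Gamma> \<phi>" using assms Th_internal Th_or_free by (simp add: okf_def)
  have "Ent \<Gamma> dTop (dInt \<phi>)"
  proof (rule Ent_single[of _ Zero _ Zero])
    fix p e x v assume "env e \<Gamma>" "v \<in> D (chl (dInt \<phi>))"
    then show "tr \<Gamma> p (dInt \<phi>) e (ev (x .: Var) Zero) v"
      using force_axiom[OF assms(1) \<phi>] \<phi> by (simp add: tr_Int) (simp add: frc_def)
  qed simp_all
  then show ?thesis using Ent_trans interp_Int[OF \<phi>] by blast
qed

lemma ax_EHAst:
  assumes "\<phi> \<in> EHAst_vf" "wff \<Gamma> \<phi>"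
  shows "Ent \<Gamma> dTop (interp \<phi>)"
  using assms
proof cases
  case Base
  then show ?thesis using ax_Th assms by (simp add: Th_def)
next
  case (St_Eq \<sigma> s t)
  then have ty: "has_type \<Gamma> s \<sigma>" "has_type \<Gamma> t \<sigma>" using assms(2) by simp_all
  have "Ent \<Gamma> (dAnd (dSt \<sigma> s) (dInt (Eq \<sigma> s t))) (dSt \<sigma> t)"
  proof (rule Ent_single[of _ "fst_tm \<sigma> TNat \<cdot> Var 0" _ "pair_tm TNat TNat \<cdot> Zero \<cdot> Zero"])
    fix p e x v
    assume e: "env e \<Gamma>" and x: "x \<in> D (wit (dAnd (dSt \<sigma> s) (dInt (Eq \<sigma> s t))))" and v: "v \<in> D (chl (dSt \<sigma> t))"
      and *: "tr \<Gamma> p (dAnd (dSt \<sigma> s) (dInt (Eq \<sigma> s t))) e x (ev (v .: x .: Var) (pair_tm TNat TNat \<cdot> Zero \<cdot> Zero))"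
    have "eqv p \<sigma> (rep (fst_tm \<sigma> TNat) \<bullet> x) (ev e s)" "eqv p \<sigma> (ev e s) (ev e t)"
      using * x e ty by (simp_all add: tr_And tr_St tr_Int)
    from eqv_trans[OF this] show "tr \<Gamma> p (dSt \<sigma> t) e (ev (x .: Var) (fst_tm \<sigma> TNat \<cdot> Var 0)) v"
      using x v e ty ev_in[OF ty(1) e] ev_in[OF ty(2) e] by (simp add: tr_St)
  qed simp_all
  then show ?thesis using St_Eq ty by (simp add: Ent_Imp_Top)
next
  case (St_closed a \<sigma>)
  then have a: "has_type \<Gamma> a \<sigma>" using closed_has_type by blast
  have "Ent \<Gamma> dTop (dSt \<sigma> a)"
  proof (rule Ent_single[of _ a _ Zero])
    fix p e x v assume "env e \<Gamma>" "v \<in> D (chl (dSt \<sigma> a))"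
    then show "tr \<Gamma> p (dSt \<sigma> a) e (ev (x .: Var) a) v"
      using a ev_in[OF a] ev_closed[OF St_closed(2)] eqv_refl by (simp add: tr_St)
  qed (use closed_has_type[OF St_closed(2)] in simp_all)
  then show ?thesis using St_closed by simp
next
  case (St_App \<sigma> \<tau> f a)
  have ty: "has_type \<Gamma> f (\<sigma> \<Rrightarrow> \<tau>)" "has_type \<Gamma> a \<sigma>" using assms(2) unfolding St_App by simp_all
  have fa: "has_type \<Gamma> (f \<cdot> a) \<tau>" using ty by auto
  let ?F = "\<sigma> \<Rrightarrow> \<tau>"
  have "Ent \<Gamma> (dAnd (dSt ?F f) (dSt \<sigma> a)) (dSt \<tau> (f \<cdot> a))"
  proof (rule Ent_single[of _ "fst_tm ?F \<sigma> \<cdot> Var 0 \<cdot> (snd_tm ?F \<sigma> \<cdot> Var 0)" _ "pair_tm TNat TNat \<cdot> Zero \<cdot> Zero"])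
    fix p e x v
    assume e: "env e \<Gamma>" and x0: "x \<in> D (wit (dAnd (dSt ?F f) (dSt \<sigma> a)))" and v: "v \<in> D (chl (dSt \<tau> (f \<cdot> a)))"
      and *: "tr \<Gamma> p (dAnd (dSt ?F f) (dSt \<sigma> a)) e x (ev (v .: x .: Var) (pair_tm TNat TNat \<cdot> Zero \<cdot> Zero))"
    have x: "x \<in> D (Pr ?F \<sigma>)" using x0 by simp
    have "eqv p ?F (rep (fst_tm ?F \<sigma>) \<bullet> x) (ev e f)" "eqv p \<sigma> (rep (snd_tm ?F \<sigma>) \<bullet> x) (ev e a)"
      using * x e ty by (simp_all add: tr_And tr_St)
    from eqv_app[OF this fst_in[OF x] ev_in[OF ty(1) e] snd_in[OF x] ev_in[OF ty(2) e]]
    show "tr \<Gamma> p (dSt \<tau> (f \<cdot> a)) e (ev (x .: Var) (fst_tm ?F \<sigma> \<cdot> Var 0 \<cdot> (snd_tm ?F \<sigma> \<cdot> Var 0))) v"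
      using v e tr_St[OF fa e app_in[OF fst_in[OF x] snd_in[OF x]]] by simp
  qed simp_all
  then show ?thesis
    using Ent_Imp_Top[OF ok_And[OF ok_St[OF ty(1)] ok_St[OF ty(2)]] ok_St[OF fa]] unfolding St_App by simp
next
  case (External_Induction \<Phi>)
  then show ?thesis using ax_External_Induction assms by simp
qed

section \<open>Realizers of the nonstandard principles\<close>

text \<open>The universal quantifier does not change witnesses or challenges. Premise and conclusion
  thus have the same types and, up to the order of two variables, the same matrix, and the identity
  mediates between them.\<close>

lemma ax_NU:
  assumes "\<phi> \<in> NU" "wff \<Gamma> \<phi>"
  shows "Ent \<Gamma> dTop (interp \<phi>)"
proof -
  obtain \<sigma> \<tau> \<Phi> where \<phi>: "\<phi> = (Forall \<tau> (ExSt \<sigma> \<Phi>) \<^bold>\<longrightarrow>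
      ExSt \<sigma> (Forall \<tau> (subst (Var 1 .: Var 0 .: weaken 2) \<Phi>)))"
    using assms(1) by (auto simp: NU_def)
  define \<Phi>' where "\<Phi>' = subst (Var 1 .: Var 0 .: weaken 2) \<Phi>"
  let ?A = "interp \<Phi>" and ?A' = "interp \<Phi>'"
  have ty [simp]: "wit ?A' = wit ?A" "chl ?A' = chl ?A" by (simp_all add: \<Phi>'_def)
  have w: "wff (\<sigma> # \<tau> # \<Gamma>) \<Phi>" using assms(2) by (simp add: \<phi> ExSt_def)
  then have w': "wff (\<tau> # \<sigma> # \<Gamma>) \<Phi>'"
    unfolding \<Phi>'_def by (rule wff_subst) (simp add: numeral_2_eq_2)
  note A = ok_interp[OF w] and A' = ok_interp[OF w']
  have S: "ok (\<sigma> # \<Delta>') (dSt \<sigma> (Var 0))" for \<Delta>' by simp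
  have 1: "Ent \<Gamma> (dAll \<tau> (dEx \<sigma> (dAnd (dSt \<sigma> (Var 0)) ?A))) (dAll \<tau> (dExSt \<sigma> ?A))"
    by (rule Ent_All_cong[OF ok_Ex[OF ok_And[OF S A]] ok_ExSt[OF A] ExSt1[OF A]])
  have 2: "Ent \<Gamma> (dAll \<tau> (dExSt \<sigma> ?A)) (dExSt \<sigma> (dAll \<tau> ?A'))"
  proof (rule Ent_same)
    fix p e x v
    assume e: "env e \<Gamma>" and x0: "x \<in> D (wit (dAll \<tau> (dExSt \<sigma> ?A)))" and v0: "v \<in> D (chl (dAll \<tau> (dExSt \<sigma> ?A)))"
      and *: "tr \<Gamma> p (dAll \<tau> (dExSt \<sigma> ?A)) e x v"
    have x: "x \<in> D (Pr \<sigma> (wit ?A))" and v: "v \<in> D (chl ?A)" using x0 v0 by simp_all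
    have "tr (\<tau> # \<sigma> # \<Gamma>) p ?A' (b .: rep (fst_tm \<sigma> (wit ?A)) \<bullet> x .: e) (rep (snd_tm \<sigma> (wit ?A)) \<bullet> x) v"
      if b: "b \<in> D \<tau>" for b
      using * x v b e
      unfolding \<Phi>'_def by (subst tr_interp_subst[OF w])
        (simp_all add: numeral_2_eq_2 tr_All[OF ok_ExSt[OF A]] tr_ExSt[OF A])
    then show "tr \<Gamma> p (dExSt \<sigma> (dAll \<tau> ?A')) e x v"
      using x v e by (simp add: tr_ExSt[OF ok_All[OF A']] tr_All[OF A'])
  qed simp_all
  have "Ent \<Gamma> (interp (Forall \<tau> (ExSt \<sigma> \<Phi>))) (interp (ExSt \<sigma> (Forall \<tau> \<Phi>')))"
    using Ent_trans[OF Ent_trans[OF 1 2] ExSt2[OF ok_All[OF A']]] by (simp add: ExSt_def)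
  then show ?thesis
    using Ent_Imp_Top ok_interp assms(2) unfolding \<phi> \<Phi>'_def by simp
qed

text \<open>The premise is witnessed by a functional whose values are pairs of an object and a
  witness for the matrix. It is split into a choice functional and a functional of
  witnesses.\<close>

lemma ax_AC:
  assumes "\<phi> \<in> ACst" "wff \<Gamma> \<phi>"
  shows "Ent \<Gamma> dTop (interp \<phi>)"
proof -
  obtain \<sigma> \<tau> \<Phi> where \<phi>: "\<phi> = (AllSt \<sigma> (ExSt \<tau> \<Phi>) \<^bold>\<longrightarrow>
     ExSt (\<sigma> \<Rrightarrow> \<tau>) (AllSt \<sigma> (subst (Var 1 \<cdot> Var 0 .: Var 0 .: weaken 2) \<Phi>)))"
    using assms(1) by (auto simp: ACst_def)
  let ?F = "\<sigma> \<Rrightarrow> \<tau>"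
  define \<Phi>' where "\<Phi>' = subst (Var 1 \<cdot> Var 0 .: Var 0 .: weaken 2) \<Phi>"
  let ?A = "interp \<Phi>" and ?A' = "interp \<Phi>'"
  have ty [simp]: "wit ?A' = wit ?A" "chl ?A' = chl ?A" by (simp_all add: \<Phi>'_def)
  have w: "wff (\<tau> # \<sigma> # \<Gamma>) \<Phi>" using assms(2) by (simp add: \<phi> ExSt_def AllSt_def)
  then have w': "wff (\<sigma> # ?F # \<Gamma>) \<Phi>'"
    unfolding \<Phi>'_def by (rule wff_subst) (simp add: numeral_2_eq_2)
  note A = ok_interp[OF w] and A' = ok_interp[OF w']
  have S: "ok (\<rho> # \<Delta>') (dSt \<rho> (Var 0))" for \<rho> \<Delta>' by simp
  note EA = ok_Ex[OF ok_And[OF S A]]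
  have 1: "Ent \<Gamma> (dAll \<sigma> (dImp (dSt \<sigma> (Var 0)) (dEx \<tau> (dAnd (dSt \<tau> (Var 0)) ?A)))) (dAllSt \<sigma> (dExSt \<tau> ?A))"
    by (rule Ent_trans[OF Ent_All_cong[OF ok_Imp[OF S EA] ok_Imp[OF S ok_ExSt[OF A]]
            Ent_Imp_cong[OF S S EA ok_ExSt[OF A] Ent_refl ExSt1[OF A]]] AllSt1[OF ok_ExSt[OF A]]])
  let ?G = "\<sigma> \<Rrightarrow> Pr \<tau> (wit ?A)"
  let ?u1 = "fst_tm \<tau> (wit ?A) \<cdot> (Var (Suc 0) \<cdot> Var 0)" and ?u2 = "snd_tm \<tau> (wit ?A) \<cdot> (Var (Suc 0) \<cdot> Var 0)"
  let ?u = "pair_tm ?F (\<sigma> \<Rrightarrow> wit ?A) \<cdot> LAM [?G] \<sigma> ?u1 \<cdot> LAM [?G] \<sigma> ?u2"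
  have 2: "Ent \<Gamma> (dAllSt \<sigma> (dExSt \<tau> ?A)) (dExSt ?F (dAllSt \<sigma> ?A'))"
  proof (rule Ent_single[of _ ?u _ "Var 0"])
    fix p e x v
    assume e: "env e \<Gamma>" and x0: "x \<in> D (wit (dAllSt \<sigma> (dExSt \<tau> ?A)))" and v0: "v \<in> D (chl (dExSt ?F (dAllSt \<sigma> ?A')))"
      and *: "tr \<Gamma> p (dAllSt \<sigma> (dExSt \<tau> ?A)) e x (ev (v .: x .: Var) (Var 0))"
    have x: "x \<in> D ?G" and v: "v \<in> D (Pr \<sigma> (chl ?A))" using x0 v0 by simp_all
    let ?d = "rep (fst_tm \<sigma> (chl ?A)) \<bullet> v"
    have d: "?d \<in> D \<sigma>" using v by simp
    note xd = app_in[OF x d]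
    have ex: "env (x .: Var) [?G]" using x by simp
    have g: "ev (x .: Var) (LAM [?G] \<sigma> ?u1) \<in> D ?F" "ev (x .: Var) (LAM [?G] \<sigma> ?u2) \<in> D (\<sigma> \<Rrightarrow> wit ?A)"
      by (rule ev_in[OF _ ex], simp)+
    have gd: "ev (x .: Var) (LAM [?G] \<sigma> ?u1) \<bullet> ?d = rep (fst_tm \<tau> (wit ?A)) \<bullet> (x \<bullet> ?d)"
      "ev (x .: Var) (LAM [?G] \<sigma> ?u2) \<bullet> ?d = rep (snd_tm \<tau> (wit ?A)) \<bullet> (x \<bullet> ?d)"
      using ev_LAM[OF _ ex d, of ?u1 \<tau>] ev_LAM[OF _ ex d, of ?u2 "wit ?A"] by simp_all
    let ?f = "ev (x .: Var) (LAM [?G] \<sigma> ?u1)"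
    have "tr (\<tau> # \<sigma> # \<Gamma>) p ?A (rep (fst_tm \<tau> (wit ?A)) \<bullet> (x \<bullet> ?d) .: ?d .: e) (rep (snd_tm \<tau> (wit ?A)) \<bullet> (x \<bullet> ?d))
        (rep (snd_tm \<sigma> (chl ?A)) \<bullet> v)"
      using * x v e d xd by (simp add: tr_AllSt[OF ok_ExSt[OF A]] tr_ExSt[OF A])
    then have "tr (\<sigma> # ?F # \<Gamma>) p ?A' (?d .: ?f .: e) (rep (snd_tm \<tau> (wit ?A)) \<bullet> (x \<bullet> ?d)) (rep (snd_tm \<sigma> (chl ?A)) \<bullet> v)"
      using e d g v xd unfolding \<Phi>'_def by (subst tr_interp_subst[OF w]) (simp_all add: numeral_2_eq_2 gd)
    then show "tr \<Gamma> p (dExSt ?F (dAllSt \<sigma> ?A')) e (ev (x .: Var) ?u) v"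
      using e d g v by (simp add: tr_ExSt[OF ok_AllSt[OF A']] tr_AllSt[OF A'] gd)
  qed simp_all
  note AA = ok_All[OF ok_Imp[OF S A']]
  have 3: "Ent \<Gamma> (dExSt ?F (dAllSt \<sigma> ?A')) (dEx ?F (dAnd (dSt ?F (Var 0)) (dAll \<sigma> (dImp (dSt \<sigma> (Var 0)) ?A'))))"
    by (rule Ent_trans[OF ExSt2[OF ok_AllSt[OF A']] Ent_Ex_cong[OF ok_And[OF S ok_AllSt[OF A']] ok_And[OF S AA]
            Ent_And_cong[OF S S ok_AllSt[OF A'] AA Ent_refl AllSt2[OF A']]]])
  have "Ent \<Gamma> (interp (AllSt \<sigma> (ExSt \<tau> \<Phi>))) (interp (ExSt ?F (AllSt \<sigma> \<Phi>')))"
    using Ent_trans[OF Ent_trans[OF 1 2] 3] by (simp add: ExSt_def AllSt_def)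
  then show ?thesis using Ent_Imp_Top ok_interp assms(2) unfolding \<phi> \<Phi>'_def by simp
qed

text \<open>An external universal statement with internal matrix has a dummy functional as witness,
  and its challenges contain the standard element. Independence of premise, overspill and underspill
  all use this form.\<close>

lemma interp_AllSt_Int:
  assumes "okf (\<sigma> # \<Gamma>) \<phi>"
  shows "Ent \<Gamma> (interp (AllSt \<sigma> \<phi>)) (dAllSt \<sigma> (dInt \<phi>))" and "Ent \<Gamma> (dAllSt \<sigma> (dInt \<phi>)) (interp (AllSt \<sigma> \<phi>))"
proof -
  have S: "ok (\<sigma> # \<Gamma>) (dSt \<sigma> (Var 0))" by simp
  have w: "ok (\<sigma> # \<Gamma>) (interp \<phi>)" "ok (\<sigma> # \<Gamma>) (dInt \<phi>)" using assms by (simp_all add: okf_def ok_interp)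
  show "Ent \<Gamma> (interp (AllSt \<sigma> \<phi>)) (dAllSt \<sigma> (dInt \<phi>))"
    using Ent_trans[OF Ent_All_cong[OF ok_Imp[OF S w(1)] ok_Imp[OF S w(2)] Ent_Imp_cong[OF S S w Ent_refl]] AllSt1[OF w(2)]]
      interp_Int[OF assms] by (simp add: AllSt_def)
  show "Ent \<Gamma> (dAllSt \<sigma> (dInt \<phi>)) (interp (AllSt \<sigma> \<phi>))"
    using Ent_trans[OF AllSt2[OF w(2)] Ent_All_cong[OF ok_Imp[OF S w(2)] ok_Imp[OF S w(1)] Ent_Imp_cong[OF S S w(2,1) Ent_refl]]]
      interp_Int[OF assms] by (simp add: AllSt_def)
qed

lemma tr_AllSt_Int:
  assumes "okf (\<sigma> # \<Gamma>) \<phi>" "env e \<Gamma>" "x \<in> D (\<sigma> \<Rrightarrow> TNat)" "y \<in> D (Pr \<sigma> TNat)"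
  shows "tr \<Gamma> p (dAllSt \<sigma> (dInt \<phi>)) e x y \<longleftrightarrow> frc (\<sigma> # \<Gamma>) p (rep (fst_tm \<sigma> TNat) \<bullet> y .: e) \<phi>"
  using assms app_in[OF assms(3)] by (simp add: tr_AllSt tr_Int)

text \<open>The premise has only a dummy witness, a functional into \<open>TNat\<close>. Feeding the
  zero functional into the implication yields the object of type \<open>\<tau>\<close> before the
  premise is assumed, so its quantifier can move to the front.\<close>

lemma ax_IP:
  assumes "\<theta> \<in> IPst_vf" "wff \<Gamma> \<theta>"
  shows "Ent \<Gamma> dTop (interp \<theta>)"
proof -
  obtain \<sigma> \<tau> \<phi> \<Psi> where \<theta>: "\<theta> = ((AllSt \<sigma> \<phi> \<^bold>\<longrightarrow> ExSt \<tau> \<Psi>) \<^bold>\<longrightarrow> ExSt \<tau> (shift (AllSt \<sigma> \<phi>) \<^bold>\<longrightarrow> \<Psi>))"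
    and int: "internal \<phi>" "or_free \<phi>"
    using assms(1) by (auto simp: IPst_vf_def)
  have w: "wff (\<sigma> # \<Gamma>) \<phi>" "wff (\<tau> # \<Gamma>) \<Psi>" using assms(2) by (simp_all add: \<theta> AllSt_def ExSt_def)
  then have wA: "wff \<Gamma> (AllSt \<sigma> \<phi>)" by (simp add: AllSt_def)
  have \<phi>: "okf (\<sigma> # \<Gamma>) \<phi>" using w int by (simp add: okf_def)
  define \<phi>' where "\<phi>' = subst (up (weaken (Suc 0))) \<phi>"
  have \<phi>': "okf (\<sigma> # \<tau> # \<Gamma>) \<phi>'" unfolding \<phi>'_def by (rule okf_subst[OF \<phi>]) simp
  have sh: "shift (AllSt \<sigma> \<phi>) = AllSt \<sigma> \<phi>'" by (simp add: AllSt_def \<phi>'_def)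
  let ?B = "interp \<Psi>" and ?Q = "dAllSt \<sigma> (dInt \<phi>)" and ?Q' = "dAllSt \<sigma> (dInt \<phi>')"
  note B = ok_interp[OF w(2)] and Q = ok_AllSt[OF ok_Int[OF \<phi>]] and Q' = ok_AllSt[OF ok_Int[OF \<phi>']]
  have S: "ok (\<rho> # \<Delta>') (dSt \<rho> (Var 0))" for \<rho> \<Delta>' by simp
  have wP: "wff \<Gamma> (ExSt \<tau> \<Psi>)" "wff (\<tau> # \<Gamma>) (AllSt \<sigma> \<phi>')"
    using w \<phi>' by (simp_all add: ExSt_def AllSt_def okf_def)
  have 1: "Ent \<Gamma> (dImp (interp (AllSt \<sigma> \<phi>)) (interp (ExSt \<tau> \<Psi>))) (dImp ?Q (dExSt \<tau> ?B))"
    by (rule Ent_Imp_cong[OF ok_interp[OF wA] Q ok_interp[OF wP(1)] ok_ExSt[OF B] interp_AllSt_Int(2)[OF \<phi>]])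
      (use ExSt1[OF B] in \<open>simp add: ExSt_def\<close>)
  let ?q = "\<sigma> \<Rrightarrow> TNat" and ?K = "Pr \<sigma> TNat" and ?PB = "Pr \<tau> (wit ?B)"
  let ?F = "?q \<Rrightarrow> ?PB" and ?G = "?q \<Rrightarrow> chl ?B \<Rrightarrow> Seq ?K"
  let ?F' = "?q \<Rrightarrow> wit ?B"
  let ?zq = "zero_tm ?q"
  let ?z = "\<lambda>i. fst_tm ?F ?G \<cdot> Var i \<cdot> ?zq"
  let ?u1 = "LAM [Pr ?F ?G] ?q (snd_tm \<tau> (wit ?B) \<cdot> ?z (Suc 0))"
  let ?g = "snd_tm ?F ?G \<cdot> Var (Suc (Suc 0)) \<cdot> ?zq \<cdot> Var 0"
  let ?u2 = "LAM [Pr ?F ?G] ?q (LAM [?q, Pr ?F ?G] (chl ?B) ?g)"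
  let ?u = "pair_tm \<tau> (Pr ?F' ?G) \<cdot> (fst_tm \<tau> (wit ?B) \<cdot> ?z 0) \<cdot> (pair_tm ?F' ?G \<cdot> ?u1 \<cdot> ?u2)"
  let ?y = "pair_tm ?q (chl ?B) \<cdot> ?zq \<cdot> (snd_tm ?q (chl ?B) \<cdot> Var 0)"
  have 2: "Ent \<Gamma> (dImp ?Q (dExSt \<tau> ?B)) (dExSt \<tau> (dImp ?Q' ?B))"
  proof (rule Ent_single[of _ ?u _ ?y])
    fix p e x v
    assume e: "env e \<Gamma>" and x0: "x \<in> D (wit (dImp ?Q (dExSt \<tau> ?B)))" and v0: "v \<in> D (chl (dExSt \<tau> (dImp ?Q' ?B)))"
      and *: "tr \<Gamma> p (dImp ?Q (dExSt \<tau> ?B)) e x (ev (v .: x .: Var) ?y)"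
    have x: "x \<in> D (Pr ?F ?G)" and v: "v \<in> D (Pr ?q (chl ?B))" using x0 v0 by simp_all
    define q0 where "q0 = rep ?zq"
    have q0: "q0 \<in> D ?q" unfolding q0_def by (rule consts_in)
    define qq where "qq = rep (fst_tm ?q (chl ?B)) \<bullet> v"
    define c where "c = rep (snd_tm ?q (chl ?B)) \<bullet> v"
    have qq: "qq \<in> D ?q" and c: "c \<in> D (chl ?B)" using v by (simp_all add: qq_def c_def)
    define w where "w = rep (fst_tm ?F ?G) \<bullet> x \<bullet> q0"
    have wD: "w \<in> D ?PB" unfolding w_def by (rule app_in[OF fst_in[OF x] q0])
    define L where "L = rep (snd_tm ?F ?G) \<bullet> x \<bullet> q0 \<bullet> c"
    have L: "L \<in> D (Seq ?K)" unfolding L_def by (rule app_in[OF app_in[OF snd_in[OF x] q0] c])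
    have y: "ev (v .: x .: Var) ?y = rep (pair_tm ?q (chl ?B)) \<bullet> q0 \<bullet> c"
      unfolding q0_def c_def by (simp del: zero_tm.simps)
    have ex: "env (x .: Var) [Pr ?F ?G]" "env (qq .: x .: Var) [?q, Pr ?F ?G]" using x qq by simp_all
    define u1 where "u1 = ev (x .: Var) ?u1"
    define u2 where "u2 = ev (x .: Var) ?u2"
    have u1: "u1 \<in> D ?F'" and u2: "u2 \<in> D ?G"
      unfolding u1_def u2_def by (rule ev_in[OF _ ex(1)], simp del: zero_tm.simps)+
    have u1a: "u1 \<bullet> qq = rep (snd_tm \<tau> (wit ?B)) \<bullet> w"
      using ev_LAM[OF _ ex(1) qq, of "snd_tm \<tau> (wit ?B) \<cdot> ?z (Suc 0)" "wit ?B"]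
      by (simp add: u1_def w_def q0_def del: zero_tm.simps)
    have u2a: "u2 \<bullet> qq \<bullet> c = L"
      using ev_LAM[OF _ ex(1) qq, of "LAM [?q, Pr ?F ?G] (chl ?B) ?g" "chl ?B \<Rrightarrow> Seq ?K"]
        ev_LAM[OF _ ex(2) c, of ?g "Seq ?K"]
      by (simp add: u2_def L_def q0_def del: zero_tm.simps)
    have u: "ev (x .: Var) ?u = rep (pair_tm \<tau> (Pr ?F' ?G)) \<bullet> (rep (fst_tm \<tau> (wit ?B)) \<bullet> w) \<bullet>
        (rep (pair_tm ?F' ?G) \<bullet> u1 \<bullet> u2)"
      by (simp add: u1_def u2_def w_def q0_def del: zero_tm.simps)
    let ?t = "rep (fst_tm \<tau> (wit ?B)) \<bullet> w"
    have t: "?t \<in> D \<tau>" using wD by simp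
    have et: "env (?t .: e) (\<tau> # \<Gamma>)" using t e by simp
    have "tr (\<tau> # \<Gamma>) p (dImp ?Q' ?B) (?t .: e) (rep (pair_tm ?F' ?G) \<bullet> u1 \<bullet> u2) v"
    proof (subst tr_Imp[OF Q' B et])
      have prem: "tr \<Gamma> q (dExSt \<tau> ?B) e w c"
        if "p \<sqsubseteq> q" "\<And>d r. d \<in> D ?K \<Longrightarrow> q \<sqsubseteq> r \<Longrightarrow> mem r ?K d L \<Longrightarrow> tr \<Gamma> r ?Q e q0 d" for q
        using *[unfolded y] that x q0 c tr_Imp[OF Q ok_ExSt[OF B] e x0, of "rep (pair_tm ?q (chl ?B)) \<bullet> q0 \<bullet> c" p]
        by (simp add: w_def L_def)
      have goal: "tr (\<tau> # \<Gamma>) q ?B (?t .: e) (rep (snd_tm \<tau> (wit ?B)) \<bullet> w) c"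
        if q: "p \<sqsubseteq> q" and hyp: "\<forall>d\<in>D ?K. \<forall>r. q \<sqsubseteq> r \<longrightarrow> mem r ?K d L \<longrightarrow> tr (\<tau> # \<Gamma>) r ?Q' (?t .: e) qq d" for q
      proof -
        have "tr \<Gamma> q (dExSt \<tau> ?B) e w c"
        proof (rule prem[OF q])
          fix d r assume d: "d \<in> D ?K" and r: "q \<sqsubseteq> r" "mem r ?K d L"
          \<comment> \<open>The truth of the premise is the forcing of an internal formula at the
            challenged element. This allows the passage from the given dummy witness
            \<open>qq\<close> to the zero functional \<open>q0\<close>.\<close>
          then have "frc (\<sigma> # \<tau> # \<Gamma>) r (rep (fst_tm \<sigma> TNat) \<bullet> d .: ?t .: e) \<phi>'"
            using hyp tr_AllSt_Int[OF \<phi>' et qq d] by blast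
          then have "frc (\<sigma> # \<Gamma>) r (rep (fst_tm \<sigma> TNat) \<bullet> d .: e) \<phi>"
            unfolding \<phi>'_def using d t e by (subst (asm) frc_subst[OF \<phi>]) simp_all
          then show "tr \<Gamma> r ?Q e q0 d" using tr_AllSt_Int[OF \<phi> e q0 d] by blast
        qed
        then show ?thesis using tr_ExSt[OF B e wD c] by blast
      qed
      show "\<forall>q. p \<sqsubseteq> q \<longrightarrow>
        (\<forall>d\<in>D (chl ?Q'). \<forall>r. q \<sqsubseteq> r \<longrightarrow> mem r (chl ?Q') d
            (rep (snd_tm (wit ?Q' \<Rrightarrow> wit ?B) (wit ?Q' \<Rrightarrow> chl ?B \<Rrightarrow> Seq (chl ?Q'))) \<bullet> (rep (pair_tm ?F' ?G) \<bullet> u1 \<bullet> u2) \<bullet>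
              (rep (fst_tm (wit ?Q') (chl ?B)) \<bullet> v) \<bullet> (rep (snd_tm (wit ?Q') (chl ?B)) \<bullet> v)) \<longrightarrow>
          tr (\<tau> # \<Gamma>) r ?Q' (?t .: e) (rep (fst_tm (wit ?Q') (chl ?B)) \<bullet> v) d) \<longrightarrow>
        tr (\<tau> # \<Gamma>) q ?B (?t .: e)
          (rep (fst_tm (wit ?Q' \<Rrightarrow> wit ?B) (wit ?Q' \<Rrightarrow> chl ?B \<Rrightarrow> Seq (chl ?Q'))) \<bullet> (rep (pair_tm ?F' ?G) \<bullet> u1 \<bullet> u2) \<bullet>
            (rep (fst_tm (wit ?Q') (chl ?B)) \<bullet> v)) (rep (snd_tm (wit ?Q') (chl ?B)) \<bullet> v)"
        using goal u1 u2 u1a u2a by (simp flip: qq_def c_def)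
    qed (use u1 u2 v in simp_all)
    then show "tr \<Gamma> p (dExSt \<tau> (dImp ?Q' ?B)) e (ev (x .: Var) ?u) v"
      unfolding u using tr_ExSt[OF ok_Imp[OF Q' B] e, of "rep (pair_tm \<tau> (Pr ?F' ?G)) \<bullet> ?t \<bullet> (rep (pair_tm ?F' ?G) \<bullet> u1 \<bullet> u2)" v p]
        u1 u2 t v by simp
  qed (simp_all del: zero_tm.simps)
  have I: "ok (\<tau> # \<Gamma>) (dImp (interp (AllSt \<sigma> \<phi>')) ?B)" using B wP by simp
  have 3: "Ent \<Gamma> (dExSt \<tau> (dImp ?Q' ?B)) (dEx \<tau> (dAnd (dSt \<tau> (Var 0)) (dImp (interp (AllSt \<sigma> \<phi>')) ?B)))"
    by (rule Ent_trans[OF ExSt2[OF ok_Imp[OF Q' B]] Ent_Ex_cong[OF ok_And[OF S ok_Imp[OF Q' B]] ok_And[OF S I]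
          Ent_And_cong[OF S S ok_Imp[OF Q' B] I Ent_refl
            Ent_Imp_cong[OF Q' ok_interp[OF wP(2)] B B interp_AllSt_Int(1)[OF \<phi>'] Ent_refl]]]])
  have "Ent \<Gamma> (interp (AllSt \<sigma> \<phi> \<^bold>\<longrightarrow> ExSt \<tau> \<Psi>)) (interp (ExSt \<tau> (shift (AllSt \<sigma> \<phi>) \<^bold>\<longrightarrow> \<Psi>)))"
    using Ent_trans[OF Ent_trans[OF 1 2] 3] unfolding sh by (simp add: ExSt_def)
  then show ?thesis using Ent_Imp_Top ok_interp assms(2) unfolding \<theta> by simp
qed

abbreviation dHyper :: "ty \<Rightarrow> dob" where
  "dHyper \<sigma> \<equiv> dAllSt \<sigma> (dInt (Mem \<sigma> (Var 0) (Var (Suc 0))))"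

lemma hyper_Var_0: "hyper \<sigma> (Var 0) = AllSt \<sigma> (Mem \<sigma> (Var 0) (Var (Suc 0)))"
  by (simp add: hyper_def)

lemma tr_Hyper:
  assumes "s \<in> D (Seq \<sigma>)" "env e \<Gamma>" "x \<in> D (\<sigma> \<Rrightarrow> TNat)" "y \<in> D (Pr \<sigma> TNat)"
  shows "tr (Seq \<sigma> # \<Gamma>) p (dHyper \<sigma>) (s .: e) x y \<longleftrightarrow> mem p \<sigma> (rep (fst_tm \<sigma> TNat) \<bullet> y) s"
  using assms by (subst tr_AllSt_Int) simp_all

text \<open>A finite sequence of challenges to the conclusion asks for the membership of finitely
  many elements only. They are collected into a sequence \<open>s\<close>, which stands in for a
  hyperfinite one, and the premise gives \<open>\<phi>\<close> at \<open>s\<close>.\<close>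

lemma ax_OS:
  assumes "\<theta> \<in> OS_vf" "wff \<Gamma> \<theta>"
  shows "Ent \<Gamma> dTop (interp \<theta>)"
proof -
  obtain \<sigma> \<phi> where \<theta>: "\<theta> = (AllSt (Seq \<sigma>) \<phi> \<^bold>\<longrightarrow> Exists (Seq \<sigma>) (hyper \<sigma> (Var 0) \<^bold>\<and> \<phi>))"
    and int: "internal \<phi>" "or_free \<phi>"
    using assms(1) by (auto simp: OS_vf_def)
  have w: "wff (Seq \<sigma> # \<Gamma>) \<phi>" "wff (Seq \<sigma> # \<Gamma>) (hyper \<sigma> (Var 0))"
    using assms(2) by (simp_all add: \<theta> AllSt_def)
  have \<phi>: "okf (Seq \<sigma> # \<Gamma>) \<phi>" using w int by (simp add: okf_def)
  have M: "okf (\<sigma> # Seq \<sigma> # \<Gamma>) (Mem \<sigma> (Var 0) (Var (Suc 0)))" by simp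
  note H = ok_AllSt[OF ok_Int[OF M]] and I = ok_Int[OF \<phi>]
  let ?KH = "Pr \<sigma> TNat"
  let ?K = "Pr ?KH TNat" and ?W = "Seq \<sigma> \<Rrightarrow> TNat" and ?q = "\<sigma> \<Rrightarrow> TNat"
  let ?f = "fst_tm \<sigma> TNat \<cdot> (fst_tm ?KH TNat \<cdot> Var 0)"
  let ?s = "map_tm ?K \<sigma> \<cdot> LAM [Seq ?K, ?W] ?K ?f \<cdot> Var 0"
  let ?u = "pair_tm ?q TNat \<cdot> zero_tm ?q \<cdot> Zero" and ?y = "pair_tm (Seq \<sigma>) TNat \<cdot> ?s \<cdot> Zero"
  have 1: "Ent \<Gamma> (dAllSt (Seq \<sigma>) (dInt \<phi>)) (dEx (Seq \<sigma>) (dAnd (dHyper \<sigma>) (dInt \<phi>)))"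
  proof (rule Ent_single[of _ ?u _ ?y])
    fix p e x v
    assume e: "env e \<Gamma>" and x0: "x \<in> D (wit (dAllSt (Seq \<sigma>) (dInt \<phi>)))"
      and v0: "v \<in> D (chl (dEx (Seq \<sigma>) (dAnd (dHyper \<sigma>) (dInt \<phi>))))"
      and *: "tr \<Gamma> p (dAllSt (Seq \<sigma>) (dInt \<phi>)) e x (ev (v .: x .: Var) ?y)"
    have x: "x \<in> D ?W" and v: "v \<in> D (Seq ?K)" using x0 v0 by simp_all
    have ex: "env (v .: x .: Var) [Seq ?K, ?W]" using x v by simp
    define f where "f = ev (v .: x .: Var) (LAM [Seq ?K, ?W] ?K ?f)"
    have f: "f \<in> D (?K \<Rrightarrow> \<sigma>)" unfolding f_def by (rule ev_in[OF _ ex]) simp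
    have fl: "f \<bullet> l = rep (fst_tm \<sigma> TNat) \<bullet> (rep (fst_tm ?KH TNat) \<bullet> l)" if "l \<in> D ?K" for l
      unfolding f_def using ev_LAM[OF _ ex that, of ?f \<sigma>] by simp
    define s where "s = rep (map_tm ?K \<sigma>) \<bullet> f \<bullet> v"
    have s: "s \<in> D (Seq \<sigma>)" unfolding s_def using f v by simp
    \<comment> \<open>The collected sequence is itself the element at which the premise is
      challenged.\<close>
    have y: "ev (v .: x .: Var) ?y = rep (pair_tm (Seq \<sigma>) TNat) \<bullet> s \<bullet> rep Zero"
      by (simp add: s_def f_def)
    have \<phi>s: "frc (Seq \<sigma> # \<Gamma>) p (s .: e) \<phi>"
      using *[unfolded y] tr_AllSt_Int[OF \<phi> e x, of "rep (pair_tm (Seq \<sigma>) TNat) \<bullet> s \<bullet> rep Zero" p] s by simp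
    have u: "ev (x .: Var) ?u = rep (pair_tm ?q TNat) \<bullet> rep (zero_tm ?q) \<bullet> rep Zero"
      by (simp del: zero_tm.simps)
    have es: "env (s .: e) (Seq \<sigma> # \<Gamma>)" using s e by simp
    show "tr \<Gamma> p (dEx (Seq \<sigma>) (dAnd (dHyper \<sigma>) (dInt \<phi>))) e (ev (x .: Var) ?u) v"
      unfolding u
    proof (rule tr_ExI[OF ok_And[OF H I] e _ _ s])
      fix l q assume l0: "l \<in> D (chl (dAnd (dHyper \<sigma>) (dInt \<phi>)))" and q: "p \<sqsubseteq> q"
        and m0: "mem q (chl (dAnd (dHyper \<sigma>) (dInt \<phi>))) l v"
      have l: "l \<in> D ?K" and m: "mem q ?K l v" using l0 m0 by simp_all
      have "mem q \<sigma> (f \<bullet> l) s" unfolding s_def by (rule mem_map[OF m l v f])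
      then show "tr (Seq \<sigma> # \<Gamma>) q (dAnd (dHyper \<sigma>) (dInt \<phi>)) (s .: e) (rep (pair_tm ?q TNat) \<bullet> rep (zero_tm ?q) \<bullet> rep Zero) l"
        using l s e frc_mono[OF \<phi>s q] \<phi> consts_in(9)[of ?q]
        by (simp add: tr_And[OF H I es] tr_Hyper fl tr_Int del: zero_tm.simps)
    qed (use v in \<open>simp_all del: zero_tm.simps\<close>)
  qed (simp_all del: zero_tm.simps)
  have 2: "Ent \<Gamma> (dEx (Seq \<sigma>) (dAnd (dHyper \<sigma>) (dInt \<phi>))) (dEx (Seq \<sigma>) (dAnd (interp (hyper \<sigma> (Var 0))) (interp \<phi>)))"
    by (rule Ent_Ex_cong[OF ok_And[OF H I] ok_And[OF ok_interp[OF w(2)] ok_interp[OF w(1)]]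
          Ent_And_cong[OF H ok_interp[OF w(2)] I ok_interp[OF w(1)]]])
      (use interp_AllSt_Int(2)[OF M] interp_Int[OF \<phi>] in \<open>simp_all add: hyper_Var_0\<close>)
  have "Ent \<Gamma> (interp (AllSt (Seq \<sigma>) \<phi>)) (interp (Exists (Seq \<sigma>) (hyper \<sigma> (Var 0) \<^bold>\<and> \<phi>)))"
    using Ent_trans[OF Ent_trans[OF interp_AllSt_Int(1)[OF \<phi>] 1] 2] by simp
  then show ?thesis using Ent_Imp_Top ok_interp assms(2) unfolding \<theta> by simp
qed

text \<open>The witness of the implication lists the elements on whose membership it relies. The
  sequence of these elements passes all its tests, so \<open>\<phi>\<close> holds there, and a term
  computes it from the witness of the premise.\<close>

lemma ax_US:
  assumes "\<theta> \<in> US_vf" "wff \<Gamma> \<theta>"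
  shows "Ent \<Gamma> dTop (interp \<theta>)"
proof -
  obtain \<sigma> \<phi> where \<theta>: "\<theta> = (Forall (Seq \<sigma>) (hyper \<sigma> (Var 0) \<^bold>\<longrightarrow> \<phi>) \<^bold>\<longrightarrow> ExSt (Seq \<sigma>) \<phi>)"
    and int: "internal \<phi>" "or_free \<phi>"
    using assms(1) by (auto simp: US_vf_def)
  have w: "wff (Seq \<sigma> # \<Gamma>) \<phi>" "wff (Seq \<sigma> # \<Gamma>) (hyper \<sigma> (Var 0))"
    using assms(2) by (simp_all add: \<theta>)
  have \<phi>: "okf (Seq \<sigma> # \<Gamma>) \<phi>" using w int by (simp add: okf_def)
  have M: "okf (\<sigma> # Seq \<sigma> # \<Gamma>) (Mem \<sigma> (Var 0) (Var (Suc 0)))" by simp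
  note H = ok_AllSt[OF ok_Int[OF M]] and I = ok_Int[OF \<phi>]
  let ?K = "Pr \<sigma> TNat" and ?q = "\<sigma> \<Rrightarrow> TNat"
  let ?F = "?q \<Rrightarrow> TNat" and ?G = "?q \<Rrightarrow> TNat \<Rrightarrow> Seq ?K"
  let ?s = "map_tm ?K \<sigma> \<cdot> fst_tm \<sigma> TNat \<cdot> (snd_tm ?F ?G \<cdot> Var 0 \<cdot> zero_tm ?q \<cdot> Zero)"
  let ?u = "pair_tm (Seq \<sigma>) TNat \<cdot> ?s \<cdot> Zero" and ?y = "pair_tm ?q TNat \<cdot> zero_tm ?q \<cdot> Zero"
  have 1: "Ent \<Gamma> (dAll (Seq \<sigma>) (dImp (dHyper \<sigma>) (dInt \<phi>))) (dExSt (Seq \<sigma>) (dInt \<phi>))"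
  proof (rule Ent_single[of _ ?u _ ?y])
    fix p e x v
    assume e: "env e \<Gamma>" and x0: "x \<in> D (wit (dAll (Seq \<sigma>) (dImp (dHyper \<sigma>) (dInt \<phi>))))"
      and v0: "v \<in> D (chl (dExSt (Seq \<sigma>) (dInt \<phi>)))"
      and *: "tr \<Gamma> p (dAll (Seq \<sigma>) (dImp (dHyper \<sigma>) (dInt \<phi>))) e x (ev (v .: x .: Var) ?y)"
    have x: "x \<in> D (Pr ?F ?G)" and v: "v \<in> D TNat" using x0 v0 by simp_all
    define q0 where "q0 = rep (zero_tm ?q)"
    have q0: "q0 \<in> D ?q" unfolding q0_def by (rule consts_in)
    define L where "L = rep (snd_tm ?F ?G) \<bullet> x \<bullet> q0 \<bullet> rep Zero"
    have L: "L \<in> D (Seq ?K)" unfolding L_def by (rule app_in[OF app_in[OF snd_in[OF x] q0] consts_in(1)])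
    define s where "s = rep (map_tm ?K \<sigma>) \<bullet> rep (fst_tm \<sigma> TNat) \<bullet> L"
    have s: "s \<in> D (Seq \<sigma>)" unfolding s_def using L by simp
    have es: "env (s .: e) (Seq \<sigma> # \<Gamma>)" using s e by simp
    let ?v = "rep (pair_tm ?q TNat) \<bullet> q0 \<bullet> rep Zero"
    have y: "ev (v .: x .: Var) ?y = ?v" by (simp add: q0_def del: zero_tm.simps)
    have u: "ev (x .: Var) ?u = rep (pair_tm (Seq \<sigma>) TNat) \<bullet> s \<bullet> rep Zero"
      by (simp add: s_def L_def q0_def del: zero_tm.simps)
    have Fx: "rep (fst_tm ?F ?G) \<bullet> x \<bullet> q0 \<in> D TNat" by (rule app_in[OF fst_in[OF x] q0])
    have "tr (Seq \<sigma> # \<Gamma>) p (dImp (dHyper \<sigma>) (dInt \<phi>)) (s .: e) x ?v"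
      using *[unfolded y] tr_All[OF ok_Imp[OF H I] e, of x ?v p] x q0 s by simp
    moreover have "tr (Seq \<sigma> # \<Gamma>) r (dHyper \<sigma>) (s .: e) q0 d"
      if "d \<in> D ?K" "mem r ?K d L" for d r
      using that s e q0 mem_map[OF that(2,1) L, of "rep (fst_tm \<sigma> TNat)" \<sigma>] by (simp add: tr_Hyper s_def)
    ultimately have "tr (Seq \<sigma> # \<Gamma>) p (dInt \<phi>) (s .: e) (rep (fst_tm ?F ?G) \<bullet> x \<bullet> q0) (rep Zero)"
      using tr_Imp[OF H I es, of x ?v p] x q0 by (simp add: L_def)
    then have "frc (Seq \<sigma> # \<Gamma>) p (s .: e) \<phi>" using Fx es by (subst (asm) tr_Int[OF \<phi>]) simp_all
    then show "tr \<Gamma> p (dExSt (Seq \<sigma>) (dInt \<phi>)) e (ev (x .: Var) ?u) v"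
      unfolding u using s v e \<phi> by (simp add: tr_ExSt tr_Int)
  qed (simp_all del: zero_tm.simps)
  have S: "ok (\<rho> # \<Delta>') (dSt \<rho> (Var 0))" for \<rho> \<Delta>' by simp
  have 2: "Ent \<Gamma> (dAll (Seq \<sigma>) (dImp (interp (hyper \<sigma> (Var 0))) (interp \<phi>))) (dAll (Seq \<sigma>) (dImp (dHyper \<sigma>) (dInt \<phi>)))"
    by (rule Ent_All_cong[OF ok_Imp[OF ok_interp[OF w(2)] ok_interp[OF w(1)]] ok_Imp[OF H I]
          Ent_Imp_cong[OF ok_interp[OF w(2)] H ok_interp[OF w(1)] I]])
      (use interp_AllSt_Int(2)[OF M] interp_Int[OF \<phi>] in \<open>simp_all add: hyper_Var_0\<close>)
  have 3: "Ent \<Gamma> (dExSt (Seq \<sigma>) (dInt \<phi>)) (dEx (Seq \<sigma>) (dAnd (dSt (Seq \<sigma>) (Var 0)) (interp \<phi>)))"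
    by (rule Ent_trans[OF ExSt2[OF I] Ent_Ex_cong[OF ok_And[OF S I] ok_And[OF S ok_interp[OF w(1)]]
          Ent_And_cong[OF S S I ok_interp[OF w(1)] Ent_refl]]])
      (use interp_Int[OF \<phi>] in simp)
  have "Ent \<Gamma> (interp (Forall (Seq \<sigma>) (hyper \<sigma> (Var 0) \<^bold>\<longrightarrow> \<phi>))) (interp (ExSt (Seq \<sigma>) \<phi>))"
    using Ent_trans[OF Ent_trans[OF 2 1] 3] by (simp add: ExSt_def)
  then show ?thesis using Ent_Imp_Top ok_interp assms(2) unfolding \<theta> by simp
qed

section \<open>Term extraction\<close>

text \<open>A proof at \<open>root\<close> may still use variables typed by \<open>nu\<close>. They
  are replaced by zero terms, which does not affect a sentence.\<close>

lemma prov_sentence: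
  assumes "prov root \<phi>" "sentence \<phi>"
  shows "derives internal Th [] [] \<phi>"
proof -
  obtain n where "derives internal Th (ctx n) [] \<phi>"
    using assms(1) by (auto simp: prov_def Rep_root)
  from derives_subst[OF this Th_subst, of "[]" "\<lambda>i. zero_tm (nu i)"]
  show ?thesis by (simp add: sentence_subst[OF assms(2)])
qed

text \<open>Applied to a dummy witness of \<open>dTop\<close> and to an element, the realizer
  returns a pair whose first component is the required object. Correctness is forced at
  \<open>root\<close> for the whole constant domain, hence the universal statement is
  provable.\<close>

lemma extraction:
  assumes "Ent [] dTop (interp (AllSt \<sigma> (ExSt \<tau> \<phi>)))" and \<phi>: "okf [\<tau>, \<sigma>] \<phi>"
  shows "\<exists>T. closed_term T (\<sigma> \<Rrightarrow> \<tau>) \<and> derives internal Th [] [] (Forall \<sigma> (inst (T \<cdot> Var 0) \<phi>))"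
proof -
  have S: "ok (\<rho> # \<Delta>') (dSt \<rho> (Var 0))" for \<rho> \<Delta>' by simp
  have I: "ok [\<tau>, \<sigma>] (interp \<phi>)" "ok [\<tau>, \<sigma>] (dInt \<phi>)" using \<phi> by (simp_all add: okf_def ok_interp)
  have E: "Ent [\<sigma>] (interp (ExSt \<tau> \<phi>)) (dExSt \<tau> (dInt \<phi>))"
    using Ent_trans[OF Ent_Ex_cong[OF ok_And[OF S I(1)] ok_And[OF S I(2)] Ent_And_cong[OF S S I Ent_refl]] ExSt1[OF I(2)]]
      interp_Int[OF \<phi>] by (simp add: ExSt_def)
  have oE: "ok [\<sigma>] (interp (ExSt \<tau> \<phi>))" "ok [\<sigma>] (dExSt \<tau> (dInt \<phi>))" using I by (simp_all add: ExSt_def)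
  have "Ent [] (interp (AllSt \<sigma> (ExSt \<tau> \<phi>))) (dAllSt \<sigma> (dExSt \<tau> (dInt \<phi>)))"
    using Ent_trans[OF Ent_All_cong[OF ok_Imp[OF S oE(1)] ok_Imp[OF S oE(2)] Ent_Imp_cong[OF S S oE Ent_refl E]]
        AllSt1[OF oE(2)]] by (simp add: AllSt_def)
  from Ent_trans[OF assms(1) this] obtain U Y
    where R: "realizes [] dTop (dAllSt \<sigma> (dExSt \<tau> (dInt \<phi>))) U Y" by (auto simp: Ent_def)
  note U = realizes_closed(1)[OF R, unfolded dSt_simps dob_simps]
  note [simp] = closed_has_type[OF U] ev_closed[OF U]
  let ?b = "fst_tm \<tau> TNat \<cdot> (U \<cdot> Zero \<cdot> Var 0)"
  define T where "T = lams [\<sigma>] ?b"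
  have T: "closed_term T (\<sigma> \<Rrightarrow> \<tau>)"
    unfolding T_def by (rule closed_lams[where \<Gamma> = "[_]", unfolded funs.simps]) simp
  let ?\<psi> = "inst (T \<cdot> Var 0) \<phi>"
  have \<psi>: "okf [\<sigma>] ?\<psi>" by (rule okf_subst[OF \<phi>]) (simp add: closed_has_type[OF T])
  have "frc [\<sigma>] root (d .: Var) ?\<psi>" if d: "d \<in> D \<sigma>" for d
  proof -
    have U0: "rep U \<bullet> rep Zero \<in> D (\<sigma> \<Rrightarrow> Pr \<tau> TNat)" by (rule app_in[OF rep_closed_in[OF U] consts_in(1)])
    note Ud = app_in[OF U0 d]
    have "tr [] root (dAllSt \<sigma> (dExSt \<tau> (dInt \<phi>))) Var (rep U \<bullet> rep Zero) (rep (pair_tm \<sigma> TNat) \<bullet> d \<bullet> rep Zero)"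
      by (rule realizes_tr[OF R]) (use d in \<open>simp_all add: tr_Top\<close>)
    then have "frc [\<tau>, \<sigma>] root (rep (fst_tm \<tau> TNat) \<bullet> (rep U \<bullet> rep Zero \<bullet> d) .: d .: Var) \<phi>"
      using U0 d Ud \<phi> by (simp add: tr_AllSt tr_ExSt tr_Int)
    moreover have "rep T \<bullet> d = rep (fst_tm \<tau> TNat) \<bullet> (rep U \<bullet> rep Zero \<bullet> d)"
      unfolding T_def by (subst app_lams1[where \<tau> = \<tau>]) (use d in simp_all)
    ultimately show ?thesis
      using d by (subst frc_subst[OF \<phi>]) (simp_all add: closed_has_type[OF T] ev_closed[OF T])
  qed
  then have "frc [] root Var (Forall \<sigma> ?\<psi>)" using \<psi> by (subst frc_Forall) simp_all
  then have "prov root (Forall \<sigma> ?\<psi>)" by (simp add: frc_def force_def)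
  from prov_sentence[OF this] show ?thesis using \<psi> T by (auto simp: okf_def)
qed

end

theorem mainTheorem15:
  fixes \<sigma> \<tau> :: ty and \<phi> :: fm and \<Delta> :: "fm set"
  assumes "sentence (AllSt \<sigma> (ExSt \<tau> \<phi>))" and "internal \<phi>" and "or_free \<phi>"
    and "\<forall>\<delta>\<in>\<Delta>. sentence \<delta> \<and> internal \<delta> \<and> or_free \<delta>"
    and "EHAst_vf \<union> OS_vf \<union> US_vf \<union> NU \<union> ACst \<union> IPst_vf \<union> \<Delta> \<turnstile>\<^sub>s\<^sub>t AllSt \<sigma> (ExSt \<tau> \<phi>)"
  shows "\<exists>T. closed_term T (\<sigma> \<Rrightarrow> \<tau>) \<and> (EHA_vf \<union> \<Delta> \<turnstile>\<^sub>i\<^sub>n\<^sub>t Forall \<sigma> (inst (T \<cdot> Var 0) \<phi>))"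
proof -
  interpret model \<Delta>
    by unfold_locales (use assms(4) in blast)
  have "Ent [] (hyps []) (interp (AllSt \<sigma> (ExSt \<tau> \<phi>)))"
  proof (rule soundness[OF assms(5)])
    fix \<Gamma> \<theta>
    assume "\<theta> \<in> EHAst_vf \<union> OS_vf \<union> US_vf \<union> NU \<union> ACst \<union> IPst_vf \<union> \<Delta>" and w: "wff \<Gamma> \<theta>"
    \<comment> \<open>The sentences in \<open>\<Delta>\<close> belong to \<open>Th\<close>: being
      internal and \<or>-free, they are realized like the axioms of the internal theory.\<close>
    then consider "\<theta> \<in> EHAst_vf" | "\<theta> \<in> OS_vf" | "\<theta> \<in> US_vf" | "\<theta> \<in> NU" | "\<theta> \<in> ACst" | "\<theta> \<in> IPst_vf" | "\<theta> \<in> Th"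
      by (auto simp: Th_def)
    then show "Ent \<Gamma> dTop (interp \<theta>)"
      using ax_EHAst ax_OS ax_US ax_NU ax_AC ax_IP ax_Th w by cases blast+
  qed simp
  moreover have "okf [\<tau>, \<sigma>] \<phi>"
    using assms(1-3) by (simp add: okf_def AllSt_def ExSt_def)
  ultimately show ?thesis
    using extraction by (simp add: Th_def)
qed

end
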